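(* Let $h_0,\lambda_0,\lambda_1>0$, $h_1\ge 0$, and let $K,\lambda,\widetilde h_0,\widetilde h_1,\widetilde\lambda_0,\widetilde\lambda_1\in\mathbb R$ satisfy $|\widetilde\lambda_0+\widetilde\lambda_1|<2\sqrt{\lambda_0\lambda_1}$. Let $T>0$, $\Omega=(0,1)$, and assume $g_0,g_1\in L^2(0,T)$ and $f\in L^1(0,T;L^2(\Omega))$. Then for each $(\widetilde u_0,\widetilde u_1)\in H^1(\Omega)\times L^2(\Omega)$ the initial-boundary value problem $$u_{tt}-u_{xx}+Ku+\lambda u_t=f(x,t)\quad\text{in }\Omega\times(0,T),$$ $$u_x(0,t)=h_0u(0,t)+\lambda_0u_t(0,t)+\widetilde h_1u(1,t)+\widetilde\lambda_1u_t(1,t)+g_0(t),$$ $$-u_x(1,t)=h_1u(1,t)+\lambda_1u_t(1,t)+\widetilde h_0u(0,t)+\widetilde\lambda_0u_t(0,t)+g_1(t),$$ $$u(x,0)=\widetilde u_0(x),\qquad u_t(x,0)=\widetilde u_1(x)$$ has a unique weak solution $u$ satisfying $$u\in L^\infty(0,T;H^1(\Omega)),\qquad u_t\in L^\infty(0,T;L^2(\Omega)),\qquad u(0,\cdot),\,u(1,\cdot)\in H^1(0,T).$$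
   Context: Write $\langle u,v\rangle=\int_0^1u(x)v(x)\,dx$, $u(t)=u(\cdot,t)$, $u'=u_t$, and for $u,v\in H^1(\Omega)$ $$a(u,v)=\langle u_x,v_x\rangle+h_0u(0)v(0)+h_1u(1)v(1).$$ A function $u$ with $u\in L^\infty(0,T;H^1(\Omega))$, $u_t\in L^\infty(0,T;L^2(\Omega))$, $u(0,\cdot),u(1,\cdot)\in H^1(0,T)$ is a weak solution of the problem if for every $v\in H^1(\Omega)$, in the weak (distributional) sense on $(0,T)$, $$\frac{d}{dt}\langle u'(t),v\rangle+a(u(t),v)+\big(\lambda_0u'(0,t)+\widetilde h_1u(1,t)+\widetilde\lambda_1u'(1,t)\big)v(0)+\big(\lambda_1u'(1,t)+\widetilde h_0u(0,t)+\widetilde\lambda_0u'(0,t)\big)v(1)$$ $$+\langle Ku(t)+\lambda u'(t),v\rangle=-g_0(t)v(0)-g_1(t)v(1)+\langle f(t),v\rangle,$$ and $u(0)=\widetilde u_0$, $u'(0)=\widetilde u_1$. Here $u'(0,t),u'(1,t)$ are the time derivatives of the boundary traces $u(0,\cdot),u(1,\cdot)$. *)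

theory Defs
  imports "HOL-Analysis.Analysis"
begin

text \<open>
  Elements of \<open>L\<^sup>2(a,b)\<close> and \<open>H\<^sup>1(a,b)\<close> are represented by functions \<open>real \<Rightarrow> real\<close>, two of which
  stand for the same element iff they agree almost everywhere on \<open>(a,b)\<close>. A function
  \<open>u(x,t)\<close> is treated as the vector-valued map \<open>t \<mapsto> u(\<cdot>,t)\<close>, so \<open>u t x\<close> stands for \<open>u(x,t)\<close>.
\<close>

abbreviation itv :: "real \<Rightarrow> real \<Rightarrow> real measure" where
  "itv a b \<equiv> lebesgue_on {a<..<b}"

definition ae_eq :: "real \<Rightarrow> real \<Rightarrow> (real \<Rightarrow> real) \<Rightarrow> (real \<Rightarrow> real) \<Rightarrow> bool" where
  "ae_eq a b v w \<longleftrightarrow> (AE x in itv a b. v x = w x)"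

definition L2 :: "real \<Rightarrow> real \<Rightarrow> (real \<Rightarrow> real) set" where
  "L2 a b = {v \<in> borel_measurable (itv a b). integrable (itv a b) (\<lambda>x. (v x)\<^sup>2)}"

definition L2_inner :: "real \<Rightarrow> real \<Rightarrow> (real \<Rightarrow> real) \<Rightarrow> (real \<Rightarrow> real) \<Rightarrow> real" where
  "L2_inner a b v w = (LINT x|itv a b. v x * w x)"

definition L2_norm :: "real \<Rightarrow> real \<Rightarrow> (real \<Rightarrow> real) \<Rightarrow> real" where
  "L2_norm a b v = sqrt (L2_inner a b v v)"

text \<open>The test functions \<open>C\<^sub>c\<^sup>\<infinity>(a,b)\<close>, extended by zero to the real line.\<close>

definition test_fun :: "real \<Rightarrow> real \<Rightarrow> (real \<Rightarrow> real) set" where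
  "test_fun a b = {\<phi>. (\<forall>n x. (deriv ^^ n) \<phi> differentiable (at x)) \<and>
                      closure {x. \<phi> x \<noteq> 0} \<subseteq> {a<..<b}}"

definition has_weak_deriv :: "real \<Rightarrow> real \<Rightarrow> (real \<Rightarrow> real) \<Rightarrow> (real \<Rightarrow> real) \<Rightarrow> bool" where
  "has_weak_deriv a b v w \<longleftrightarrow>
     (\<forall>\<phi>\<in>test_fun a b. (LINT x|itv a b. v x * deriv \<phi> x) = - (LINT x|itv a b. w x * \<phi> x))"

definition H1 :: "real \<Rightarrow> real \<Rightarrow> (real \<Rightarrow> real) set" where
  "H1 a b = {v \<in> L2 a b. \<exists>w \<in> L2 a b. has_weak_deriv a b v w}"

text \<open>For \<open>v \<in> H\<^sup>1(a,b)\<close> the weak derivative is unique up to null sets; this picks a representative.\<close>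

definition weak_deriv :: "real \<Rightarrow> real \<Rightarrow> (real \<Rightarrow> real) \<Rightarrow> real \<Rightarrow> real" where
  "weak_deriv a b v = (SOME w. w \<in> L2 a b \<and> has_weak_deriv a b v w)"

definition H1_norm :: "real \<Rightarrow> real \<Rightarrow> (real \<Rightarrow> real) \<Rightarrow> real" where
  "H1_norm a b v = sqrt ((L2_norm a b v)\<^sup>2 + (L2_norm a b (weak_deriv a b v))\<^sup>2)"

text \<open>
  The point value \<open>v(c)\<close>, \<open>c \<in> [a,b]\<close>, of \<open>v \<in> H\<^sup>1(a,b)\<close>, in particular its boundary traces
  \<open>v(a)\<close> and \<open>v(b)\<close>: the value of the representative of \<open>v\<close> that is continuous on \<open>[a,b]\<close>
  (which, unlike \<open>v\<close> itself, is unique as a function on \<open>[a,b]\<close>).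
\<close>

definition trace_at :: "real \<Rightarrow> real \<Rightarrow> (real \<Rightarrow> real) \<Rightarrow> real \<Rightarrow> real" where
  "trace_at a b v c = (THE y. \<exists>w. continuous_on {a..b} w \<and> ae_eq a b w v \<and> y = w c)"

text \<open>
  Bochner spaces over \<open>(0,T)\<close> with values in a space \<open>X\<close> of functions with (semi)norm \<open>N\<close>:
  strong measurability is almost-everywhere approximability by \<open>X\<close>-valued simple functions.
\<close>

definition strongly_measurable ::
  "real \<Rightarrow> (real \<Rightarrow> real) set \<Rightarrow> ((real \<Rightarrow> real) \<Rightarrow> real) \<Rightarrow> (real \<Rightarrow> real \<Rightarrow> real) \<Rightarrow> bool" where
  "strongly_measurable T X N u \<longleftrightarrow>
     (\<exists>s :: nat \<Rightarrow> real \<Rightarrow> real \<Rightarrow> real.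
        (\<forall>n. simple_function (itv 0 T) (s n) \<and> (\<forall>t\<in>{0<..<T}. s n t \<in> X)) \<and>
        (AE t in itv 0 T. u t \<in> X \<and> (\<lambda>n. N (\<lambda>x. s n t x - u t x)) \<longlonglongrightarrow> 0))"

definition Bochner_L1 ::
  "real \<Rightarrow> (real \<Rightarrow> real) set \<Rightarrow> ((real \<Rightarrow> real) \<Rightarrow> real) \<Rightarrow> (real \<Rightarrow> real \<Rightarrow> real) set" where
  "Bochner_L1 T X N = {u. strongly_measurable T X N u \<and> integrable (itv 0 T) (\<lambda>t. N (u t))}"

definition Bochner_Linf ::
  "real \<Rightarrow> (real \<Rightarrow> real) set \<Rightarrow> ((real \<Rightarrow> real) \<Rightarrow> real) \<Rightarrow> (real \<Rightarrow> real \<Rightarrow> real) set" where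
  "Bochner_Linf T X N = {u. strongly_measurable T X N u \<and> (\<exists>C. AE t in itv 0 T. N (u t) \<le> C)}"

text \<open>
  \<open>w = u\<^sub>t\<close> as \<open>L\<^sup>2(0,1)\<close>-valued distributions on \<open>(0,T)\<close>, i.e.
  \<open>\<integral> \<phi>'(t) u(t) dt = - \<integral> \<phi>(t) w(t) dt\<close> in \<open>L\<^sup>2(0,1)\<close> for all test functions \<open>\<phi>\<close>. The two
  \<open>L\<^sup>2(0,1)\<close>-valued integrals are compared through their inner products with all elements of
  \<open>L\<^sup>2(0,1)\<close>, which may be taken inside the integral.
\<close>

definition has_weak_time_deriv ::
  "real \<Rightarrow> (real \<Rightarrow> real \<Rightarrow> real) \<Rightarrow> (real \<Rightarrow> real \<Rightarrow> real) \<Rightarrow> bool" where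
  "has_weak_time_deriv T u w \<longleftrightarrow>
     (\<forall>v\<in>L2 0 1. has_weak_deriv 0 T (\<lambda>t. L2_inner 0 1 (u t) v) (\<lambda>t. L2_inner 0 1 (w t) v))"

text \<open>
  Initial values of maps that are only given for almost every \<open>t\<close>. A function
  \<open>u \<in> L\<^sup>\<infinity>(0,T;H\<^sup>1)\<close> with \<open>u\<^sub>t \<in> L\<^sup>\<infinity>(0,T;L\<^sup>2)\<close> has a representative in \<open>C([0,T];L\<^sup>2)\<close>; for a
  weak solution the equation gives \<open>u'' \<in> L\<^sup>1(0,T;(H\<^sup>1)')\<close>, so that \<open>u' \<in> L\<^sup>\<infinity>(0,T;L\<^sup>2)\<close> has a
  representative that is weakly continuous from \<open>[0,T]\<close> to \<open>L\<^sup>2\<close>.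
\<close>

definition has_initial_value ::
  "real \<Rightarrow> (real \<Rightarrow> real \<Rightarrow> real) \<Rightarrow> (real \<Rightarrow> real) \<Rightarrow> bool" where
  "has_initial_value T u y \<longleftrightarrow>
     (\<exists>U. (\<forall>t\<in>{0..T}. U t \<in> L2 0 1) \<and>
          (\<forall>t\<in>{0..T}. ((\<lambda>s. L2_norm 0 1 (\<lambda>x. U s x - U t x)) \<longlongrightarrow> 0) (at t within {0..T})) \<and>
          (AE t in itv 0 T. ae_eq 0 1 (U t) (u t)) \<and>
          ae_eq 0 1 (U 0) y)"

definition has_weak_initial_value ::
  "real \<Rightarrow> (real \<Rightarrow> real \<Rightarrow> real) \<Rightarrow> (real \<Rightarrow> real) \<Rightarrow> bool" where
  "has_weak_initial_value T w y \<longleftrightarrow>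
     (\<exists>W. (\<forall>t\<in>{0..T}. W t \<in> L2 0 1) \<and>
          (\<forall>v\<in>L2 0 1. continuous_on {0..T} (\<lambda>t. L2_inner 0 1 (W t) v)) \<and>
          (AE t in itv 0 T. ae_eq 0 1 (W t) (w t)) \<and>
          ae_eq 0 1 (W 0) y)"

definition bilin :: "real \<Rightarrow> real \<Rightarrow> (real \<Rightarrow> real) \<Rightarrow> (real \<Rightarrow> real) \<Rightarrow> real" where
  "bilin h0 h1 v w =
     L2_inner 0 1 (weak_deriv 0 1 v) (weak_deriv 0 1 w)
     + h0 * trace_at 0 1 v 0 * trace_at 0 1 w 0 + h1 * trace_at 0 1 v 1 * trace_at 0 1 w 1"

text \<open>
  Weak solutions of
  \<open>u\<^sub>t\<^sub>t - u\<^sub>x\<^sub>x + K u + lam u\<^sub>t = f\<close> in \<open>(0,1) \<times> (0,T)\<close>,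
  \<open>u\<^sub>x(0,t) = h0 u(0,t) + lam0 u\<^sub>t(0,t) + ht1 u(1,t) + lt1 u\<^sub>t(1,t) + g0(t)\<close>,
  \<open>- u\<^sub>x(1,t) = h1 u(1,t) + lam1 u\<^sub>t(1,t) + ht0 u(0,t) + lt0 u\<^sub>t(0,t) + g1(t)\<close>,
  \<open>u(x,0) = u0(x)\<close>, \<open>u\<^sub>t(x,0) = u1(x)\<close>.
  Below, \<open>ut\<close> is the weak time derivative of \<open>u\<close>, \<open>b0\<close> and \<open>b1\<close> are the boundary traces
  \<open>u(0,\<cdot>)\<close> and \<open>u(1,\<cdot>)\<close>, and \<open>b0'\<close>, \<open>b1'\<close> their weak derivatives. The
  equation is required in the sense of distributions on \<open>(0,T)\<close>, so the time derivative of
  \<open>\<langle>u'(t),v\<rangle>\<close> is moved to the test function \<open>\<phi>\<close>.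
\<close>

definition weak_solution ::
  "real \<Rightarrow> real \<Rightarrow> real \<Rightarrow> real \<Rightarrow> real \<Rightarrow> real \<Rightarrow> real \<Rightarrow> real \<Rightarrow> real \<Rightarrow> real \<Rightarrow> real \<Rightarrow>
   (real \<Rightarrow> real) \<Rightarrow> (real \<Rightarrow> real) \<Rightarrow> (real \<Rightarrow> real \<Rightarrow> real) \<Rightarrow> (real \<Rightarrow> real) \<Rightarrow> (real \<Rightarrow> real) \<Rightarrow>
   (real \<Rightarrow> real \<Rightarrow> real) \<Rightarrow> bool" where
  "weak_solution T h0 h1 lam0 lam1 K lam ht0 ht1 lt0 lt1 g0 g1 f u0 u1 u \<longleftrightarrow>
     (let b0 = (\<lambda>t. trace_at 0 1 (u t) 0); b1 = (\<lambda>t. trace_at 0 1 (u t) 1);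
          b0' = weak_deriv 0 T b0; b1' = weak_deriv 0 T b1
      in u \<in> Bochner_Linf T (H1 0 1) (H1_norm 0 1) \<and>
         b0 \<in> H1 0 T \<and> b1 \<in> H1 0 T \<and>
         has_initial_value T u u0 \<and>
         (\<exists>ut \<in> Bochner_Linf T (L2 0 1) (L2_norm 0 1).
            has_weak_time_deriv T u ut \<and>
            has_weak_initial_value T ut u1 \<and>
            (\<forall>v \<in> H1 0 1. \<forall>\<phi> \<in> test_fun 0 T.
               - (LINT t|itv 0 T. L2_inner 0 1 (ut t) v * deriv \<phi> t)
               + (LINT t|itv 0 T.
                    (bilin h0 h1 (u t) v
                     + (lam0 * b0' t + ht1 * b1 t + lt1 * b1' t) * trace_at 0 1 v 0
                     + (lam1 * b1' t + ht0 * b0 t + lt0 * b0' t) * trace_at 0 1 v 1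
                     + L2_inner 0 1 (\<lambda>x. K * u t x + lam * ut t x) v) * \<phi> t)
               = (LINT t|itv 0 T.
                    (- g0 t * trace_at 0 1 v 0 - g1 t * trace_at 0 1 v 1
                     + L2_inner 0 1 (f t) v) * \<phi> t))))"

end

theory Submission
  imports Defs
begin

text \<open>
  Existence follows from d'Alembert's formula. With the Riemann invariants \<open>p = u\<^sub>t + u\<^sub>x\<close> and \<open>q = u\<^sub>t - u\<^sub>x\<close>
  the equation becomes \<open>p\<^sub>t - p\<^sub>x = F\<close>, \<open>q\<^sub>t + q\<^sub>x = F\<close> with \<open>F = f - K u - lam u\<^sub>t\<close>, and the boundary conditions
  become \<open>(1 + lam0) u\<^sub>t(0) + lt1 u\<^sub>t(1) = p(0) - h0 u(0) - ht1 u(1) - g0\<close> and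
  \<open>lt0 u\<^sub>t(0) + (1 + lam1) u\<^sub>t(1) = q(1) - h1 u(1) - ht0 u(0) - g1\<close>. The bound on \<open>lt0 + lt1\<close> makes this
  \<open>2 \<times> 2\<close> system invertible, so the outgoing invariants \<open>p(0)\<close>, \<open>q(1)\<close> determine the boundary velocities, and
  these determine the incoming invariants \<open>p(1) = 2 u\<^sub>t(1) - q(1)\<close> and \<open>q(0) = 2 u\<^sub>t(0) - p(0)\<close>, which reach
  the opposite end one unit of time later. All remaining couplings are of Volterra type, so in a norm with
  weight \<open>exp (- \<gamma> t)\<close> the whole problem is a contraction.

  For uniqueness, the equation for the difference \<open>z\<close> of two solutions is integrated once in time and tested
  with \<open>z(t)\<close> itself, which lies in \<open>H\<^sup>1\<close>. With \<open>Z\<close> the time primitive of \<open>z\<close>, this bounds the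
  derivative of \<open>\<parallel>z\<parallel>\<^sup>2 + \<parallel>Z\<^sub>x\<parallel>\<^sup>2\<close>; the boundary velocities enter through
  \<open>lam0 z(0)\<^sup>2 + (lt0 + lt1) z(0) z(1) + lam1 z(1)\<^sup>2\<close>, which is positive definite and absorbs the other boundary
  terms, and Gronwall's inequality gives \<open>z = 0\<close>.
\<close>

section \<open>The Hilbert space of square integrable functions on the line\<close>

text \<open>The obstacle is low regularity: the invariants are only square integrable and the data
  cannot be differentiated, so no classical solution is at hand. Everything is kept in
  \<open>L\<^sup>2\<close> of the whole line, where translation is a strongly continuous isometry.
  There the initial state, the boundary input and the boundary output are restrictions of elements
  of one space to (0, 1), (1, 1 + T) and (0, T): the traces of the invariants are restrictions and
  never limits, and derivatives fall on the test function. A separate type is built because Bochner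
  integrals of curves require a second countable Banach space type. In the uniqueness part the usual
  multiplier, the time derivative, is only in \<open>L\<^sup>2\<close> and has no traces, so the
  weak equation cannot be tested with it. Integration in time lowers the whole energy identity by
  one derivative, so that the difference itself can serve as the multiplier. The boundary velocities
  then turn into increments of traces since time 0; as the initial condition is imposed only in
  \<open>L\<^sup>2\<close>, the initial values of the traces have to be identified
  separately.\<close>

definition sq_int :: "(real \<Rightarrow> real) set" where
  "sq_int = {f \<in> borel_measurable borel. integrable lborel (\<lambda>x. (f x)\<^sup>2)}"

lemma sq_int_measurable [measurable_dest]: "f \<in> sq_int \<Longrightarrow> f \<in> borel_measurable borel"
  by (simp add: sq_int_def)

lemma abs_mult_le_sum_squares: "\<bar>a * b\<bar> \<le> a\<^sup>2 + b\<^sup>2" for a b :: real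
proof -
  have "2 * \<bar>a\<bar> * \<bar>b\<bar> \<le> \<bar>a\<bar>\<^sup>2 + \<bar>b\<bar>\<^sup>2" by (rule sum_squares_bound)
  moreover have "0 \<le> \<bar>a\<bar> * \<bar>b\<bar>" by simp
  ultimately show ?thesis unfolding abs_mult power2_abs by linarith
qed

lemma sq_int_mult:
  assumes "f \<in> sq_int" "g \<in> sq_int"
  shows "integrable lborel (\<lambda>x. f x * g x)"
proof (rule Bochner_Integration.integrable_bound)
  show "integrable lborel (\<lambda>x. (f x)\<^sup>2 + (g x)\<^sup>2)"
    using assms by (auto simp: sq_int_def)
  show "(\<lambda>x. f x * g x) \<in> borel_measurable lborel"
    using assms by (auto simp: sq_int_def)
  show "AE x in lborel. norm (f x * g x) \<le> norm ((f x)\<^sup>2 + (g x)\<^sup>2)"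
    using abs_mult_le_sum_squares by simp
qed

lemma sq_int_zero: "(\<lambda>x. 0) \<in> sq_int"
  by (simp add: sq_int_def)

lemma sq_int_add:
  assumes "f \<in> sq_int" "g \<in> sq_int"
  shows "(\<lambda>x. f x + g x) \<in> sq_int"
  using assms sq_int_mult[OF assms] by (auto simp: sq_int_def power2_sum mult.assoc)

lemma sq_int_scale: "f \<in> sq_int \<Longrightarrow> (\<lambda>x. c * f x) \<in> sq_int"
  by (auto simp: sq_int_def power_mult_distrib)

lemma sq_int_indicator:
  assumes "f \<in> sq_int" "S \<in> sets borel"
  shows "(\<lambda>x. indicat_real S x * f x) \<in> sq_int"
proof -
  have "integrable lborel (\<lambda>x. indicat_real S x *\<^sub>R (f x)\<^sup>2)"
    using assms by (intro integrable_mult_indicator) (auto simp: sq_int_def)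
  moreover have "(\<lambda>x. (indicat_real S x * f x)\<^sup>2) = (\<lambda>x. indicat_real S x *\<^sub>R (f x)\<^sup>2)"
    by (auto simp: indicator_def)
  ultimately show ?thesis
    using assms by (auto simp: sq_int_def)
qed

lemma sq_int_shift:
  assumes "f \<in> sq_int"
  shows "(\<lambda>x. f (x + t)) \<in> sq_int"
  using assms lborel_integrable_real_affine[of "\<lambda>x. (f x)\<^sup>2" 1 t]
  by (auto simp: sq_int_def add.commute)

lemma sq_int_reflect:
  assumes "f \<in> sq_int"
  shows "(\<lambda>x. f (1 - x)) \<in> sq_int"
  using assms lborel_integrable_real_affine[of "\<lambda>x. (f x)\<^sup>2" "-1" 1]
  by (auto simp: sq_int_def)

lemma AE_lborel_affine:
  assumes "AE x in lborel. P x" "c \<noteq> (0::real)"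
  shows "AE x in lborel. P (t + c * x)"
proof -
  obtain N where N: "{x. \<not> P x} \<subseteq> N" "N \<in> sets borel" "emeasure lborel N = 0"
    using assms(1) by (auto elim!: AE_E)
  have "\<integral>\<^sup>+x. indicator N (t + c * x) \<partial>lborel = 0"
    using nn_integral_real_affine[of "indicator N" c t] N assms(2) by auto
  moreover have "(\<lambda>x. indicator N (t + c * x) :: ennreal) \<in> borel_measurable lborel"
    using N(2) by measurable
  ultimately have "AE x in lborel. (indicator N (t + c * x) :: ennreal) = 0"
    using nn_integral_0_iff_AE by blast
  then show ?thesis
    by eventually_elim (use N(1) in \<open>auto simp: indicator_def split: if_splits\<close>)
qed

lemma AE_lborel_shift: "AE x in lborel. P x \<Longrightarrow> AE x in lborel. P (x + t :: real)"
  using AE_lborel_affine[of P 1 t] by (simp add: add.commute)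

lemma AE_lborel_reflect: "AE x in lborel. P x \<Longrightarrow> AE x in lborel. P (1 - x :: real)"
  using AE_lborel_affine[of P "-1" 1] by simp

definition canon :: "(real \<Rightarrow> real) \<Rightarrow> real \<Rightarrow> real" where
  "canon f = (SOME g. g \<in> sq_int \<and> (AE x in lborel. g x = f x))"

lemma canon:
  assumes "f \<in> sq_int"
  shows "canon f \<in> sq_int" "AE x in lborel. canon f x = f x"
  using someI[of "\<lambda>g. g \<in> sq_int \<and> (AE x in lborel. g x = f x)" f] assms
  by (auto simp: canon_def)

text \<open>\<open>SOME\<close> sees only the predicate, and functions that agree almost everywhere
  define the same one. Classes can thus be compared by literal equality of their
  representatives.\<close>

lemma canon_cong:
  assumes "AE x in lborel. f x = g x"
  shows "canon f = canon g"
proof -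
  have "(AE x in lborel. h x = f x) \<longleftrightarrow> (AE x in lborel. h x = g x)" for h :: "real \<Rightarrow> real"
  proof
    assume "AE x in lborel. h x = f x"
    then show "AE x in lborel. h x = g x" using assms by eventually_elim simp
  next
    assume "AE x in lborel. h x = g x"
    then show "AE x in lborel. h x = f x" using assms by eventually_elim simp
  qed
  then show ?thesis by (simp add: canon_def)
qed

text \<open>
  \<open>lsq\<close> is \<open>L\<^sup>2(\<real>)\<close>; every class is stored as a chosen Borel representative.
\<close>

typedef lsq = "{f \<in> sq_int. canon f = f}"
proof -
  have "canon (canon (\<lambda>x. 0)) = canon (\<lambda>x. 0)"
    by (rule canon_cong, rule canon(2), rule sq_int_zero)
  then show ?thesis
    using canon(1)[OF sq_int_zero] by blast
qed

definition fn :: "lsq \<Rightarrow> real \<Rightarrow> real" where "fn = Rep_lsq"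

definition cls :: "(real \<Rightarrow> real) \<Rightarrow> lsq" where "cls f = Abs_lsq (canon f)"

lemma fn_sq_int [simp]: "fn y \<in> sq_int"
  using Rep_lsq[of y] by (simp add: fn_def)

lemma fn_measurable [measurable]: "fn y \<in> borel_measurable borel"
  using fn_sq_int by (rule sq_int_measurable)

lemma fn_cls:
  assumes "f \<in> sq_int"
  shows "AE x in lborel. fn (cls f) x = f x"
proof -
  have "canon f \<in> {f \<in> sq_int. canon f = f}"
    using canon(1)[OF assms] canon_cong[OF canon(2)[OF assms]] by simp
  then show ?thesis
    using canon(2)[OF assms] by (simp add: fn_def cls_def Abs_lsq_inverse)
qed

lemma cls_cong: "AE x in lborel. f x = g x \<Longrightarrow> cls f = cls g"
  by (simp add: cls_def canon_cong)

lemma cls_fn [simp]: "cls (fn y) = y"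
  using Rep_lsq[of y] by (simp add: fn_def cls_def Rep_lsq_inverse)

lemma lsq_eqI: "AE x in lborel. fn y x = fn z x \<Longrightarrow> y = z"
  by (metis cls_cong cls_fn)

instantiation lsq :: real_inner
begin

definition zero_lsq :: lsq where "0 = cls (\<lambda>x. 0)"
definition plus_lsq :: "lsq \<Rightarrow> lsq \<Rightarrow> lsq" where "y + z = cls (\<lambda>x. fn y x + fn z x)"
definition uminus_lsq :: "lsq \<Rightarrow> lsq" where "- y = cls (\<lambda>x. - 1 * fn y x)"
definition minus_lsq :: "lsq \<Rightarrow> lsq \<Rightarrow> lsq" where "y - z = y + (- z :: lsq)"
definition scaleR_lsq :: "real \<Rightarrow> lsq \<Rightarrow> lsq" where "c *\<^sub>R y = cls (\<lambda>x. c * fn y x)"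
definition inner_lsq :: "lsq \<Rightarrow> lsq \<Rightarrow> real" where "y \<bullet> z = (LINT x|lborel. fn y x * fn z x)"
definition norm_lsq :: "lsq \<Rightarrow> real" where "norm_lsq y = sqrt (y \<bullet> y)"
definition sgn_lsq :: "lsq \<Rightarrow> lsq" where "sgn_lsq y = inverse (norm y) *\<^sub>R y"
definition dist_lsq :: "lsq \<Rightarrow> lsq \<Rightarrow> real" where "dist_lsq y z = norm (y - z)"
definition uniformity_lsq :: "(lsq \<times> lsq) filter" where
  "uniformity_lsq = (INF e\<in>{0 <..}. principal {(x, y). dist x y < e})"
definition open_lsq :: "lsq set \<Rightarrow> bool" where
  "open_lsq U \<longleftrightarrow> (\<forall>x\<in>U. eventually (\<lambda>(x', y). x' = x \<longrightarrow> y \<in> U) uniformity)"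

lemma fn_zero: "AE x in lborel. fn 0 x = 0"
  unfolding zero_lsq_def using fn_cls[OF sq_int_zero] .

lemma fn_add: "AE x in lborel. fn (y + z) x = fn y x + fn z x"
  unfolding plus_lsq_def by (intro fn_cls sq_int_add) auto

lemma fn_scaleR: "AE x in lborel. fn (c *\<^sub>R y) x = c * fn y x"
  unfolding scaleR_lsq_def by (intro fn_cls sq_int_scale) auto

lemma fn_uminus: "AE x in lborel. fn (- y) x = - fn y x"
  using fn_cls[OF sq_int_scale[OF fn_sq_int[of y], of "-1"]] by (simp add: uminus_lsq_def)

lemma fn_minus: "AE x in lborel. fn (y - z) x = fn y x - fn z x"
  unfolding minus_lsq_def using fn_add[of y "- z"] fn_uminus[of z] by eventually_elim simp

lemma inner_lsq_integrable: "integrable lborel (\<lambda>x. fn y x * fn z x)"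
  by (intro sq_int_mult) auto

instance
proof
  fix x y z :: lsq and a b c :: real
  show "x + y + z = x + (y + z)"
    by (rule lsq_eqI)
      (use fn_add[of "x + y" z] fn_add[of x y] fn_add[of x "y + z"] fn_add[of y z] in eventually_elim, simp)
  show "x + y = y + x"
    by (simp add: plus_lsq_def add.commute)
  show "0 + x = x"
    by (rule lsq_eqI) (use fn_add[of 0 x] fn_zero in eventually_elim, simp)
  show "- x + x = 0"
    by (rule lsq_eqI) (use fn_add[of "- x" x] fn_uminus[of x] fn_zero in eventually_elim, simp)
  show "x - y = x + - y"
    by (simp add: minus_lsq_def)
  show "a *\<^sub>R (x + y) = a *\<^sub>R x + a *\<^sub>R y"
    by (rule lsq_eqI)
      (use fn_scaleR[of a "x + y"] fn_add[of x y] fn_add[of "a *\<^sub>R x" "a *\<^sub>R y"]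
        fn_scaleR[of a x] fn_scaleR[of a y] in eventually_elim, simp add: algebra_simps)
  show "(a + b) *\<^sub>R x = a *\<^sub>R x + b *\<^sub>R x"
    by (rule lsq_eqI)
      (use fn_scaleR[of "a + b" x] fn_add[of "a *\<^sub>R x" "b *\<^sub>R x"]
        fn_scaleR[of a x] fn_scaleR[of b x] in eventually_elim, simp add: algebra_simps)
  show "a *\<^sub>R b *\<^sub>R x = (a * b) *\<^sub>R x"
    by (rule lsq_eqI)
      (use fn_scaleR[of a "b *\<^sub>R x"] fn_scaleR[of b x] fn_scaleR[of "a * b" x]
        in eventually_elim, simp add: algebra_simps)
  show "1 *\<^sub>R x = x"
    by (rule lsq_eqI) (use fn_scaleR[of 1 x] in eventually_elim, simp)
  show "dist x y = norm (x - y)" by (simp add: dist_lsq_def)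
  show "sgn x = inverse (norm x) *\<^sub>R x" by (simp add: sgn_lsq_def)
  show "uniformity = (INF e\<in>{0 <..}. principal {(x, y :: lsq). dist x y < e})"
    by (simp add: uniformity_lsq_def)
  show "open U \<longleftrightarrow> (\<forall>x\<in>U. \<forall>\<^sub>F (x', y) in uniformity. x' = x \<longrightarrow> y \<in> U)" for U :: "lsq set"
    by (simp add: open_lsq_def)
  show "x \<bullet> y = y \<bullet> x" by (simp add: inner_lsq_def mult.commute)
  have "(x + y) \<bullet> z = (LINT t|lborel. fn x t * fn z t + fn y t * fn z t)"
    unfolding inner_lsq_def
    by (rule integral_cong_AE, simp, simp, use fn_add[of x y] in eventually_elim, simp add: algebra_simps)
  then show "(x + y) \<bullet> z = x \<bullet> z + y \<bullet> z"
    by (simp add: inner_lsq_def inner_lsq_integrable)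
  have "(a *\<^sub>R x) \<bullet> y = (LINT t|lborel. a * (fn x t * fn y t))"
    unfolding inner_lsq_def
    by (rule integral_cong_AE, simp, simp, use fn_scaleR[of a x] in eventually_elim, simp add: algebra_simps)
  then show "(a *\<^sub>R x) \<bullet> y = a * (x \<bullet> y)"
    by (simp add: inner_lsq_def)
  show "0 \<le> x \<bullet> x" by (simp add: inner_lsq_def)
  show "norm x = sqrt (x \<bullet> x)" by (simp add: norm_lsq_def)
  have "x \<bullet> x = 0 \<longleftrightarrow> (AE t in lborel. fn x t * fn x t = 0)"
    unfolding inner_lsq_def
    by (intro integral_nonneg_eq_0_iff_AE inner_lsq_integrable) auto
  moreover have "(AE t in lborel. fn x t * fn x t = 0) \<longleftrightarrow> x = 0"
  proof
    assume *: "AE t in lborel. fn x t * fn x t = 0"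
    show "x = 0"
      by (rule lsq_eqI) (use * fn_zero in eventually_elim, simp)
  next
    assume "x = 0" then show "AE t in lborel. fn x t * fn x t = 0"
      using fn_zero by (auto elim: eventually_mono)
  qed
  ultimately show "x \<bullet> x = 0 \<longleftrightarrow> x = 0" by simp
qed

end

lemma inner_cls:
  assumes "f \<in> sq_int" "g \<in> sq_int"
  shows "cls f \<bullet> cls g = (LINT x|lborel. f x * g x)"
  unfolding inner_lsq_def
proof (rule integral_cong_AE)
  show "AE x in lborel. fn (cls f) x * fn (cls g) x = f x * g x"
    using fn_cls[OF assms(1)] fn_cls[OF assms(2)] by eventually_elim simp
qed (use assms[THEN sq_int_measurable] in simp_all)

lemma norm_sq_lsq: "(norm y)\<^sup>2 = (LINT x|lborel. (fn y x)\<^sup>2)" for y :: lsq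
  unfolding power2_norm_eq_inner inner_lsq_def by (simp add: power2_eq_square)

lemma norm_cls_sq:
  assumes "f \<in> sq_int"
  shows "(norm (cls f))\<^sup>2 = (LINT x|lborel. (f x)\<^sup>2)"
  unfolding power2_norm_eq_inner using inner_cls[OF assms assms] by (simp add: power2_eq_square)

lemma nn_norm_sq_lsq: "(\<integral>\<^sup>+x. ennreal ((fn y x)\<^sup>2) \<partial>lborel) = ennreal ((norm y)\<^sup>2)" for y :: lsq
  unfolding norm_sq_lsq by (rule nn_integral_eq_integral) (use fn_sq_int[of y] in \<open>auto simp: sq_int_def\<close>)

section \<open>Completeness (Riesz-Fischer)\<close>

lemma Cauchy_fast_subseq:
  fixes X :: "nat \<Rightarrow> 'a::metric_space"
  assumes "Cauchy X" and e: "\<And>k. e k > (0::real)"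
  obtains r where "strict_mono r" "\<And>k. dist (X (r (Suc k))) (X (r k)) < e k"
proof -
  have "\<exists>M. \<forall>m\<ge>M. \<forall>n\<ge>M. dist (X m) (X n) < e k" for k
    using assms by (auto simp: Cauchy_def)
  then obtain M where M: "\<And>k m n. m \<ge> M k \<Longrightarrow> n \<ge> M k \<Longrightarrow> dist (X m) (X n) < e k"
    by metis
  have "\<exists>r. \<forall>k. M k \<le> r k \<and> r k < r (Suc k)"
  proof (rule dependent_nat_choice)
    show "\<exists>x. M 0 \<le> x" by blast
    show "\<exists>y. M (Suc n) \<le> y \<and> x < y" for x n
      by (rule exI[of _ "max (M (Suc n)) (Suc x)"]) auto
  qed
  then obtain r where r: "\<And>k. M k \<le> r k" "\<And>k. r k < r (Suc k)"
    by blast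
  show ?thesis
  proof
    show "strict_mono r" using r(2) by (simp add: strict_mono_Suc_iff)
    show "dist (X (r (Suc k))) (X (r k)) < e k" for k
      using M r(1)[of k] r(2)[of k] by simp
  qed
qed

text \<open>On the line, small \<open>L\<^sup>2\<close> norms give no control of integrals of
  absolute values. The squares of the increments are therefore weighted by \<open>2 ^ k\<close>,
  which keeps their integrals summable, and
  \<open>\<bar>g\<bar> \<le> 2 ^ k * g\<^sup>2 + (1/2) ^ k\<close> turns this into absolute
  summability at almost every point.\<close>

lemma AE_convergent_if_fast:
  fixes y :: "nat \<Rightarrow> lsq"
  assumes fast: "\<And>k. norm (y (Suc k) - y k) < (1/2) ^ k"
  shows "AE x in lborel. convergent (\<lambda>k. fn (y k) x)"
proof -
  define g where "g k = fn (y (Suc k) - y k)" for k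
  have [measurable]: "g k \<in> borel_measurable borel" for k
    by (simp add: g_def)
  have bound: "(\<integral>\<^sup>+x. ennreal (2 ^ k * (g k x)\<^sup>2) \<partial>lborel) \<le> ennreal ((1/2) ^ k)" for k
  proof -
    have "(\<integral>\<^sup>+x. ennreal (2 ^ k * (g k x)\<^sup>2) \<partial>lborel) = ennreal (2 ^ k) * (\<integral>\<^sup>+x. ennreal ((g k x)\<^sup>2) \<partial>lborel)"
      by (subst nn_integral_cmult[symmetric]) (auto simp: ennreal_mult)
    also have "\<dots> = ennreal (2 ^ k * (norm (y (Suc k) - y k))\<^sup>2)"
      by (simp add: g_def nn_norm_sq_lsq ennreal_mult)
    also have "\<dots> \<le> ennreal (2 ^ k * ((1/2) ^ k)\<^sup>2)"
      using fast[of k] by (intro ennreal_leI mult_left_mono power_mono) auto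
    also have "2 ^ k * ((1/2) ^ k)\<^sup>2 = ((1/2) ^ k :: real)"
      by (simp add: power2_eq_square flip: power_mult_distrib mult.assoc)
    finally show ?thesis .
  qed
  have "(\<integral>\<^sup>+x. (\<Sum>k. ennreal (2 ^ k * (g k x)\<^sup>2)) \<partial>lborel) = (\<Sum>k. \<integral>\<^sup>+x. ennreal (2 ^ k * (g k x)\<^sup>2) \<partial>lborel)"
    by (rule nn_integral_suminf) auto
  also have "\<dots> \<le> (\<Sum>k. ennreal ((1/2) ^ k))"
    by (intro suminf_le bound) auto
  also have "\<dots> = ennreal (\<Sum>k. (1/2) ^ k)"
    by (intro suminf_ennreal2 summable_geometric) auto
  also have "\<dots> < \<infinity>" by simp
  finally have "AE x in lborel. (\<Sum>k. ennreal (2 ^ k * (g k x)\<^sup>2)) \<noteq> \<infinity>"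
    by (intro nn_integral_PInf_AE) auto
  moreover have "AE x in lborel. \<forall>k. g k x = fn (y (Suc k)) x - fn (y k) x"
    unfolding AE_all_countable g_def by (intro allI fn_minus)
  ultimately show ?thesis
  proof eventually_elim
    case (elim x)
    have "summable (\<lambda>k. 2 ^ k * (g k x)\<^sup>2)"
      using elim by (intro summable_suminf_not_top) auto
    then have "summable (\<lambda>k. 2 ^ k * (g k x)\<^sup>2 + (1/2) ^ k)"
      by (intro summable_add summable_geometric) auto
    moreover have "norm (g k x) \<le> 2 ^ k * (g k x)\<^sup>2 + (1/2) ^ k" for k
    proof -
      \<comment> \<open>The square alone would leave twice the linear term; the added
        \<open>2 ^ k * \<bar>g k x\<bar>\<close> leaves it exactly once.\<close>
      have "0 \<le> (2 ^ k * \<bar>g k x\<bar> - 1)\<^sup>2 + 2 ^ k * \<bar>g k x\<bar>" by simp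
      also have "\<dots> \<le> 2 ^ k * (2 ^ k * (g k x)\<^sup>2 + (1/2) ^ k - \<bar>g k x\<bar>)"
        by (simp add: power2_eq_square algebra_simps power_divide)
      finally have *: "0 \<le> 2 ^ k * (2 ^ k * (g k x)\<^sup>2 + (1/2) ^ k - \<bar>g k x\<bar>)" .
      have "0 \<le> 2 ^ k * (g k x)\<^sup>2 + (1/2) ^ k - \<bar>g k x\<bar>"
        by (rule mult_left_le_imp_le[where c="2 ^ k"]) (use * in simp_all)
      then show ?thesis by simp
    qed
    ultimately have "summable (\<lambda>k. g k x)"
      by (rule summable_comparison_test'[where N=0])
    then have "convergent (\<lambda>n. \<Sum>k<n. g k x)"
      by (simp add: summable_iff_convergent)
    moreover have "(\<Sum>k<n. g k x) = fn (y n) x - fn (y 0) x" for n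
      using elim sum_lessThan_telescope[of "\<lambda>k. fn (y k) x" n] by simp
    ultimately have "convergent (\<lambda>n. (fn (y n) x - fn (y 0) x) + fn (y 0) x)"
      by (intro convergent_add) (auto simp: convergent_const)
    then show ?case by simp
  qed
qed

instance lsq :: complete_space
proof
  fix X :: "nat \<Rightarrow> lsq" assume X: "Cauchy X"
  obtain r where r: "strict_mono r" "\<And>k. dist (X (r (Suc k))) (X (r k)) < (1/2) ^ k"
    using Cauchy_fast_subseq[OF X, of "\<lambda>k. (1/2) ^ k"] by auto
  define y where "y k = X (r k)" for k
  have y_eq: "y = X \<circ> r" by (auto simp: y_def)
  define f where "f x = lim (\<lambda>k. fn (y k) x)" for x
  have [measurable]: "f \<in> borel_measurable borel"
    unfolding f_def by measurable
  have "AE x in lborel. convergent (\<lambda>k. fn (y k) x)"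
    by (rule AE_convergent_if_fast) (use r(2) in \<open>simp add: y_def dist_norm\<close>)
  then have lim: "AE x in lborel. (\<lambda>k. fn (y k) x) \<longlonglongrightarrow> f x"
    by eventually_elim (simp add: f_def convergent_LIMSEQ_iff)
  have "Cauchy y"
    using Cauchy_subseq_Cauchy[OF X r(1)] unfolding y_eq .
  \<comment> \<open>Fatou's lemma for \<open>y j - y k\<close> as j grows passes the Cauchy bound on
    to \<open>f - y k\<close>. One instance of it also shows that \<open>f\<close> is square
    integrable.\<close>
  have near: "\<exists>N. \<forall>k\<ge>N. (\<integral>\<^sup>+x. ennreal ((f x - fn (y k) x)\<^sup>2) \<partial>lborel) \<le> ennreal (e\<^sup>2)" if "e > 0" for e
  proof -
    obtain N where N: "\<And>j k. j \<ge> N \<Longrightarrow> k \<ge> N \<Longrightarrow> norm (y j - y k) < e"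
      using \<open>Cauchy y\<close> \<open>e > 0\<close> by (metis Cauchy_iff)
    have "(\<integral>\<^sup>+x. ennreal ((f x - fn (y k) x)\<^sup>2) \<partial>lborel) \<le> ennreal (e\<^sup>2)" if "k \<ge> N" for k
    proof -
      have "AE x in lborel. \<forall>j. fn (y j - y k) x = fn (y j) x - fn (y k) x"
        unfolding AE_all_countable by (intro allI fn_minus)
      with lim have "AE x in lborel. ennreal ((f x - fn (y k) x)\<^sup>2) \<le> liminf (\<lambda>j. ennreal ((fn (y j - y k) x)\<^sup>2))"
      proof eventually_elim
        case (elim x)
        then have "(\<lambda>j. ennreal ((fn (y j - y k) x)\<^sup>2)) \<longlonglongrightarrow> ennreal ((f x - fn (y k) x)\<^sup>2)"
          by (auto intro!: tendsto_intros)
        from lim_imp_Liminf[OF _ this] show ?case by simp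
      qed
      then have "(\<integral>\<^sup>+x. ennreal ((f x - fn (y k) x)\<^sup>2) \<partial>lborel)
          \<le> (\<integral>\<^sup>+x. liminf (\<lambda>j. ennreal ((fn (y j - y k) x)\<^sup>2)) \<partial>lborel)"
        by (rule nn_integral_mono_AE)
      also have "\<dots> \<le> liminf (\<lambda>j. \<integral>\<^sup>+x. ennreal ((fn (y j - y k) x)\<^sup>2) \<partial>lborel)"
        by (rule nn_integral_liminf) auto
      also have "\<dots> = liminf (\<lambda>j. ennreal ((norm (y j - y k))\<^sup>2))"
        by (simp add: nn_norm_sq_lsq)
      also have "\<dots> \<le> ennreal (e\<^sup>2)"
      proof (rule Liminf_le)
        show "\<forall>\<^sub>F j in sequentially. ennreal ((norm (y j - y k))\<^sup>2) \<le> ennreal (e\<^sup>2)"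
          unfolding eventually_sequentially
          using N[OF _ that] by (auto intro!: exI[of _ N] ennreal_leI power_mono intro: less_imp_le)
      qed simp
      finally show ?thesis .
    qed
    then show ?thesis by blast
  qed
  have diff: "(\<lambda>x. f x - fn (y k) x) \<in> sq_int"
    if "(\<integral>\<^sup>+x. ennreal ((f x - fn (y k) x)\<^sup>2) \<partial>lborel) \<le> ennreal (e\<^sup>2)" for k e
    using le_less_trans[OF that] by (auto simp: sq_int_def intro!: integrableI_bounded)
  have f: "f \<in> sq_int"
  proof -
    obtain k where "(\<integral>\<^sup>+x. ennreal ((f x - fn (y k) x)\<^sup>2) \<partial>lborel) \<le> ennreal (1\<^sup>2)"
      using near[of 1] by auto
    from sq_int_add[OF diff[OF this] fn_sq_int[of "y k"]] show ?thesis by simp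
  qed
  have "y \<longlonglongrightarrow> cls f"
  proof (rule metric_LIMSEQ_I)
    fix e :: real assume "e > 0"
    then obtain N where N: "\<And>k. k \<ge> N \<Longrightarrow> (\<integral>\<^sup>+x. ennreal ((f x - fn (y k) x)\<^sup>2) \<partial>lborel) \<le> ennreal ((e/2)\<^sup>2)"
      using near[of "e/2"] by auto
    have "dist (y k) (cls f) < e" if "k \<ge> N" for k
    proof -
      have "ennreal ((norm (cls f - y k))\<^sup>2) = (\<integral>\<^sup>+x. ennreal ((f x - fn (y k) x)\<^sup>2) \<partial>lborel)"
        unfolding nn_norm_sq_lsq[symmetric]
        by (rule nn_integral_cong_AE) (use fn_minus[of "cls f" "y k"] fn_cls[OF f] in eventually_elim, simp)
      also have "\<dots> \<le> ennreal ((e/2)\<^sup>2)" by (rule N[OF that])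
      finally have "(norm (cls f - y k))\<^sup>2 \<le> (e/2)\<^sup>2" by (simp add: ennreal_le_iff)
      then have "norm (cls f - y k) \<le> e/2"
        by (rule power2_le_imp_le) (use \<open>e > 0\<close> in simp)
      then show ?thesis using \<open>e > 0\<close> by (simp add: dist_norm norm_minus_commute)
    qed
    then show "\<exists>N. \<forall>k\<ge>N. dist (y k) (cls f) < e" by blast
  qed
  then have "(X \<circ> r) \<longlonglongrightarrow> cls f" unfolding y_eq .
  from Cauchy_converges_subseq[OF X r(1) this] show "convergent X"
    by (auto simp: convergent_def)
qed

instance lsq :: banach ..

section \<open>Separability: density of rational step functions\<close>

lemma AE_zero_if_rays_zero:
  fixes h :: "real \<Rightarrow> real"
  assumes h: "integrable lborel h"
    and zero: "\<And>x. (LINT y|lborel. indicat_real {x<..} y * h y) = 0"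
  shows "AE x in lborel. h x = 0"
proof -
  have [measurable]: "h \<in> borel_measurable borel" using h by auto
  have int: "integrable lborel (\<lambda>y. indicat_real {x<..} y * max (h y) 0)"
      "integrable lborel (\<lambda>y. indicat_real {x<..} y * max (- h y) 0)" for x
    by (rule Bochner_Integration.integrable_bound[OF h]; auto simp: indicator_def)+
  have eq: "(LINT y|lborel. indicat_real {x<..} y * max (h y) 0)
      = (LINT y|lborel. indicat_real {x<..} y * max (- h y) 0)" for x
  proof -
    have "(LINT y|lborel. indicat_real {x<..} y * max (h y) 0)
        - (LINT y|lborel. indicat_real {x<..} y * max (- h y) 0) = (LINT y|lborel. indicat_real {x<..} y * h y)"
      by (subst Bochner_Integration.integral_diff[symmetric, OF int])
        (auto intro!: Bochner_Integration.integral_cong simp: max_def indicator_def)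
    then show ?thesis using zero by simp
  qed
  have em: "emeasure (density lborel (\<lambda>y. ennreal (max (c * h y) 0))) {x<..}
      = ennreal (LINT y|lborel. indicat_real {x<..} y * max (c * h y) 0)" if "c = 1 \<or> c = -1" for x c
  proof -
    have "emeasure (density lborel (\<lambda>y. ennreal (max (c * h y) 0))) {x<..}
        = (\<integral>\<^sup>+y. ennreal (indicat_real {x<..} y * max (c * h y) 0) \<partial>lborel)"
      by (subst emeasure_density) (auto intro!: nn_integral_cong simp: indicator_def)
    also have "\<dots> = ennreal (LINT y|lborel. indicat_real {x<..} y * max (c * h y) 0)"
      by (rule nn_integral_eq_integral) (use int that in auto)
    finally show ?thesis .
  qed
  \<comment> \<open>The positive and the negative part of \<open>h\<close> are densities of two
    finite measures with equal values on all rays. Such measures coincide, and densities are unique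
    almost everywhere.\<close>
  have "density lborel (\<lambda>y. ennreal (max (h y) 0)) = density lborel (\<lambda>y. ennreal (max (- h y) 0))"
    using em[of 1] em[of "-1"] eq by (intro measure_eqI_lessThan) auto
  then have "AE y in lborel. ennreal (max (h y) 0) = ennreal (max (- h y) 0)"
    by (intro sigma_finite_measure.density_unique[OF sigma_finite_lborel]) auto
  then show ?thesis
    by eventually_elim (auto simp: max_def split: if_splits)
qed

text \<open>Pairing with \<open>ivl c d\<close> is integration over (c, d). All primitives of
  elements of \<open>lsq\<close> are written in this way; for \<open>d \<le> c\<close> the vector is
  0.\<close>

definition ivl :: "real \<Rightarrow> real \<Rightarrow> lsq" where
  "ivl c d = cls (indicat_real {c<..<d})"

lemma sq_int_ivl: "indicat_real {c<..<d} \<in> sq_int"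
proof -
  have "integrable lborel (indicat_real {c<..<d})"
    by (rule integrable_real_indicator, simp, cases "c \<le> d") auto
  moreover have "(\<lambda>x. (indicat_real {c<..<d} x)\<^sup>2) = indicat_real {c<..<d}"
    by (auto simp: indicator_def)
  ultimately show ?thesis by (simp add: sq_int_def)
qed

lemma fn_ivl: "AE x in lborel. fn (ivl c d) x = indicat_real {c<..<d} x"
  unfolding ivl_def by (rule fn_cls[OF sq_int_ivl])

lemma inner_ivl: "y \<bullet> ivl c d = (LINT x|lborel. fn y x * indicat_real {c<..<d} x)"
  using inner_cls[OF fn_sq_int[of y] sq_int_ivl] by (simp add: ivl_def)

lemma integrable_ivl: "integrable lborel (\<lambda>x. fn y x * indicat_real {c<..<d} x)"
  by (intro sq_int_mult sq_int_ivl fn_sq_int)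

text \<open>A square integrable function on the line need not be integrable, so the criterion with
  rays is applied to the cut-offs to (-n, n), whose ray integrals are again pairings with
  intervals.\<close>

lemma orth_ivl_imp_zero:
  assumes orth: "\<And>c d. y \<bullet> ivl c d = 0"
  shows "y = 0"
proof (rule lsq_eqI)
  have "AE x in lborel. fn y x * indicat_real {- real n<..<real n} x = 0" for n
  proof (rule AE_zero_if_rays_zero[OF integrable_ivl])
    fix x
    have "indicat_real {x<..} t * (fn y t * indicat_real {- real n<..<real n} t)
        = fn y t * indicat_real {max x (- real n)<..<real n} t" for t
      by (auto simp: indicator_def)
    then show "(LINT t|lborel. indicat_real {x<..} t * (fn y t * indicat_real {- real n<..<real n} t)) = 0"
      using orth[of "max x (- real n)" "real n"] by (simp only: inner_ivl)
  qed
  then have "AE x in lborel. \<forall>n. fn y x * indicat_real {- real n<..<real n} x = 0"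
    unfolding AE_all_countable by blast
  then show "AE x in lborel. fn y x = fn 0 x"
    using fn_zero
  proof eventually_elim
    case (elim x)
    obtain n where "\<bar>x\<bar> < real n" using reals_Archimedean2 by blast
    then show ?case using elim(1)[rule_format, of n] elim(2) by (auto simp: indicator_def split: if_splits)
  qed
qed

text \<open>The projection argument: a sequence that minimises the distance from \<open>x\<close> to
  \<open>C\<close> is Cauchy by the parallelogram identity, and \<open>x\<close> minus its limit is
  orthogonal to \<open>C\<close>.\<close>

lemma closed_subspace_orthogonal:
  fixes C :: "'a::{real_inner, complete_space} set"
  assumes C: "subspace C" "closed C" and x: "x \<notin> C"
  obtains z where "z \<noteq> 0" "\<And>y. y \<in> C \<Longrightarrow> z \<bullet> y = 0"
proof -
  define d where "d = Inf ((\<lambda>y. norm (x - y)) ` C)"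
  have ne: "C \<noteq> {}" using subspace_0[OF C(1)] by auto
  have bdd: "bdd_below ((\<lambda>y. norm (x - y)) ` C)"
    by (rule bdd_belowI[of _ 0]) auto
  have d_le: "d \<le> norm (x - y)" if "y \<in> C" for y
    unfolding d_def using bdd that by (intro cInf_lower) auto
  have d_nn: "0 \<le> d"
    unfolding d_def using ne by (intro cInf_greatest) auto
  have "\<exists>y\<in>C. norm (x - y) < d + e" if "e > 0" for e
    using cInf_lessD[of "(\<lambda>y. norm (x - y)) ` C" "d + e"] ne that by (auto simp: d_def)
  then have "\<exists>y\<in>C. norm (x - y) < d + inverse (real (Suc n))" for n
    by auto
  then obtain y where y: "\<And>n. y n \<in> C" "\<And>n. norm (x - y n) < d + inverse (real (Suc n))"
    by metis
  have lim: "(\<lambda>n. norm (x - y n)) \<longlonglongrightarrow> d"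
    by (rule tendsto_sandwich[of "\<lambda>_. d" _ sequentially "\<lambda>n. d + inverse (real (Suc n))" d])
      (use y d_le LIMSEQ_inverse_real_of_nat_add in \<open>auto intro!: always_eventually less_imp_le\<close>)
  have par: "(norm (y m - y n))\<^sup>2 \<le> 2 * ((norm (x - y m))\<^sup>2 - d\<^sup>2) + 2 * ((norm (x - y n))\<^sup>2 - d\<^sup>2)" for m n
  proof -
    have "(1/2) *\<^sub>R (y m + y n) \<in> C"
      using C(1) y(1) by (intro subspace_mul subspace_add) auto
    from d_le[OF this] have "d\<^sup>2 \<le> (norm (x - (1/2) *\<^sub>R (y m + y n)))\<^sup>2"
      using d_nn by (intro power_mono)
    moreover have "(norm (y m - y n))\<^sup>2 + 4 * (norm (x - (1/2) *\<^sub>R (y m + y n)))\<^sup>2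
        = 2 * (norm (x - y m))\<^sup>2 + 2 * (norm (x - y n))\<^sup>2"
      by (simp add: power2_norm_eq_inner algebra_simps inner_commute)
    ultimately show ?thesis by simp
  qed
  have "Cauchy y"
  proof (rule CauchyI)
    fix e :: real assume "e > 0"
    have "(\<lambda>n. (norm (x - y n))\<^sup>2) \<longlonglongrightarrow> d\<^sup>2"
      by (intro tendsto_intros lim)
    then have "\<forall>\<^sub>F n in sequentially. (norm (x - y n))\<^sup>2 < d\<^sup>2 + e\<^sup>2 / 4"
      by (rule order_tendstoD) (use \<open>e > 0\<close> in simp)
    then obtain N where N: "\<And>n. n \<ge> N \<Longrightarrow> (norm (x - y n))\<^sup>2 < d\<^sup>2 + e\<^sup>2 / 4"
      by (auto simp: eventually_sequentially)
    have "norm (y m - y n) < e" if "m \<ge> N" "n \<ge> N" for m n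
    proof (rule power2_less_imp_less)
      show "(norm (y m - y n))\<^sup>2 < e\<^sup>2" using par[of m n] N[OF that(1)] N[OF that(2)] unfolding right_diff_distrib by argo
    qed (use \<open>e > 0\<close> in simp)
    then show "\<exists>M. \<forall>m\<ge>M. \<forall>n\<ge>M. norm (y m - y n) < e" by blast
  qed
  then obtain p where p: "y \<longlonglongrightarrow> p"
    by (auto simp: Cauchy_convergent_iff convergent_def)
  have "p \<in> C"
    using C(2) y(1) p by (auto simp: closed_sequential_limits)
  have "(\<lambda>n. norm (x - y n)) \<longlonglongrightarrow> norm (x - p)"
    by (intro tendsto_intros p)
  with lim have norm_p: "norm (x - p) = d"
    using LIMSEQ_unique by blast
  show ?thesis
  proof
    show "x - p \<noteq> 0" using x \<open>p \<in> C\<close> by auto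
    fix v assume "v \<in> C"
    show "(x - p) \<bullet> v = 0"
    proof (cases "v = 0")
      case False
      \<comment> \<open>This parameter minimises the distance from \<open>x\<close> along the line
        through \<open>p\<close> in direction \<open>v\<close>; as \<open>p\<close> is already
        closest, nothing can be gained.\<close>
      define t where "t = ((x - p) \<bullet> v) / (v \<bullet> v)"
      have "p + t *\<^sub>R v \<in> C"
        using C(1) \<open>p \<in> C\<close> \<open>v \<in> C\<close> by (intro subspace_mul subspace_add) auto
      from d_le[OF this] have "d\<^sup>2 \<le> (norm (x - p - t *\<^sub>R v))\<^sup>2"
        using d_nn by (intro power_mono) (simp_all add: algebra_simps)
      also have "\<dots> = d\<^sup>2 - 2 * t * ((x - p) \<bullet> v) + t\<^sup>2 * (v \<bullet> v)"
        unfolding norm_p[symmetric] power2_norm_eq_inner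
        by (simp add: inner_diff_left inner_diff_right inner_commute power2_eq_square algebra_simps)
      also have "\<dots> = d\<^sup>2 - ((x - p) \<bullet> v)\<^sup>2 / (v \<bullet> v)"
        using False by (simp add: t_def power2_eq_square field_simps)
      finally have "((x - p) \<bullet> v)\<^sup>2 / (v \<bullet> v) \<le> 0" by simp
      moreover have "v \<bullet> v > 0" using False by simp
      ultimately show ?thesis by (simp add: divide_le_0_iff)
    qed simp
  qed
qed

text \<open>Rational coefficients and endpoints keep the set countable. The price is that only its
  closure is a real subspace.\<close>

definition step_funs :: "lsq set" where
  "step_funs = (\<lambda>l. \<Sum>(q, c, d)\<leftarrow>l. of_rat q *\<^sub>R ivl (of_rat c) (of_rat d)) ` (UNIV :: (rat \<times> rat \<times> rat) list set)"

lemma step_funs_add: "y \<in> step_funs \<Longrightarrow> z \<in> step_funs \<Longrightarrow> y + z \<in> step_funs"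
proof -
  let ?S = "\<lambda>l. \<Sum>(q, c, d)\<leftarrow>l. of_rat q *\<^sub>R ivl (of_rat c) (of_rat d)"
  assume "y \<in> step_funs" "z \<in> step_funs"
  then obtain k l where "y = ?S k" "z = ?S l" by (auto simp: step_funs_def)
  then have "y + z = ?S (k @ l)" by simp
  then show ?thesis unfolding step_funs_def by blast
qed

lemma step_funs_scale:
  assumes "y \<in> step_funs"
  shows "of_rat r *\<^sub>R y \<in> step_funs"
proof -
  have "of_rat r *\<^sub>R (\<Sum>(q, c, d)\<leftarrow>l. of_rat q *\<^sub>R ivl (of_rat c) (of_rat d))
      = (\<Sum>(q, c, d)\<leftarrow>map (\<lambda>(q, c, d). (r * q, c, d)) l. of_rat q *\<^sub>R ivl (of_rat c) (of_rat d))" for l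
    by (induction l) (simp_all add: scaleR_add_right of_rat_mult split_beta)
  then show ?thesis using assms unfolding step_funs_def by blast
qed

lemma step_funs_ivl: "ivl (of_rat c) (of_rat d) \<in> step_funs"
  unfolding step_funs_def by (rule image_eqI[of _ _ "[(1, c, d)]"]) auto

lemma subspace_closure_step_funs: "subspace (closure step_funs)"
  unfolding subspace_def
proof (intro conjI ballI allI)
  have "0 \<in> step_funs"
    unfolding step_funs_def by (rule image_eqI[of _ _ "[]"]) auto
  then show "0 \<in> closure step_funs" using closure_subset by blast
  fix y z assume y: "y \<in> closure step_funs" and "z \<in> closure step_funs"
  then obtain Y Z where Y: "\<And>n. Y n \<in> step_funs" "Y \<longlonglongrightarrow> y" and Z: "\<And>n. Z n \<in> step_funs" "Z \<longlonglongrightarrow> z"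
    unfolding closure_sequential by blast
  show "y + z \<in> closure step_funs"
    unfolding closure_sequential
    by (rule exI[of _ "\<lambda>n. Y n + Z n"]) (use Y Z in \<open>auto intro!: step_funs_add tendsto_add\<close>)
  fix c :: real
  have "c \<in> closure \<rat>" using Rats_closure_real by simp
  then obtain q where q: "\<And>n. q n \<in> \<rat>" "q \<longlonglongrightarrow> c"
    unfolding closure_sequential by blast
  have "q n *\<^sub>R Y n \<in> step_funs" for n
    using q(1)[of n] step_funs_scale[OF Y(1)] by (auto elim!: Rats_cases)
  then show "c *\<^sub>R y \<in> closure step_funs"
    unfolding closure_sequential
    by (intro exI[of _ "\<lambda>n. q n *\<^sub>R Y n"]) (use q Y in \<open>auto intro!: tendsto_scaleR\<close>)
qed


text \<open>Otherwise projection yields a nonzero vector orthogonal to all rational intervals.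
  Rational approximation of the endpoints makes it orthogonal to every interval, hence zero.\<close>

lemma closure_step_funs: "closure step_funs = UNIV"
proof (rule ccontr)
  assume "closure step_funs \<noteq> UNIV"
  then obtain x where "x \<notin> closure step_funs" by blast
  from closed_subspace_orthogonal[OF subspace_closure_step_funs closed_closure this]
  obtain z where z: "z \<noteq> 0" "\<And>y. y \<in> closure step_funs \<Longrightarrow> z \<bullet> y = 0" by blast
  have rat: "z \<bullet> ivl (of_rat c) (of_rat d) = 0" for c d
    using z(2) step_funs_ivl closure_subset by blast
  have "z \<bullet> ivl c d = 0" for c d
  proof -
    have "\<exists>q. c + e < of_rat q \<and> of_rat q < c + 2 * e" if "e > 0" for c e :: real
      using of_rat_dense[of "c + e" "c + 2 * e"] that by auto
    then have "\<exists>q. c + inverse (real (Suc n)) < of_rat q \<and> of_rat q < c + 2 * inverse (real (Suc n))" for c :: real and n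
      by simp
    then obtain q where q: "\<And>c n. c + inverse (real (Suc n)) < of_rat (q c n)"
        "\<And>c n. of_rat (q c n) < c + 2 * inverse (real (Suc n))"
      by metis
    define l where "l n = (of_rat (q c n) :: real)" for n
    \<comment> \<open>Starting from \<open>d - 3 / (n + 1)\<close>, the choice of \<open>q\<close>
      lands between \<open>d - 2 / (n + 1)\<close> and \<open>d - 1 / (n + 1)\<close>. Both
      endpoints are approached from inside (c, d), so the integrand on (c, d) dominates.\<close>
    define r where "r n = (of_rat (q (d - 3 * inverse (real (Suc n))) n) :: real)" for n
    have lim_inv: "(\<lambda>n. c + k * inverse (real (Suc n))) \<longlonglongrightarrow> c" for c k
      using tendsto_add[OF tendsto_const tendsto_mult[OF tendsto_const LIMSEQ_inverse_real_of_nat], of c k] by simp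
    have l: "c < l n" "l \<longlonglongrightarrow> c" and r: "r n < d" "r \<longlonglongrightarrow> d" for n
    proof -
      have p: "inverse (real (Suc n)) > 0" for n by simp
      show "c < l n" using q(1)[of c n] p[of n] unfolding l_def by linarith
      show "r n < d" using q(2)[of "d - 3 * inverse (real (Suc n))" n] p[of n] unfolding r_def by linarith
      show "l \<longlonglongrightarrow> c"
      proof (rule tendsto_sandwich[OF _ _ tendsto_const lim_inv[of c 2]])
        show "\<forall>\<^sub>F n in sequentially. c \<le> l n" "\<forall>\<^sub>F n in sequentially. l n \<le> c + 2 * inverse (real (Suc n))"
          using q[where c=c] p unfolding l_def by (auto intro!: always_eventually less_imp_le intro: less_trans)
             (smt (verit))
      qed
      show "r \<longlonglongrightarrow> d"
      proof (rule tendsto_sandwich[OF _ _ lim_inv[of d "-3"] tendsto_const])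
        have "d + - 3 * inverse (real (Suc n)) \<le> r n \<and> r n \<le> d" for n
          using q[where c="d - 3 * inverse (real (Suc n))", of n] p[of n] unfolding r_def by linarith
        then show "\<forall>\<^sub>F n in sequentially. d + - 3 * inverse (real (Suc n)) \<le> r n" "\<forall>\<^sub>F n in sequentially. r n \<le> d"
          by auto
      qed
    qed
    have "(\<lambda>n. LINT x|lborel. fn z x * indicat_real {l n<..<r n} x)
        \<longlonglongrightarrow> (LINT x|lborel. fn z x * indicat_real {c<..<d} x)"
    proof (rule integral_dominated_convergence[where w="\<lambda>x. \<bar>fn z x * indicat_real {c<..<d} x\<bar>"])
      show "AE x in lborel. (\<lambda>n. fn z x * indicat_real {l n<..<r n} x) \<longlonglongrightarrow> fn z x * indicat_real {c<..<d} x"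
      proof (intro AE_I2 tendsto_mult tendsto_const)
        fix x
        have "\<forall>\<^sub>F n in sequentially. indicat_real {l n<..<r n} x = indicat_real {c<..<d} x"
        proof (cases "c < x \<and> x < d")
          case True
          then have "\<forall>\<^sub>F n in sequentially. l n < x" "\<forall>\<^sub>F n in sequentially. x < r n"
            using l(2) r(2) by (auto intro: order_tendstoD)
          then show ?thesis by eventually_elim (use True in auto)
        next
          case False
          then have "indicat_real {l n<..<r n} x = indicat_real {c<..<d} x" for n
            using l(1)[of n] r(1)[of n] by (auto simp: indicator_def)
          then show ?thesis by simp
        qed
        then show "(\<lambda>n. indicat_real {l n<..<r n} x) \<longlonglongrightarrow> indicat_real {c<..<d} x"
          by (rule tendsto_eventually)
      qed
      show "AE x in lborel. norm (fn z x * indicat_real {l n<..<r n} x) \<le> \<bar>fn z x * indicat_real {c<..<d} x\<bar>" for n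
        using l(1)[of n] r(1)[of n] by (intro AE_I2) (auto simp: indicator_def)
    qed (use integrable_ivl[of z c d] in auto)
    moreover have "(LINT x|lborel. fn z x * indicat_real {l n<..<r n} x) = 0" for n
      using rat unfolding inner_ivl[symmetric] l_def r_def by blast
    ultimately show ?thesis
      by (simp add: inner_ivl LIMSEQ_const_iff)
  qed
  then have "z = 0" by (rule orth_ivl_imp_zero)
  with z(1) show False by simp
qed

lemma countable_step_funs: "countable step_funs"
  unfolding step_funs_def by (intro countable_image) auto

lemma lsq_dense_ball:
  assumes "e > 0"
  shows "\<exists>d\<in>step_funs. dist d x < e"
  using closure_step_funs assms closure_approachable[of x step_funs] by auto

text \<open>Bochner integrals of \<open>lsq\<close>-valued curves are only defined on types of this
  class.\<close>

instance lsq :: second_countable_topology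
proof
  let ?B = "(\<lambda>(d, q). ball d (of_rat q)) ` (step_funs \<times> (UNIV :: rat set))"
  have "topological_basis ?B"
  proof (rule topological_basisI)
    fix U :: "lsq set" and x assume "open U" "x \<in> U"
    then obtain e where e: "e > 0" "ball x e \<subseteq> U" by (auto simp: open_contains_ball)
    obtain q where q: "0 < real_of_rat q" "real_of_rat q < e / 2" using of_rat_dense[of 0 "e/2"] e by auto
    obtain d where d: "d \<in> step_funs" "dist d x < of_rat q" using lsq_dense_ball[OF q(1), of x] by blast
    have "ball d (of_rat q) \<subseteq> ball x e"
    proof
      fix y assume "y \<in> ball d (of_rat q)"
      then show "y \<in> ball x e"
        using d(2) q(2) dist_triangle[of x y d] by (simp add: dist_commute)
    qed
    with e d show "\<exists>V\<in>?B. x \<in> V \<and> V \<subseteq> U" by force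
  qed auto
  moreover have "countable ?B"
    using countable_step_funs by auto
  ultimately show "\<exists>B :: lsq set set. countable B \<and> open = generate_topology B"
    using topological_basis_imp_subbasis by blast
qed

section \<open>Intervals, and translation, restriction and reflection as operators\<close>

lemma inner_ivl_ivl: "ivl a b \<bullet> ivl c d = max 0 (min b d - max a c)"
proof -
  have "ivl a b \<bullet> ivl c d = (LINT x|lborel. indicat_real {a<..<b} x * indicat_real {c<..<d} x)"
    unfolding ivl_def by (rule inner_cls[OF sq_int_ivl sq_int_ivl])
  also have "\<dots> = (LINT x|lborel. indicat_real {max a c<..<min b d} x)"
    by (intro Bochner_Integration.integral_cong) (auto simp: indicator_def)
  also have "\<dots> = max 0 (min b d - max a c)"
    by (cases "max a c \<le> min b d") (auto simp: max_def min_def)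
  finally show ?thesis .
qed

lemma norm_ivl: "norm (ivl c d) = sqrt (max 0 (d - c))"
  by (simp add: norm_eq_sqrt_inner inner_ivl_ivl)

lemma ivl_empty: "d \<le> c \<Longrightarrow> ivl c d = 0"
  using norm_ivl[of c d] by simp

lemma ivl_split: "c \<le> d \<Longrightarrow> d \<le> e \<Longrightarrow> ivl c e = ivl c d + ivl d e"
proof (rule lsq_eqI)
  assume "c \<le> d" "d \<le> e"
  have "AE x in lborel. x \<noteq> d" by (rule AE_lborel_singleton)
  with fn_add[of "ivl c d" "ivl d e"] fn_ivl[of c d] fn_ivl[of d e] fn_ivl[of c e]
  show "AE x in lborel. fn (ivl c e) x = fn (ivl c d + ivl d e) x"
    by eventually_elim (use \<open>c \<le> d\<close> \<open>d \<le> e\<close> in \<open>auto simp: indicator_def\<close>)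
qed

lemma ivl_diff: "c \<le> d \<Longrightarrow> d \<le> e \<Longrightarrow> ivl d e = ivl c e - ivl c d"
  by (subst ivl_split[of c d e]) simp_all

text \<open>For positive \<open>t\<close> the graph moves to the left, the direction in which
  solutions of \<open>p\<^sub>t = p\<^sub>x\<close> travel.\<close>

definition shift :: "real \<Rightarrow> lsq \<Rightarrow> lsq" where
  "shift t y = cls (\<lambda>x. fn y (x + t))"

text \<open>The orthogonal projection onto the functions living on (c, d). Spaces over an interval
  are treated as subspaces of \<open>lsq\<close>, and support conditions take the form
  \<open>y = res c d y\<close>.\<close>

definition res :: "real \<Rightarrow> real \<Rightarrow> lsq \<Rightarrow> lsq" where
  "res c d y = cls (\<lambda>x. indicat_real {c<..<d} x * fn y x)"

definition rfl :: "lsq \<Rightarrow> lsq" where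
  "rfl y = cls (\<lambda>x. fn y (1 - x))"

lemma fn_shift: "AE x in lborel. fn (shift t y) x = fn y (x + t)"
  unfolding shift_def by (intro fn_cls sq_int_shift fn_sq_int)

lemma fn_res: "AE x in lborel. fn (res c d y) x = indicat_real {c<..<d} x * fn y x"
  unfolding res_def by (intro fn_cls sq_int_indicator fn_sq_int) auto

lemma fn_rfl: "AE x in lborel. fn (rfl y) x = fn y (1 - x)"
  unfolding rfl_def by (intro fn_cls sq_int_reflect fn_sq_int)

lemma shift_cls: "f \<in> sq_int \<Longrightarrow> shift t (cls f) = cls (\<lambda>x. f (x + t))"
  unfolding shift_def by (intro cls_cong AE_lborel_shift fn_cls)

lemma res_cls: "f \<in> sq_int \<Longrightarrow> res c d (cls f) = cls (\<lambda>x. indicat_real {c<..<d} x * f x)"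
  unfolding res_def by (rule cls_cong, drule fn_cls, erule eventually_mono) simp

lemma rfl_cls: "f \<in> sq_int \<Longrightarrow> rfl (cls f) = cls (\<lambda>x. f (1 - x))"
  unfolding rfl_def by (intro cls_cong AE_lborel_reflect fn_cls)

lemma shift_add: "shift t (y + z) = shift t y + shift t z"
  by (rule lsq_eqI) (use fn_shift[of t "y + z"] AE_lborel_shift[OF fn_add[of y z], of t] fn_shift[of t y]
    fn_shift[of t z] fn_add[of "shift t y" "shift t z"] in eventually_elim, simp)

lemma shift_scale: "shift t (c *\<^sub>R y) = c *\<^sub>R shift t y"
  by (rule lsq_eqI) (use fn_shift[of t "c *\<^sub>R y"] AE_lborel_shift[OF fn_scaleR[of c y], of t] fn_shift[of t y]
    fn_scaleR[of c "shift t y"] in eventually_elim, simp)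

lemma inner_shift: "shift t y \<bullet> shift t z = y \<bullet> z"
proof -
  have "shift t y \<bullet> shift t z = (LINT x|lborel. fn y (x + t) * fn z (x + t))"
    unfolding shift_def by (intro inner_cls sq_int_shift fn_sq_int)
  also have "\<dots> = y \<bullet> z"
    using lborel_integral_real_affine[of 1 "\<lambda>x. fn y x * fn z x" t] by (simp add: inner_lsq_def add.commute)
  finally show ?thesis .
qed

lemma norm_shift [simp]: "norm (shift t y) = norm y"
  by (simp add: norm_eq_sqrt_inner inner_shift)

lemma bounded_linear_shift: "bounded_linear (shift t)"
  by (rule bounded_linear_intro[where K=1]) (auto simp: shift_add shift_scale)

lemmas shift_diff = bounded_linear.linear[OF bounded_linear_shift, THEN linear_diff]

lemma shift_shift: "shift s (shift t y) = shift (s + t) y"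
  unfolding shift_def[of t y] shift_def[of "s + t"]
  by (subst shift_cls) (auto intro!: sq_int_shift simp: add_ac)

lemma shift_0 [simp]: "shift 0 y = y"
  by (simp add: shift_def)

lemma inner_shift_left: "shift t y \<bullet> z = y \<bullet> shift (- t) z"
  using inner_shift[of t y "shift (- t) z"] by (simp add: shift_shift)

lemma shift_ivl: "shift t (ivl c d) = ivl (c - t) (d - t)"
  unfolding ivl_def by (subst shift_cls[OF sq_int_ivl]) (rule arg_cong[where f=cls], rule ext, auto simp: indicator_def of_bool_def)

lemma res_add: "res c d (y + z) = res c d y + res c d z"
  by (rule lsq_eqI) (use fn_res[of c d "y + z"] fn_add[of y z] fn_res[of c d y]
    fn_res[of c d z] fn_add[of "res c d y" "res c d z"] in eventually_elim, simp add: algebra_simps)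

lemma res_scale: "res c d (k *\<^sub>R y) = k *\<^sub>R res c d y"
  by (rule lsq_eqI) (use fn_res[of c d "k *\<^sub>R y"] fn_scaleR[of k y] fn_res[of c d y]
    fn_scaleR[of k "res c d y"] in eventually_elim, simp)

lemma inner_res: "res c d y \<bullet> z = y \<bullet> res c d z"
proof -
  have "res c d y \<bullet> z = (LINT x|lborel. indicat_real {c<..<d} x * fn y x * fn z x)"
    using inner_cls[OF sq_int_indicator[OF fn_sq_int[of y], of "{c<..<d}"] fn_sq_int[of z]] by (simp add: res_def)
  also have "\<dots> = (LINT x|lborel. fn y x * (indicat_real {c<..<d} x * fn z x))"
    by (intro Bochner_Integration.integral_cong) auto
  also have "\<dots> = y \<bullet> res c d z"
    using inner_cls[OF fn_sq_int[of y] sq_int_indicator[OF fn_sq_int[of z], of "{c<..<d}"]] by (simp add: res_def)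
  finally show ?thesis .
qed

lemma res_res: "res a b (res c d y) = res (max a c) (min b d) y"
  unfolding res_def[of c d] res_def[of "max a c"]
  by (subst res_cls, rule sq_int_indicator, simp, simp)
    (rule arg_cong[where f=cls], rule ext, auto simp: indicator_def of_bool_def)

lemma norm_res_le: "norm (res c d y) \<le> norm y"
proof -
  have "norm (res c d y) ^ 2 = y \<bullet> res c d y"
    by (simp add: power2_norm_eq_inner inner_res res_res)
  also have "\<dots> \<le> norm y * norm (res c d y)"
    by (rule norm_cauchy_schwarz)
  finally show ?thesis
    by (cases "norm (res c d y) = 0") (auto simp: power2_eq_square)
qed

lemma bounded_linear_res: "bounded_linear (res c d)"
  by (rule bounded_linear_intro[where K=1]) (auto simp: res_add res_scale norm_res_le)

lemmas res_diff = bounded_linear.linear[OF bounded_linear_res, THEN linear_diff]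

lemma norm_res_mono: "c' \<le> c \<Longrightarrow> d \<le> d' \<Longrightarrow> norm (res c d y) \<le> norm (res c' d' y)"
  using norm_res_le[of c d "res c' d' y"] by (simp add: res_res)

lemma res_ivl: "res a b (ivl c d) = ivl (max a c) (min b d)"
  unfolding ivl_def by (subst res_cls[OF sq_int_ivl]) (rule arg_cong[where f=cls], rule ext, auto simp: indicator_def of_bool_def)

lemma res_empty: "d \<le> c \<Longrightarrow> res c d y = 0"
  unfolding res_def zero_lsq_def by (rule arg_cong[where f=cls]) (auto simp: indicator_def)

lemma inner_ivl_res: "y \<bullet> ivl c d = res c d y \<bullet> ivl c d"
  by (simp add: inner_res res_ivl)

lemma shift_res: "shift t (res c d y) = res (c - t) (d - t) (shift t y)"
  unfolding res_def[of c d] shift_def[of t y]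
  by (subst shift_cls, rule sq_int_indicator, simp, simp, subst res_cls, rule sq_int_shift, simp)
    (rule arg_cong[where f=cls], rule ext, auto simp: indicator_def of_bool_def)

lemma rfl_add: "rfl (y + z) = rfl y + rfl z"
  by (rule lsq_eqI) (use fn_rfl[of "y + z"] AE_lborel_reflect[OF fn_add[of y z]] fn_rfl[of y]
    fn_rfl[of z] fn_add[of "rfl y" "rfl z"] in eventually_elim, simp)

lemma rfl_scale: "rfl (c *\<^sub>R y) = c *\<^sub>R rfl y"
  by (rule lsq_eqI) (use fn_rfl[of "c *\<^sub>R y"] AE_lborel_reflect[OF fn_scaleR[of c y]] fn_rfl[of y]
    fn_scaleR[of c "rfl y"] in eventually_elim, simp)

lemma rfl_rfl [simp]: "rfl (rfl y) = y"
  unfolding rfl_def[of y] by (subst rfl_cls) (auto intro!: sq_int_reflect)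

lemma inner_rfl: "rfl y \<bullet> rfl z = y \<bullet> z"
proof -
  have "rfl y \<bullet> rfl z = (LINT x|lborel. fn y (1 - x) * fn z (1 - x))"
    unfolding rfl_def by (intro inner_cls sq_int_reflect fn_sq_int)
  also have "\<dots> = y \<bullet> z"
    using lborel_integral_real_affine[of "-1" "\<lambda>x. fn y x * fn z x" 1] by (simp add: inner_lsq_def)
  finally show ?thesis .
qed

lemma inner_rfl_left: "rfl y \<bullet> z = y \<bullet> rfl z"
  using inner_rfl[of y "rfl z"] by simp

lemma norm_rfl [simp]: "norm (rfl y) = norm y"
  by (simp add: norm_eq_sqrt_inner inner_rfl)

lemma bounded_linear_rfl: "bounded_linear rfl"
  by (rule bounded_linear_intro[where K=1]) (auto simp: rfl_add rfl_scale)

lemmas rfl_diff = bounded_linear.linear[OF bounded_linear_rfl, THEN linear_diff]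

lemma rfl_res: "rfl (res c d y) = res (1 - d) (1 - c) (rfl y)"
  unfolding res_def[of c d] rfl_def[of y]
  by (subst rfl_cls, rule sq_int_indicator, simp, simp, subst res_cls, rule sq_int_reflect, simp)
    (rule arg_cong[where f=cls], rule ext, auto simp: indicator_def of_bool_def)

text \<open>The overlap of two intervals is explicit, so the distance of an interval from its
  translate is an explicit continuous function of \<open>t\<close>.\<close>

lemma shift_tendsto_ivl: "((\<lambda>t. shift t (ivl c d)) \<longlongrightarrow> ivl c d) (at 0)"
proof -
  have "((\<lambda>t. sqrt (2 * max 0 (d - c) - 2 * max 0 (min (d - t) d - max (c - t) c))) \<longlongrightarrow>
      sqrt (2 * max 0 (d - c) - 2 * max 0 (min (d - 0) d - max (c - 0) c))) (at 0)"
    by (intro tendsto_intros)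
  moreover have "norm (shift t (ivl c d) - ivl c d)
      = sqrt (2 * max 0 (d - c) - 2 * max 0 (min (d - t) d - max (c - t) c))" for t
    unfolding shift_ivl norm_eq_sqrt_inner
    by (simp add: inner_diff_left inner_diff_right inner_commute inner_ivl_ivl)
  ultimately have "((\<lambda>t. norm (shift t (ivl c d) - ivl c d)) \<longlongrightarrow> 0) (at 0)" by simp
  then show ?thesis by (simp add: tendsto_norm_zero_iff LIM_zero_iff)
qed

lemma shift_tendsto_step: "y \<in> step_funs \<Longrightarrow> ((\<lambda>t. shift t y) \<longlongrightarrow> y) (at 0)"
proof -
  have "((\<lambda>t. shift t (\<Sum>(q, c, d)\<leftarrow>l. of_rat q *\<^sub>R ivl (of_rat c) (of_rat d))) \<longlongrightarrow>
    (\<Sum>(q, c, d)\<leftarrow>l. of_rat q *\<^sub>R ivl (of_rat c) (of_rat d))) (at 0)" for l :: "(rat \<times> rat \<times> rat) list"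
  proof (induction l)
    case Nil
    have "shift t 0 = 0" for t
      using norm_shift[of t 0] by (simp del: norm_shift)
    then show ?case by simp
  next
    case (Cons x l)
    then show ?case
      by (cases x) (auto simp: shift_add shift_scale intro!: tendsto_add tendsto_scaleR shift_tendsto_ivl)
  qed
  then show "y \<in> step_funs \<Longrightarrow> ((\<lambda>t. shift t y) \<longlongrightarrow> y) (at 0)"
    unfolding step_funs_def by blast
qed

text \<open>Strong continuity of the translation group extends from step functions to all vectors
  because translations are isometries.\<close>

lemma shift_tendsto_0: "((\<lambda>t. shift t y) \<longlongrightarrow> y) (at 0)"
proof (rule tendstoI)
  fix e :: real assume "e > 0"
  then obtain z where z: "z \<in> step_funs" "dist z y < e / 3"
    using lsq_dense_ball[of "e/3" y] by auto
  have "\<forall>\<^sub>F t in at 0. dist (shift t z) z < e / 3"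
    using shift_tendsto_step[OF z(1)] by (rule tendstoD) (use \<open>e > 0\<close> in simp)
  then show "\<forall>\<^sub>F t in at 0. dist (shift t y) y < e"
  proof eventually_elim
    case (elim t)
    have "dist (shift t y) (shift t z) = dist y z"
      by (simp add: dist_norm flip: shift_diff)
    then show ?case
      using elim z(2) dist_triangle[of "shift t y" y "shift t z"] dist_triangle[of "shift t z" y z]
      by (simp add: dist_commute)
  qed
qed

text \<open>Joint continuity makes a translate with both arguments depending on a parameter
  measurable. A change of the vector is not amplified, since translations are isometries, and a
  change of the parameter is a translation near 0 of a fixed vector.\<close>

lemma continuous_shift: "continuous_on UNIV (\<lambda>p. shift (fst p) (snd p))"
proof -
  have "((\<lambda>p. shift (fst p) (snd p)) \<longlongrightarrow> shift s z) (at (s, z))" for s z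
  proof -
    have "((\<lambda>p. shift (fst p - s) z) \<longlongrightarrow> z) (at (s, z))"
    proof -
      have "isCont (\<lambda>t. shift t z) 0" using shift_tendsto_0[of z] by (simp add: isCont_def)
      moreover have "((\<lambda>p. fst p - s) \<longlongrightarrow> 0) (at (s, z))"
        by (auto intro!: tendsto_eq_intros)
      ultimately have "((\<lambda>p. shift (fst p - s) z) \<longlongrightarrow> shift 0 z) (at (s, z))"
        by (rule isCont_tendsto_compose)
      then show ?thesis by simp
    qed
    then have "((\<lambda>p. norm (snd p - z) + norm (shift (fst p - s) z - z)) \<longlongrightarrow> norm (z - z) + norm (z - z)) (at (s, z))"
      by (auto intro!: tendsto_eq_intros)
    then have "((\<lambda>p. norm (snd p - z) + norm (shift (fst p - s) z - z)) \<longlongrightarrow> 0) (at (s, z))" by simp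
    moreover have "norm (shift (fst p) (snd p) - shift s z) \<le> norm (snd p - z) + norm (shift (fst p - s) z - z)" for p
    proof -
      have "shift (fst p) (snd p) - shift s z = shift (fst p) (snd p - z) + shift s (shift (fst p - s) z - z)"
        by (simp add: shift_diff shift_shift)
      then show ?thesis using norm_triangle_ineq[of "shift (fst p) (snd p - z)" "shift s (shift (fst p - s) z - z)"]
        by simp
    qed
    ultimately have "((\<lambda>p. shift (fst p) (snd p) - shift s z) \<longlongrightarrow> 0) (at (s, z))"
      by (intro Lim_null_comparison[where f="\<lambda>p. shift (fst p) (snd p) - shift s z"]) auto
    then show ?thesis by (simp add: LIM_zero_iff)
  qed
  then show ?thesis
    by (simp add: continuous_on_def)
qed

lemma measurable_shift [measurable]:
  assumes [measurable]: "f \<in> borel_measurable M" "g \<in> borel_measurable M"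
  shows "(\<lambda>s. shift (f s) (g s)) \<in> borel_measurable M"
  using borel_measurable_continuous_Pair[OF assms continuous_shift] by simp

lemma continuous_on_shift:
  assumes "continuous_on S f" "continuous_on S g"
  shows "continuous_on S (\<lambda>s. shift (f s) (g s))"
  using continuous_on_compose2[OF continuous_shift continuous_on_Pair[OF assms]] by simp

section \<open>Test functions\<close>

definition smooth :: "(real \<Rightarrow> real) \<Rightarrow> bool" where
  "smooth f \<longleftrightarrow> (\<forall>n x. (deriv ^^ n) f differentiable (at x))"

text \<open>With this coinduction principle no formula for the n-th derivative is needed: it
  suffices to place a function in a set of differentiable functions that is closed under
  \<open>deriv\<close>.\<close>

lemma smooth_coinduct:
  assumes "f \<in> S" and S: "\<And>g. g \<in> S \<Longrightarrow> (\<forall>x. g differentiable (at x)) \<and> deriv g \<in> S"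
  shows "smooth f"
proof -
  have "(deriv ^^ n) f \<in> S" for n
    by (induction n) (use assms in auto)
  then show ?thesis using S by (auto simp: smooth_def)
qed

lemma smooth_deriv: "smooth f \<Longrightarrow> smooth (deriv f)"
  unfolding smooth_def by (metis comp_apply funpow_Suc_right)

lemma smooth_DERIV: "smooth f \<Longrightarrow> (f has_real_derivative deriv f x) (at x)"
  unfolding smooth_def by (metis DERIV_deriv_iff_real_differentiable funpow_0)

lemma smooth_continuous: "smooth f \<Longrightarrow> isCont f x"
  using smooth_DERIV DERIV_isCont by blast

lemma smooth_measurable: "smooth f \<Longrightarrow> f \<in> borel_measurable borel"
  by (intro borel_measurable_continuous_onI continuous_at_imp_continuous_on ballI smooth_continuous)

lemma smooth_coinduct_DERIV:
  assumes "f \<in> S" and S: "\<And>g. g \<in> S \<Longrightarrow> \<exists>g'\<in>S. \<forall>x. (g has_real_derivative g' x) (at x)"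
  shows "smooth f"
  using assms(1)
proof (rule smooth_coinduct)
  fix g assume "g \<in> S"
  then obtain g' where "g' \<in> S" and g': "\<And>x. (g has_real_derivative g' x) (at x)" using S by blast
  moreover have "deriv g = g'" using g' by (auto intro!: DERIV_imp_deriv)
  ultimately show "(\<forall>x. g differentiable (at x)) \<and> deriv g \<in> S"
    using real_differentiable_def by blast
qed

text \<open>Products of smooth functions are not visibly closed under differentiation; by Leibniz'
  rule their finite sums are, as coinduction requires.\<close>

inductive_set prods :: "(real \<Rightarrow> real) set" where
  mult: "smooth f \<Longrightarrow> smooth g \<Longrightarrow> (\<lambda>x. f x * g x) \<in> prods"
| add: "f \<in> prods \<Longrightarrow> g \<in> prods \<Longrightarrow> (\<lambda>x. f x + g x) \<in> prods"

lemma smooth_prods: "f \<in> prods \<Longrightarrow> smooth f"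
proof (rule smooth_coinduct_DERIV[of f prods], assumption)
  fix g assume "g \<in> prods"
  then show "\<exists>g'\<in>prods. \<forall>x. (g has_real_derivative g' x) (at x)"
  proof induction
    case (mult f g)
    have "(\<lambda>x. f x * deriv g x + deriv f x * g x) \<in> prods"
      using mult by (intro prods.intros smooth_deriv)
    then show ?case
      using mult by (intro bexI[of _ "\<lambda>x. f x * deriv g x + deriv f x * g x"])
        (auto intro!: DERIV_mult' smooth_DERIV)
  next
    case (add f g)
    then obtain f' g' where "f' \<in> prods" "g' \<in> prods"
      "\<And>x. (f has_real_derivative f' x) (at x)" "\<And>x. (g has_real_derivative g' x) (at x)" by blast
    then show ?case
      by (intro bexI[of _ "\<lambda>x. f' x + g' x"]) (auto intro!: prods.add DERIV_add)
  qed
qed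

lemma smooth_mult: "smooth f \<Longrightarrow> smooth g \<Longrightarrow> smooth (\<lambda>x. f x * g x)"
  by (rule smooth_prods) (rule prods.mult)

lemma smooth_affine: "smooth f \<Longrightarrow> smooth (\<lambda>x. k * f (c * x + d))"
proof (rule smooth_coinduct_DERIV[of _ "{\<lambda>x. k * f (c * x + d) | k f. smooth f}"])
  fix g assume "g \<in> {\<lambda>x. k * f (c * x + d) | k f. smooth f}"
  then obtain k f where g: "g = (\<lambda>x. k * f (c * x + d))" and f: "smooth f" by blast
  have "(g has_real_derivative (k * c) * deriv f (c * x + d)) (at x)" for x
    unfolding g by (rule derivative_eq_intros DERIV_chain2[OF smooth_DERIV[OF f]] refl)+ simp
  moreover have "(\<lambda>x. (k * c) * deriv f (c * x + d)) \<in> {\<lambda>x. k * f (c * x + d) | k f. smooth f}"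
    using smooth_deriv[OF f] by blast
  ultimately show "\<exists>g'\<in>{\<lambda>x. k * f (c * x + d) | k f. smooth f}. \<forall>x. (g has_real_derivative g' x) (at x)"
    by (intro bexI[of _ "\<lambda>x. (k * c) * deriv f (c * x + d)"]) auto
qed blast

lemma smooth_scale: "smooth f \<Longrightarrow> smooth (\<lambda>x. k * f x)"
  using smooth_affine[of f k 1 0] by simp

lemma smooth_const: "smooth (\<lambda>x. c)"
  by (rule smooth_coinduct_DERIV[of _ "range (\<lambda>c x. c)"]) (auto intro!: exI[of _ "0"])

lemma smooth_prim:
  assumes "smooth f" "\<And>x. (F has_real_derivative f x) (at x)"
  shows "smooth F"
  by (rule smooth_coinduct_DERIV[of _ "insert F (Collect smooth)"])
    (use assms in \<open>auto intro: smooth_deriv smooth_DERIV\<close>)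

lemma smooth_add: "smooth f \<Longrightarrow> smooth g \<Longrightarrow> smooth (\<lambda>x. f x + g x)"
  using smooth_prods[OF prods.add[OF prods.mult prods.mult, of f "\<lambda>_. 1" g "\<lambda>_. 1"]] smooth_const by simp

section \<open>A function flat at 0 and the bump functions built from it\<close>

definition flat :: "real poly \<Rightarrow> real \<Rightarrow> real" where
  "flat p x = (if x > 0 then poly p (1 / x) * exp (- (1 / x)) else 0)"

lemma tendsto_poly_exp: "((\<lambda>y. poly p y * exp (- y)) \<longlongrightarrow> (0::real)) at_top"
proof -
  have "((\<lambda>y. \<Sum>i\<le>degree p. coeff p i * (y ^ i / exp y)) \<longlongrightarrow> (\<Sum>i\<le>degree p. coeff p i * 0)) at_top"
    by (intro tendsto_sum tendsto_mult tendsto_const tendsto_power_div_exp_0)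
  then show ?thesis
    by (simp add: poly_altdef exp_minus sum_distrib_right divide_inverse mult.assoc)
qed

text \<open>Differentiating \<open>p(1/x) * exp(-1/x)\<close> sends \<open>p\<close> to
  \<open>X\<^sup>2 * (p - p')\<close>, so the whole family is closed under differentiation. At 0 the
  difference quotient only replaces \<open>p\<close> by \<open>X * p\<close>, and the exponential
  still wins.\<close>

lemma flat_DERIV: "(flat p has_real_derivative flat ([:0, 0, 1:] * (p - pderiv p)) x) (at x)"
proof -
  let ?q = "[:0, 0, 1:] * (p - pderiv p)"
  consider "x > 0" | "x < 0" | "x = 0" by linarith
  then show ?thesis
  proof cases
    case 1
    have "((\<lambda>x. poly p (1 / x) * exp (- (1 / x))) has_real_derivative flat ?q x) (at x)"
      using 1 by (auto intro!: derivative_eq_intros DERIV_chain2[OF poly_DERIV]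
          simp: flat_def power2_eq_square divide_simps algebra_simps)
    then show ?thesis
      by (rule DERIV_cong_ev[OF refl _ refl, THEN iffD1, rotated])
        (use 1 in \<open>auto simp: flat_def intro!: eventually_mono[OF eventually_nhds_in_open[of "{0<..}" x]]\<close>)
  next
    case 2
    have "((\<lambda>x. 0) has_real_derivative flat ?q x) (at x)"
      using 2 by (auto simp: flat_def)
    then show ?thesis
      by (rule DERIV_cong_ev[OF refl _ refl, THEN iffD1, rotated])
        (use 2 in \<open>auto simp: flat_def intro!: eventually_mono[OF eventually_nhds_in_open[of "{..<0}" x]]\<close>)
  next
    case 3
    have "((\<lambda>h. flat p h / h) \<longlongrightarrow> 0) (at_right 0)"
    proof -
      have "((\<lambda>h. poly ([:0, 1:] * p) (1 / h) * exp (- (1 / h))) \<longlongrightarrow> 0) (at_right 0)"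
        by (rule filterlim_compose[OF tendsto_poly_exp])
          (simp add: filterlim_inverse_at_top_right flip: inverse_eq_divide)
      then show ?thesis
        by (rule tendsto_cong[THEN iffD1, rotated])
          (auto simp: flat_def eventually_at_filter)
    qed
    moreover have "((\<lambda>h. flat p h / h) \<longlongrightarrow> 0) (at_left 0)"
      by (rule tendsto_eventually) (auto simp: flat_def eventually_at_filter)
    ultimately have "((\<lambda>h. flat p h / h) \<longlongrightarrow> 0) (at 0)"
      by (simp add: filterlim_at_split)
    then show ?thesis using 3 by (simp add: DERIV_def flat_def)
  qed
qed

lemma smooth_flat: "smooth (flat p)"
  by (rule smooth_coinduct_DERIV[of _ "range flat"]) (use flat_DERIV in blast)+

lemma flat_1: "flat 1 x = (if x > 0 then exp (- (1 / x)) else 0)"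
  by (simp add: flat_def)

text \<open>The \<open>- 1\<close> in each factor keeps the support at distance
  \<open>1 / (n + 1)\<close> from the ends, while the growing slope drives both factors to 1 inside
  (c, d). So these are test functions that converge to the indicator and stay between 0 and
  1.\<close>

definition bump :: "real \<Rightarrow> real \<Rightarrow> nat \<Rightarrow> real \<Rightarrow> real" where
  "bump c d n x = flat 1 (real (Suc n) * x + (- real (Suc n) * c - 1)) * flat 1 (- real (Suc n) * x + (real (Suc n) * d - 1))"

lemma test_fun_smooth: "\<phi> \<in> test_fun a b \<Longrightarrow> smooth \<phi>"
  by (simp add: test_fun_def smooth_def)

lemma test_funI:
  assumes "smooth \<phi>" "a < c" "d < b" "\<And>x. x \<notin> {c..d} \<Longrightarrow> \<phi> x = 0"
  shows "\<phi> \<in> test_fun a b"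
proof -
  have "closure {x. \<phi> x \<noteq> 0} \<subseteq> {c..d}"
  proof (rule closure_minimal)
    show "{x. \<phi> x \<noteq> 0} \<subseteq> {c..d}" using assms(4) by blast
  qed simp
  also have "\<dots> \<subseteq> {a<..<b}" using assms by auto
  finally show ?thesis using assms(1) by (simp add: test_fun_def smooth_def)
qed

lemma test_funE:
  assumes "\<phi> \<in> test_fun a b"
  obtains c d where "a < c" "d < b" "\<And>x. x \<notin> {c..d} \<Longrightarrow> \<phi> x = 0"
proof -
  let ?K = "closure {x. \<phi> x \<noteq> 0}"
  have K: "?K \<subseteq> {a<..<b}" using assms by (simp add: test_fun_def)
  show ?thesis
  proof (cases "?K = {}")
    case True
    then show ?thesis using that[of "a + 1" "b - 1"] closure_subset by fastforce
  next
    case False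
    have "bounded ?K" using K bounded_subset bounded_box by (metis box_real(1))
    then have "compact ?K" by (simp add: compact_eq_bounded_closed)
    obtain c where c: "c \<in> ?K" "\<And>x. x \<in> ?K \<Longrightarrow> c \<le> x"
      using compact_attains_inf[OF \<open>compact ?K\<close> False] by blast
    obtain d where d: "d \<in> ?K" "\<And>x. x \<in> ?K \<Longrightarrow> x \<le> d"
      using compact_attains_sup[OF \<open>compact ?K\<close> False] by blast
    show ?thesis
    proof (rule that)
      show "a < c" "d < b" using c(1) d(1) K by auto
      fix x assume "x \<notin> {c..d}"
      then have "x \<notin> ?K" using c(2) d(2) by auto
      then show "\<phi> x = 0" using closure_subset[of "{x. \<phi> x \<noteq> 0}"] by auto
    qed
  qed
qed

lemma bump_bounds: "0 \<le> bump c d n x" "bump c d n x \<le> 1"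
  unfolding bump_def flat_1 by (auto intro!: mult_le_one)

lemma bump_support:
  assumes "bump c d n x \<noteq> 0"
  shows "c + inverse (real (Suc n)) \<le> x" "x \<le> d - inverse (real (Suc n))"
proof -
  have "real (Suc n) * x + (- real (Suc n) * c - 1) > 0" "- real (Suc n) * x + (real (Suc n) * d - 1) > 0"
    using assms by (auto simp: bump_def flat_1 split: if_splits)
  then show "c + inverse (real (Suc n)) \<le> x" "x \<le> d - inverse (real (Suc n))"
    by (simp_all add: field_simps del: of_nat_Suc)
qed

lemma smooth_bump: "smooth (bump c d n)"
  unfolding bump_def[abs_def]
  using smooth_mult[OF smooth_affine[OF smooth_flat, of 1] smooth_affine[OF smooth_flat, of 1]] by simp

lemma bump_test_fun:
  assumes "a \<le> c" "d \<le> b"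
  shows "bump c d n \<in> test_fun a b"
proof (rule test_funI[OF smooth_bump])
  have "inverse (real (Suc n)) > 0" by simp
  then show "a < c + inverse (real (Suc n))" "d - inverse (real (Suc n)) < b" using assms by linarith+
qed (use bump_support in fastforce)

lemma flat_affine_tendsto:
  assumes "y > 0"
  shows "(\<lambda>n. flat 1 (real (Suc n) * y - 1)) \<longlonglongrightarrow> 1"
proof -
  have "filterlim (\<lambda>n. real (Suc n) * y - 1) at_top sequentially"
  proof -
    have "filterlim (\<lambda>n. y * real (Suc n)) at_top sequentially"
      by (rule filterlim_tendsto_pos_mult_at_top[OF tendsto_const assms])
        (rule filterlim_compose[OF filterlim_real_sequentially filterlim_Suc])
    from filterlim_tendsto_add_at_top[OF tendsto_const[of "-1"] this] show ?thesis
      by (simp add: mult.commute)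
  qed
  moreover have "((\<lambda>z. flat 1 z) \<longlongrightarrow> exp (- 0)) at_top"
  proof (rule tendsto_cong[THEN iffD1])
    show "((\<lambda>z::real. exp (- (1 / z))) \<longlongrightarrow> exp (- 0)) at_top"
      by (intro tendsto_intros tendsto_divide_0[OF tendsto_const] filterlim_at_top_imp_at_infinity filterlim_ident)
    show "\<forall>\<^sub>F z in at_top. exp (- (1 / z)) = flat 1 z"
      using eventually_gt_at_top[of 0] by eventually_elim (simp add: flat_1)
  qed
  ultimately show ?thesis using filterlim_compose by force
qed

lemma bump_tendsto: "(\<lambda>n. bump c d n x) \<longlonglongrightarrow> indicat_real {c<..<d} x"
proof (cases "c < x \<and> x < d")
  case True
  then have "(\<lambda>n. flat 1 (real (Suc n) * (x - c) - 1) * flat 1 (real (Suc n) * (d - x) - 1)) \<longlonglongrightarrow> 1 * 1"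
    by (intro tendsto_mult flat_affine_tendsto) auto
  then show ?thesis using True by (simp add: bump_def algebra_simps)
next
  case False
  have "bump c d n x = 0" for n
  proof (rule ccontr)
    assume "bump c d n x \<noteq> 0"
    from bump_support[OF this] have "c + inverse (real (Suc n)) \<le> x" "x \<le> d - inverse (real (Suc n))" .
    moreover have "inverse (real (Suc n)) > 0" by simp
    ultimately show False using False by linarith
  qed
  then show ?thesis using False by (auto simp: indicator_def)
qed

lemma bump_measurable [measurable]: "bump c d n \<in> borel_measurable borel"
  by (rule smooth_measurable[OF smooth_bump])

lemma integral_bump_tendsto:
  assumes h: "integrable lborel (h :: real \<Rightarrow> real)"
  shows "(\<lambda>n. LINT x|lborel. h x * bump c d n x) \<longlonglongrightarrow> (LINT x|lborel. h x * indicat_real {c<..<d} x)"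
proof (rule integral_dominated_convergence[where w="\<lambda>x. \<bar>h x\<bar>"])
  show "AE x in lborel. (\<lambda>n. h x * bump c d n x) \<longlonglongrightarrow> h x * indicat_real {c<..<d} x"
    by (intro AE_I2 tendsto_mult tendsto_const bump_tendsto)
  show "AE x in lborel. norm (h x * bump c d n x) \<le> \<bar>h x\<bar>" for n
    using bump_bounds[of c d n] by (intro AE_I2) (auto simp: abs_mult intro: mult_left_le)
qed (use h in auto)

text \<open>The fundamental lemma of the calculus of variations: bumps that converge to the
  indicator of a ray cut at \<open>b\<close> turn the hypothesis into vanishing ray
  integrals.\<close>

lemma AE_zero_if_test_zero:
  assumes h: "integrable lborel (h :: real \<Rightarrow> real)" and supp: "\<And>x. x \<notin> {a<..<b} \<Longrightarrow> h x = 0"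
    and zero: "\<And>\<phi>. \<phi> \<in> test_fun a b \<Longrightarrow> (LINT x|lborel. h x * \<phi> x) = 0"
  shows "AE x in lborel. h x = 0"
proof (rule AE_zero_if_rays_zero[OF h])
  fix x
  have "(\<lambda>n. LINT y|lborel. h y * bump (max x a) b n y) = (\<lambda>n. 0)"
    by (intro ext zero bump_test_fun) auto
  with integral_bump_tendsto[OF h, of "max x a" b]
  have "(LINT y|lborel. h y * indicat_real {max x a<..<b} y) = 0"
    by (simp add: LIMSEQ_const_iff)
  moreover have "h y * indicat_real {max x a<..<b} y = indicat_real {x<..} y * h y" for y
    using supp[of y] by (auto simp: indicator_def)
  ultimately show "(LINT y|lborel. indicat_real {x<..} y * h y) = 0" by simp
qed

section \<open>Primitives and weak derivatives\<close>

text \<open>Over \<open>itv a b\<close> this integrates from \<open>a\<close> to \<open>t\<close>,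
  over \<open>lborel\<close> from minus infinity to \<open>t\<close>; one theory serves
  both.\<close>

definition prim :: "real measure \<Rightarrow> (real \<Rightarrow> 'a) \<Rightarrow> real \<Rightarrow> 'a::{banach, second_countable_topology}" where
  "prim M F t = (LINT s|M. indicat_real {..<t} s *\<^sub>R F s)"

text \<open>Sigma-finiteness is there for Fubini, measurability of the identity for the cut-off at
  \<open>t\<close>, and the absence of atoms for continuity of primitives.\<close>

locale time_measure = sigma_finite_measure M for M :: "real measure" +
  assumes id_measurable: "(\<lambda>x. x) \<in> borel_measurable M"
    and AE_neq: "\<And>t. AE s in M. s \<noteq> t"
begin

lemma borel_imp_measurable: "f \<in> borel_measurable borel \<Longrightarrow> f \<in> borel_measurable M"
  by (rule measurable_compose[OF id_measurable])

lemma integrable_prim: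
  assumes "integrable M F"
  shows "integrable M (\<lambda>s. indicat_real {..<t} s *\<^sub>R (F s :: 'a::{banach, second_countable_topology}))"
proof (rule Bochner_Integration.integrable_bound[OF assms])
  show "(\<lambda>s. indicat_real {..<t} s *\<^sub>R F s) \<in> borel_measurable M"
    by (rule borel_measurable_scaleR[OF borel_imp_measurable]) (use assms in auto)
qed (auto simp: indicator_def)

lemma norm_prim_le:
  assumes "integrable M F"
  shows "norm (prim M F t) \<le> prim M (\<lambda>s. norm (F s)) t"
proof -
  have "norm (prim M F t) \<le> (LINT s|M. norm (indicat_real {..<t} s *\<^sub>R F s))"
    unfolding prim_def by (rule integral_norm_bound)
  also have "\<dots> = prim M (\<lambda>s. norm (F s)) t"
    unfolding prim_def by (intro Bochner_Integration.integral_cong) auto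
  finally show ?thesis .
qed

lemma prim_mono:
  fixes F G :: "real \<Rightarrow> real"
  assumes "integrable M F" "integrable M G" "AE s in M. s < t \<longrightarrow> F s \<le> G s"
  shows "prim M F t \<le> prim M G t"
  unfolding prim_def
  by (intro integral_mono_AE integrable_prim assms, use assms(3) in eventually_elim) (auto simp: indicator_def)

lemma norm_prim_le_integral:
  assumes "integrable M F"
  shows "norm (prim M F t) \<le> (LINT s|M. norm (F s))"
proof -
  have "prim M (\<lambda>s. norm (F s)) t \<le> (LINT s|M. norm (F s))"
    unfolding prim_def using integrable_norm[OF assms]
    by (intro integral_mono integrable_prim) (auto simp: indicator_def)
  with norm_prim_le[OF assms] show ?thesis by (rule order_trans)
qed

lemma prim_linear:
  assumes "bounded_linear h" "integrable M F"
  shows "h (prim M F t) = prim M (\<lambda>s. h (F s)) t"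
proof -
  have "prim M (\<lambda>s. h (F s)) t = (LINT s|M. h (indicat_real {..<t} s *\<^sub>R F s))"
    unfolding prim_def using assms(1) by (simp add: linear_simps)
  also have "\<dots> = h (prim M F t)"
    unfolding prim_def by (rule integral_bounded_linear[OF assms(1) integrable_prim[OF assms(2)]])
  finally show ?thesis ..
qed

lemma prim_inner:
  fixes F :: "real \<Rightarrow> 'a::{real_inner, banach, second_countable_topology}"
  assumes "integrable M F"
  shows "prim M F t \<bullet> v = prim M (\<lambda>s. F s \<bullet> v) t"
  by (rule prim_linear[OF bounded_linear_inner_left assms])

lemma prim_add:
  assumes "integrable M F" "integrable M G"
  shows "prim M (\<lambda>s. F s + G s) t = prim M F t + prim M G t"
  unfolding prim_def by (simp add: scaleR_add_right integrable_prim assms)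

lemma prim_diff:
  assumes "integrable M F" "integrable M G"
  shows "prim M (\<lambda>s. F s - G s) t = prim M F t - prim M G t"
  unfolding prim_def by (simp add: scaleR_diff_right integrable_prim assms)

lemma prim_scaleR: "prim M (\<lambda>s. c *\<^sub>R F s) t = c *\<^sub>R prim M F t"
proof -
  have "indicat_real {..<t} s *\<^sub>R c *\<^sub>R F s = c *\<^sub>R indicat_real {..<t} s *\<^sub>R F s" for s
    by (rule scaleR_left_commute)
  then show ?thesis unfolding prim_def by (simp only: integral_scaleR_right)
qed

lemma prim_cmult: "prim M (\<lambda>s. c * F s) t = c * prim M F t" for c :: real
  using prim_scaleR[of c F t] by simp

lemma prim_cong_AE:
  assumes "integrable M F" "integrable M G" "AE s in M. s < t \<longrightarrow> F s = G s"
  shows "prim M F t = prim M G t"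
  unfolding prim_def
  by (rule integral_cong_AE, (intro borel_measurable_integrable integrable_prim assms)+)
    (use assms(3) in \<open>auto elim!: eventually_mono simp: indicator_def\<close>)

lemma continuous_prim:
  fixes F :: "real \<Rightarrow> 'a::{banach, second_countable_topology}"
  assumes "integrable M F"
  shows "continuous_on S (prim M F)"
proof (rule continuous_at_imp_continuous_on, rule ballI, unfold continuous_at_sequentially comp_def, intro allI impI)
  fix t and u :: "nat \<Rightarrow> real" assume u: "u \<longlonglongrightarrow> t"
  show "(\<lambda>n. prim M F (u n)) \<longlonglongrightarrow> prim M F t"
    unfolding prim_def
  proof (rule integral_dominated_convergence[where w="\<lambda>s. norm (F s)"])
    show "AE s in M. (\<lambda>n. indicat_real {..<u n} s *\<^sub>R F s) \<longlonglongrightarrow> indicat_real {..<t} s *\<^sub>R F s"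
      using AE_neq[of t]
    proof eventually_elim
      case (elim s)
      consider "s < t" | "t < s" using elim by linarith
      then have "\<forall>\<^sub>F n in sequentially. indicat_real {..<u n} s = indicat_real {..<t} s"
      proof cases
        case 1
        then have "\<forall>\<^sub>F n in sequentially. s < u n" using u by (auto intro: order_tendstoD)
        then show ?thesis by eventually_elim (use 1 in auto)
      next
        case 2
        then have "\<forall>\<^sub>F n in sequentially. u n < s" using u by (auto intro: order_tendstoD)
        then show ?thesis by eventually_elim (use 2 in auto)
      qed
      then have "(\<lambda>n. indicat_real {..<u n} s) \<longlonglongrightarrow> indicat_real {..<t} s"
        by (rule tendsto_eventually)
      then show ?case by (intro tendsto_scaleR tendsto_const)
    qed
    show "AE s in M. norm (indicat_real {..<u n} s *\<^sub>R F s) \<le> norm (F s)" for n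
      by (auto simp: indicator_def)
  qed (intro borel_measurable_integrable integrable_prim integrable_norm assms)+
qed

lemma prim_measurable: "integrable M F \<Longrightarrow> prim M F \<in> borel_measurable M"
  by (intro borel_imp_measurable borel_measurable_continuous_onI continuous_prim)

text \<open>Fubini on the triangle of pairs with y < x. The product of the two norms is integrable
  on the square and serves as the majorant.\<close>

lemma prim_triangle:
  fixes F G :: "real \<Rightarrow> 'a::{real_inner, banach, second_countable_topology}"
  assumes F: "integrable M F" and G: "integrable M G"
  shows "(LINT x|M. F x \<bullet> prim M G x) = (LINT y|M. G y \<bullet> (LINT x|M. indicat_real {y<..} x *\<^sub>R F x))"
proof -
  interpret P: pair_sigma_finite M M ..
  have [measurable]: "F \<in> borel_measurable M" "G \<in> borel_measurable M"
    using F G by auto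
  define f where "f p = (if snd p < fst p then F (fst p) \<bullet> G (snd p) else 0)" for p
  have [measurable]: "(\<lambda>p. fst p) \<in> borel_measurable (M \<Otimes>\<^sub>M M)" "(\<lambda>p. snd p) \<in> borel_measurable (M \<Otimes>\<^sub>M M)"
    using measurable_compose[OF measurable_fst id_measurable] measurable_compose[OF measurable_snd id_measurable]
    by blast+
  have f_meas [measurable]: "f \<in> borel_measurable (M \<Otimes>\<^sub>M M)"
    unfolding f_def[abs_def] by measurable
  have int_y: "integrable M (\<lambda>y. f (x, y))" for x
  proof -
    have "integrable M (\<lambda>y. F x \<bullet> (indicat_real {..<x} y *\<^sub>R G y))"
      by (intro integrable_inner_right integrable_prim G)
    then show ?thesis
      by (rule Bochner_Integration.integrable_cong[OF refl, THEN iffD1, rotated]) (auto simp: f_def indicator_def)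
  qed
  have int: "integrable (M \<Otimes>\<^sub>M M) f"
  proof (rule P.Fubini_integrable[OF f_meas])
    show "integrable M (\<lambda>x. LINT y|M. norm (f (x, y)))"
    proof (rule Bochner_Integration.integrable_bound)
      show "integrable M (\<lambda>x. norm (F x) * (LINT y|M. norm (G y)))"
        using F by auto
      show "(\<lambda>x. LINT y|M. norm (f (x, y))) \<in> borel_measurable M" by measurable
      have "(LINT y|M. norm (f (x, y))) \<le> (LINT y|M. norm (F x) * norm (G y))" for x
        using int_y[of x] G by (intro integral_mono) (auto simp: f_def Cauchy_Schwarz_ineq2)
      then show "AE x in M. norm (LINT y|M. norm (f (x, y))) \<le> norm (norm (F x) * (LINT y|M. norm (G y)))"
        by (intro AE_I2) simp
    qed
  qed (use int_y in simp)
  have "(LINT x|M. F x \<bullet> prim M G x) = (LINT x|M. LINT y|M. f (x, y))"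
  proof (rule Bochner_Integration.integral_cong[OF refl])
    fix x
    have "F x \<bullet> prim M G x = (LINT y|M. F x \<bullet> (indicat_real {..<x} y *\<^sub>R G y))"
      unfolding prim_def by (rule integral_inner_right[symmetric]) (intro impI integrable_prim G)
    also have "\<dots> = (LINT y|M. f (x, y))"
      by (intro Bochner_Integration.integral_cong) (auto simp: f_def indicator_def)
    finally show "F x \<bullet> prim M G x = (LINT y|M. f (x, y))" .
  qed
  also have "\<dots> = (LINT y|M. LINT x|M. f (x, y))"
    using P.Fubini_integral[of "\<lambda>x y. f (x, y)"] int by (simp add: case_prod_unfold)
  also have "\<dots> = (LINT y|M. G y \<bullet> (LINT x|M. indicat_real {y<..} x *\<^sub>R F x))"
  proof (rule Bochner_Integration.integral_cong[OF refl])
    fix y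
    have "integrable M (\<lambda>x. indicat_real {y<..} x *\<^sub>R F x)"
    proof (rule Bochner_Integration.integrable_bound[OF F])
      show "(\<lambda>x. indicat_real {y<..} x *\<^sub>R F x) \<in> borel_measurable M"
        by (rule borel_measurable_scaleR[OF borel_imp_measurable]) (use F in auto)
    qed (auto simp: indicator_def)
    then have "G y \<bullet> (LINT x|M. indicat_real {y<..} x *\<^sub>R F x) = (LINT x|M. G y \<bullet> (indicat_real {y<..} x *\<^sub>R F x))"
      by (intro integral_inner_right[symmetric]) simp
    also have "\<dots> = (LINT x|M. f (x, y))"
      by (intro Bochner_Integration.integral_cong) (auto simp: f_def indicator_def inner_commute)
    finally show "(LINT x|M. f (x, y)) = G y \<bullet> (LINT x|M. indicat_real {y<..} x *\<^sub>R F x)" ..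
  qed
  finally show ?thesis .
qed

lemma integral_after:
  assumes "integrable M F"
  shows "(LINT x|M. indicat_real {y<..} x *\<^sub>R F x) = integral\<^sup>L M F - prim M (F :: real \<Rightarrow> 'a::{banach, second_countable_topology}) y"
proof -
  have "(LINT x|M. indicat_real {y<..} x *\<^sub>R F x) = (LINT x|M. F x - indicat_real {..<y} x *\<^sub>R F x)"
  proof (rule integral_cong_AE)
    show "AE x in M. indicat_real {y<..} x *\<^sub>R F x = F x - indicat_real {..<y} x *\<^sub>R F x"
      using AE_neq[of y] by eventually_elim (auto simp: indicator_def)
    show "(\<lambda>x. indicat_real {y<..} x *\<^sub>R F x) \<in> borel_measurable M"
      by (rule borel_measurable_scaleR[OF borel_imp_measurable]) (use assms in auto)
  qed (intro borel_measurable_integrable Bochner_Integration.integrable_diff integrable_prim assms)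
  also have "\<dots> = integral\<^sup>L M F - prim M F y"
    unfolding prim_def by (intro Bochner_Integration.integral_diff integrable_prim assms)
  finally show ?thesis .
qed

lemma integrable_inner_prim:
  fixes F G :: "real \<Rightarrow> 'a::{real_inner, banach, second_countable_topology}"
  assumes F: "integrable M F" and G: "integrable M G"
  shows "integrable M (\<lambda>x. F x \<bullet> prim M G x)"
proof (rule Bochner_Integration.integrable_bound)
  show "integrable M (\<lambda>x. norm (F x) * (LINT s|M. norm (G s)))" using F by auto
  show "(\<lambda>x. F x \<bullet> prim M G x) \<in> borel_measurable M"
    using F prim_measurable[OF G] by (intro borel_measurable_inner) auto
  have "\<bar>F x \<bullet> prim M G x\<bar> \<le> norm (F x) * (LINT s|M. norm (G s))" for x
    by (rule order_trans[OF Cauchy_Schwarz_ineq2 mult_left_mono]) (auto intro: norm_prim_le_integral G)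
  then show "AE x in M. norm (F x \<bullet> prim M G x) \<le> norm (norm (F x) * (LINT s|M. norm (G s)))"
    by (intro AE_I2) simp
qed

text \<open>The product rule for absolutely continuous curves, in integrated form. After truncation
  at \<open>t\<close> the square (0, t) x (0, t) is split into the two triangles of
  \<open>prim_triangle\<close>.\<close>

lemma prim_by_parts:
  fixes F G :: "real \<Rightarrow> 'a::{real_inner, banach, second_countable_topology}"
  assumes F: "integrable M F" and G: "integrable M G"
  shows "prim M (\<lambda>x. F x \<bullet> prim M G x + G x \<bullet> prim M F x) t = prim M F t \<bullet> prim M G t"
proof -
  let ?F = "\<lambda>s. indicat_real {..<t} s *\<^sub>R F s" and ?G = "\<lambda>s. indicat_real {..<t} s *\<^sub>R G s"
  have F': "integrable M ?F" and G': "integrable M ?G" using F G by (auto intro: integrable_prim)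
  have cut: "x < t \<Longrightarrow> prim M (\<lambda>s. indicat_real {..<t} s *\<^sub>R H s) x = prim M H x" for x and H :: "real \<Rightarrow> 'a"
    unfolding prim_def by (intro Bochner_Integration.integral_cong) (auto simp: indicator_def)
  have "prim M (\<lambda>x. F x \<bullet> prim M G x) t = (LINT x|M. ?F x \<bullet> prim M ?G x)"
    unfolding prim_def[of M "\<lambda>x. F x \<bullet> prim M G x"]
    by (intro Bochner_Integration.integral_cong refl) (simp add: cut split: split_indicator)
  also have "\<dots> = (LINT y|M. ?G y \<bullet> (integral\<^sup>L M ?F - prim M ?F y))"
    by (subst prim_triangle[OF F' G']) (simp only: integral_after[OF F'])
  also have "\<dots> = (LINT y|M. ?G y \<bullet> integral\<^sup>L M ?F - ?G y \<bullet> prim M ?F y)"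
    by (simp only: inner_diff_right)
  also have "\<dots> = (LINT y|M. ?G y \<bullet> integral\<^sup>L M ?F) - (LINT y|M. ?G y \<bullet> prim M ?F y)"
    by (intro Bochner_Integration.integral_diff integrable_inner_left integrable_inner_prim F' G')
  also have "(LINT y|M. ?G y \<bullet> integral\<^sup>L M ?F) = integral\<^sup>L M ?G \<bullet> integral\<^sup>L M ?F"
    by (rule integral_inner_left) (simp add: G')
  also have "(LINT y|M. ?G y \<bullet> prim M ?F y) = prim M (\<lambda>x. G x \<bullet> prim M F x) t"
    unfolding prim_def[of M "\<lambda>x. G x \<bullet> prim M F x"]
    by (intro Bochner_Integration.integral_cong refl) (simp add: cut split: split_indicator)
  finally have "prim M (\<lambda>x. F x \<bullet> prim M G x) t
      = prim M G t \<bullet> prim M F t - prim M (\<lambda>x. G x \<bullet> prim M F x) t"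
    unfolding prim_def[of M F t] prim_def[of M G t] .
  then show ?thesis
    by (simp add: prim_add[OF integrable_inner_prim[OF F G] integrable_inner_prim[OF G F]] inner_commute)
qed

end

lemma time_measure_lborel: "time_measure lborel"
  by unfold_locales (auto intro: AE_lborel_singleton)

lemma time_measure_itv: "time_measure (itv a b)"
proof -
  interpret finite_measure "itv a b" by (rule finite_measure_lebesgue_on) simp
  show ?thesis
  proof unfold_locales
    show "(\<lambda>x. x) \<in> borel_measurable (itv a b)"
      by (intro measurable_restrict_space1 measurable_completion) simp
    show "AE s in itv a b. s \<noteq> t" for t
      using AE_completion[OF AE_lborel_singleton[of t]]
      by (subst AE_restrict_space_iff) (auto elim: eventually_mono)
  qed
qed

interpretation lborel: time_measure lborel by (rule time_measure_lborel)

interpretation itv: time_measure "itv a b" for a b by (rule time_measure_itv)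

section \<open>Lebesgue measure on an interval versus Borel functions on the line\<close>

lemma AE_itv_iff: "(AE x in itv a b. P x) \<longleftrightarrow> (AE x in lborel. x \<in> {a<..<b} \<longrightarrow> P x)"
  by (subst AE_restrict_space_iff) (auto simp: AE_completion_iff)

lemma finite_measure_itv: "finite_measure (itv a b)"
  by (rule finite_measure_lebesgue_on) simp

text \<open>The spaces in the statement consist of Lebesgue measurable functions on an interval,
  \<open>lsq\<close> of Borel functions on the line. The bridge is a Borel representative extended
  by zero.\<close>

definition bor :: "real \<Rightarrow> real \<Rightarrow> (real \<Rightarrow> real) \<Rightarrow> real \<Rightarrow> real" where
  "bor a b f = (SOME g. g \<in> borel_measurable borel \<and> (\<forall>x. x \<notin> {a<..<b} \<longrightarrow> g x = 0) \<and> (AE x in itv a b. g x = f x))"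

lemma bor:
  assumes "f \<in> borel_measurable (itv a b)"
  shows bor_measurable: "bor a b f \<in> borel_measurable borel"
    and bor_outside: "\<And>x. x \<notin> {a<..<b} \<Longrightarrow> bor a b f x = 0"
    and bor_AE: "AE x in itv a b. bor a b f x = f x"
proof -
  have "(\<lambda>x. indicat_real {a<..<b} x *\<^sub>R f x) \<in> borel_measurable lebesgue"
    using assms by (subst (asm) borel_measurable_restrict_space_iff) auto
  then obtain g where g: "g \<in> borel_measurable lborel" "AE x in lborel. indicat_real {a<..<b} x *\<^sub>R f x = g x"
    using completion_ex_borel_measurable_real by blast
  have "\<exists>g. g \<in> borel_measurable borel \<and> (\<forall>x. x \<notin> {a<..<b} \<longrightarrow> g x = 0) \<and> (AE x in itv a b. g x = f x)"
  proof (intro exI conjI)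
    show "(\<lambda>x. indicat_real {a<..<b} x * g x) \<in> borel_measurable borel" using g(1) by auto
    show "AE x in itv a b. indicat_real {a<..<b} x * g x = f x"
      unfolding AE_itv_iff using g(2) by eventually_elim auto
  qed auto
  from someI_ex[OF this]
  show "bor a b f \<in> borel_measurable borel" "\<And>x. x \<notin> {a<..<b} \<Longrightarrow> bor a b f x = 0"
    "AE x in itv a b. bor a b f x = f x" by (auto simp: bor_def)
qed

lemma itv_integral:
  assumes g: "g \<in> borel_measurable borel" "\<And>x. x \<notin> {a<..<b} \<Longrightarrow> g x = 0"
    and f: "f \<in> borel_measurable (itv a b)" and eq: "AE x in itv a b. g x = (f x :: real)"
  shows "integrable (itv a b) f \<longleftrightarrow> integrable lborel g" "(LINT x|itv a b. f x) = (LINT x|lborel. g x)"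
proof -
  have gm: "g \<in> borel_measurable (itv a b)"
    using g(1) by (intro measurable_restrict_space1 measurable_completion) simp
  have ind: "(\<lambda>x. indicat_real {a<..<b} x *\<^sub>R g x) = g"
    using g(2) by (auto simp: indicator_def fun_eq_iff)
  have "integrable (itv a b) f \<longleftrightarrow> integrable (itv a b) g"
    by (rule integrable_cong_AE[OF f gm]) (use eq in \<open>auto elim: eventually_mono\<close>)
  also have "\<dots> \<longleftrightarrow> integrable lborel g"
    by (subst integrable_restrict_space) (use g(1) ind in \<open>auto simp: integrable_completion\<close>)
  finally show "integrable (itv a b) f \<longleftrightarrow> integrable lborel g" .
  have "(LINT x|itv a b. f x) = (LINT x|itv a b. g x)"
    by (rule integral_cong_AE[OF f gm]) (use eq in \<open>auto elim: eventually_mono\<close>)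
  also have "\<dots> = (LINT x|lborel. g x)"
    by (subst integral_restrict_space) (use g(1) ind in \<open>auto simp: integral_completion\<close>)
  finally show "(LINT x|itv a b. f x) = (LINT x|lborel. g x)" .
qed

lemma borel_imp_itv: "f \<in> borel_measurable borel \<Longrightarrow> f \<in> borel_measurable (itv a b)"
  by (rule itv.borel_imp_measurable)

lemma integrable_itv_bounded:
  assumes "f \<in> borel_measurable (itv a b)" "AE x in itv a b. norm (f x :: 'a::{banach, second_countable_topology}) \<le> B"
  shows "integrable (itv a b) f"
  using finite_measure.integrable_const_bound[OF finite_measure_itv assms(2,1)] .

lemma continuous_bounded_Icc:
  fixes g :: "real \<Rightarrow> 'a::real_normed_vector"
  assumes "continuous_on {a..b} g"
  obtains C where "\<And>t. t \<in> {a..b} \<Longrightarrow> norm (g t) \<le> C"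
proof -
  have "bounded (g ` {a..b})"
    using assms by (intro compact_imp_bounded compact_continuous_image) auto
  then show ?thesis using that unfolding bounded_iff by blast
qed

lemma integrable_itv_continuous:
  assumes "continuous_on {a..b} (f :: real \<Rightarrow> 'a::{banach, second_countable_topology})"
  shows "integrable (itv a b) f"
proof -
  obtain B where B: "\<And>x. x \<in> {a..b} \<Longrightarrow> norm (f x) \<le> B"
    using continuous_bounded_Icc[OF assms] by metis
  show ?thesis
  proof (rule integrable_itv_bounded)
    have "continuous_on {a<..<b} f" using assms by (rule continuous_on_subset) auto
    then show "f \<in> borel_measurable (itv a b)"
      by (rule continuous_imp_measurable_on_sets_lebesgue) simp
    show "AE x in itv a b. norm (f x) \<le> B"
      unfolding AE_itv_iff using B by (intro AE_I2) auto
  qed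
qed

lemma test_fun_outside: "\<phi> \<in> test_fun a b \<Longrightarrow> x \<notin> {a<..<b} \<Longrightarrow> \<phi> x = 0"
  using closure_subset[of "{x. \<phi> x \<noteq> 0}"] by (auto simp: test_fun_def)

lemma smooth_continuous_on: "smooth f \<Longrightarrow> continuous_on S f"
  by (intro continuous_at_imp_continuous_on ballI smooth_continuous)

lemma integrable_mult_continuous:
  assumes f: "integrable (itv a b) f" and g: "continuous_on {a..b} (g :: real \<Rightarrow> real)"
  shows "integrable (itv a b) (\<lambda>x. f x * g x)"
proof -
  obtain B where B: "\<And>x. x \<in> {a..b} \<Longrightarrow> norm (g x) \<le> B"
    using continuous_bounded_Icc[OF g] by metis
  show ?thesis
  proof (rule Bochner_Integration.integrable_bound)
    show "integrable (itv a b) (\<lambda>x. B * f x)" using f by simp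
    show "(\<lambda>x. f x * g x) \<in> borel_measurable (itv a b)"
      using f integrable_itv_continuous[OF g] by auto
    show "AE x in itv a b. norm (f x * g x) \<le> norm (B * f x)"
    proof (rule AE_I2)
      fix x assume "x \<in> space (itv a b)"
      then have "norm (g x) \<le> B" by (intro B) auto
      then have "\<bar>f x\<bar> * \<bar>g x\<bar> \<le> \<bar>f x\<bar> * \<bar>B\<bar>" by (intro mult_left_mono) auto
      then show "norm (f x * g x) \<le> norm (B * f x)" by (simp add: abs_mult mult.commute)
    qed
  qed
qed

lemma bor_integrable: "integrable (itv a b) f \<Longrightarrow> integrable lborel (bor a b f)"
  using itv_integral(1)[of "bor a b f" a b f] bor[of f a b] by auto

lemma integral_itv_bor:
  assumes f: "f \<in> borel_measurable (itv a b)" and g: "g \<in> borel_measurable borel"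
  shows "(LINT x|itv a b. f x * g x) = (LINT x|lborel. bor a b f x * g x)"
  by (rule itv_integral(2))
    (use bor[OF f] borel_imp_itv[OF g] f g in \<open>auto intro!: borel_measurable_times elim: eventually_mono\<close>)

section \<open>Weak derivatives and primitives\<close>

lemma integral_itv_deriv_after:
  assumes "\<phi> \<in> test_fun a b" "a < y" "y < b"
  shows "(LINT x|itv a b. indicat_real {y<..} x * deriv \<phi> x) = - \<phi> y"
proof -
  have sm: "smooth \<phi>" by (rule test_fun_smooth[OF assms(1)])
  note [measurable] = smooth_measurable[OF smooth_deriv[OF sm]]
  have "\<phi> b = 0" using assms(1) by (auto elim!: test_funE)
  have "(LINT x|itv a b. indicat_real {y<..} x * deriv \<phi> x) = (LINT x|lborel. indicat_real {y<..<b} x * deriv \<phi> x)"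
  proof (rule itv_integral(2))
    show "(\<lambda>x. indicat_real {y<..} x * deriv \<phi> x) \<in> borel_measurable (itv a b)"
      by (rule borel_imp_itv) measurable
    show "AE x in itv a b. indicat_real {y<..<b} x * deriv \<phi> x = indicat_real {y<..} x * deriv \<phi> x"
      unfolding AE_itv_iff by (intro AE_I2) (auto simp: indicator_def)
  qed (use assms in auto)
  also have "\<dots> = (LINT x|lborel. deriv \<phi> x * indicat_real {y..b} x)"
  proof (rule integral_cong_AE)
    show "AE x in lborel. indicat_real {y<..<b} x * deriv \<phi> x = deriv \<phi> x * indicat_real {y..b} x"
      using AE_lborel_singleton[of y] AE_lborel_singleton[of b] by eventually_elim (auto simp: indicator_def)
  qed auto
  also have "\<dots> = \<phi> b - \<phi> y"
    by (rule integral_FTC_Icc_real)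
      (use assms in \<open>auto intro: smooth_DERIV smooth_continuous smooth_deriv sm\<close>)
  finally show ?thesis using \<open>\<phi> b = 0\<close> by simp
qed

lemma integral_itv_deriv:
  assumes "\<phi> \<in> test_fun a b"
  shows "(LINT x|itv a b. deriv \<phi> x) = 0"
proof -
  obtain c d where cd: "a < c" "d < b" "\<And>x. x \<notin> {c..d} \<Longrightarrow> \<phi> x = 0"
    using assms by (auto elim: test_funE)
  show ?thesis
  proof (cases "a < b")
    case True
    \<comment> \<open>A point left of the support, so the integral after \<open>y\<close> is the
      full one. The minimum with \<open>b\<close> is taken because nothing bounds \<open>c\<close>
      by \<open>b\<close>.\<close>
    define y where "y = (a + min c b) / 2"
    have y: "a < y" "y < b" "y < c" using cd True by (auto simp: y_def min_def field_simps)
    have "deriv \<phi> x = indicat_real {y<..} x * deriv \<phi> x" for x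
    proof (cases "x \<le> y")
      case True
      have "\<forall>\<^sub>F z in nhds x. \<phi> z = 0"
        using eventually_nhds_in_open[of "{..<c}" x] True y by (auto elim!: eventually_mono intro!: cd(3))
      then have "deriv \<phi> x = deriv (\<lambda>_. 0) x" by (intro deriv_cong_ev) auto
      then show ?thesis using True by simp
    qed auto
    then have "(LINT x|itv a b. deriv \<phi> x) = - \<phi> y"
      using integral_itv_deriv_after[OF assms y(1,2)] by presburger
    then show ?thesis using cd(3)[of y] y by simp
  next
    case False
    then have "{a<..<b} = {}" by auto
    then show ?thesis by (simp add: integral_lebesgue_on_empty)
  qed
qed

text \<open>By \<open>prim_triangle\<close>, pairing a primitive of \<open>w\<close> with the
  derivative of a test function pairs \<open>w\<close> with the tail integrals of that derivative,
  which are the negative of the test function.\<close>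

lemma has_weak_deriv_prim:
  assumes w: "integrable (itv a b) w" and v: "v \<in> borel_measurable (itv a b)"
    and eq: "AE x in itv a b. v x = c + prim (itv a b) w x"
  shows "has_weak_deriv a b v w"
  unfolding has_weak_deriv_def
proof
  fix \<phi> assume \<phi>: "\<phi> \<in> test_fun a b"
  note sm = test_fun_smooth[OF \<phi>]
  have int: "integrable (itv a b) (deriv \<phi>)"
    by (intro integrable_itv_continuous smooth_continuous_on smooth_deriv sm)
  have int2: "integrable (itv a b) (\<lambda>x. deriv \<phi> x * prim (itv a b) w x)"
    using itv.integrable_inner_prim[OF int w] by simp
  have "(LINT x|itv a b. v x * deriv \<phi> x) = (LINT x|itv a b. c * deriv \<phi> x + deriv \<phi> x * prim (itv a b) w x)"
  proof (rule integral_cong_AE)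
    show "AE x in itv a b. v x * deriv \<phi> x = c * deriv \<phi> x + deriv \<phi> x * prim (itv a b) w x"
      using eq by eventually_elim (simp add: algebra_simps)
  qed (use int int2 v in auto)
  also have "\<dots> = (LINT x|itv a b. deriv \<phi> x * prim (itv a b) w x)"
    using int int2 integral_itv_deriv[OF \<phi>] by simp
  also have "\<dots> = (LINT y|itv a b. w y * (LINT x|itv a b. indicat_real {y<..} x * deriv \<phi> x))"
    using itv.prim_triangle[OF int w] by simp
  also have "\<dots> = (LINT y|itv a b. - (w y * \<phi> y))"
    by (intro Bochner_Integration.integral_cong refl) (simp add: integral_itv_deriv_after[OF \<phi>])
  finally show "(LINT x|itv a b. v x * deriv \<phi> x) = - (LINT x|itv a b. w x * \<phi> x)" by simp
qed

lemma test_fun_integrable: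
  assumes "\<phi> \<in> test_fun a b"
  shows "integrable lborel \<phi>"
proof -
  obtain c d where cd: "\<And>x. x \<notin> {c..d} \<Longrightarrow> \<phi> x = 0"
    using test_funE[OF assms] by metis
  have "set_integrable lborel {c..d} \<phi>"
    unfolding set_integrable_def by (rule borel_integrable_compact) (auto intro: smooth_continuous_on test_fun_smooth assms)
  moreover have "(\<lambda>x. indicat_real {c..d} x *\<^sub>R \<phi> x) = \<phi>"
    using cd by (auto simp: indicator_def fun_eq_iff)
  ultimately show ?thesis by (simp add: set_integrable_def)
qed

text \<open>The zero mean makes the primitive vanish again to the right of the support.\<close>

lemma test_fun_antiderivative:
  assumes \<theta>: "\<theta> \<in> test_fun a b" and zero: "(LINT x|lborel. \<theta> x) = 0"
  obtains \<Theta> where "\<Theta> \<in> test_fun a b" "deriv \<Theta> = \<theta>"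
proof -
  obtain c d where cd: "a < c" "d < b" "\<And>x. x \<notin> {c..d} \<Longrightarrow> \<theta> x = 0"
    using \<theta> by (auto elim: test_funE)
  note sm = test_fun_smooth[OF \<theta>] and int = test_fun_integrable[OF \<theta>]
  let ?T = "prim lborel \<theta>"
  have eq: "?T z = integral {m..z} \<theta>" if "m \<le> c" "m \<le> z" for m z
  proof -
    have "?T z = (LINT x|lborel. indicat_real {m..z} x *\<^sub>R \<theta> x)"
      unfolding prim_def
    proof (rule integral_cong_AE)
      show "AE x in lborel. indicat_real {..<z} x *\<^sub>R \<theta> x = indicat_real {m..z} x *\<^sub>R \<theta> x"
        using AE_lborel_singleton[of z] by eventually_elim (use cd(3) that in \<open>auto simp: indicator_def\<close>)
    qed (use int in auto)
    also have "\<dots> = integral {m..z} \<theta>"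
    proof -
      have "set_integrable lborel {m..z} \<theta>"
        unfolding set_integrable_def by (rule borel_integrable_compact) (auto intro: smooth_continuous_on sm)
      from set_borel_integral_eq_integral(2)[OF this] show ?thesis by (simp add: set_lebesgue_integral_def)
    qed
    finally show ?thesis .
  qed
  have der: "(?T has_real_derivative \<theta> x) (at x)" for x
  proof -
    define m where "m = min c x - 1"
    have "((\<lambda>z. integral {m..z} \<theta>) has_real_derivative \<theta> x) (at x within {m..x + 1})"
      by (rule integral_has_real_derivative) (auto simp: m_def intro: smooth_continuous_on sm)
    then have "((\<lambda>z. integral {m..z} \<theta>) has_real_derivative \<theta> x) (at x)"
      by (subst (asm) at_within_Icc_at) (auto simp: m_def)
    moreover have "\<forall>\<^sub>F z in nhds x. ?T z = integral {m..z} \<theta>"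
    proof -
      have "\<forall>\<^sub>F z in nhds x. z \<in> {m<..}"
        by (rule eventually_nhds_in_open) (auto simp: m_def)
      then show ?thesis
        by eventually_elim (rule eq, auto simp: m_def)
    qed
    ultimately show ?thesis
      by (subst DERIV_cong_ev[OF refl _ refl]) auto
  qed
  show ?thesis
  proof (rule that)
    show "?T \<in> test_fun a b"
    proof (rule test_funI[OF smooth_prim[OF sm der] cd(1,2)])
      fix x assume "x \<notin> {c..d}"
      then consider "x < c" | "d < x" by fastforce
      then show "?T x = 0"
      proof cases
        case 1
        then have "(\<lambda>s. indicat_real {..<x} s *\<^sub>R \<theta> s) = (\<lambda>s. 0)"
          using cd(3) by (auto simp: indicator_def fun_eq_iff)
        then show ?thesis by (simp add: prim_def)
      next
        case 2
        then have "(\<lambda>s. indicat_real {..<x} s *\<^sub>R \<theta> s) = \<theta>"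
          using cd(3) by (auto simp: indicator_def fun_eq_iff)
        then show ?thesis using zero by (simp only: prim_def)
      qed
    qed
    show "deriv ?T = \<theta>" using der by (auto intro!: DERIV_imp_deriv)
  qed
qed

lemma test_fun_lincomb:
  assumes "\<phi> \<in> test_fun a b" "\<psi> \<in> test_fun a b"
  shows "(\<lambda>x. \<phi> x + k * \<psi> x) \<in> test_fun a b"
proof -
  obtain c d where cd: "a < c" "d < b" "\<And>x. x \<notin> {c..d} \<Longrightarrow> \<phi> x = 0"
    using assms(1) by (auto elim: test_funE)
  obtain c' d' where cd': "a < c'" "d' < b" "\<And>x. x \<notin> {c'..d'} \<Longrightarrow> \<psi> x = 0"
    using assms(2) by (auto elim: test_funE)
  show ?thesis
  proof (rule test_funI[of _ a "min c c'" "max d d'"])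
    show "smooth (\<lambda>x. \<phi> x + k * \<psi> x)"
      by (intro smooth_add smooth_scale test_fun_smooth[OF assms(1)] test_fun_smooth[OF assms(2)])
    fix x assume "x \<notin> {min c c'..max d d'}"
    then have "x \<notin> {c..d}" "x \<notin> {c'..d'}" by auto
    then show "\<phi> x + k * \<psi> x = 0" using cd(3)[of x] cd'(3)[of x] by simp
  qed (use cd cd' in auto)
qed

text \<open>The du Bois-Reymond lemma. Subtracting a suitable multiple of one fixed bump
  \<open>\<beta>\<close> from a test function leaves mean zero, hence a derivative of a test
  function. The constant \<open>c\<close> is the mean of \<open>h\<close> weighted by
  \<open>\<beta>\<close>.\<close>

lemma AE_const_if_weak_deriv_zero:
  assumes ab: "a < b" and h: "integrable (itv a b) h"
    and zero: "\<And>\<phi>. \<phi> \<in> test_fun a b \<Longrightarrow> (LINT x|itv a b. h x * deriv \<phi> x) = 0"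
  shows "\<exists>c. AE x in itv a b. h x = c"
proof -
  define H where "H = bor a b h"
  have hm: "h \<in> borel_measurable (itv a b)" using h by auto
  have H: "integrable lborel H" unfolding H_def by (rule bor_integrable[OF h])
  have [measurable]: "H \<in> borel_measurable borel" using H by auto
  have mult: "integrable lborel (\<lambda>x. H x * \<phi> x)" if "\<phi> \<in> test_fun a b" for \<phi>
  proof -
    note [measurable] = smooth_measurable[OF test_fun_smooth[OF that]]
    have "integrable (itv a b) (\<lambda>x. h x * \<phi> x)"
      by (intro integrable_mult_continuous h smooth_continuous_on test_fun_smooth[OF that])
    then show ?thesis
      by (subst (asm) itv_integral(1)[of "\<lambda>x. H x * \<phi> x"])
        (use bor[OF hm] hm borel_imp_itv[of \<phi>] in \<open>auto simp: H_def elim: eventually_mono\<close>)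
  qed
  have zero': "(LINT x|lborel. H x * \<theta> x) = 0" if \<theta>: "\<theta> \<in> test_fun a b" and \<theta>0: "(LINT x|lborel. \<theta> x) = 0" for \<theta>
  proof -
    obtain \<Theta> where "\<Theta> \<in> test_fun a b" "deriv \<Theta> = \<theta>"
      using test_fun_antiderivative[OF \<theta> \<theta>0] by metis
    then show ?thesis
      using zero[of \<Theta>] integral_itv_bor[OF hm smooth_measurable[OF test_fun_smooth[OF \<theta>]]] by (simp add: H_def)
  qed
  have "(\<lambda>n. LINT x|lborel. indicat_real {a<..<b} x * bump a b n x) \<longlonglongrightarrow> (LINT x|lborel. indicat_real {a<..<b} x * indicat_real {a<..<b} x)"
    by (rule integral_bump_tendsto) (use ab in auto)
  moreover have "(LINT x|lborel. indicat_real {a<..<b} x * indicat_real {a<..<b} x) = b - a"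
    using ab by (simp flip: indicator_inter_arith)
  ultimately have "\<forall>\<^sub>F n in sequentially. 0 < (LINT x|lborel. indicat_real {a<..<b} x * bump a b n x)"
    using ab by (intro order_tendstoD(1)) auto
  then obtain n where n: "0 < (LINT x|lborel. indicat_real {a<..<b} x * bump a b n x)"
    by (auto simp: eventually_sequentially)
  define \<beta> where "\<beta> = bump a b n"
  have \<beta>: "\<beta> \<in> test_fun a b" unfolding \<beta>_def by (rule bump_test_fun) auto
  have "(\<lambda>x. indicat_real {a<..<b} x * bump a b n x) = \<beta>"
  proof
    fix x
    show "indicat_real {a<..<b} x * bump a b n x = \<beta> x"
      using test_fun_outside[OF \<beta>, of x] by (auto simp: \<beta>_def indicator_def)
  qed
  with n have I: "0 < (LINT x|lborel. \<beta> x)" (is "0 < ?I") by simp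
  define c where "c = (LINT x|lborel. H x * \<beta> x) / ?I"
  have "AE x in lborel. H x - c * indicat_real {a<..<b} x = 0"
  proof (rule AE_zero_if_test_zero)
    show "integrable lborel (\<lambda>x. H x - c * indicat_real {a<..<b} x)"
      using H ab by auto
    show "H x - c * indicat_real {a<..<b} x = 0" if "x \<notin> {a<..<b}" for x
      using that bor_outside[OF hm that] by (simp add: H_def)
    fix \<psi> assume \<psi>: "\<psi> \<in> test_fun a b"
    note ints = test_fun_integrable[OF \<psi>] test_fun_integrable[OF \<beta>] mult[OF \<psi>] mult[OF \<beta>]
    define k where "k = - (LINT x|lborel. \<psi> x) / ?I"
    have "(LINT x|lborel. \<psi> x + k * \<beta> x) = 0"
      using ints I by (simp add: k_def)
    from zero'[OF test_fun_lincomb[OF \<psi> \<beta>] this]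
    have "(LINT x|lborel. H x * \<psi> x + k * (H x * \<beta> x)) = 0"
      by (simp add: algebra_simps)
    then have "(LINT x|lborel. H x * \<psi> x) + k * (LINT x|lborel. H x * \<beta> x) = 0"
      using ints by simp
    then have *: "(LINT x|lborel. H x * \<psi> x) = c * (LINT x|lborel. \<psi> x)"
      by (simp add: k_def c_def)
    have "\<psi> x = indicat_real {a<..<b} x * \<psi> x" for x
      using test_fun_outside[OF \<psi>, of x] by (auto simp: indicator_def)
    then have "(LINT x|lborel. (H x - c * indicat_real {a<..<b} x) * \<psi> x) = (LINT x|lborel. H x * \<psi> x - c * \<psi> x)"
      by (metis (no_types, opaque_lifting) left_diff_distrib mult.assoc)
    also have "\<dots> = 0" using ints * by simp
    finally show "(LINT x|lborel. (H x - c * indicat_real {a<..<b} x) * \<psi> x) = 0" .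
  qed
  then have "AE x in itv a b. H x = c"
    unfolding AE_itv_iff by eventually_elim auto
  with bor_AE[OF hm] have "AE x in itv a b. h x = c"
    unfolding H_def by eventually_elim simp
  then show ?thesis ..
qed

text \<open>Existence of the absolutely continuous representative: \<open>v\<close> minus the
  primitive of \<open>w\<close> has weak derivative zero and is therefore constant.\<close>

theorem has_weak_deriv_iff:
  assumes ab: "a < b" and v: "integrable (itv a b) v" and w: "integrable (itv a b) w"
  shows "has_weak_deriv a b v w \<longleftrightarrow> (\<exists>c. AE x in itv a b. v x = c + prim (itv a b) w x)"
proof
  assume weak: "has_weak_deriv a b v w"
  have p: "integrable (itv a b) (prim (itv a b) w)"
    by (intro integrable_itv_continuous itv.continuous_prim w)
  have "\<exists>c. AE x in itv a b. v x - prim (itv a b) w x = c"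
  proof (rule AE_const_if_weak_deriv_zero[OF ab])
    show "integrable (itv a b) (\<lambda>x. v x - prim (itv a b) w x)" using v p by simp
    fix \<phi> assume \<phi>: "\<phi> \<in> test_fun a b"
    have d: "continuous_on {a..b} (deriv \<phi>)"
      by (intro smooth_continuous_on smooth_deriv test_fun_smooth[OF \<phi>])
    have "has_weak_deriv a b (prim (itv a b) w) w"
      by (rule has_weak_deriv_prim[where c=0]) (use w p in auto)
    with weak \<phi> have "(LINT x|itv a b. v x * deriv \<phi> x) = (LINT x|itv a b. prim (itv a b) w x * deriv \<phi> x)"
      by (simp add: has_weak_deriv_def)
    then show "(LINT x|itv a b. (v x - prim (itv a b) w x) * deriv \<phi> x) = 0"
      using integrable_mult_continuous[OF v d] integrable_mult_continuous[OF p d] by (simp add: left_diff_distrib)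
  qed
  then obtain c where "AE x in itv a b. v x - prim (itv a b) w x = c" ..
  then have "AE x in itv a b. v x = c + prim (itv a b) w x"
    by eventually_elim simp
  then show "\<exists>c. AE x in itv a b. v x = c + prim (itv a b) w x" ..
next
  assume "\<exists>c. AE x in itv a b. v x = c + prim (itv a b) w x"
  then show "has_weak_deriv a b v w"
    using has_weak_deriv_prim[OF w] v by auto
qed

lemma weak_deriv_unique:
  assumes w: "integrable (itv a b) w" "integrable (itv a b) w'"
    and weak: "has_weak_deriv a b v w" "has_weak_deriv a b v w'"
  shows "AE x in itv a b. w x = w' x"
proof -
  let ?d = "\<lambda>x. w x - w' x"
  have d: "integrable (itv a b) ?d" using w by simp
  have dm: "?d \<in> borel_measurable (itv a b)" using d by auto
  have "AE x in lborel. bor a b ?d x = 0"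
  proof (rule AE_zero_if_test_zero[OF bor_integrable[OF d] bor_outside[OF dm]])
    fix \<phi> assume \<phi>: "\<phi> \<in> test_fun a b"
    have c: "continuous_on {a..b} \<phi>" by (intro smooth_continuous_on test_fun_smooth[OF \<phi>])
    have "(LINT x|itv a b. w x * \<phi> x) = (LINT x|itv a b. w' x * \<phi> x)"
      using weak \<phi> by (auto simp: has_weak_deriv_def)
    then have "(LINT x|itv a b. ?d x * \<phi> x) = 0"
      using integrable_mult_continuous[OF w(1) c] integrable_mult_continuous[OF w(2) c] by (simp add: left_diff_distrib)
    then show "(LINT x|lborel. bor a b ?d x * \<phi> x) = 0"
      using integral_itv_bor[OF dm smooth_measurable[OF test_fun_smooth[OF \<phi>]]] by simp
  qed
  then have "AE x in itv a b. bor a b ?d x = 0"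
    unfolding AE_itv_iff by eventually_elim simp
  with bor_AE[OF dm] show ?thesis
    by eventually_elim simp
qed

section \<open>Sobolev functions on an interval\<close>

text \<open>Extension by zero as an isometric embedding of \<open>L\<^sup>2(a,b)\<close> into
  \<open>lsq\<close>; it identifies exactly the functions that agree almost everywhere on (a,
  b).\<close>

definition em :: "real \<Rightarrow> real \<Rightarrow> (real \<Rightarrow> real) \<Rightarrow> lsq" where
  "em a b v = cls (bor a b v)"

lemma L2_measurable: "v \<in> L2 a b \<Longrightarrow> v \<in> borel_measurable (itv a b)"
  by (simp add: L2_def)

lemma bor_sq_int:
  assumes "v \<in> L2 a b"
  shows "bor a b v \<in> sq_int"
proof -
  note vm = L2_measurable[OF assms]
  have "integrable (itv a b) (\<lambda>x. (v x)\<^sup>2) \<longleftrightarrow> integrable lborel (\<lambda>x. (bor a b v x)\<^sup>2)"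
    by (rule itv_integral(1)) (use bor[OF vm] vm in \<open>auto elim: eventually_mono\<close>)
  then show ?thesis
    using assms bor_measurable[OF vm] by (simp add: L2_def sq_int_def)
qed

lemma fn_em_bor: "v \<in> L2 a b \<Longrightarrow> AE x in lborel. fn (em a b v) x = bor a b v x"
  unfolding em_def by (intro fn_cls bor_sq_int)

lemma fn_em:
  assumes "v \<in> L2 a b"
  shows "AE x in itv a b. fn (em a b v) x = v x"
proof -
  have "AE x in itv a b. fn (em a b v) x = bor a b v x"
    unfolding AE_itv_iff using fn_em_bor[OF assms] by eventually_elim simp
  with bor_AE[OF L2_measurable[OF assms]] show ?thesis by eventually_elim simp
qed

lemma inner_em_right:
  assumes "v \<in> L2 a b"
  shows "y \<bullet> em a b v = (LINT x|itv a b. fn y x * v x)"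
proof -
  have "y \<bullet> em a b v = (LINT x|lborel. fn y x * bor a b v x)"
    using inner_cls[OF fn_sq_int[of y] bor_sq_int[OF assms]] by (simp add: em_def)
  also have "\<dots> = (LINT x|itv a b. v x * fn y x)"
    using integral_itv_bor[OF L2_measurable[OF assms] fn_measurable[of y]] by (simp add: mult.commute)
  finally show ?thesis by (simp add: mult.commute)
qed

lemma inner_em:
  assumes "v \<in> L2 a b" "w \<in> L2 a b"
  shows "em a b v \<bullet> em a b w = L2_inner a b v w"
  unfolding inner_em_right[OF assms(2)] L2_inner_def
  by (rule integral_cong_AE)
    (use fn_em[OF assms(1)] assms[THEN L2_measurable] borel_imp_itv[OF fn_measurable] in \<open>auto elim: eventually_mono\<close>)

lemma norm_em: "v \<in> L2 a b \<Longrightarrow> norm (em a b v) = L2_norm a b v"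
  by (simp add: L2_norm_def norm_eq_sqrt_inner inner_em)

lemma L2_fn: "fn y \<in> L2 a b"
proof -
  have "integrable lborel (\<lambda>x. (fn y x)\<^sup>2)" using fn_sq_int[of y] by (simp add: sq_int_def)
  then have "integrable lebesgue (\<lambda>x. (fn y x)\<^sup>2)" by (simp add: integrable_completion)
  then have "integrable (itv a b) (\<lambda>x. (fn y x)\<^sup>2)"
    by (simp add: integrable_restrict_space integrable_mult_indicator[where 'b=real, unfolded real_scaleR_def])
  then show ?thesis using borel_imp_itv[OF fn_measurable] by (simp add: L2_def)
qed

lemma em_eqI:
  assumes v: "v \<in> borel_measurable (itv a b)" and eq: "AE x in itv a b. v x = fn y x"
  shows "v \<in> L2 a b" "em a b v = res a b y"
proof -
  have "integrable (itv a b) (\<lambda>x. (v x)\<^sup>2) \<longleftrightarrow> integrable (itv a b) (\<lambda>x. (fn y x)\<^sup>2)"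
    by (rule integrable_cong_AE) (use v eq borel_imp_itv[OF fn_measurable[of y]] in \<open>auto elim: eventually_mono\<close>)
  then show L2: "v \<in> L2 a b"
    using v L2_fn[of y a b] by (simp add: L2_def)
  have "AE x in lborel. x \<in> {a<..<b} \<longrightarrow> bor a b v x = v x"
    using bor_AE[OF v] by (simp only: AE_itv_iff)
  moreover have "AE x in lborel. x \<in> {a<..<b} \<longrightarrow> v x = fn y x"
    using eq by (simp only: AE_itv_iff)
  ultimately show "em a b v = res a b y"
    unfolding em_def res_def
    by (intro cls_cong, eventually_elim) (use bor_outside[OF v] in \<open>auto simp: indicator_def\<close>)
qed

lemma em_fn: "em a b (fn y) = res a b y"
  by (rule em_eqI(2)) (auto intro: borel_imp_itv fn_measurable)

lemma res_em: "v \<in> L2 a b \<Longrightarrow> res a b (em a b v) = em a b v"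
proof -
  assume v: "v \<in> L2 a b"
  have "AE x in itv a b. v x = fn (em a b v) x"
    using fn_em[OF v] by eventually_elim simp
  from em_eqI(2)[OF L2_measurable[OF v] this] show ?thesis ..
qed

lemma em_eq_iff:
  assumes "v \<in> L2 a b" "w \<in> L2 a b"
  shows "em a b v = em a b w \<longleftrightarrow> ae_eq a b v w"
proof
  assume "em a b v = em a b w"
  with fn_em[OF assms(1)] fn_em[OF assms(2)] show "ae_eq a b v w"
    unfolding ae_eq_def by simp (erule eventually_elim2, assumption, simp)
next
  assume "ae_eq a b v w"
  then have "AE x in itv a b. v x = fn (em a b w) x"
    unfolding ae_eq_def using fn_em[OF assms(2)] by eventually_elim simp
  then show "em a b v = em a b w"
    using em_eqI(2)[OF L2_measurable[OF assms(1)]] res_em[OF assms(2)] by simp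
qed

lemma L2_lincomb:
  assumes v: "v \<in> L2 a b" and w: "w \<in> L2 a b"
  shows "(\<lambda>x. c * v x + d * w x) \<in> L2 a b"
    and "em a b (\<lambda>x. c * v x + d * w x) = c *\<^sub>R em a b v + d *\<^sub>R em a b w"
proof -
  let ?y = "c *\<^sub>R em a b v + d *\<^sub>R em a b w"
  have m: "(\<lambda>x. c * v x + d * w x) \<in> borel_measurable (itv a b)"
    using v w by (auto simp: L2_def)
  have "AE x in lborel. fn ?y x = c * fn (em a b v) x + d * fn (em a b w) x"
    using fn_add[of "c *\<^sub>R em a b v" "d *\<^sub>R em a b w"] fn_scaleR[of c "em a b v"] fn_scaleR[of d "em a b w"]
    by eventually_elim simp
  then have "AE x in itv a b. fn ?y x = c * fn (em a b v) x + d * fn (em a b w) x"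
    unfolding AE_itv_iff by eventually_elim simp
  with fn_em[OF v] fn_em[OF w] have eq: "AE x in itv a b. c * v x + d * w x = fn ?y x"
    by eventually_elim simp
  show "(\<lambda>x. c * v x + d * w x) \<in> L2 a b"
    by (rule em_eqI(1)[OF m eq])
  show "em a b (\<lambda>x. c * v x + d * w x) = ?y"
    using em_eqI(2)[OF m eq] by (simp add: res_add res_scale res_em v w)
qed

lemma L2_diff:
  assumes "v \<in> L2 a b" "w \<in> L2 a b"
  shows "(\<lambda>x. v x - w x) \<in> L2 a b" "em a b (\<lambda>x. v x - w x) = em a b v - em a b w"
  using L2_lincomb[OF assms, of 1 "-1"] by simp_all

lemma L2_integrable: "v \<in> L2 a b \<Longrightarrow> integrable (itv a b) v"
proof (rule Bochner_Integration.integrable_bound)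
  assume v: "v \<in> L2 a b"
  show "integrable (itv a b) (\<lambda>x. 1 + (v x)\<^sup>2)"
    by (intro Bochner_Integration.integrable_add finite_measure.integrable_const[OF finite_measure_itv])
      (use v in \<open>simp add: L2_def\<close>)
  show "v \<in> borel_measurable (itv a b)" using v by (rule L2_measurable)
  have "\<bar>t\<bar> \<le> 1 + t\<^sup>2" for t :: real
    using sum_squares_bound[of 1 "\<bar>t\<bar>"] by simp
  then show "AE x in itv a b. norm (v x) \<le> norm (1 + (v x)\<^sup>2)" by (intro AE_I2) simp
qed

lemma L2_continuous:
  assumes "continuous_on {a..b} v"
  shows "v \<in> L2 a b"
  using integrable_mult_continuous[OF integrable_itv_continuous[OF assms] assms] integrable_itv_continuous[OF assms]
  by (auto simp: L2_def power2_eq_square)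

lemma em_1: "em a b (\<lambda>x. 1) = ivl a b"
proof -
  have "AE x in itv a b. 1 = fn (ivl a b) x"
    unfolding AE_itv_iff using fn_ivl[of a b] by eventually_elim simp
  from em_eqI(2)[OF _ this] show ?thesis by (simp add: res_ivl)
qed

lemma prim_fn_eq_inner:
  assumes "a \<le> x" "x \<le> b"
  shows "prim (itv a b) (fn y) x = y \<bullet> ivl a x"
proof -
  have "prim (itv a b) (fn y) x = (LINT s|lborel. fn y s * indicat_real {a<..<x} s)"
    unfolding prim_def
  proof (rule itv_integral(2))
    show "(\<lambda>s. indicat_real {..<x} s *\<^sub>R fn y s) \<in> borel_measurable (itv a b)"
      by (rule borel_imp_itv) auto
    show "AE s in itv a b. fn y s * indicat_real {a<..<x} s = indicat_real {..<x} s *\<^sub>R fn y s"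
      unfolding AE_itv_iff by (intro AE_I2) (auto simp: indicator_def)
  qed (use assms in auto)
  then show ?thesis by (simp add: inner_ivl)
qed

lemma prim_L2_eq_inner:
  assumes "w \<in> L2 a b" "a \<le> x" "x \<le> b"
  shows "prim (itv a b) w x = em a b w \<bullet> ivl a x"
proof -
  have "prim (itv a b) w x = prim (itv a b) (fn (em a b w)) x"
    by (rule itv.prim_cong_AE) (use assms fn_em[OF assms(1)] in \<open>auto intro!: L2_integrable L2_fn elim!: eventually_mono\<close>)
  then show ?thesis using prim_fn_eq_inner[OF assms(2,3)] by simp
qed

lemma prim_itv_end: "prim (itv a b) F b = (LINT s|itv a b. F s)"
  unfolding prim_def by (intro Bochner_Integration.integral_cong) auto

lemma prim_itv_start: "t \<le> a \<Longrightarrow> prim (itv a b) F t = 0"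
proof -
  assume "t \<le> a"
  then have "prim (itv a b) F t = (LINT s|itv a b. 0)"
    unfolding prim_def by (intro Bochner_Integration.integral_cong) (auto simp: indicator_def)
  then show ?thesis by simp
qed

text \<open>The set of coincidence is closed and meets the open interval in full measure, so it
  contains the interval and its closure.\<close>

lemma ae_eq_continuous_imp_eq:
  fixes v w :: "real \<Rightarrow> real"
  assumes ab: "a < b" and cont: "continuous_on {a..b} v" "continuous_on {a..b} w"
    and eq: "AE x in itv a b. v x = w x" and z: "z \<in> {a..b}"
  shows "v z = w z"
proof -
  let ?C = "{x \<in> {a..b}. v x - w x = 0}"
  have C: "closed ?C"
    by (rule continuous_closed_preimage_constant) (auto intro!: continuous_intros cont)
  have "{a<..<b} \<subseteq> ?C"
  proof
    fix x assume x: "x \<in> {a<..<b}"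
    have "AE y in lebesgue. y \<in> {a<..<b} \<longrightarrow> y \<in> ?C"
      using eq by (subst (asm) AE_restrict_space_iff) (auto elim!: eventually_mono)
    then show "x \<in> ?C"
      using mem_closed_if_AE_lebesgue_open[of "{a<..<b}" ?C x] C x by auto
  qed
  then have "closure {a<..<b} \<subseteq> ?C" using C by (rule closure_minimal)
  then show ?thesis using ab z by auto
qed

section \<open>Traces and the integral representation of Sobolev functions\<close>

lemma trace_at_eq:
  assumes "a < b" "continuous_on {a..b} w" "AE x in itv a b. v x = w x" "z \<in> {a..b}"
  shows "trace_at a b v z = w z"
  unfolding trace_at_def
proof (rule the_equality)
  show "\<exists>u. continuous_on {a..b} u \<and> ae_eq a b u v \<and> w z = u z"
    using assms(2,3) by (intro exI[of _ w]) (auto simp: ae_eq_def elim: eventually_mono)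
  fix y assume "\<exists>u. continuous_on {a..b} u \<and> ae_eq a b u v \<and> y = u z"
  then obtain u where u: "continuous_on {a..b} u" "ae_eq a b u v" "y = u z" by blast
  have "AE x in itv a b. u x = w x"
    using u(2) assms(3) unfolding ae_eq_def by eventually_elim simp
  then show "y = w z" using ae_eq_continuous_imp_eq[OF assms(1) u(1) assms(2) _ assms(4)] u(3) by simp
qed

lemma continuous_inner_ivl: "continuous_on {a..b} (\<lambda>x. y \<bullet> ivl a x)"
  using itv.continuous_prim[OF L2_integrable[OF L2_fn], of "{a..b}" a b y]
  by (rule continuous_on_eq) (simp add: prim_fn_eq_inner)

lemma weak_deriv_some:
  assumes "v \<in> H1 a b"
  shows "weak_deriv a b v \<in> L2 a b" "has_weak_deriv a b v (weak_deriv a b v)"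
  using someI_ex[of "\<lambda>w. w \<in> L2 a b \<and> has_weak_deriv a b v w"] assms
  by (auto simp: weak_deriv_def H1_def)

lemma H1_L2: "v \<in> H1 a b \<Longrightarrow> v \<in> L2 a b"
  by (simp add: H1_def)

abbreviation dx :: "real \<Rightarrow> real \<Rightarrow> (real \<Rightarrow> real) \<Rightarrow> lsq" where
  "dx a b v \<equiv> em a b (weak_deriv a b v)"

text \<open>Together with \<open>H1_repr\<close> this describes \<open>H\<^sup>1(a,b)\<close> by
  pairs: the trace at \<open>a\<close> and the derivative as a vector of \<open>lsq\<close>, whose
  pairing with \<open>ivl a x\<close> is the integral from \<open>a\<close> to \<open>x\<close>. The
  later constructions of Sobolev functions and of time traces go through it.\<close>

lemma H1I:
  assumes ab: "a < b" and v: "v \<in> borel_measurable (itv a b)"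
    and eq: "AE x in itv a b. v x = c + y \<bullet> ivl a x"
  shows "v \<in> H1 a b" "dx a b v = res a b y"
    "\<And>z. z \<in> {a..b} \<Longrightarrow> trace_at a b v z = c + y \<bullet> ivl a z"
proof -
  have cont: "continuous_on {a..b} (\<lambda>x. c + y \<bullet> ivl a x)"
    by (intro continuous_intros continuous_inner_ivl)
  have "(\<lambda>x. c + y \<bullet> ivl a x) \<in> L2 a b" by (rule L2_continuous[OF cont])
  from fn_em[OF this] eq have "AE x in itv a b. v x = fn (em a b (\<lambda>x. c + y \<bullet> ivl a x)) x"
    by eventually_elim simp
  from em_eqI(1)[OF v this] have L2: "v \<in> L2 a b" .
  have "AE x in itv a b. v x = c + prim (itv a b) (fn y) x"
    using eq AE_space[of "itv a b"] by eventually_elim (simp add: prim_fn_eq_inner)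
  then have wd: "has_weak_deriv a b v (fn y)"
    using v by (intro has_weak_deriv_prim L2_integrable L2_fn)
  show H1: "v \<in> H1 a b"
    using L2 wd L2_fn by (auto simp: H1_def)
  have "AE x in itv a b. weak_deriv a b v x = fn y x"
    using weak_deriv_some[OF H1] wd by (intro weak_deriv_unique) (auto intro: L2_integrable L2_fn)
  then show "dx a b v = res a b y"
    by (rule em_eqI(2)[OF L2_measurable[OF weak_deriv_some(1)[OF H1]]])
  show "trace_at a b v z = c + y \<bullet> ivl a z" if "z \<in> {a..b}" for z
    by (rule trace_at_eq[OF ab cont eq that])
qed

lemma H1_repr:
  assumes ab: "a < b" and v: "v \<in> H1 a b"
  shows "AE x in itv a b. v x = trace_at a b v a + dx a b v \<bullet> ivl a x"
    and "\<And>z. z \<in> {a..b} \<Longrightarrow> trace_at a b v z = trace_at a b v a + dx a b v \<bullet> ivl a z"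
proof -
  note wd = weak_deriv_some[OF v]
  obtain c where "AE x in itv a b. v x = c + prim (itv a b) (weak_deriv a b v) x"
    using has_weak_deriv_iff[OF ab L2_integrable[OF H1_L2[OF v]] L2_integrable[OF wd(1)]] wd(2) by blast
  then have c: "AE x in itv a b. v x = c + dx a b v \<bullet> ivl a x"
    using AE_space[of "itv a b"] by eventually_elim (simp add: prim_L2_eq_inner[OF wd(1)])
  note tr = H1I(3)[OF ab L2_measurable[OF H1_L2[OF v]] c]
  have "trace_at a b v a = c" using tr[of a] ab by (simp add: ivl_empty)
  with c tr show "AE x in itv a b. v x = trace_at a b v a + dx a b v \<bullet> ivl a x"
    "\<And>z. z \<in> {a..b} \<Longrightarrow> trace_at a b v z = trace_at a b v a + dx a b v \<bullet> ivl a z" by simp_all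
qed

lemma H1_norm_eq:
  assumes "v \<in> H1 a b"
  shows "H1_norm a b v = sqrt ((norm (em a b v))\<^sup>2 + (norm (dx a b v))\<^sup>2)"
  by (simp add: H1_norm_def norm_em H1_L2 weak_deriv_some assms)

lemma H1_lincomb:
  assumes ab: "a < b" and v: "v \<in> H1 a b" and w: "w \<in> H1 a b"
  shows "(\<lambda>x. c * v x + d * w x) \<in> H1 a b"
    and "dx a b (\<lambda>x. c * v x + d * w x) = c *\<^sub>R dx a b v + d *\<^sub>R dx a b w"
    and "\<And>z. z \<in> {a..b} \<Longrightarrow> trace_at a b (\<lambda>x. c * v x + d * w x) z = c * trace_at a b v z + d * trace_at a b w z"
proof -
  let ?y = "c *\<^sub>R dx a b v + d *\<^sub>R dx a b w" and ?c = "c * trace_at a b v a + d * trace_at a b w a"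
  have m: "(\<lambda>x. c * v x + d * w x) \<in> borel_measurable (itv a b)"
    using L2_measurable[OF H1_L2[OF v]] L2_measurable[OF H1_L2[OF w]] by auto
  have eq: "AE x in itv a b. c * v x + d * w x = ?c + ?y \<bullet> ivl a x"
    using H1_repr(1)[OF ab v] H1_repr(1)[OF ab w]
    by eventually_elim (simp add: inner_add_left algebra_simps)
  note H = H1I[OF ab m eq]
  show "(\<lambda>x. c * v x + d * w x) \<in> H1 a b" by (rule H(1))
  show "dx a b (\<lambda>x. c * v x + d * w x) = ?y"
    using H(2) by (simp add: res_add res_scale res_em weak_deriv_some(1) v w)
  show "trace_at a b (\<lambda>x. c * v x + d * w x) z = c * trace_at a b v z + d * trace_at a b w z" if "z \<in> {a..b}" for z
    using H(3)[OF that] H1_repr(2)[OF ab v that] H1_repr(2)[OF ab w that]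
    by (simp add: inner_add_left algebra_simps)
qed

lemma H1_diff:
  assumes "a < b" "v \<in> H1 a b" "w \<in> H1 a b"
  shows "(\<lambda>x. v x - w x) \<in> H1 a b" "dx a b (\<lambda>x. v x - w x) = dx a b v - dx a b w"
    "\<And>z. z \<in> {a..b} \<Longrightarrow> trace_at a b (\<lambda>x. v x - w x) z = trace_at a b v z - trace_at a b w z"
  using H1_lincomb[OF assms, where c=1 and d="-1"] by simp_all

lemma dx_ivl: "v \<in> H1 a b \<Longrightarrow> dx a b v \<bullet> ivl a b = (LINT x|itv a b. weak_deriv a b v x)"
  by (cases "a \<le> b")
    (simp_all add: prim_L2_eq_inner[OF weak_deriv_some(1), symmetric] prim_itv_end ivl_empty integral_lebesgue_on_empty)

text \<open>Each function is its trace at \<open>a\<close> plus a primitive. The constants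
  contribute increments of traces, and \<open>prim_by_parts\<close> handles the product of the
  primitives.\<close>

lemma H1_by_parts:
  assumes ab: "a < b" and v: "v \<in> H1 a b" and w: "w \<in> H1 a b"
  shows "dx a b v \<bullet> em a b w + em a b v \<bullet> dx a b w
    = trace_at a b v b * trace_at a b w b - trace_at a b v a * trace_at a b w a"
proof -
  let ?F = "weak_deriv a b v" and ?G = "weak_deriv a b w" and ?M = "itv a b"
  let ?v = "trace_at a b v a" and ?w = "trace_at a b w a"
  note dv = weak_deriv_some(1)[OF v] and dw = weak_deriv_some(1)[OF w]
  note F = L2_integrable[OF dv] and G = L2_integrable[OF dw]
  have FG: "integrable ?M (\<lambda>x. ?F x * prim ?M ?G x)" "integrable ?M (\<lambda>x. ?G x * prim ?M ?F x)"
    using itv.integrable_inner_prim[OF F G] itv.integrable_inner_prim[OF G F] by simp_all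
  have 1: "dx a b v' \<bullet> em a b w' = (LINT x|?M. weak_deriv a b v' x * trace_at a b w' a + weak_deriv a b v' x * prim ?M (weak_deriv a b w') x)"
    if v': "v' \<in> H1 a b" and w': "w' \<in> H1 a b" for v' w'
    unfolding inner_em[OF weak_deriv_some(1)[OF v'] H1_L2[OF w']] L2_inner_def
  proof (rule integral_cong_AE)
    have "integrable ?M (\<lambda>x. weak_deriv a b v' x * prim ?M (weak_deriv a b w') x)"
      using itv.integrable_inner_prim[OF L2_integrable[OF weak_deriv_some(1)[OF v']] L2_integrable[OF weak_deriv_some(1)[OF w']]]
      by simp
    then show "(\<lambda>x. weak_deriv a b v' x * trace_at a b w' a + weak_deriv a b v' x * prim ?M (weak_deriv a b w') x) \<in> borel_measurable ?M"
      using L2_measurable[OF weak_deriv_some(1)[OF v']] by auto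
    show "(\<lambda>x. weak_deriv a b v' x * w' x) \<in> borel_measurable ?M"
      using L2_measurable[OF weak_deriv_some(1)[OF v']] L2_measurable[OF H1_L2[OF w']] by auto
    show "AE x in ?M. weak_deriv a b v' x * w' x = weak_deriv a b v' x * trace_at a b w' a + weak_deriv a b v' x * prim ?M (weak_deriv a b w') x"
      using H1_repr(1)[OF ab w'] AE_space[of ?M]
      by eventually_elim (simp add: prim_L2_eq_inner[OF weak_deriv_some(1)[OF w']] algebra_simps)
  qed
  have "dx a b v \<bullet> em a b w + em a b v \<bullet> dx a b w
      = ?w * (LINT x|?M. ?F x) + ?v * (LINT x|?M. ?G x) + (LINT x|?M. ?F x * prim ?M ?G x + ?G x * prim ?M ?F x)"
    using 1[OF v w] 1[OF w v] F G FG by (simp add: inner_commute)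
  also have "(LINT x|?M. ?F x * prim ?M ?G x + ?G x * prim ?M ?F x) = (LINT x|?M. ?F x) * (LINT x|?M. ?G x)"
    using itv.prim_by_parts[OF F G, of b] by (simp add: prim_itv_end)
  also have "(LINT x|?M. ?F x) = trace_at a b v b - ?v"
    using H1_repr(2)[OF ab v, of b] ab dx_ivl[OF v] by simp
  also have "(LINT x|?M. ?G x) = trace_at a b w b - ?w"
    using H1_repr(2)[OF ab w, of b] ab dx_ivl[OF w] by simp
  finally show ?thesis by (simp add: algebra_simps)
qed

section \<open>Transport along characteristics\<close>

lemma itv_shift_measurable:
  assumes "F \<in> borel_measurable (itv a b)" "h \<in> borel_measurable borel"
  shows "(\<lambda>s. shift (h s) (F s)) \<in> borel_measurable (itv a b)"
  by (intro measurable_shift assms borel_imp_itv)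

lemma integrable_shift:
  assumes "integrable (itv a b) F" "h \<in> borel_measurable borel"
  shows "integrable (itv a b) (\<lambda>s. shift (h s) (F s))"
proof (rule Bochner_Integration.integrable_bound[OF assms(1)])
  show "(\<lambda>s. shift (h s) (F s)) \<in> borel_measurable (itv a b)"
    by (intro itv_shift_measurable borel_measurable_integrable assms)
qed simp

lemma integrable_shift_const: "integrable (itv a b) (\<lambda>s. shift (- s) y)"
  by (intro integrable_itv_continuous continuous_on_shift continuous_intros)

text \<open>Integrating \<open>g(y - r)\<close> over 0 < r < t gives the integral of
  \<open>g\<close> over (y - t, y). By Fubini, the integral of a curve of translates can thus be
  evaluated pointwise in \<open>y\<close>.\<close>

lemma inner_shift_integral:
  assumes "0 \<le> t" "t \<le> T"
  shows "prim (itv 0 T) (\<lambda>r. w \<bullet> shift (- r) g) t = (LINT y|lborel. fn w y * (g \<bullet> ivl (y - t) y))"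
proof -
  define f where "f p = indicat_real {0<..<t} (fst p) * (fn w (snd p) * fn g (snd p - fst p))" for p
  have [measurable]: "f \<in> borel_measurable (lborel \<Otimes>\<^sub>M lborel)"
    unfolding f_def[abs_def] by measurable
  have inner: "w \<bullet> shift (- r) g = (LINT y|lborel. fn w y * fn g (y - r))"
    and bound: "(LINT y|lborel. \<bar>fn w y * fn g (y - r)\<bar>) \<le> (norm w)\<^sup>2 + (norm g)\<^sup>2"
    and int: "integrable lborel (\<lambda>y. fn w y * fn g (y - r))" for r
  proof -
    have s: "(\<lambda>y. fn g (y - r)) \<in> sq_int" using sq_int_shift[OF fn_sq_int, of g "- r"] by simp
    then have "shift (- r) g = cls (\<lambda>y. fn g (y - r))" by (simp add: shift_def)
    then show "w \<bullet> shift (- r) g = (LINT y|lborel. fn w y * fn g (y - r))"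
      using inner_cls[OF fn_sq_int[of w] s] by simp
    show int: "integrable lborel (\<lambda>y. fn w y * fn g (y - r))"
      by (intro sq_int_mult s fn_sq_int)
    have sq: "integrable lborel (\<lambda>y. (fn w y)\<^sup>2)" "integrable lborel (\<lambda>y. (fn g (y - r))\<^sup>2)"
      using s fn_sq_int[of w] by (auto simp: sq_int_def)
    have "(LINT y|lborel. \<bar>fn w y * fn g (y - r)\<bar>) \<le> (LINT y|lborel. (fn w y)\<^sup>2 + (fn g (y - r))\<^sup>2)"
      using int sq by (intro integral_mono abs_mult_le_sum_squares) auto
    also have "\<dots> = (norm w)\<^sup>2 + (norm (shift (- r) g))\<^sup>2"
      using sq s by (simp add: norm_sq_lsq[of w] norm_cls_sq shift_def)
    finally show "(LINT y|lborel. \<bar>fn w y * fn g (y - r)\<bar>) \<le> (norm w)\<^sup>2 + (norm g)\<^sup>2" by simp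
  qed
  have f_int: "integrable lborel (\<lambda>y. f (r, y))" for r
    using int[of r] by (simp add: f_def)
  have fint: "integrable (lborel \<Otimes>\<^sub>M lborel) f"
  proof (rule lborel_pair.Fubini_integrable)
    show "integrable lborel (\<lambda>r. LINT y|lborel. norm (f (r, y)))"
    proof (rule Bochner_Integration.integrable_bound)
      show "integrable lborel (\<lambda>r. indicat_real {0<..<t} r * ((norm w)\<^sup>2 + (norm g)\<^sup>2))"
        using assms by auto
      show "AE r in lborel. norm (LINT y|lborel. norm (f (r, y))) \<le> norm (indicat_real {0<..<t} r * ((norm w)\<^sup>2 + (norm g)\<^sup>2))"
        using bound by (intro AE_I2) (auto simp: f_def indicator_def)
    qed simp
  qed (use f_int in auto)
  have "prim (itv 0 T) (\<lambda>r. w \<bullet> shift (- r) g) t = (LINT r|lborel. indicat_real {0<..<t} r * (w \<bullet> shift (- r) g))"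
    unfolding prim_def
  proof (rule itv_integral(2))
    have m: "(\<lambda>r. w \<bullet> shift (- r) g) \<in> borel_measurable borel"
      by (intro borel_measurable_continuous_onI continuous_intros continuous_on_shift)
    then show "(\<lambda>r. indicat_real {0<..<t} r * (w \<bullet> shift (- r) g)) \<in> borel_measurable borel" by measurable
    show "(\<lambda>r. indicat_real {..<t} r *\<^sub>R (w \<bullet> shift (- r) g)) \<in> borel_measurable (itv 0 T)"
      using m by (intro borel_imp_itv) measurable
    show "AE r in itv 0 T. indicat_real {0<..<t} r * (w \<bullet> shift (- r) g) = indicat_real {..<t} r *\<^sub>R (w \<bullet> shift (- r) g)"
      unfolding AE_itv_iff by (intro AE_I2) (auto simp: indicator_def)
  qed (use assms in auto)
  also have "\<dots> = (LINT r|lborel. LINT y|lborel. f (r, y))"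
    by (simp add: f_def inner)
  also have "\<dots> = (LINT y|lborel. LINT r|lborel. f (r, y))"
    using lborel_pair.Fubini_integral[of "\<lambda>x y. f (x, y)"] fint by (simp add: case_prod_unfold)
  also have "\<dots> = (LINT y|lborel. fn w y * (g \<bullet> ivl (y - t) y))"
  proof (rule Bochner_Integration.integral_cong[OF refl])
    fix y
    have "g \<bullet> ivl (y - t) y = (LINT z|lborel. fn g z * indicat_real {y - t<..<y} z)" by (rule inner_ivl)
    also have "\<dots> = (LINT r|lborel. fn g (y - r) * indicat_real {y - t<..<y} (y - r))"
      using lborel_integral_real_affine[of "-1" "\<lambda>z. fn g z * indicat_real {y - t<..<y} z" y] by simp
    also have "\<dots> = (LINT r|lborel. indicat_real {0<..<t} r * fn g (y - r))"
      by (intro Bochner_Integration.integral_cong) (auto simp: indicator_def)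
    finally have "fn w y * (g \<bullet> ivl (y - t) y) = (LINT r|lborel. fn w y * (indicat_real {0<..<t} r * fn g (y - r)))"
      by simp
    also have "\<dots> = (LINT r|lborel. f (r, y))"
      by (intro Bochner_Integration.integral_cong) (auto simp: f_def)
    finally show "(LINT r|lborel. f (r, y)) = fn w y * (g \<bullet> ivl (y - t) y)" ..
  qed
  finally show ?thesis .
qed

lemma fn_em_H1:
  assumes v: "v \<in> H1 0 1"
  shows "AE x in lborel. fn (em 0 1 v) x = indicat_real {0<..<1} x * (trace_at 0 1 v 0 + dx 0 1 v \<bullet> ivl 0 x)"
proof -
  have "AE x in itv 0 1. fn (em 0 1 v) x = trace_at 0 1 v 0 + dx 0 1 v \<bullet> ivl 0 x"
    using fn_em[OF H1_L2[OF v]] H1_repr(1)[OF _ v] by (auto elim: eventually_elim2)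
  then have "AE x in lborel. x \<in> {0<..<1} \<longrightarrow> fn (em 0 1 v) x = trace_at 0 1 v 0 + dx 0 1 v \<bullet> ivl 0 x"
    by (simp only: AE_itv_iff)
  with fn_res[of 0 1 "em 0 1 v"] show ?thesis
    unfolding res_em[OF H1_L2[OF v]] by eventually_elim (auto simp: indicator_def)
qed

lemma res_dx: "v \<in> H1 a b \<Longrightarrow> res a b (dx a b v) = dx a b v"
  by (intro res_em weak_deriv_some)

text \<open>Translating a function that jumps at 0 and 1 moves the two jumps along with it.\<close>

lemma shift_H1:
  assumes v: "v \<in> H1 0 1" and t: "0 \<le> t" "t \<le> T"
  shows "shift (- t) (em 0 1 v) = em 0 1 v - prim (itv 0 T) (\<lambda>r. shift (- r) (dx 0 1 v)) t
    + (trace_at 0 1 v 1 *\<^sub>R ivl 1 (1 + t) - trace_at 0 1 v 0 *\<^sub>R ivl 0 t)"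
    (is "?l = ?r")
proof -
  let ?ve = "em 0 1 v" and ?g = "dx 0 1 v" and ?va = "trace_at 0 1 v 0" and ?vb = "trace_at 0 1 v 1"
  have tr: "?vb = ?va + ?g \<bullet> ivl 0 1" by (rule H1_repr(2)) (use v in auto)
  \<comment> \<open>The function \<open>v\<close> continued by its end values to a continuous
    function on the line. Its increments are the integrals of the derivative, without jumps.\<close>
  define \<phi> where "\<phi> x = ?va + ?g \<bullet> ivl 0 (max 0 (min 1 x))" for x
  have gdiff: "?g \<bullet> ivl (y - t) y = \<phi> y - \<phi> (y - t)" for y
  proof -
    have "?g \<bullet> ivl (y - t) y = ?g \<bullet> ivl (max 0 (y - t)) (min 1 y)"
      using inner_res[of 0 1 ?g "ivl (y - t) y"] by (simp add: res_dx v res_ivl)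
    also have "ivl (max 0 (y - t)) (min 1 y) = ivl 0 (max 0 (min 1 y)) - ivl 0 (max 0 (min 1 (y - t)))"
    proof (cases "max 0 (y - t) \<le> min 1 y")
      case True
      then have "max 0 (min 1 (y - t)) = max 0 (y - t)" "max 0 (min 1 y) = min 1 y" by auto
      then show ?thesis using ivl_diff[of 0 "max 0 (y - t)" "min 1 y"] True by simp
    next
      case False
      then have "max 0 (min 1 (y - t)) = max 0 (min 1 y)" using t by auto
      then show ?thesis using False by (simp add: ivl_empty)
    qed
    finally show ?thesis by (simp add: \<phi>_def inner_diff_right)
  qed
  have AE_v: "AE x in lborel. fn ?ve x = indicat_real {0<..<1} x * \<phi> x"
    using fn_em_H1[OF v] by eventually_elim (auto simp: \<phi>_def indicator_def)
  have ends: "\<phi> x = ?va" if "x \<le> 0" for x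
    using that by (simp add: \<phi>_def ivl_empty)
  have ends1: "\<phi> x = ?vb" if "1 \<le> x" for x
    using that tr by (simp add: \<phi>_def)
  have "w \<bullet> ?l = w \<bullet> ?r" for w
  proof -
    \<comment> \<open>What is left of the translate after removing \<open>v\<close> and the two
      travelling jumps. Away from four points it is minus the increment of \<open>\<phi>\<close>
      over (y - t, y), which \<open>inner_shift_integral\<close> recognises as the integral over
      translates of the derivative.\<close>
    let ?d = "?l - ?ve - (?vb *\<^sub>R ivl 1 (1 + t) - ?va *\<^sub>R ivl 0 t)"
    have "AE y in lborel. fn ?d y = - (?g \<bullet> ivl (y - t) y)"
      using fn_minus[of "?l - ?ve" "?vb *\<^sub>R ivl 1 (1 + t) - ?va *\<^sub>R ivl 0 t"] fn_minus[of ?l ?ve]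
        fn_minus[of "?vb *\<^sub>R ivl 1 (1 + t)" "?va *\<^sub>R ivl 0 t"] fn_scaleR[of ?vb "ivl 1 (1 + t)"]
        fn_scaleR[of ?va "ivl 0 t"] fn_ivl[of 1 "1 + t"] fn_ivl[of 0 t]
        AE_lborel_singleton[of 0] AE_lborel_singleton[of 1] AE_lborel_singleton[of t] AE_lborel_singleton[of "1 + t"]
        AE_v AE_lborel_shift[OF AE_v, of "- t"] fn_shift[of "- t" ?ve]
    proof eventually_elim
      case (elim y)
      then have *: "fn ?d y = indicat_real {0<..<1} (y - t) * \<phi> (y - t) - indicat_real {0<..<1} y * \<phi> y
          - (?vb * indicat_real {1<..<1 + t} y - ?va * indicat_real {0<..<t} y)" by simp
      consider "y < 0" | "0 < y" "y < 1" | "1 < y" using elim by linarith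
      then show ?case
      proof cases
        case 1
        then show ?thesis unfolding * gdiff using t ends[of y] ends[of "y - t"] by simp
      next
        case 2
        show ?thesis
        proof (cases "y < t")
          case True
          then show ?thesis unfolding * gdiff using t 2 ends[of "y - t"] by simp
        next
          case False
          then show ?thesis unfolding * gdiff using t 2 elim by simp
        qed
      next
        case 3
        consider "y < t" | "t < y" "y < 1 + t" | "1 + t < y" using elim by linarith
        then show ?thesis
          by cases (unfold * gdiff, use t 3 ends[of "y - t"] ends1[of y] ends1[of "y - t"] in simp_all)
      qed
    qed
    then have eq: "AE y in lborel. fn w y * fn ?d y = fn w y * - (?g \<bullet> ivl (y - t) y)"
      by eventually_elim (simp only:)
    have "w \<bullet> ?d = (LINT y|lborel. fn w y * fn ?d y)"
      by (rule inner_lsq_def)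
    also have "\<dots> = (LINT y|lborel. fn w y * - (?g \<bullet> ivl (y - t) y))"
    proof (rule integral_cong_AE[OF _ _ eq])
      have "continuous_on UNIV (\<lambda>y. ?g \<bullet> ivl (y - t) y)"
        unfolding gdiff[abs_def] \<phi>_def
        by (intro continuous_intros continuous_on_compose2[OF continuous_inner_ivl[of 0 1]]) auto
      then have [measurable]: "(\<lambda>y. ?g \<bullet> ivl (y - t) y) \<in> borel_measurable borel"
        by (rule borel_measurable_continuous_onI)
      show "(\<lambda>y. fn w y * - (?g \<bullet> ivl (y - t) y)) \<in> borel_measurable lborel" by measurable
    qed simp
    also have "\<dots> = - prim (itv 0 T) (\<lambda>r. w \<bullet> shift (- r) ?g) t"
      by (simp add: inner_shift_integral[OF t])
    also have "prim (itv 0 T) (\<lambda>r. w \<bullet> shift (- r) ?g) t = w \<bullet> prim (itv 0 T) (\<lambda>r. shift (- r) ?g) t"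
      using itv.prim_inner[OF integrable_shift_const, of 0 T ?g t w] by (simp add: inner_commute)
    finally show ?thesis by (simp add: inner_diff_right inner_add_right)
  qed
  then have "(?l - ?r) \<bullet> (?l - ?r) = 0" by (simp add: inner_diff_right)
  then show ?thesis by simp
qed

text \<open>
  \<open>wave T P F t\<close> is the solution of \<open>p\<^sub>t - p\<^sub>x = F\<close> on the line, moved back to time 0 along the characteristics;
  \<open>profile T P F t\<close> is \<open>p(t)\<close> on \<open>(0, 1)\<close>. If \<open>F\<close> lives on \<open>(0, 1)\<close>, then the values of \<open>P\<close> on \<open>(1, 1 + T)\<close> are the
  trace of \<open>p\<close> at 1, and the values of \<open>wave T P F T\<close> on \<open>(0, T)\<close> are the trace of \<open>p\<close> at 0.
\<close>

definition wave :: "real \<Rightarrow> lsq \<Rightarrow> (real \<Rightarrow> lsq) \<Rightarrow> real \<Rightarrow> lsq" where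
  "wave T P F t = P + prim (itv 0 T) (\<lambda>s. shift (- s) (F s)) t"

definition profile :: "real \<Rightarrow> lsq \<Rightarrow> (real \<Rightarrow> lsq) \<Rightarrow> real \<Rightarrow> lsq" where
  "profile T P F t = res 0 1 (shift t (wave T P F t))"

lemma source_support: "F s = res 0 1 (F s) \<Longrightarrow> shift (- s) (F s) = res s (1 + s) (shift (- s) (F s))"
  using shift_res[of "- s" 0 1 "F s"] by simp

lemma continuous_wave: "integrable (itv 0 T) F \<Longrightarrow> continuous_on S (wave T P F)"
  unfolding wave_def[abs_def] by (intro continuous_intros itv.continuous_prim integrable_shift) auto

lemma continuous_profile: "integrable (itv 0 T) F \<Longrightarrow> continuous_on S (profile T P F)"
  unfolding profile_def[abs_def]
  by (intro bounded_linear.continuous_on[OF bounded_linear_res] continuous_on_shift continuous_intros continuous_wave)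

text \<open>The weak form of \<open>p\<^sub>t - p\<^sub>x = F\<close>, integrated in time. Moving
  the translation onto the test function pairs \<open>wave\<close> with a translate of
  \<open>v\<close>. By \<open>shift_H1\<close> this is \<open>v\<close> minus a time integral plus
  jumps; the product of the two time integrals is integrated by parts, and the jumps produce the
  traces of \<open>p\<close> at both ends.\<close>

lemma transport:
  assumes F: "integrable (itv 0 T) F" and supp: "\<And>s. F s = res 0 1 (F s)"
    and v: "v \<in> H1 0 1" and t: "0 \<le> t" "t \<le> T"
  shows "profile T P F t \<bullet> em 0 1 v = P \<bullet> em 0 1 v
    + prim (itv 0 T) (\<lambda>s. F s \<bullet> em 0 1 v - profile T P F s \<bullet> dx 0 1 v) t
    + trace_at 0 1 v 1 * (P \<bullet> ivl 1 (1 + t)) - trace_at 0 1 v 0 * (wave T P F T \<bullet> ivl 0 t)"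
proof -
  let ?M = "itv 0 T"
  let ?ve = "em 0 1 v" and ?g = "dx 0 1 v" and ?va = "trace_at 0 1 v 0" and ?vb = "trace_at 0 1 v 1"
  define G where "G s = shift (- s) (F s)" for s
  define h where "h s = shift (- s) ?g" for s
  define j where "j s = ?vb *\<^sub>R ivl 1 (1 + s) - ?va *\<^sub>R ivl 0 s" for s
  have G: "integrable ?M G" unfolding G_def by (intro integrable_shift F) simp
  have h: "integrable ?M h" unfolding h_def by (rule integrable_shift_const)
  have Gs: "G s = res s (1 + s) (G s)" for s
    unfolding G_def by (rule source_support[OF supp])
  have G_ivl: "G s \<bullet> ivl c d = G s \<bullet> ivl (max s c) (min (1 + s) d)" for s c d
    by (subst Gs) (simp only: inner_res res_ivl)
  have y: "shift (- s) ?ve = ?ve - prim ?M h s + j s" if "0 \<le> s" "s \<le> T" for s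
    using shift_H1[OF v that] unfolding h_def j_def .
  have Gh: "integrable ?M (\<lambda>s. G s \<bullet> prim ?M h s)" "integrable ?M (\<lambda>s. h s \<bullet> prim ?M G s)"
    by (intro itv.integrable_inner_prim G h)+
  \<comment> \<open>The source emitted at time \<open>s\<close>, moved back to time 0, lives on (s,
    1 + s). It misses the jump on (0, s) and cannot distinguish the ends \<open>1 + s\<close> and
    \<open>1 + t\<close>.\<close>
  have G1: "G s \<bullet> j s = ?vb * (G s \<bullet> ivl 1 (1 + t))" if "s < t" "0 < s" for s
  proof -
    have "G s \<bullet> ivl 0 s = 0" using G_ivl[of s 0 s] that by (simp add: ivl_empty)
    moreover have "G s \<bullet> ivl 1 (1 + s) = G s \<bullet> ivl 1 (1 + t)"
      using G_ivl[of s 1 "1 + s"] G_ivl[of s 1 "1 + t"] that by simp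
    ultimately show ?thesis by (simp add: j_def inner_diff_right)
  qed
  \<comment> \<open>A source emitted after \<open>t\<close> cannot reach the end 0 before
    \<open>t\<close>, so on (0, t) the final wave already agrees with the wave at time
    \<open>t\<close>.\<close>
  have G0: "prim ?M G T \<bullet> ivl 0 t = prim ?M G t \<bullet> ivl 0 t"
  proof -
    have "prim ?M (\<lambda>s. G s \<bullet> ivl 0 t) T = prim ?M (\<lambda>s. G s \<bullet> ivl 0 t) t"
      unfolding prim_def
    proof (rule Bochner_Integration.integral_cong[OF refl])
      fix s
      show "indicat_real {..<T} s *\<^sub>R (G s \<bullet> ivl 0 t) = indicat_real {..<t} s *\<^sub>R (G s \<bullet> ivl 0 t)"
      proof (cases "s < t")
        case False
        then have "G s \<bullet> ivl 0 t = 0" using G_ivl[of s 0 t] by (simp add: ivl_empty)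
        then show ?thesis by simp
      qed (use t in simp)
    qed
    then show ?thesis by (simp add: itv.prim_inner[OF G])
  qed
  have Pi: "wave T P F s = P + prim ?M G s" for s
    unfolding wave_def G_def ..
  have p: "profile T P F s \<bullet> z = wave T P F s \<bullet> shift (- s) z" if "res 0 1 z = z" for s z
    by (simp add: profile_def inner_res that inner_shift_left)
  have "prim ?M (\<lambda>s. F s \<bullet> ?ve - profile T P F s \<bullet> ?g) t
      = prim ?M (\<lambda>s. (G s \<bullet> ?ve + ?vb * (G s \<bullet> ivl 1 (1 + t)) - h s \<bullet> P) - (G s \<bullet> prim ?M h s + h s \<bullet> prim ?M G s)) t"
  proof (rule itv.prim_cong_AE)
    show "integrable ?M (\<lambda>s. F s \<bullet> ?ve - profile T P F s \<bullet> ?g)"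
      by (intro Bochner_Integration.integrable_diff integrable_inner_left F
          integrable_itv_continuous continuous_intros continuous_profile)
    show "integrable ?M (\<lambda>s. (G s \<bullet> ?ve + ?vb * (G s \<bullet> ivl 1 (1 + t)) - h s \<bullet> P) - (G s \<bullet> prim ?M h s + h s \<bullet> prim ?M G s))"
      using G h Gh by (intro Bochner_Integration.integrable_diff Bochner_Integration.integrable_add
          integrable_mult_right integrable_inner_left) auto
    show "AE s in ?M. s < t \<longrightarrow> F s \<bullet> ?ve - profile T P F s \<bullet> ?g
        = (G s \<bullet> ?ve + ?vb * (G s \<bullet> ivl 1 (1 + t)) - h s \<bullet> P) - (G s \<bullet> prim ?M h s + h s \<bullet> prim ?M G s)"
      using AE_space
    proof eventually_elim
      case (elim s)
      show ?case
      proof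
        assume "s < t"
        have s: "0 < s" "s \<le> T" using elim by auto
        have "F s \<bullet> ?ve = G s \<bullet> shift (- s) ?ve" by (simp add: G_def inner_shift)
        also have "\<dots> = G s \<bullet> ?ve - G s \<bullet> prim ?M h s + ?vb * (G s \<bullet> ivl 1 (1 + t))"
          using s G1[OF \<open>s < t\<close> s(1)] by (simp add: y inner_diff_right inner_add_right)
        finally show "F s \<bullet> ?ve - profile T P F s \<bullet> ?g
          = (G s \<bullet> ?ve + ?vb * (G s \<bullet> ivl 1 (1 + t)) - h s \<bullet> P) - (G s \<bullet> prim ?M h s + h s \<bullet> prim ?M G s)"
          by (simp add: p[OF res_dx[OF v]] Pi inner_add_left inner_add_right inner_commute flip: h_def)
      qed
    qed
  qed
  also have "\<dots> = prim ?M G t \<bullet> ?ve + ?vb * (prim ?M G t \<bullet> ivl 1 (1 + t)) - prim ?M h t \<bullet> P - prim ?M G t \<bullet> prim ?M h t"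
    using G h Gh by (simp add: itv.prim_diff itv.prim_add itv.prim_cmult itv.prim_inner itv.prim_by_parts[OF G h, symmetric])
  finally have main: "prim ?M (\<lambda>s. F s \<bullet> ?ve - profile T P F s \<bullet> ?g) t
      = prim ?M G t \<bullet> ?ve + ?vb * (prim ?M G t \<bullet> ivl 1 (1 + t)) - prim ?M h t \<bullet> P - prim ?M G t \<bullet> prim ?M h t" .
  have "profile T P F t \<bullet> ?ve = (P + prim ?M G t) \<bullet> (?ve - prim ?M h t + j t)"
    by (simp add: p[OF res_em[OF H1_L2[OF v]]] Pi y[OF t])
  also have "\<dots> = P \<bullet> ?ve + prim ?M (\<lambda>s. F s \<bullet> ?ve - profile T P F s \<bullet> ?g) t
      + ?vb * (P \<bullet> ivl 1 (1 + t)) - ?va * (wave T P F T \<bullet> ivl 0 t)"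
    unfolding main Pi inner_add_left[of P "prim ?M G T"] G0 j_def
    by (simp add: inner_add_left inner_add_right inner_diff_right inner_commute algebra_simps)
  finally show ?thesis .
qed

section \<open>The fixed point problem on the boundary\<close>

text \<open>
  \<open>Bd m d\<close> says that \<open>d\<close> has weighted norm at most \<open>m\<close>. The map contracts the weighted norm,
  so an iterate of it contracts the given norm.
\<close>

lemma fixpoint_if_weighted_contraction:
  fixes \<Phi> :: "'a::{real_normed_vector, complete_space} \<Rightarrow> 'a" and Bd :: "real \<Rightarrow> 'a \<Rightarrow> bool"
  assumes C: "\<And>m d. Bd m d \<Longrightarrow> norm d \<le> C * m" and norm_Bd: "\<And>d. Bd (norm d) d"
    and contr: "\<And>m x y. Bd m (x - y) \<Longrightarrow> Bd (m / 2) (\<Phi> x - \<Phi> y)"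
  shows "\<exists>x. \<Phi> x = x"
proof -
  have Bd_iter: "Bd (norm (x - y) * (1/2) ^ n) ((\<Phi> ^^ n) x - (\<Phi> ^^ n) y)" for n x y
  proof (induction n)
    case (Suc n)
    from contr[OF this] show ?case by (simp add: field_simps)
  qed (simp add: norm_Bd)
  have "(\<lambda>n. \<bar>C\<bar> * (1/2) ^ n) \<longlonglongrightarrow> \<bar>C\<bar> * 0"
    by (intro tendsto_intros LIMSEQ_realpow_zero) auto
  then have "\<forall>\<^sub>F n in sequentially. \<bar>C\<bar> * (1/2) ^ n < 1"
    by (rule order_tendstoD) simp
  then obtain n where n: "\<bar>C\<bar> * (1/2) ^ n < 1"
    by (auto simp: eventually_sequentially)
  have lip: "dist ((\<Phi> ^^ n) x) ((\<Phi> ^^ n) y) \<le> (\<bar>C\<bar> * (1/2) ^ n) * dist x y" for x y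
  proof -
    have "dist ((\<Phi> ^^ n) x) ((\<Phi> ^^ n) y) \<le> C * (norm (x - y) * (1/2) ^ n)"
      unfolding dist_norm by (rule C[OF Bd_iter])
    also have "\<dots> \<le> \<bar>C\<bar> * (norm (x - y) * (1/2) ^ n)" by (intro mult_right_mono) auto
    finally show ?thesis by (simp add: dist_norm mult_ac)
  qed
  have "\<exists>!x. (\<Phi> ^^ n) x = x"
    by (rule banach_fix_type[where c="\<bar>C\<bar> * (1/2) ^ n"]) (use n lip in auto)
  then obtain x where x: "(\<Phi> ^^ n) x = x" "\<And>y. (\<Phi> ^^ n) y = y \<Longrightarrow> y = x" by auto
  \<comment> \<open>\<open>\<Phi>\<close> commutes with its iterate, so it maps the unique fixed
    point of the iterate to a fixed point of the iterate, that is, to itself.\<close>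
  have "(\<Phi> ^^ n) (\<Phi> x) = \<Phi> x"
    using x(1) by (metis funpow_swap1)
  from x(2)[OF this] show ?thesis ..
qed

text \<open>The gain from the exponential weight: one time integration costs a factor
  \<open>1 / \<gamma>\<close>, so Volterra terms become small for large
  \<open>\<gamma>\<close>.\<close>

lemma prim_exp_le:
  assumes "0 < \<gamma>" "0 \<le> c" "0 \<le> t" "t \<le> T"
  shows "prim (itv 0 T) (\<lambda>s. c * exp (\<gamma> * s)) t \<le> c * exp (\<gamma> * t) / \<gamma>"
proof -
  have "prim (itv 0 T) (\<lambda>s. exp (\<gamma> * s)) t = (LINT s|lborel. indicat_real {0<..<t} s * exp (\<gamma> * s))"
    unfolding prim_def
  proof (rule itv_integral(2))
    show "(\<lambda>s. indicat_real {..<t} s *\<^sub>R exp (\<gamma> * s)) \<in> borel_measurable (itv 0 T)"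
      by (rule borel_imp_itv) measurable
    show "AE s in itv 0 T. indicat_real {0<..<t} s * exp (\<gamma> * s) = indicat_real {..<t} s *\<^sub>R exp (\<gamma> * s)"
      unfolding AE_itv_iff by (intro AE_I2) (auto simp: indicator_def)
  qed (use assms in auto)
  also have "\<dots> = (LINT s|lborel. exp (\<gamma> * s) * indicat_real {0..t} s)"
  proof (rule integral_cong_AE)
    show "AE s in lborel. indicat_real {0<..<t} s * exp (\<gamma> * s) = exp (\<gamma> * s) * indicat_real {0..t} s"
      using AE_lborel_singleton[of 0] AE_lborel_singleton[of t] by eventually_elim (auto simp: indicator_def)
  qed auto
  also have "\<dots> = exp (\<gamma> * t) / \<gamma> - exp (\<gamma> * 0) / \<gamma>"
    by (rule integral_FTC_Icc_real[where F="\<lambda>s. exp (\<gamma> * s) / \<gamma>"])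
      (use assms in \<open>auto intro!: derivative_eq_intros continuous_intros\<close>)
  also have "\<dots> \<le> exp (\<gamma> * t) / \<gamma>" using assms by simp
  finally have "c * prim (itv 0 T) (\<lambda>s. exp (\<gamma> * s)) t \<le> c * (exp (\<gamma> * t) / \<gamma>)"
    using assms by (intro mult_left_mono)
  then show ?thesis by (simp add: itv.prim_cmult)
qed

lemma integrable_exp: "integrable (itv a b) (\<lambda>s. c * exp (\<gamma> * s))"
  by (intro integrable_itv_continuous continuous_intros)

lemma norm_prim_exp_le:
  fixes F :: "real \<Rightarrow> 'a::{banach, second_countable_topology}"
  assumes F: "integrable (itv 0 T) F" and g: "0 < \<gamma>" "0 \<le> c" and t: "0 \<le> t" "t \<le> T"
    and le: "\<And>s. 0 < s \<Longrightarrow> s < t \<Longrightarrow> norm (F s) \<le> c * exp (\<gamma> * s)"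
  shows "norm (prim (itv 0 T) F t) \<le> c * exp (\<gamma> * t) / \<gamma>"
proof -
  have "norm (prim (itv 0 T) F t) \<le> prim (itv 0 T) (\<lambda>s. norm (F s)) t"
    by (rule itv.norm_prim_le[OF F])
  also have "\<dots> \<le> prim (itv 0 T) (\<lambda>s. c * exp (\<gamma> * s)) t"
  proof (rule itv.prim_mono)
    show "AE s in itv 0 T. s < t \<longrightarrow> norm (F s) \<le> c * exp (\<gamma> * s)"
      using le by (intro AE_I2) auto
  qed (use F integrable_exp in auto)
  also have "\<dots> \<le> c * exp (\<gamma> * t) / \<gamma>" by (rule prim_exp_le[OF g t])
  finally show ?thesis .
qed

lemma norm_res_em:
  assumes v: "v \<in> L2 0 T" and t: "t \<le> T"
  shows "(norm (res 0 t (em 0 T v)))\<^sup>2 = prim (itv 0 T) (\<lambda>s. (v s)\<^sup>2) t"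
proof -
  let ?w = "\<lambda>s. indicat_real {..<t} s * v s"
  have m: "?w \<in> borel_measurable (itv 0 T)"
    using borel_imp_itv[of "indicat_real {..<t}"] L2_measurable[OF v] by auto
  have "AE s in itv 0 T. fn (res 0 t (em 0 T v)) s = indicat_real {0<..<t} s * fn (em 0 T v) s"
    unfolding AE_itv_iff using fn_res[of 0 t "em 0 T v"] by eventually_elim simp
  with fn_em[OF v] have "AE s in itv 0 T. ?w s = fn (res 0 t (em 0 T v)) s"
    using AE_space[of "itv 0 T"] by eventually_elim (auto simp: indicator_def)
  note w = em_eqI[OF m this]
  have "(norm (res 0 t (em 0 T v)))\<^sup>2 = L2_inner 0 T ?w ?w"
    using w inner_em[OF w(1) w(1)] t by (simp add: power2_norm_eq_inner res_res)
  also have "\<dots> = prim (itv 0 T) (\<lambda>s. (v s)\<^sup>2) t"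
    unfolding L2_inner_def prim_def by (intro Bochner_Integration.integral_cong) (auto simp: indicator_def power2_eq_square)
  finally show ?thesis .
qed

text \<open>Passing from a pointwise bound to an \<open>L\<^sup>2\<close> bound in time integrates a
  square, so the gain is only the square root of \<open>1 / \<gamma>\<close>.\<close>

lemma norm_res_em_exp_le:
  assumes v: "continuous_on {0..T} v" and g: "0 < \<gamma>" "0 \<le> c" and t: "0 \<le> t" "t \<le> T"
    and le: "\<And>s. 0 < s \<Longrightarrow> s < t \<Longrightarrow> \<bar>v s\<bar> \<le> c * exp (\<gamma> * s)"
  shows "norm (res 0 t (em 0 T v)) \<le> c * exp (\<gamma> * t) / sqrt \<gamma>"
proof (rule power2_le_imp_le)
  have v2: "integrable (itv 0 T) (\<lambda>s. (v s)\<^sup>2)"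
    by (intro integrable_itv_continuous continuous_intros v)
  have "(norm (res 0 t (em 0 T v)))\<^sup>2 = prim (itv 0 T) (\<lambda>s. (v s)\<^sup>2) t"
    by (rule norm_res_em[OF L2_continuous[OF v] t(2)])
  also have "\<dots> \<le> prim (itv 0 T) (\<lambda>s. c\<^sup>2 * exp ((2 * \<gamma>) * s)) t"
  proof (rule itv.prim_mono[OF v2 integrable_exp])
    have "(v s)\<^sup>2 \<le> c\<^sup>2 * exp ((2 * \<gamma>) * s)" if "0 < s" "s < t" for s
    proof -
      have "(v s)\<^sup>2 \<le> (c * exp (\<gamma> * s))\<^sup>2"
        using power_mono[OF le[OF that], of 2] by simp
      then show ?thesis by (simp add: power_mult_distrib exp_double[symmetric] mult.assoc)
    qed
    then show "AE s in itv 0 T. s < t \<longrightarrow> (v s)\<^sup>2 \<le> c\<^sup>2 * exp ((2 * \<gamma>) * s)"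
      by (intro AE_I2) auto
  qed
  also have "\<dots> \<le> c\<^sup>2 * exp ((2 * \<gamma>) * t) / (2 * \<gamma>)"
    using g by (intro prim_exp_le t) auto
  also have "\<dots> \<le> c\<^sup>2 * exp ((2 * \<gamma>) * t) / \<gamma>"
    using g by (intro divide_left_mono) auto
  also have "\<dots> = (c * exp (\<gamma> * t) / sqrt \<gamma>)\<^sup>2"
    using g by (simp add: power_mult_distrib power_divide exp_double[symmetric] mult.assoc)
  finally show "(norm (res 0 t (em 0 T v)))\<^sup>2 \<le> (c * exp (\<gamma> * t) / sqrt \<gamma>)\<^sup>2" .
qed (use g in auto)

lemma wave_diff:
  assumes "integrable (itv 0 T) F" "integrable (itv 0 T) F'"
  shows "wave T P F t - wave T P' F' t = wave T (P - P') (\<lambda>s. F s - F' s) t"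
  unfolding wave_def shift_diff
  by (subst itv.prim_diff) (auto intro!: integrable_shift assms)

lemma profile_diff:
  assumes "integrable (itv 0 T) F" "integrable (itv 0 T) F'"
  shows "profile T P F t - profile T P' F' t = profile T (P - P') (\<lambda>s. F s - F' s) t"
  unfolding profile_def by (simp add: wave_diff[OF assms, symmetric] shift_diff res_diff)

text \<open>Two different gains. At the far end only boundary input older than one time unit has
  arrived, which gives \<open>exp (- \<gamma>)\<close>; the source is integrated in time, which
  gives \<open>1 / \<gamma>\<close>. The profile inside (0, 1) sees the boundary input without
  delay, so there \<open>m1\<close> stays as it is.\<close>

lemma wave_bound:
  assumes F: "integrable (itv 0 T) F" and supp: "\<And>s. F s = res 0 1 (F s)"
    and P: "P = shift (- 1) (res 0 T \<beta>)"
    and g: "0 < \<gamma>" "0 \<le> m1" "0 \<le> m2" and t: "0 \<le> t" "t \<le> T"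
    and \<beta>: "\<And>s. 0 \<le> s \<Longrightarrow> s \<le> T \<Longrightarrow> norm (res 0 s \<beta>) \<le> m1 * exp (\<gamma> * s)"
    and F_le: "\<And>s. 0 \<le> s \<Longrightarrow> s \<le> T \<Longrightarrow> norm (F s) \<le> m2 * exp (\<gamma> * s)"
  shows "norm (res 0 t (wave T P F T)) \<le> (m1 * exp (- \<gamma>) + m2 / \<gamma>) * exp (\<gamma> * t)"
    and "norm (profile T P F t) \<le> (m1 + m2 / \<gamma>) * exp (\<gamma> * t)"
proof -
  let ?G = "\<lambda>s. shift (- s) (F s)"
  have G: "integrable (itv 0 T) ?G" by (intro integrable_shift F) simp
  have G_le: "norm (prim (itv 0 T) ?G t) \<le> m2 * exp (\<gamma> * t) / \<gamma>"
    using F_le t by (intro norm_prim_exp_le G g t) auto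
  \<comment> \<open>The back-translated source of time \<open>s\<close> starts at \<open>s\<close>,
    so only times before \<open>t\<close> act on (0, t).\<close>
  have late: "res 0 t (prim (itv 0 T) ?G T) = res 0 t (prim (itv 0 T) ?G t)"
  proof -
    have "prim (itv 0 T) (\<lambda>s. res 0 t (?G s)) T = prim (itv 0 T) (\<lambda>s. res 0 t (?G s)) t"
      unfolding prim_def
    proof (rule Bochner_Integration.integral_cong[OF refl])
      fix s
      show "indicat_real {..<T} s *\<^sub>R res 0 t (?G s) = indicat_real {..<t} s *\<^sub>R res 0 t (?G s)"
      proof (cases "s < t")
        case False
        have "res 0 t (?G s) = res 0 t (res s (1 + s) (?G s))"
          using source_support[of F s, OF supp] by simp
        also have "\<dots> = 0" using False by (simp add: res_res res_empty)
        finally show ?thesis by simp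
      qed (use t in simp)
    qed
    then show ?thesis by (simp add: itv.prim_linear[OF bounded_linear_res G])
  qed
  have "norm (res 0 t P) \<le> m1 * exp (- \<gamma>) * exp (\<gamma> * t)"
  proof (cases "1 \<le> t")
    case True
    have "res 0 t P = shift (- 1) (res (- 1) (t - 1) (res 0 T \<beta>))"
      unfolding P by (simp add: shift_res)
    also have "norm \<dots> = norm (res 0 (t - 1) \<beta>)"
      using t by (simp add: res_res)
    also have "\<dots> \<le> m1 * exp (\<gamma> * (t - 1))" using True t by (intro \<beta>) auto
    also have "\<dots> = m1 * exp (- \<gamma>) * exp (\<gamma> * t)" by (simp add: right_diff_distrib exp_diff exp_minus field_simps)
    finally show ?thesis .
  next
    case False
    then have "res 0 t P = 0"
      unfolding P using t by (simp add: shift_res res_res res_empty)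
    then show ?thesis using g by simp
  qed
  moreover have "norm (res 0 t (prim (itv 0 T) ?G T)) \<le> m2 / \<gamma> * exp (\<gamma> * t)"
    unfolding late using order_trans[OF norm_res_le G_le] by simp
  ultimately show "norm (res 0 t (wave T P F T)) \<le> (m1 * exp (- \<gamma>) + m2 / \<gamma>) * exp (\<gamma> * t)"
    unfolding wave_def res_add using norm_triangle_ineq[of "res 0 t P"] by (smt (verit) distrib_right)
  have "norm (res 0 1 (shift t P)) \<le> m1 * exp (\<gamma> * t)"
  proof -
    have "res 0 1 (shift t P) = shift (t - 1) (res (t - 1) t (res 0 T \<beta>))"
      unfolding P by (simp add: shift_shift shift_res) (simp add: algebra_simps)
    also have "norm \<dots> = norm (res (max (t - 1) 0) t \<beta>)"
      using t by (simp add: res_res)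
    also have "\<dots> \<le> norm (res 0 t \<beta>)" by (rule norm_res_mono) auto
    also have "\<dots> \<le> m1 * exp (\<gamma> * t)" by (rule \<beta>[OF t])
    finally show ?thesis .
  qed
  moreover have "norm (res 0 1 (shift t (prim (itv 0 T) ?G t))) \<le> m2 / \<gamma> * exp (\<gamma> * t)"
    using order_trans[OF norm_res_le[of 0 1 "shift t (prim (itv 0 T) ?G t)"]] G_le by simp
  ultimately show "norm (profile T P F t) \<le> (m1 + m2 / \<gamma>) * exp (\<gamma> * t)"
    unfolding profile_def wave_def shift_add res_add
    using norm_triangle_ineq[of "res 0 1 (shift t P)"] by (smt (verit) distrib_right)
qed

text \<open>
  The unknowns are \<open>\<rho> = p(0)\<close>, \<open>\<sigma> = q(1)\<close> on \<open>(0, T)\<close>, the traces \<open>c0 = u(0)\<close>, \<open>c1 = u(1)\<close>, and \<open>V = u\<^sub>t\<close>;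
  \<open>mij\<close> is the inverse of the matrix of the boundary system, and \<open>p0\<close>, \<open>q0\<close>, \<open>U0\<close>, \<open>c00\<close>, \<open>c10\<close> are the initial
  values of \<open>p\<close>, \<open>q\<close>, \<open>u\<close>, \<open>u(0)\<close>, \<open>u(1)\<close>. Then \<open>vel m11 m12\<close> is \<open>u\<^sub>t(0)\<close>, \<open>vel m21 m22\<close> is \<open>u\<^sub>t(1)\<close>, and \<open>src V\<close> is \<open>F\<close>.
  The right-moving \<open>q\<close> is reflected at 1/2 by \<open>rfl\<close>, so that both invariants move to the left.
\<close>

locale wave_data =
  fixes h0 h1 K lam ht0 ht1 T m11 m12 m21 m22 c00 c10 :: real
    and g0 g1 p0 q0 U0 :: lsq and f :: "real \<Rightarrow> lsq"
  assumes T: "0 < T" and f: "integrable (itv 0 T) f" and f_supp: "\<And>s. f s = res 0 1 (f s)"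
begin

definition vel :: "real \<Rightarrow> real \<Rightarrow> lsq \<Rightarrow> lsq \<Rightarrow> (real \<Rightarrow> real) \<Rightarrow> (real \<Rightarrow> real) \<Rightarrow> lsq" where
  "vel a b \<rho> \<sigma> c0 c1 = res 0 T
     (a *\<^sub>R (\<rho> - (h0 *\<^sub>R em 0 T c0 + ht1 *\<^sub>R em 0 T c1 + g0))
      + b *\<^sub>R (\<sigma> - (h1 *\<^sub>R em 0 T c1 + ht0 *\<^sub>R em 0 T c0 + g1)))"

definition src :: "(real \<Rightarrow> lsq) \<Rightarrow> real \<Rightarrow> lsq" where
  "src V s = f s - res 0 1 (K *\<^sub>R (U0 + prim (itv 0 T) V s) + lam *\<^sub>R V s)"

text \<open>The initial invariant occupies (0, 1). The incoming one,
  \<open>2 u\<^sub>t(1) - q(1)\<close>, is put on (1, 1 + T), so that transport to the left delivers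
  its value for time \<open>s\<close> to the end 1 exactly at time \<open>s\<close>. After
  reflection, \<open>right_in\<close> does the same at the end 0.\<close>

definition left_in :: "lsq \<Rightarrow> lsq \<Rightarrow> (real \<Rightarrow> real) \<Rightarrow> (real \<Rightarrow> real) \<Rightarrow> lsq" where
  "left_in \<rho> \<sigma> c0 c1 = p0 + shift (- 1) (res 0 T (2 *\<^sub>R vel m21 m22 \<rho> \<sigma> c0 c1 - \<sigma>))"

definition right_in :: "lsq \<Rightarrow> lsq \<Rightarrow> (real \<Rightarrow> real) \<Rightarrow> (real \<Rightarrow> real) \<Rightarrow> lsq" where
  "right_in \<rho> \<sigma> c0 c1 = rfl q0 + shift (- 1) (res 0 T (2 *\<^sub>R vel m11 m12 \<rho> \<sigma> c0 c1 - \<rho>))"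

lemma src_supp: "src V s = res 0 1 (src V s)"
  unfolding src_def res_diff using f_supp[of s] by (simp add: res_res)

lemma rfl_supp: "y = res 0 1 y \<Longrightarrow> rfl y = res 0 1 (rfl y)"
  using rfl_res[of 0 1 y] by simp

lemma integrable_src:
  assumes "continuous_on {0..T} V"
  shows "integrable (itv 0 T) (src V)"
proof -
  note V = integrable_itv_continuous[OF assms]
  have "integrable (itv 0 T) (\<lambda>s. U0 + prim (itv 0 T) V s)"
    by (intro integrable_itv_continuous continuous_intros itv.continuous_prim V)
  then have "integrable (itv 0 T) (\<lambda>s. res 0 1 (K *\<^sub>R (U0 + prim (itv 0 T) V s) + lam *\<^sub>R V s))"
    using V by (intro integrable_bounded_linear[OF bounded_linear_res]) auto
  with f show ?thesis unfolding src_def[abs_def] by simp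
qed

lemma integrable_rfl: "integrable M F \<Longrightarrow> integrable M (\<lambda>s. rfl (F s))"
  by (rule integrable_bounded_linear[OF bounded_linear_rfl])

section \<open>Lipschitz bounds in the weighted norm\<close>

context
  fixes \<rho> \<sigma> \<rho>' \<sigma>' :: lsq and ca cb ca' cb' :: "real \<Rightarrow> real" and V V' :: "real \<Rightarrow> lsq" and \<gamma> \<kappa> m :: real
  assumes cont: "continuous_on {0..T} ca" "continuous_on {0..T} cb" "continuous_on {0..T} ca'" "continuous_on {0..T} cb'"
      "continuous_on {0..T} V" "continuous_on {0..T} V'"
    and pos: "1 \<le> \<gamma>" "0 \<le> \<kappa>" "\<kappa>\<^sup>2 \<le> \<gamma>" "0 \<le> m"
    and \<rho>: "\<And>t. 0 \<le> t \<Longrightarrow> t \<le> T \<Longrightarrow> norm (res 0 t (\<rho> - \<rho>')) \<le> m * exp (\<gamma> * t)"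
    and \<sigma>: "\<And>t. 0 \<le> t \<Longrightarrow> t \<le> T \<Longrightarrow> norm (res 0 t (\<sigma> - \<sigma>')) \<le> m * exp (\<gamma> * t)"
    and ca: "\<And>t. 0 \<le> t \<Longrightarrow> t \<le> T \<Longrightarrow> \<bar>ca t - ca' t\<bar> \<le> (\<kappa> * m) * exp (\<gamma> * t)"
    and cb: "\<And>t. 0 \<le> t \<Longrightarrow> t \<le> T \<Longrightarrow> \<bar>cb t - cb' t\<bar> \<le> (\<kappa> * m) * exp (\<gamma> * t)"
    and V: "\<And>t. 0 \<le> t \<Longrightarrow> t \<le> T \<Longrightarrow> norm (V t - V' t) \<le> (\<kappa> * m) * exp (\<gamma> * t)"
begin

text \<open>The traces are only known up to the larger bound \<open>\<kappa> * m\<close>. As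
  \<open>\<kappa>\<^sup>2 \<le> \<gamma>\<close>, the gain from integrating a square in time absorbs
  the factor \<open>\<kappa>\<close>, and the traces count no more than \<open>\<rho>\<close> and
  \<open>\<sigma>\<close>.\<close>

lemma trace_diff_le:
  assumes "continuous_on {0..T} c" "continuous_on {0..T} c'" "0 \<le> t" "t \<le> T"
    "\<And>t. 0 \<le> t \<Longrightarrow> t \<le> T \<Longrightarrow> \<bar>c t - c' t\<bar> \<le> (\<kappa> * m) * exp (\<gamma> * t)"
  shows "norm (res 0 t (em 0 T c - em 0 T c')) \<le> m * exp (\<gamma> * t)"
proof -
  have "em 0 T c - em 0 T c' = em 0 T (\<lambda>s. c s - c' s)"
    using L2_diff(2)[OF L2_continuous[OF assms(1)] L2_continuous[OF assms(2)]] by simp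
  moreover have "norm (res 0 t (em 0 T (\<lambda>s. c s - c' s))) \<le> (\<kappa> * m) * exp (\<gamma> * t) / sqrt \<gamma>"
    using pos assms by (intro norm_res_em_exp_le continuous_intros) auto
  moreover have "(\<kappa> * m) * exp (\<gamma> * t) / sqrt \<gamma> \<le> m * exp (\<gamma> * t)"
  proof -
    have "\<kappa> \<le> sqrt \<gamma>" using pos(3) by (rule real_le_rsqrt)
    then have "\<kappa> / sqrt \<gamma> \<le> 1" using pos(1) by simp
    then have "\<kappa> / sqrt \<gamma> * (m * exp (\<gamma> * t)) \<le> 1 * (m * exp (\<gamma> * t))"
      using pos(4) by (intro mult_right_mono) auto
    then show ?thesis by simp
  qed
  ultimately show ?thesis by simp
qed

lemma vel_diff_le:
  assumes t: "0 \<le> t" "t \<le> T"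
  shows "norm (res 0 t (vel a b \<rho> \<sigma> ca cb - vel a b \<rho>' \<sigma>' ca' cb'))
    \<le> ((\<bar>a\<bar> + \<bar>b\<bar>) * (1 + \<bar>h0\<bar> + \<bar>h1\<bar> + \<bar>ht0\<bar> + \<bar>ht1\<bar>) * m) * exp (\<gamma> * t)"
proof -
  let ?E = "m * exp (\<gamma> * t)"
  let ?d0 = "res 0 t (em 0 T ca - em 0 T ca')" and ?d1 = "res 0 t (em 0 T cb - em 0 T cb')"
  have d0: "norm ?d0 \<le> ?E" and d1: "norm ?d1 \<le> ?E"
    using trace_diff_le[OF cont(1,3) t ca] trace_diff_le[OF cont(2,4) t cb] by auto
  have comb: "norm (y - (k *\<^sub>R y0 + l *\<^sub>R y1)) \<le> (1 + \<bar>h0\<bar> + \<bar>h1\<bar> + \<bar>ht0\<bar> + \<bar>ht1\<bar>) * ?E"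
    if "norm y \<le> ?E" "norm y0 \<le> ?E" "norm y1 \<le> ?E" "\<bar>k\<bar> + \<bar>l\<bar> \<le> \<bar>h0\<bar> + \<bar>h1\<bar> + \<bar>ht0\<bar> + \<bar>ht1\<bar>"
    for y y0 y1 :: lsq and k l
  proof -
    have "norm (y - (k *\<^sub>R y0 + l *\<^sub>R y1)) \<le> norm y + (norm (k *\<^sub>R y0) + norm (l *\<^sub>R y1))"
      by (rule order_trans[OF norm_triangle_ineq4 add_left_mono[OF norm_triangle_ineq]])
    also have "\<dots> \<le> ?E + (\<bar>k\<bar> * ?E + \<bar>l\<bar> * ?E)"
      using that by (intro add_mono) (auto intro: mult_left_mono)
    also have "\<dots> = (1 + (\<bar>k\<bar> + \<bar>l\<bar>)) * ?E" by (simp add: algebra_simps)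
    also have "\<dots> \<le> (1 + \<bar>h0\<bar> + \<bar>h1\<bar> + \<bar>ht0\<bar> + \<bar>ht1\<bar>) * ?E"
      using that pos by (intro mult_right_mono) auto
    finally show ?thesis .
  qed
  define H where "H = 1 + \<bar>h0\<bar> + \<bar>h1\<bar> + \<bar>ht0\<bar> + \<bar>ht1\<bar>"
  define y where "y = res 0 t (\<rho> - \<rho>') - (h0 *\<^sub>R ?d0 + ht1 *\<^sub>R ?d1)"
  define z where "z = res 0 t (\<sigma> - \<sigma>') - (h1 *\<^sub>R ?d1 + ht0 *\<^sub>R ?d0)"
  have y: "norm y \<le> H * ?E" unfolding y_def H_def by (rule comb[OF \<rho>[OF t] d0 d1]) simp
  have z: "norm z \<le> H * ?E" unfolding z_def H_def by (rule comb[OF \<sigma>[OF t] d1 d0]) simp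
  have cut: "res 0 t (res 0 T w) = res 0 t w" for w using t by (simp add: res_res)
  have "res 0 t (vel a b \<rho> \<sigma> ca cb - vel a b \<rho>' \<sigma>' ca' cb') = a *\<^sub>R y + b *\<^sub>R z"
    unfolding vel_def y_def z_def res_diff cut
    by (simp add: res_add res_scale res_diff scaleR_add_right scaleR_diff_right)
  then have "norm (res 0 t (vel a b \<rho> \<sigma> ca cb - vel a b \<rho>' \<sigma>' ca' cb')) \<le> \<bar>a\<bar> * norm y + \<bar>b\<bar> * norm z"
    using norm_triangle_ineq[of "a *\<^sub>R y" "b *\<^sub>R z"] by simp
  also have "\<dots> \<le> \<bar>a\<bar> * (H * ?E) + \<bar>b\<bar> * (H * ?E)"
    by (rule add_mono[OF mult_left_mono[OF y abs_ge_zero] mult_left_mono[OF z abs_ge_zero]])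
  also have "\<dots> = ((\<bar>a\<bar> + \<bar>b\<bar>) * H * m) * exp (\<gamma> * t)"
    by (simp add: algebra_simps)
  finally show ?thesis unfolding H_def .
qed

lemma src_diff_le:
  assumes t: "0 \<le> t" "t \<le> T"
  shows "norm (src V t - src V' t) \<le> ((\<bar>K\<bar> + \<bar>lam\<bar>) * \<kappa> * m) * exp (\<gamma> * t)"
proof -
  let ?E = "\<kappa> * m * exp (\<gamma> * t)"
  have ints: "integrable (itv 0 T) V" "integrable (itv 0 T) V'"
    using cont by (auto intro: integrable_itv_continuous)
  have "norm (prim (itv 0 T) (\<lambda>s. V s - V' s) t) \<le> ?E / \<gamma>"
    using V t pos by (intro norm_prim_exp_le ints Bochner_Integration.integrable_diff) auto
  also have "\<dots> \<le> ?E / 1" using pos by (intro divide_left_mono) auto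
  finally have 1: "norm (prim (itv 0 T) (\<lambda>s. V s - V' s) t) \<le> ?E" by simp
  have "src V t - src V' t = - res 0 1 (K *\<^sub>R prim (itv 0 T) (\<lambda>s. V s - V' s) t + lam *\<^sub>R (V t - V' t))"
    by (simp add: src_def itv.prim_diff[OF ints] res_add res_diff res_scale algebra_simps)
  also have "norm \<dots> \<le> norm (K *\<^sub>R prim (itv 0 T) (\<lambda>s. V s - V' s) t + lam *\<^sub>R (V t - V' t))"
    using norm_res_le by simp
  also have "\<dots> \<le> \<bar>K\<bar> * norm (prim (itv 0 T) (\<lambda>s. V s - V' s) t) + \<bar>lam\<bar> * norm (V t - V' t)"
    by (rule order_trans[OF norm_triangle_ineq]) simp
  also have "\<dots> \<le> \<bar>K\<bar> * ?E + \<bar>lam\<bar> * ?E"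
    using 1 V[OF t] by (intro add_mono mult_left_mono) auto
  finally show ?thesis by (simp add: algebra_simps)
qed

lemma incoming_diff_le:
  assumes t: "0 \<le> t" "t \<le> T"
    and \<tau>: "\<And>t. 0 \<le> t \<Longrightarrow> t \<le> T \<Longrightarrow> norm (res 0 t (\<tau> - \<tau>')) \<le> m * exp (\<gamma> * t)"
  shows "norm (res 0 t ((2 *\<^sub>R vel a b \<rho> \<sigma> ca cb - \<tau>) - (2 *\<^sub>R vel a b \<rho>' \<sigma>' ca' cb' - \<tau>')))
    \<le> ((2 * ((\<bar>a\<bar> + \<bar>b\<bar>) * (1 + \<bar>h0\<bar> + \<bar>h1\<bar> + \<bar>ht0\<bar> + \<bar>ht1\<bar>)) + 1) * m) * exp (\<gamma> * t)"
proof -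
  let ?d = "res 0 t (vel a b \<rho> \<sigma> ca cb - vel a b \<rho>' \<sigma>' ca' cb')"
  have "res 0 t ((2 *\<^sub>R vel a b \<rho> \<sigma> ca cb - \<tau>) - (2 *\<^sub>R vel a b \<rho>' \<sigma>' ca' cb' - \<tau>')) = 2 *\<^sub>R ?d - res 0 t (\<tau> - \<tau>')"
    by (simp add: res_diff res_add res_scale scaleR_diff_right)
  also have "norm \<dots> \<le> 2 * norm ?d + norm (res 0 t (\<tau> - \<tau>'))"
    by (rule order_trans[OF norm_triangle_ineq4]) simp
  finally have *: "norm (res 0 t ((2 *\<^sub>R vel a b \<rho> \<sigma> ca cb - \<tau>) - (2 *\<^sub>R vel a b \<rho>' \<sigma>' ca' cb' - \<tau>')))
      \<le> 2 * norm ?d + norm (res 0 t (\<tau> - \<tau>'))" .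
  have "2 * (X * m * e) + m * e = ((2 * X + 1) * m) * e" for X e :: real
    by (simp add: algebra_simps)
  with * vel_diff_le[OF t, of a b] \<tau>[OF t] show ?thesis by (smt (verit))
qed

end

end

text \<open>Bounded continuous functions on the whole line form a Banach space type. Curves on
  [0, T] enter it by being frozen outside the interval.\<close>

lemma clamped_bcontfun:
  fixes F :: "real \<Rightarrow> 'a::real_normed_vector"
  assumes "0 \<le> T" "continuous_on {0..T} F"
  shows "(\<lambda>t. F (max 0 (min T t))) \<in> bcontfun"
proof -
  have "continuous_on UNIV (\<lambda>t. F (max 0 (min T t)))"
    by (rule continuous_on_compose2[OF assms(2)]) (use assms(1) in \<open>auto intro!: continuous_intros\<close>)
  moreover have "bounded (F ` {0..T})"
    by (intro compact_imp_bounded compact_continuous_image assms) auto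
  then have "bounded (range (\<lambda>t. F (max 0 (min T t))))"
    by (rule bounded_subset) (use assms(1) in auto)
  ultimately show ?thesis by (simp add: bcontfun_def)
qed

context wave_data
begin

lemma continuous_left_right:
  assumes "continuous_on {0..T} V"
  shows "continuous_on {0..T} (\<lambda>t. (1/2) *\<^sub>R (profile T P (src V) t + rfl (profile T Q (\<lambda>s. rfl (src V s)) t)))"
  by (intro continuous_intros continuous_profile bounded_linear.continuous_on[OF bounded_linear_rfl]
      integrable_src integrable_rfl assms)

text \<open>The outgoing invariants are merely square integrable in time, while traces and velocity
  are continuous curves, hence the mixed space. The weights are unequal too: the updated curves
  depend on \<open>\<rho>\<close> and \<open>\<sigma>\<close> without any small factor and are
  measured against \<open>\<kappa> * m\<close>, whereas the updated \<open>\<rho>\<close> and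
  \<open>\<sigma>\<close> profit from the delay and from time integration.\<close>

theorem fixed_point:
  obtains \<rho> \<sigma> :: lsq and c0 c1 :: "real \<Rightarrow> real" and V :: "real \<Rightarrow> lsq"
  where "continuous_on {0..T} c0" "continuous_on {0..T} c1" "continuous_on {0..T} V"
    and "\<rho> = res 0 T (wave T (left_in \<rho> \<sigma> c0 c1) (src V) T)"
    and "\<sigma> = res 0 T (wave T (right_in \<rho> \<sigma> c0 c1) (\<lambda>s. rfl (src V s)) T)"
    and "\<And>t. t \<in> {0..T} \<Longrightarrow> c0 t = c00 + vel m11 m12 \<rho> \<sigma> c0 c1 \<bullet> ivl 0 t"
    and "\<And>t. t \<in> {0..T} \<Longrightarrow> c1 t = c10 + vel m21 m22 \<rho> \<sigma> c0 c1 \<bullet> ivl 0 t"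
    and "\<And>t. t \<in> {0..T} \<Longrightarrow> V t = (1/2) *\<^sub>R (profile T (left_in \<rho> \<sigma> c0 c1) (src V) t
           + rfl (profile T (right_in \<rho> \<sigma> c0 c1) (\<lambda>s. rfl (src V s)) t))"
proof -
  define H where "H = 1 + \<bar>h0\<bar> + \<bar>h1\<bar> + \<bar>ht0\<bar> + \<bar>ht1\<bar>"
  define C where "C = (\<bar>m11\<bar> + \<bar>m12\<bar> + \<bar>m21\<bar> + \<bar>m22\<bar>) * H"
  define C1 where "C1 = 2 * C + 1"
  define C2 where "C2 = \<bar>K\<bar> + \<bar>lam\<bar>"
  \<comment> \<open>Half of \<open>\<kappa>\<close> is the total constant of the updated curves:
    \<open>sqrt T * C\<close> for each of the two traces and \<open>C1 + 1\<close> for the velocity.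
    So the curve part of the image is bounded by \<open>\<kappa> * (m / 2)\<close>.\<close>
  define \<kappa> where "\<kappa> = 2 * (2 * sqrt T * C + C1 + 1)"
  \<comment> \<open>The summands serve in turn \<open>\<gamma> \<ge> 1\<close>, the absorption of
    \<open>\<kappa>\<close> in \<open>trace_diff_le\<close>, and the factor 1/2 for
    \<open>\<rho>\<close> and \<open>\<sigma>\<close>, where
    \<open>exp (- \<gamma>) \<le> 1 / \<gamma>\<close> puts delay and time integration on the same
    footing.\<close>
  define \<gamma> where "\<gamma> = 1 + \<kappa>\<^sup>2 + 2 * (C1 + C2 * \<kappa>)"
  have H: "1 \<le> H" by (simp add: H_def)
  then have C: "0 \<le> C" by (simp add: C_def)
  then have C1: "1 \<le> C1" by (simp add: C1_def)
  have C2: "0 \<le> C2" by (simp add: C2_def)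
  have \<kappa>: "2 \<le> \<kappa>" using C C1 T by (simp add: \<kappa>_def)
  have \<gamma>: "1 \<le> \<gamma>" "\<kappa>\<^sup>2 \<le> \<gamma>" "2 * (C1 + C2 * \<kappa>) \<le> \<gamma>"
    using C1 C2 \<kappa> by (auto simp: \<gamma>_def)
  have small: "C1 * exp (- \<gamma>) + C2 * \<kappa> / \<gamma> \<le> 1/2" "C2 * \<kappa> / \<gamma> \<le> 1"
  proof -
    have "\<gamma> \<le> exp \<gamma>" using exp_ge_add_one_self[of \<gamma>] by linarith
    then have "exp (- \<gamma>) \<le> 1 / \<gamma>" using \<gamma>(1) by (simp add: exp_minus field_simps)
    then have "C1 * exp (- \<gamma>) \<le> C1 * (1 / \<gamma>)" using C1 by (intro mult_left_mono) auto
    then have "C1 * exp (- \<gamma>) + C2 * \<kappa> / \<gamma> \<le> (C1 + C2 * \<kappa>) / \<gamma>" by (simp add: add_divide_distrib)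
    also have "\<dots> \<le> 1/2" using \<gamma> by (simp add: divide_le_eq)
    finally show "C1 * exp (- \<gamma>) + C2 * \<kappa> / \<gamma> \<le> 1/2" .
    moreover have "0 \<le> C1 * exp (- \<gamma>)" using C1 by simp
    ultimately show "C2 * \<kappa> / \<gamma> \<le> 1" by linarith
  qed
  define cl where "cl t = max 0 (min T t)" for t
  have cl: "0 \<le> cl t" "cl t \<le> T" "0 \<le> t \<Longrightarrow> t \<le> T \<Longrightarrow> cl t = t" for t
    using T by (auto simp: cl_def)
  define newW where "newW \<rho> \<sigma> W t = (let c0 = (\<lambda>t. fst (W t)); c1 = (\<lambda>t. fst (snd (W t))); V = (\<lambda>t. snd (snd (W t))) in
      (c00 + vel m11 m12 \<rho> \<sigma> c0 c1 \<bullet> ivl 0 t, c10 + vel m21 m22 \<rho> \<sigma> c0 c1 \<bullet> ivl 0 t,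
       (1/2) *\<^sub>R (profile T (left_in \<rho> \<sigma> c0 c1) (src V) t + rfl (profile T (right_in \<rho> \<sigma> c0 c1) (\<lambda>s. rfl (src V s)) t))))"
    for \<rho> \<sigma> and W :: "real \<Rightarrow> real \<times> real \<times> lsq" and t
  define new\<rho> where "new\<rho> \<rho> \<sigma> W = res 0 T (wave T (left_in \<rho> \<sigma> (\<lambda>t. fst (W t)) (\<lambda>t. fst (snd (W t)))) (src (\<lambda>t. snd (snd (W t)))) T)"
    for \<rho> \<sigma> and W :: "real \<Rightarrow> real \<times> real \<times> lsq"
  define new\<sigma> where "new\<sigma> \<rho> \<sigma> W = res 0 T (wave T (right_in \<rho> \<sigma> (\<lambda>t. fst (W t)) (\<lambda>t. fst (snd (W t)))) (\<lambda>s. rfl (src (\<lambda>t. snd (snd (W t))) s)) T)"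
    for \<rho> \<sigma> and W :: "real \<Rightarrow> real \<times> real \<times> lsq"
  have cont_newW: "continuous_on {0..T} (newW \<rho> \<sigma> W)" if "continuous_on {0..T} W" for \<rho> \<sigma> W
    unfolding newW_def Let_def
    by (intro continuous_on_Pair continuous_on_add continuous_on_const continuous_inner_ivl continuous_left_right
        continuous_on_snd that)
  define \<Phi> where "\<Phi> x = (case x of ((\<rho>, \<sigma>), W) \<Rightarrow>
      ((new\<rho> \<rho> \<sigma> (apply_bcontfun W), new\<sigma> \<rho> \<sigma> (apply_bcontfun W)),
       Bcontfun (\<lambda>t. newW \<rho> \<sigma> (apply_bcontfun W) (cl t))))"
    for x :: "(lsq \<times> lsq) \<times> (real \<Rightarrow>\<^sub>C (real \<times> real \<times> lsq))"
  have cont_W: "continuous_on S (apply_bcontfun W)" for S and W :: "real \<Rightarrow>\<^sub>C (real \<times> real \<times> lsq)"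
    using apply_bcontfun[of W] by (auto simp: bcontfun_def intro: continuous_on_subset)
  have apply_new: "apply_bcontfun (Bcontfun (\<lambda>t. newW \<rho> \<sigma> (apply_bcontfun W) (cl t))) t = newW \<rho> \<sigma> (apply_bcontfun W) (cl t)"
    for \<rho> \<sigma> W t
    using Bcontfun_inverse[OF clamped_bcontfun[OF _ cont_newW[OF cont_W]]] T by (simp add: cl_def)
  \<comment> \<open>The restrictions to (0, t) say nothing about \<open>\<rho>\<close> and
    \<open>\<sigma>\<close> outside (0, T). The two full norms are included so that
    \<open>Bd\<close> controls the norm of the product space.\<close>
  define Bd where "Bd m x \<longleftrightarrow> (case x of ((\<rho>, \<sigma>), W) \<Rightarrow>
      norm \<rho> \<le> m * exp (\<gamma> * T) \<and> norm \<sigma> \<le> m * exp (\<gamma> * T) \<and>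
      (\<forall>t\<in>{0..T}. norm (res 0 t \<rho>) \<le> m * exp (\<gamma> * t)) \<and> (\<forall>t\<in>{0..T}. norm (res 0 t \<sigma>) \<le> m * exp (\<gamma> * t)) \<and>
      (\<forall>t. norm (apply_bcontfun W t) \<le> (\<kappa> * m) * exp (\<gamma> * cl t)))"
    for m and x :: "(lsq \<times> lsq) \<times> (real \<Rightarrow>\<^sub>C (real \<times> real \<times> lsq))"
  have "\<exists>x. \<Phi> x = x"
  proof (rule fixpoint_if_weighted_contraction[where Bd=Bd and C="(2 + \<kappa>) * exp (\<gamma> * T)"])
    fix m and d :: "(lsq \<times> lsq) \<times> (real \<Rightarrow>\<^sub>C (real \<times> real \<times> lsq))"
    assume Bd: "Bd m d"
    obtain \<rho> \<sigma> W where d: "d = ((\<rho>, \<sigma>), W)" by (metis surj_pair)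
    have "norm \<rho> \<le> m * exp (\<gamma> * T)" using Bd by (simp add: Bd_def d)
    then have "0 \<le> m * exp (\<gamma> * T)" using norm_ge_zero order_trans by blast
    then have m: "0 \<le> m" by (simp add: zero_le_mult_iff)
    have "norm (apply_bcontfun W t) \<le> (\<kappa> * m) * exp (\<gamma> * T)" for t
    proof -
      have "norm (apply_bcontfun W t) \<le> (\<kappa> * m) * exp (\<gamma> * cl t)" using Bd by (simp add: Bd_def d)
      also have "\<dots> \<le> (\<kappa> * m) * exp (\<gamma> * T)" using cl m \<kappa> \<gamma> by (intro mult_left_mono) auto
      finally show ?thesis .
    qed
    then have W: "norm W \<le> (\<kappa> * m) * exp (\<gamma> * T)" by (rule norm_bound)
    have "norm d \<le> norm \<rho> + norm \<sigma> + norm W"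
      unfolding d using norm_Pair_le[of "(\<rho>, \<sigma>)" W] norm_Pair_le[of \<rho> \<sigma>] by linarith
    also have "\<dots> \<le> m * exp (\<gamma> * T) + m * exp (\<gamma> * T) + (\<kappa> * m) * exp (\<gamma> * T)"
      using Bd W by (intro add_mono) (auto simp: Bd_def d)
    finally show "norm d \<le> (2 + \<kappa>) * exp (\<gamma> * T) * m" by (simp add: algebra_simps)
  next
    fix d :: "(lsq \<times> lsq) \<times> (real \<Rightarrow>\<^sub>C (real \<times> real \<times> lsq))"
    obtain \<rho> \<sigma> W where d: "d = ((\<rho>, \<sigma>), W)" by (metis surj_pair)
    have "norm (\<rho>, \<sigma>) \<le> norm d" "norm W \<le> norm d"
      unfolding d using norm_fst_le[of "(\<rho>, \<sigma>)" W] norm_snd_le[of W "(\<rho>, \<sigma>)"] by auto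
    then have le: "norm \<rho> \<le> norm d" "norm \<sigma> \<le> norm d" "norm W \<le> norm d"
      using norm_fst_le[of \<rho> \<sigma>] norm_snd_le[of \<sigma> \<rho>] by auto
    have exp1: "x \<le> norm d * exp (\<gamma> * t)" if "x \<le> norm d" "0 \<le> t" for x t
    proof -
      have "norm d * 1 \<le> norm d * exp (\<gamma> * t)" using that(2) \<gamma>(1) by (intro mult_left_mono) auto
      with that(1) show ?thesis by simp
    qed
    have "norm (apply_bcontfun W t) \<le> (\<kappa> * norm d) * exp (\<gamma> * cl t)" for t
    proof -
      have "norm (apply_bcontfun W t) \<le> norm d * exp (\<gamma> * cl t)"
        using norm_bounded[of W t] le(3) cl by (intro exp1) auto
      also have "\<dots> \<le> \<kappa> * (norm d * exp (\<gamma> * cl t))"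
        using mult_right_mono[of 1 \<kappa> "norm d * exp (\<gamma> * cl t)"] \<kappa> by simp
      finally show ?thesis by simp
    qed
    moreover have "norm \<rho> \<le> norm d * exp (\<gamma> * T)" "norm \<sigma> \<le> norm d * exp (\<gamma> * T)"
      using le T by (auto intro!: exp1)
    moreover have "norm (res 0 t \<rho>) \<le> norm d * exp (\<gamma> * t)" "norm (res 0 t \<sigma>) \<le> norm d * exp (\<gamma> * t)" if "t \<in> {0..T}" for t
      using le that by (auto intro!: exp1 order_trans[OF norm_res_le])
    ultimately show "Bd (norm d) d" by (simp add: Bd_def d)
  next
    fix m and x y :: "(lsq \<times> lsq) \<times> (real \<Rightarrow>\<^sub>C (real \<times> real \<times> lsq))"
    assume Bd: "Bd m (x - y)"
    obtain \<rho> \<sigma> W where x: "x = ((\<rho>, \<sigma>), W)" by (metis surj_pair)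
    obtain \<rho>' \<sigma>' W' where y: "y = ((\<rho>', \<sigma>'), W')" by (metis surj_pair)
    let ?c0 = "\<lambda>t. fst (apply_bcontfun W t)" and ?c1 = "\<lambda>t. fst (snd (apply_bcontfun W t))" and ?V = "\<lambda>t. snd (snd (apply_bcontfun W t))"
    let ?d0 = "\<lambda>t. fst (apply_bcontfun W' t)" and ?d1 = "\<lambda>t. fst (snd (apply_bcontfun W' t))" and ?U = "\<lambda>t. snd (snd (apply_bcontfun W' t))"
    have conts: "continuous_on {0..T} ?c0" "continuous_on {0..T} ?c1" "continuous_on {0..T} ?d0" "continuous_on {0..T} ?d1"
      "continuous_on {0..T} ?V" "continuous_on {0..T} ?U"
      by (intro continuous_on_fst continuous_on_snd cont_W)+
    have rs: "norm (\<rho> - \<rho>') \<le> m * exp (\<gamma> * T)"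
      "\<And>t. 0 \<le> t \<Longrightarrow> t \<le> T \<Longrightarrow> norm (res 0 t (\<rho> - \<rho>')) \<le> m * exp (\<gamma> * t)"
      "\<And>t. 0 \<le> t \<Longrightarrow> t \<le> T \<Longrightarrow> norm (res 0 t (\<sigma> - \<sigma>')) \<le> m * exp (\<gamma> * t)"
      and Wd: "\<And>t. norm (apply_bcontfun W t - apply_bcontfun W' t) \<le> (\<kappa> * m) * exp (\<gamma> * cl t)"
      using Bd by (auto simp: Bd_def x y minus_bcontfun.rep_eq)
    have "0 \<le> m * exp (\<gamma> * T)" using rs(1) norm_ge_zero order_trans by blast
    then have m: "0 \<le> m" by (simp add: zero_le_mult_iff)
    have Wt: "\<bar>?c0 t - ?d0 t\<bar> \<le> (\<kappa> * m) * exp (\<gamma> * t)" "\<bar>?c1 t - ?d1 t\<bar> \<le> (\<kappa> * m) * exp (\<gamma> * t)"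
      "norm (?V t - ?U t) \<le> (\<kappa> * m) * exp (\<gamma> * t)" if "0 \<le> t" "t \<le> T" for t
    proof -
      let ?w = "apply_bcontfun W t - apply_bcontfun W' t"
      have w: "norm ?w \<le> (\<kappa> * m) * exp (\<gamma> * t)" using Wd[of t] cl(3)[OF that] by simp
      have "norm (fst ?w) \<le> norm ?w" "norm (snd ?w) \<le> norm ?w"
        "norm (fst (snd ?w)) \<le> norm (snd ?w)" "norm (snd (snd ?w)) \<le> norm (snd ?w)"
        by (metis norm_fst_le norm_snd_le prod.collapse)+
      with w show "\<bar>?c0 t - ?d0 t\<bar> \<le> (\<kappa> * m) * exp (\<gamma> * t)" "\<bar>?c1 t - ?d1 t\<bar> \<le> (\<kappa> * m) * exp (\<gamma> * t)"
        "norm (?V t - ?U t) \<le> (\<kappa> * m) * exp (\<gamma> * t)" by auto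
    qed
    note facts = conts \<gamma>(1) order_trans[OF zero_le_numeral \<kappa>] \<gamma>(2) m rs(2,3) Wt
    have velb: "norm (res 0 t (vel a b \<rho> \<sigma> ?c0 ?c1 - vel a b \<rho>' \<sigma>' ?d0 ?d1)) \<le> (C * m) * exp (\<gamma> * t)"
      if "0 \<le> t" "t \<le> T" "\<bar>a\<bar> + \<bar>b\<bar> \<le> \<bar>m11\<bar> + \<bar>m12\<bar> + \<bar>m21\<bar> + \<bar>m22\<bar>" for t a b
    proof -
      have "norm (res 0 t (vel a b \<rho> \<sigma> ?c0 ?c1 - vel a b \<rho>' \<sigma>' ?d0 ?d1)) \<le> ((\<bar>a\<bar> + \<bar>b\<bar>) * H * m) * exp (\<gamma> * t)"
        unfolding H_def by (rule vel_diff_le[where V="?V" and V'="?U" and \<kappa>=\<kappa>]) (fact facts that)+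
      also have "\<dots> \<le> (C * m) * exp (\<gamma> * t)"
        unfolding C_def using that(3) H m by (intro mult_right_mono) auto
      finally show ?thesis .
    qed
    have incb: "norm (res 0 t ((2 *\<^sub>R vel a b \<rho> \<sigma> ?c0 ?c1 - \<tau>) - (2 *\<^sub>R vel a b \<rho>' \<sigma>' ?d0 ?d1 - \<tau>'))) \<le> (C1 * m) * exp (\<gamma> * t)"
      if "0 \<le> t" "t \<le> T" "\<bar>a\<bar> + \<bar>b\<bar> \<le> \<bar>m11\<bar> + \<bar>m12\<bar> + \<bar>m21\<bar> + \<bar>m22\<bar>"
        and tau: "\<And>t. 0 \<le> t \<Longrightarrow> t \<le> T \<Longrightarrow> norm (res 0 t (\<tau> - \<tau>')) \<le> m * exp (\<gamma> * t)" for t a b \<tau> \<tau>'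
    proof -
      have "norm (res 0 t ((2 *\<^sub>R vel a b \<rho> \<sigma> ?c0 ?c1 - \<tau>) - (2 *\<^sub>R vel a b \<rho>' \<sigma>' ?d0 ?d1 - \<tau>')))
          \<le> ((2 * ((\<bar>a\<bar> + \<bar>b\<bar>) * H) + 1) * m) * exp (\<gamma> * t)"
        unfolding H_def by (rule incoming_diff_le[where V="?V" and V'="?U" and \<kappa>=\<kappa>]) (fact facts that)+
      also have "\<dots> \<le> (C1 * m) * exp (\<gamma> * t)"
      proof -
        have "(\<bar>a\<bar> + \<bar>b\<bar>) * H \<le> C" unfolding C_def using that(3) H by (intro mult_right_mono) auto
        then show ?thesis unfolding C1_def using m by (intro mult_right_mono) auto
      qed
      finally show ?thesis .
    qed
    have srcb: "norm (src ?V t - src ?U t) \<le> (C2 * \<kappa> * m) * exp (\<gamma> * t)" if "0 \<le> t" "t \<le> T" for t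
      unfolding C2_def
      by (rule src_diff_le[where ca="?c0" and ca'="?d0" and cb="?c1" and cb'="?d1" and \<rho>=\<rho> and \<rho>'=\<rho>' and \<sigma>=\<sigma> and \<sigma>'=\<sigma>']) (fact facts that)+
    have ints: "integrable (itv 0 T) (src ?V)" "integrable (itv 0 T) (src ?U)"
      by (intro integrable_src conts)+
    have left: "norm (res 0 t (wave T (left_in \<rho> \<sigma> ?c0 ?c1) (src ?V) T - wave T (left_in \<rho>' \<sigma>' ?d0 ?d1) (src ?U) T))
        \<le> (C1 * m * exp (- \<gamma>) + C2 * \<kappa> * m / \<gamma>) * exp (\<gamma> * t)"
      "norm (profile T (left_in \<rho> \<sigma> ?c0 ?c1) (src ?V) t - profile T (left_in \<rho>' \<sigma>' ?d0 ?d1) (src ?U) t)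
        \<le> (C1 * m + C2 * \<kappa> * m / \<gamma>) * exp (\<gamma> * t)" if t: "0 \<le> t" "t \<le> T" for t
    proof -
      let ?\<beta> = "(2 *\<^sub>R vel m21 m22 \<rho> \<sigma> ?c0 ?c1 - \<sigma>) - (2 *\<^sub>R vel m21 m22 \<rho>' \<sigma>' ?d0 ?d1 - \<sigma>')"
      have P: "left_in \<rho> \<sigma> ?c0 ?c1 - left_in \<rho>' \<sigma>' ?d0 ?d1 = shift (- 1) (res 0 T ?\<beta>)"
        by (simp only: left_in_def shift_diff res_diff add_diff_cancel_left)
      have supp: "src ?V s - src ?U s = res 0 1 (src ?V s - src ?U s)" for s
        unfolding res_diff by (simp only: src_supp[symmetric])
      note b = wave_bound[OF Bochner_Integration.integrable_diff[OF ints] supp P, of \<gamma> "C1 * m" "C2 * \<kappa> * m" t]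
      show "norm (res 0 t (wave T (left_in \<rho> \<sigma> ?c0 ?c1) (src ?V) T - wave T (left_in \<rho>' \<sigma>' ?d0 ?d1) (src ?U) T))
        \<le> (C1 * m * exp (- \<gamma>) + C2 * \<kappa> * m / \<gamma>) * exp (\<gamma> * t)"
        unfolding wave_diff[OF ints] by (rule b(1)) (use t \<gamma>(1) C1 C2 \<kappa> m incb[of _ m21 m22, OF _ _ _ rs(3)] srcb in auto)
      show "norm (profile T (left_in \<rho> \<sigma> ?c0 ?c1) (src ?V) t - profile T (left_in \<rho>' \<sigma>' ?d0 ?d1) (src ?U) t)
        \<le> (C1 * m + C2 * \<kappa> * m / \<gamma>) * exp (\<gamma> * t)"
        unfolding profile_diff[OF ints] by (rule b(2)) (use t \<gamma>(1) C1 C2 \<kappa> m incb[of _ m21 m22, OF _ _ _ rs(3)] srcb in auto)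
    qed
    have right: "norm (res 0 t (wave T (right_in \<rho> \<sigma> ?c0 ?c1) (\<lambda>s. rfl (src ?V s)) T - wave T (right_in \<rho>' \<sigma>' ?d0 ?d1) (\<lambda>s. rfl (src ?U s)) T))
        \<le> (C1 * m * exp (- \<gamma>) + C2 * \<kappa> * m / \<gamma>) * exp (\<gamma> * t)"
      "norm (profile T (right_in \<rho> \<sigma> ?c0 ?c1) (\<lambda>s. rfl (src ?V s)) t - profile T (right_in \<rho>' \<sigma>' ?d0 ?d1) (\<lambda>s. rfl (src ?U s)) t)
        \<le> (C1 * m + C2 * \<kappa> * m / \<gamma>) * exp (\<gamma> * t)" if t: "0 \<le> t" "t \<le> T" for t
    proof -
      let ?\<beta> = "(2 *\<^sub>R vel m11 m12 \<rho> \<sigma> ?c0 ?c1 - \<rho>) - (2 *\<^sub>R vel m11 m12 \<rho>' \<sigma>' ?d0 ?d1 - \<rho>')"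
      note ri = ints[THEN integrable_rfl]
      have P: "right_in \<rho> \<sigma> ?c0 ?c1 - right_in \<rho>' \<sigma>' ?d0 ?d1 = shift (- 1) (res 0 T ?\<beta>)"
        by (simp only: right_in_def shift_diff res_diff add_diff_cancel_left)
      have supp: "rfl (src ?V s) - rfl (src ?U s) = res 0 1 (rfl (src ?V s) - rfl (src ?U s))" for s
        unfolding res_diff by (simp only: rfl_supp[OF src_supp, symmetric])
      have srcr: "norm (rfl (src ?V t) - rfl (src ?U t)) \<le> (C2 * \<kappa> * m) * exp (\<gamma> * t)" if "0 \<le> t" "t \<le> T" for t
        using srcb[OF that] by (simp flip: rfl_diff)
      note b = wave_bound[OF Bochner_Integration.integrable_diff[OF ri] supp P, of \<gamma> "C1 * m" "C2 * \<kappa> * m" t]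
      show "norm (res 0 t (wave T (right_in \<rho> \<sigma> ?c0 ?c1) (\<lambda>s. rfl (src ?V s)) T - wave T (right_in \<rho>' \<sigma>' ?d0 ?d1) (\<lambda>s. rfl (src ?U s)) T))
        \<le> (C1 * m * exp (- \<gamma>) + C2 * \<kappa> * m / \<gamma>) * exp (\<gamma> * t)"
        unfolding wave_diff[OF ri] by (rule b(1)) (use t \<gamma>(1) C1 C2 \<kappa> m incb[of _ m11 m12, OF _ _ _ rs(2)] srcr in auto)
      show "norm (profile T (right_in \<rho> \<sigma> ?c0 ?c1) (\<lambda>s. rfl (src ?V s)) t - profile T (right_in \<rho>' \<sigma>' ?d0 ?d1) (\<lambda>s. rfl (src ?U s)) t)
        \<le> (C1 * m + C2 * \<kappa> * m / \<gamma>) * exp (\<gamma> * t)"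
        unfolding profile_diff[OF ri] by (rule b(2)) (use t \<gamma>(1) C1 C2 \<kappa> m incb[of _ m11 m12, OF _ _ _ rs(2)] srcr in auto)
    qed
    have half: "(C1 * m * exp (- \<gamma>) + C2 * \<kappa> * m / \<gamma>) * e \<le> m / 2 * e" if "0 \<le> e" for e
    proof (rule mult_right_mono[OF _ that])
      have "m * (C1 * exp (- \<gamma>) + C2 * \<kappa> / \<gamma>) \<le> m * (1/2)" by (rule mult_left_mono[OF small(1) m])
      then show "C1 * m * exp (- \<gamma>) + C2 * \<kappa> * m / \<gamma> \<le> m / 2" by (simp add: algebra_simps)
    qed
    let ?r = "new\<rho> \<rho> \<sigma> (apply_bcontfun W) - new\<rho> \<rho>' \<sigma>' (apply_bcontfun W')"
    let ?s = "new\<sigma> \<rho> \<sigma> (apply_bcontfun W) - new\<sigma> \<rho>' \<sigma>' (apply_bcontfun W')"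
    have r: "norm (res 0 t ?r) \<le> m / 2 * exp (\<gamma> * t)" and s: "norm (res 0 t ?s) \<le> m / 2 * exp (\<gamma> * t)"
      if t: "0 \<le> t" "t \<le> T" for t
      using order_trans[OF left(1)[OF t] half] order_trans[OF right(1)[OF t] half] t
      by (simp_all add: new\<rho>_def new\<sigma>_def res_res flip: res_diff)
    have "norm ?r = norm (res 0 T ?r)" "norm ?s = norm (res 0 T ?s)"
      by (simp_all add: new\<rho>_def new\<sigma>_def res_res flip: res_diff)
    with r[of T] s[of T] T have rT: "norm ?r \<le> m / 2 * exp (\<gamma> * T)" and sT: "norm ?s \<le> m / 2 * exp (\<gamma> * T)" by auto
    have w: "norm (newW \<rho> \<sigma> (apply_bcontfun W) t - newW \<rho>' \<sigma>' (apply_bcontfun W') t) \<le> \<kappa> * (m / 2) * exp (\<gamma> * t)"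
      if t: "0 \<le> t" "t \<le> T" for t
    proof -
      let ?E = "m * exp (\<gamma> * t)"
      have iv: "\<bar>vel a b \<rho> \<sigma> ?c0 ?c1 \<bullet> ivl 0 t - vel a b \<rho>' \<sigma>' ?d0 ?d1 \<bullet> ivl 0 t\<bar> \<le> sqrt T * C * ?E"
        if ab: "\<bar>a\<bar> + \<bar>b\<bar> \<le> \<bar>m11\<bar> + \<bar>m12\<bar> + \<bar>m21\<bar> + \<bar>m22\<bar>" for a b
      proof -
        let ?z = "vel a b \<rho> \<sigma> ?c0 ?c1 - vel a b \<rho>' \<sigma>' ?d0 ?d1"
        have "\<bar>?z \<bullet> ivl 0 t\<bar> \<le> norm (res 0 t ?z) * norm (ivl 0 t)"
          unfolding inner_ivl_res[of ?z] by (rule Cauchy_Schwarz_ineq2)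
        also have "\<dots> \<le> (C * m) * exp (\<gamma> * t) * sqrt T"
          using velb[OF t ab] t by (intro mult_mono) (auto simp: norm_ivl intro: order_trans[OF norm_ge_zero])
        finally show ?thesis by (simp add: inner_diff_left mult_ac)
      qed
      let ?L = "profile T (left_in \<rho> \<sigma> ?c0 ?c1) (src ?V) t - profile T (left_in \<rho>' \<sigma>' ?d0 ?d1) (src ?U) t"
      let ?R = "profile T (right_in \<rho> \<sigma> ?c0 ?c1) (\<lambda>s. rfl (src ?V s)) t - profile T (right_in \<rho>' \<sigma>' ?d0 ?d1) (\<lambda>s. rfl (src ?U s)) t"
      have one: "(C1 * m + C2 * \<kappa> * m / \<gamma>) * exp (\<gamma> * t) \<le> (C1 + 1) * ?E"
      proof -
        have "m * (C2 * \<kappa> / \<gamma>) \<le> m * 1" by (rule mult_left_mono[OF small(2) m])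
        then have "C1 * m + C2 * \<kappa> * m / \<gamma> \<le> (C1 + 1) * m" by (simp add: algebra_simps)
        then show ?thesis using mult_right_mono[of _ _ "exp (\<gamma> * t)"] by (fastforce simp: mult.assoc)
      qed
      have "norm ((1/2) *\<^sub>R (?L + rfl ?R)) \<le> (1/2) * (norm ?L + norm ?R)"
        using norm_triangle_ineq[of ?L "rfl ?R"] by simp
      also have "\<dots> \<le> (C1 + 1) * ?E"
      proof -
        have avg: "a \<le> X \<Longrightarrow> b \<le> X \<Longrightarrow> (1/2) * (a + b) \<le> X" for a b X :: real by simp
        show ?thesis
          by (rule avg[OF order_trans[OF left(2)[OF t] one] order_trans[OF right(2)[OF t] one]])
      qed
      finally have vb: "norm ((1/2) *\<^sub>R (?L + rfl ?R)) \<le> (C1 + 1) * ?E" .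
      have "newW \<rho> \<sigma> (apply_bcontfun W) t - newW \<rho>' \<sigma>' (apply_bcontfun W') t
         = (vel m11 m12 \<rho> \<sigma> ?c0 ?c1 \<bullet> ivl 0 t - vel m11 m12 \<rho>' \<sigma>' ?d0 ?d1 \<bullet> ivl 0 t,
            vel m21 m22 \<rho> \<sigma> ?c0 ?c1 \<bullet> ivl 0 t - vel m21 m22 \<rho>' \<sigma>' ?d0 ?d1 \<bullet> ivl 0 t, (1/2) *\<^sub>R (?L + rfl ?R))"
        unfolding newW_def Let_def by (simp add: rfl_diff scaleR_diff_right scaleR_add_right)
      also have "norm \<dots> \<le> sqrt T * C * ?E + (sqrt T * C * ?E + (C1 + 1) * ?E)"
        by (intro order_trans[OF norm_Pair_le] add_mono, unfold real_norm_def) (use iv vb in auto)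
      also have "\<dots> = \<kappa> * (m / 2) * exp (\<gamma> * t)"
        by (simp add: \<kappa>_def algebra_simps)
      finally show ?thesis .
    qed
    show "Bd (m / 2) (\<Phi> x - \<Phi> y)"
      unfolding Bd_def \<Phi>_def x y using r s rT sT w cl
      by (simp add: minus_bcontfun.rep_eq apply_new)
  qed
  then obtain x where fix_x: "\<Phi> x = x" ..
  obtain \<rho> \<sigma> W where x: "x = ((\<rho>, \<sigma>), W)" by (metis surj_pair)
  let ?c0 = "\<lambda>t. fst (apply_bcontfun W t)" and ?c1 = "\<lambda>t. fst (snd (apply_bcontfun W t))" and ?V = "\<lambda>t. snd (snd (apply_bcontfun W t))"
  have "apply_bcontfun W t = newW \<rho> \<sigma> (apply_bcontfun W) t" if "t \<in> {0..T}" for t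
    using fix_x apply_new[of \<rho> \<sigma> W t] cl(3)[of t] that by (simp add: \<Phi>_def x)
  then have W: "?c0 t = fst (newW \<rho> \<sigma> (apply_bcontfun W) t)" "?c1 t = fst (snd (newW \<rho> \<sigma> (apply_bcontfun W) t))"
      "?V t = snd (snd (newW \<rho> \<sigma> (apply_bcontfun W) t))" if "t \<in> {0..T}" for t
    using that by simp_all
  show ?thesis
  proof (rule that[of ?c0 ?c1 ?V \<rho> \<sigma>])
    show "continuous_on {0..T} ?c0" "continuous_on {0..T} ?c1" "continuous_on {0..T} ?V"
      by (intro continuous_on_fst continuous_on_snd cont_W)+
    show "\<rho> = res 0 T (wave T (left_in \<rho> \<sigma> ?c0 ?c1) (src ?V) T)"
      "\<sigma> = res 0 T (wave T (right_in \<rho> \<sigma> ?c0 ?c1) (\<lambda>s. rfl (src ?V s)) T)"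
      using fix_x by (simp_all add: \<Phi>_def x new\<rho>_def new\<sigma>_def)
  qed (fact W[unfolded newW_def Let_def fst_conv snd_conv])+
qed

end

section \<open>From the fixed point to weak identities\<close>

lemma rfl_ivl: "rfl (ivl c d) = ivl (1 - d) (1 - c)"
  unfolding ivl_def by (subst rfl_cls[OF sq_int_ivl])
    (rule arg_cong[where f=cls], rule ext, auto simp: indicator_def of_bool_def)

text \<open>\<open>transport\<close> covers waves moving to the left. For \<open>q\<close> it is
  applied with the reflected test function, whose derivative changes sign and whose traces are
  exchanged.\<close>

lemma H1_reflect:
  assumes v: "v \<in> H1 0 1"
  obtains v' where "v' \<in> H1 0 1" "em 0 1 v' = rfl (em 0 1 v)" "dx 0 1 v' = - rfl (dx 0 1 v)"
    "trace_at 0 1 v' 0 = trace_at 0 1 v 1" "trace_at 0 1 v' 1 = trace_at 0 1 v 0"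
proof -
  let ?g = "dx 0 1 v" and ?va = "trace_at 0 1 v 0" and ?vb = "trace_at 0 1 v 1"
  define v' where "v' x = ?vb + (- rfl ?g) \<bullet> ivl 0 x" for x
  have tr: "?vb = ?va + ?g \<bullet> ivl 0 1" by (rule H1_repr(2)) (use v in auto)
  have v'_eq: "v' x = ?va + ?g \<bullet> ivl 0 (1 - x)" if "0 < x" "x < 1" for x
    using that by (simp add: v'_def tr inner_rfl_left rfl_ivl ivl_diff[of 0 "1 - x" 1] inner_diff_right)
  have "continuous_on {0..1} v'"
    unfolding v'_def by (intro continuous_intros continuous_inner_ivl)
  then have "v' \<in> borel_measurable (itv 0 1)"
    by (intro borel_measurable_integrable integrable_itv_continuous)
  note H = H1I[OF zero_less_one this, of ?vb "- rfl ?g"]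
  have v': "v' \<in> H1 0 1" by (rule H(1)) (simp add: v'_def)
  have dx: "dx 0 1 v' = - rfl ?g"
  proof -
    have "dx 0 1 v' = res 0 1 (- rfl ?g)" by (rule H(2)) (simp add: v'_def)
    also have "\<dots> = - rfl (res 0 1 ?g)"
      by (simp add: rfl_res linear_neg[OF bounded_linear.linear[OF bounded_linear_res]])
    finally show ?thesis by (simp add: res_dx v)
  qed
  have t: "trace_at 0 1 v' z = ?vb + (- rfl ?g) \<bullet> ivl 0 z" if "z \<in> {0..1}" for z
    by (rule H(3)) (use that in \<open>auto simp: v'_def\<close>)
  have t0: "trace_at 0 1 v' 0 = ?vb" using t[of 0] by (simp add: ivl_empty)
  show ?thesis
  proof (rule that[OF v' _ dx t0])
    show "trace_at 0 1 v' 1 = ?va"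
      using t[of 1] tr by (simp add: inner_rfl_left rfl_ivl)
    show "em 0 1 v' = rfl (em 0 1 v)"
    proof (rule lsq_eqI)
      show "AE x in lborel. fn (em 0 1 v') x = fn (rfl (em 0 1 v)) x"
        using fn_em_H1[OF v'] AE_lborel_reflect[OF fn_em_H1[OF v]] fn_rfl[of "em 0 1 v"]
      proof eventually_elim
        case (elim x)
        show ?case
          using elim v'_eq[of x] by (cases "0 < x \<and> x < 1") (auto simp: t0 dx v'_def)
      qed
    qed
  qed
qed

lemma profile_rfl_supp: "res 0 1 (profile T P F t) = profile T P F t"
  by (simp add: profile_def res_res)

text \<open>On (1, 1 + t) only the boundary input is visible; by \<open>incoming_inner_unit\<close>,
  on (0, 1) only the initial value is.\<close>

lemma incoming_ivl:
  assumes "y = res 0 1 y" "t \<le> T"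
  shows "(y + shift (- 1) (res 0 T \<beta>)) \<bullet> ivl 1 (1 + t) = \<beta> \<bullet> ivl 0 t"
proof -
  have "y \<bullet> ivl 1 (1 + t) = 0"
    by (subst assms(1)) (simp add: inner_res res_ivl ivl_empty)
  moreover have "shift (- 1) (res 0 T \<beta>) \<bullet> ivl 1 (1 + t) = \<beta> \<bullet> ivl 0 t"
    using assms(2) by (simp add: inner_shift_left shift_ivl inner_res res_ivl)
  ultimately show ?thesis by (simp add: inner_add_left)
qed

lemma incoming_inner_unit:
  assumes "res 0 1 z = z"
  shows "(y + shift (- 1) (res 0 T \<beta>)) \<bullet> z = y \<bullet> z"
proof -
  have "shift (- 1) (res 0 T \<beta>) \<bullet> z = shift (- 1) (res 0 T \<beta>) \<bullet> res 0 1 z" using assms by simp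
  also have "\<dots> = res 0 1 (shift (- 1) (res 0 T \<beta>)) \<bullet> z" by (simp only: inner_res)
  also have "res 0 1 (shift (- 1) (res 0 T \<beta>)) = 0" by (simp add: shift_res res_res res_empty)
  finally show ?thesis by (simp add: inner_add_left)
qed

context wave_data
begin

text \<open>Half the sum and half the difference of the transport identities for \<open>p\<close>
  and \<open>q\<close>. \<open>V\<close> plays the part of \<open>u\<^sub>t\<close> and
  \<open>D\<close> that of \<open>u\<^sub>x\<close>. The first identity is the wave equation
  integrated in time, with \<open>B - \<sigma>\<close> for \<open>u\<^sub>x(1)\<close> and
  \<open>A - \<rho>\<close> for \<open>- u\<^sub>x(0)\<close>; the second is
  \<open>D\<^sub>t = V\<^sub>x\<close> with the boundary velocities as traces of
  \<open>V\<close>.\<close>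

theorem weak_identities:
  assumes p0: "p0 = res 0 1 p0" and q0: "q0 = res 0 1 q0"
  obtains \<rho> \<sigma> A B :: lsq and c0 c1 :: "real \<Rightarrow> real" and V D :: "real \<Rightarrow> lsq"
  where "continuous_on {0..T} c0" "continuous_on {0..T} c1" "continuous_on {0..T} V" "continuous_on {0..T} D"
    and "A = vel m11 m12 \<rho> \<sigma> c0 c1" "B = vel m21 m22 \<rho> \<sigma> c0 c1" "\<rho> = res 0 T \<rho>" "\<sigma> = res 0 T \<sigma>"
    and "\<And>t. t \<in> {0..T} \<Longrightarrow> c0 t = c00 + A \<bullet> ivl 0 t"
    and "\<And>t. t \<in> {0..T} \<Longrightarrow> c1 t = c10 + B \<bullet> ivl 0 t"
    and "\<And>t. t \<in> {0..T} \<Longrightarrow> V t = res 0 1 (V t)"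
    and "\<And>t. t \<in> {0..T} \<Longrightarrow> D t = res 0 1 (D t)"
    and "V 0 = (1/2) *\<^sub>R (p0 + q0)"
    and "\<And>v t. v \<in> H1 0 1 \<Longrightarrow> t \<in> {0..T} \<Longrightarrow>
      V t \<bullet> em 0 1 v = (1/2) *\<^sub>R (p0 + q0) \<bullet> em 0 1 v
        + prim (itv 0 T) (\<lambda>s. src V s \<bullet> em 0 1 v - D s \<bullet> dx 0 1 v) t
        + trace_at 0 1 v 1 * ((B - \<sigma>) \<bullet> ivl 0 t) + trace_at 0 1 v 0 * ((A - \<rho>) \<bullet> ivl 0 t)"
    and "\<And>v t. v \<in> H1 0 1 \<Longrightarrow> t \<in> {0..T} \<Longrightarrow>
      D t \<bullet> em 0 1 v = (1/2) *\<^sub>R (p0 - q0) \<bullet> em 0 1 v - prim (itv 0 T) V t \<bullet> dx 0 1 v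
        + trace_at 0 1 v 1 * (B \<bullet> ivl 0 t) - trace_at 0 1 v 0 * (A \<bullet> ivl 0 t)"
proof -
  from fixed_point obtain \<rho> \<sigma> c0 c1 V where cont: "continuous_on {0..T} c0" "continuous_on {0..T} c1" "continuous_on {0..T} V"
    and \<rho>: "\<rho> = res 0 T (wave T (left_in \<rho> \<sigma> c0 c1) (src V) T)"
    and \<sigma>: "\<sigma> = res 0 T (wave T (right_in \<rho> \<sigma> c0 c1) (\<lambda>s. rfl (src V s)) T)"
    and c0: "\<And>t. t \<in> {0..T} \<Longrightarrow> c0 t = c00 + vel m11 m12 \<rho> \<sigma> c0 c1 \<bullet> ivl 0 t"
    and c1: "\<And>t. t \<in> {0..T} \<Longrightarrow> c1 t = c10 + vel m21 m22 \<rho> \<sigma> c0 c1 \<bullet> ivl 0 t"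
    and V: "\<And>t. t \<in> {0..T} \<Longrightarrow> V t = (1/2) *\<^sub>R (profile T (left_in \<rho> \<sigma> c0 c1) (src V) t
           + rfl (profile T (right_in \<rho> \<sigma> c0 c1) (\<lambda>s. rfl (src V s)) t))"
    by metis
  define A where "A = vel m11 m12 \<rho> \<sigma> c0 c1"
  define B where "B = vel m21 m22 \<rho> \<sigma> c0 c1"
  define P where "P = left_in \<rho> \<sigma> c0 c1"
  define Q where "Q = right_in \<rho> \<sigma> c0 c1"
  define p where "p t = profile T P (src V) t" for t
  define q where "q t = rfl (profile T Q (\<lambda>s. rfl (src V s)) t)" for t
  define D where "D t = (1/2) *\<^sub>R (p t - q t)" for t
  have P: "P = p0 + shift (- 1) (res 0 T (2 *\<^sub>R B - \<sigma>))"
    by (simp add: P_def left_in_def B_def)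
  have Q: "Q = rfl q0 + shift (- 1) (res 0 T (2 *\<^sub>R A - \<rho>))"
    by (simp add: Q_def right_in_def A_def)
  have V': "V t = (1/2) *\<^sub>R (p t + q t)" if "t \<in> {0..T}" for t
    using V[OF that] by (simp add: p_def q_def P_def Q_def)
  note src = integrable_src[OF cont(3)]
  note srcr = integrable_rfl[OF src]
  have cp: "continuous_on {0..T} p" unfolding p_def by (intro continuous_profile src)
  have cq: "continuous_on {0..T} q"
    unfolding q_def by (intro bounded_linear.continuous_on[OF bounded_linear_rfl] continuous_profile srcr)
  have rq: "rfl q0 = res 0 1 (rfl q0)" by (rule rfl_supp[OF q0])
  have \<rho>t: "wave T P (src V) T \<bullet> ivl 0 t = \<rho> \<bullet> ivl 0 t" "wave T Q (\<lambda>s. rfl (src V s)) T \<bullet> ivl 0 t = \<sigma> \<bullet> ivl 0 t" if "t \<in> {0..T}" for t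
    by (subst \<rho> \<sigma>, use that in \<open>simp add: P_def Q_def inner_res res_ivl\<close>)+
  have left: "p t \<bullet> em 0 1 v = p0 \<bullet> em 0 1 v + prim (itv 0 T) (\<lambda>s. src V s \<bullet> em 0 1 v - p s \<bullet> dx 0 1 v) t
      + trace_at 0 1 v 1 * ((2 *\<^sub>R B - \<sigma>) \<bullet> ivl 0 t) - trace_at 0 1 v 0 * (\<rho> \<bullet> ivl 0 t)"
    if v: "v \<in> H1 0 1" and t: "t \<in> {0..T}" for v t
  proof -
    have t': "0 \<le> t" "t \<le> T" using t by auto
    have "P \<bullet> em 0 1 v = p0 \<bullet> em 0 1 v"
      unfolding P by (rule incoming_inner_unit[OF res_em[OF H1_L2[OF v]]])
    moreover have "P \<bullet> ivl 1 (1 + t) = (2 *\<^sub>R B - \<sigma>) \<bullet> ivl 0 t"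
      unfolding P by (rule incoming_ivl[OF p0 t'(2)])
    ultimately show ?thesis
      using transport[OF src src_supp v t', of P] \<rho>t(1)[OF t] by (simp only: p_def)
  qed
  have right: "q t \<bullet> em 0 1 v = q0 \<bullet> em 0 1 v + prim (itv 0 T) (\<lambda>s. src V s \<bullet> em 0 1 v + q s \<bullet> dx 0 1 v) t
      + trace_at 0 1 v 0 * ((2 *\<^sub>R A - \<rho>) \<bullet> ivl 0 t) - trace_at 0 1 v 1 * (\<sigma> \<bullet> ivl 0 t)"
    if v: "v \<in> H1 0 1" and t: "t \<in> {0..T}" for v t
  proof -
    have t': "0 \<le> t" "t \<le> T" using t by auto
    obtain v' where v': "v' \<in> H1 0 1" "em 0 1 v' = rfl (em 0 1 v)" "dx 0 1 v' = - rfl (dx 0 1 v)"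
      "trace_at 0 1 v' 0 = trace_at 0 1 v 1" "trace_at 0 1 v' 1 = trace_at 0 1 v 0"
      using H1_reflect[OF v] by metis
    have "Q \<bullet> em 0 1 v' = rfl q0 \<bullet> em 0 1 v'"
      unfolding Q by (rule incoming_inner_unit[OF res_em[OF H1_L2[OF v'(1)]]])
    then have 1: "Q \<bullet> em 0 1 v' = q0 \<bullet> em 0 1 v" by (simp add: v'(2) inner_rfl)
    have 2: "Q \<bullet> ivl 1 (1 + t) = (2 *\<^sub>R A - \<rho>) \<bullet> ivl 0 t"
      unfolding Q by (rule incoming_ivl[OF rq t'(2)])
    have 3: "rfl (src V s) \<bullet> em 0 1 v' - profile T Q (\<lambda>s. rfl (src V s)) s \<bullet> dx 0 1 v' = src V s \<bullet> em 0 1 v + q s \<bullet> dx 0 1 v" for s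
      by (simp add: v' inner_rfl q_def inner_rfl_left)
    have 4: "profile T Q (\<lambda>s. rfl (src V s)) t \<bullet> em 0 1 v' = q t \<bullet> em 0 1 v"
      by (simp add: v' q_def inner_rfl_left)
    show ?thesis
      using transport[OF srcr rfl_supp[OF src_supp] v'(1) t', of Q] \<rho>t(2)[OF t] by (simp only: 1 2 3 4 v'(4,5))
  qed
  have start: "p 0 = p0" "q 0 = q0"
  proof -
    have "res 0 1 (y + shift (- 1) (res 0 T \<beta>)) = res 0 1 y" for y \<beta>
      by (simp add: res_add shift_res res_res res_empty)
    then show "p 0 = p0" "q 0 = q0"
      using p0 rq by (simp_all add: p_def q_def profile_def wave_def prim_itv_start P Q)
  qed
  have ints: "integrable (itv 0 T) (\<lambda>s. src V s \<bullet> y)" "integrable (itv 0 T) (\<lambda>s. p s \<bullet> y)" "integrable (itv 0 T) (\<lambda>s. q s \<bullet> y)" for y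
    using src integrable_itv_continuous[OF cp] integrable_itv_continuous[OF cq] by auto
  show ?thesis
  proof (rule that[of c0 c1 V D A \<rho> \<sigma> B])
    show "continuous_on {0..T} D" unfolding D_def by (intro continuous_intros cp cq)
    show "\<rho> = res 0 T \<rho>" "\<sigma> = res 0 T \<sigma>" by (subst \<rho> \<sigma>, simp add: res_res, subst \<rho> \<sigma>, simp)+
    have "res 0 1 (p t) = p t" "res 0 1 (q t) = q t" for t
      by (simp_all add: p_def q_def profile_rfl_supp rfl_res[of 0 1, simplified, symmetric])
    then show "V t = res 0 1 (V t)" "D t = res 0 1 (D t)" if "t \<in> {0..T}" for t
      using V'[OF that] by (simp_all add: D_def res_scale res_add res_diff)
    show "V 0 = (1/2) *\<^sub>R (p0 + q0)" using V'[of 0] T by (simp add: start)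
    fix v t assume v: "v \<in> H1 0 1" and t: "t \<in> {0..T}"
    let ?e = "em 0 1 v" and ?g = "dx 0 1 v"
    note lr = left[OF v t] right[OF v t]
    have "prim (itv 0 T) (\<lambda>s. src V s \<bullet> ?e - D s \<bullet> ?g) t
        = prim (itv 0 T) (\<lambda>s. (1/2) * ((src V s \<bullet> ?e - p s \<bullet> ?g) + (src V s \<bullet> ?e + q s \<bullet> ?g))) t"
      by (rule arg_cong[where f="\<lambda>F. prim (itv 0 T) F t"])
        (auto simp: D_def inner_diff_left field_simps)
    also have "\<dots> = (1/2) * (prim (itv 0 T) (\<lambda>s. src V s \<bullet> ?e - p s \<bullet> ?g) t + prim (itv 0 T) (\<lambda>s. src V s \<bullet> ?e + q s \<bullet> ?g) t)"
      by (subst itv.prim_cmult, subst itv.prim_add) (use ints in auto)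
    finally show "V t \<bullet> ?e = (1/2) *\<^sub>R (p0 + q0) \<bullet> ?e + prim (itv 0 T) (\<lambda>s. src V s \<bullet> ?e - D s \<bullet> ?g) t
        + trace_at 0 1 v 1 * ((B - \<sigma>) \<bullet> ivl 0 t) + trace_at 0 1 v 0 * ((A - \<rho>) \<bullet> ivl 0 t)"
      using lr by (simp add: V'[OF t] inner_add_left inner_diff_left algebra_simps)
    have "prim (itv 0 T) V t \<bullet> ?g = prim (itv 0 T) (\<lambda>s. V s \<bullet> ?g) t"
      by (rule itv.prim_inner[OF integrable_itv_continuous[OF cont(3)]])
    also have "\<dots> = prim (itv 0 T) (\<lambda>s. (1/2) * ((src V s \<bullet> ?e + q s \<bullet> ?g) - (src V s \<bullet> ?e - p s \<bullet> ?g))) t"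
    proof (rule itv.prim_cong_AE)
      show "integrable (itv 0 T) (\<lambda>s. V s \<bullet> ?g)" using integrable_itv_continuous[OF cont(3)] by auto
      show "AE s in itv 0 T. s < t \<longrightarrow> V s \<bullet> ?g = (1/2) * ((src V s \<bullet> ?e + q s \<bullet> ?g) - (src V s \<bullet> ?e - p s \<bullet> ?g))"
        using V' by (intro AE_I2) (auto simp: inner_add_left)
    qed (use ints in auto)
    also have "\<dots> = (1/2) * (prim (itv 0 T) (\<lambda>s. src V s \<bullet> ?e + q s \<bullet> ?g) t - prim (itv 0 T) (\<lambda>s. src V s \<bullet> ?e - p s \<bullet> ?g) t)"
      by (subst itv.prim_cmult, subst itv.prim_diff) (use ints in auto)
    finally show "D t \<bullet> ?e = (1/2) *\<^sub>R (p0 - q0) \<bullet> ?e - prim (itv 0 T) V t \<bullet> ?g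
        + trace_at 0 1 v 1 * (B \<bullet> ivl 0 t) - trace_at 0 1 v 0 * (A \<bullet> ivl 0 t)"
      using lr by (simp add: D_def inner_add_left inner_diff_left algebra_simps)
  qed (use cont c0 c1 in \<open>simp_all add: A_def B_def\<close>)
qed

end

section \<open>Measurability of curves\<close>

text \<open>Completeness of Lebesgue measure. It makes measurability of curves and of their pairings
  invariant under changes on null sets, as is needed when they are known only almost
  everywhere.\<close>

lemma itv_AE_set:
  assumes "AE t in itv a b. P t"
  shows "{t \<in> space (itv a b). P t} \<in> sets (itv a b)"
proof -
  obtain N where N: "{t \<in> space (itv a b). \<not> P t} \<subseteq> N" "emeasure (itv a b) N = 0" "N \<in> sets (itv a b)"
    using assms by (rule AE_E)
  have "N \<in> null_sets lebesgue"
    using N(2,3) by (auto simp: emeasure_restrict_space sets_restrict_space null_sets_def)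
  then have "{t \<in> {a<..<b}. \<not> P t} \<in> null_sets lebesgue"
    using N(1) by (rule_tac null_sets_completion_subset[of _ N]) auto
  then have "{a<..<b} - {t \<in> {a<..<b}. \<not> P t} \<in> sets lebesgue" by auto
  moreover have "{t \<in> space (itv a b). P t} = {a<..<b} - {t \<in> {a<..<b}. \<not> P t}" by auto
  ultimately show ?thesis by (simp add: sets_restrict_space_iff)
qed

lemma itv_measurable_AE_cong:
  fixes f g :: "real \<Rightarrow> 'b::topological_space"
  assumes g: "g \<in> borel_measurable (itv a b)" and eq: "AE t in itv a b. f t = g t"
  shows "f \<in> borel_measurable (itv a b)"
proof (rule measurableI)
  fix A :: "'b set" assume A: "A \<in> sets borel"
  have 1: "{t \<in> space (itv a b). f t = g t} \<in> sets (itv a b)" by (rule itv_AE_set[OF eq])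
  have "AE t in itv a b. \<not> (f t \<noteq> g t \<and> f t \<in> A)" using eq by eventually_elim simp
  from itv_AE_set[OF this]
  have "space (itv a b) - {t \<in> space (itv a b). \<not> (f t \<noteq> g t \<and> f t \<in> A)} \<in> sets (itv a b)" by auto
  moreover have "(g -` A \<inter> space (itv a b)) \<inter> {t \<in> space (itv a b). f t = g t} \<in> sets (itv a b)"
    using measurable_sets[OF g A] 1 by auto
  moreover have "f -` A \<inter> space (itv a b)
      = (space (itv a b) - {t \<in> space (itv a b). \<not> (f t \<noteq> g t \<and> f t \<in> A)})
        \<union> ((g -` A \<inter> space (itv a b)) \<inter> {t \<in> space (itv a b). f t = g t})"
    by auto
  ultimately show "f -` A \<inter> space (itv a b) \<in> sets (itv a b)" by simp
qed simp

lemma itv_measurable_AE_LIMSEQ: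
  fixes f :: "real \<Rightarrow> 'b::{banach, second_countable_topology}"
  assumes s: "\<And>n. s n \<in> borel_measurable (itv a b)" and lim: "AE t in itv a b. (\<lambda>n. s n t) \<longlonglongrightarrow> f t"
  shows "f \<in> borel_measurable (itv a b)"
proof (rule itv_measurable_AE_cong)
  show "(\<lambda>t. lim (\<lambda>n. s n t)) \<in> borel_measurable (itv a b)"
    using s by (rule borel_measurable_lim_metric)
  show "AE t in itv a b. f t = lim (\<lambda>n. s n t)"
    using lim by eventually_elim (simp add: limI)
qed

lemma integrable_itv_cong_AE:
  assumes "integrable (itv a b) g" "AE t in itv a b. f t = g t"
  shows "integrable (itv a b) f"
  using integrable_cong_AE[OF itv_measurable_AE_cong[OF borel_measurable_integrable[OF assms(1)] assms(2)] _ assms(2)] assms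
  by auto

lemma integral_itv_cong_AE:
  assumes "g \<in> borel_measurable (itv a b)" "AE t in itv a b. f t = g t"
  shows "(LINT t|itv a b. f t) = (LINT t|itv a b. g t)"
  by (rule integral_cong_AE[OF itv_measurable_AE_cong[OF assms] assms])

lemma L2_norm_diff:
  assumes "v \<in> L2 a b" "w \<in> L2 a b"
  shows "L2_norm a b (\<lambda>x. v x - w x) = norm (em a b v - em a b w)"
  using L2_diff[OF assms] by (simp flip: norm_em)

lemma H1_norm_diff:
  assumes "a < b" "v \<in> H1 a b" "w \<in> H1 a b"
  shows "H1_norm a b (\<lambda>x. v x - w x) = sqrt ((norm (em a b v - em a b w))\<^sup>2 + (norm (dx a b v - dx a b w))\<^sup>2)"
  using H1_diff[OF assms] L2_diff[OF H1_L2[OF assms(2)] H1_L2[OF assms(3)]] by (simp add: H1_norm_eq)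

text \<open>Any image of a simple function is simple, and the bound on \<open>h\<close> carries the
  convergence over. With \<open>em\<close> and \<open>dx\<close> for \<open>h\<close>, strongly
  measurable curves of functions become Borel measurable curves in \<open>lsq\<close>.\<close>

lemma strongly_measurable_image:
  fixes h :: "(real \<Rightarrow> real) \<Rightarrow> 'b::{banach, second_countable_topology}"
  assumes u: "strongly_measurable T X N u"
    and h: "\<And>v w. v \<in> X \<Longrightarrow> w \<in> X \<Longrightarrow> norm (h v - h w) \<le> N (\<lambda>x. v x - w x)"
  shows "(\<lambda>t. h (u t)) \<in> borel_measurable (itv 0 T)"
proof -
  obtain s where s: "\<And>n. simple_function (itv 0 T) (s n)" "\<And>n t. t \<in> {0<..<T} \<Longrightarrow> s n t \<in> X"
    "AE t in itv 0 T. u t \<in> X \<and> (\<lambda>n. N (\<lambda>x. s n t x - u t x)) \<longlonglongrightarrow> 0"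
    using u unfolding strongly_measurable_def by blast
  show ?thesis
  proof (rule itv_measurable_AE_LIMSEQ)
    show "(\<lambda>t. h (s n t)) \<in> borel_measurable (itv 0 T)" for n
      by (intro borel_measurable_simple_function simple_function_compose1[OF s(1)])
    show "AE t in itv 0 T. (\<lambda>n. h (s n t)) \<longlonglongrightarrow> h (u t)"
      using s(3) AE_space[of "itv 0 T"]
    proof eventually_elim
      case (elim t)
      then have "u t \<in> X" and lim: "(\<lambda>n. N (\<lambda>x. s n t x - u t x)) \<longlonglongrightarrow> 0" and "t \<in> {0<..<T}" by simp_all
      then have "norm (h (s n t) - h (u t)) \<le> N (\<lambda>x. s n t x - u t x)" for n
        by (intro h s(2))
      then have "(\<lambda>n. h (s n t) - h (u t)) \<longlonglongrightarrow> 0"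
        by (rule Lim_null_comparison[OF always_eventually[OF allI] lim])
      then show ?case by (simp add: LIM_zero_iff)
    qed
  qed
qed

lemma strongly_measurable_AE: "strongly_measurable T X N u \<Longrightarrow> AE t in itv 0 T. u t \<in> X"
  unfolding strongly_measurable_def by (auto elim: eventually_mono)

lemma L2_curve_measurable:
  assumes "strongly_measurable T (L2 0 1) (L2_norm 0 1) u"
  shows "(\<lambda>t. em 0 1 (u t)) \<in> borel_measurable (itv 0 T)"
  by (rule strongly_measurable_image[OF assms]) (simp add: L2_norm_diff)

lemma H1_curve_measurable:
  assumes "strongly_measurable T (H1 0 1) (H1_norm 0 1) u"
  shows "(\<lambda>t. em 0 1 (u t)) \<in> borel_measurable (itv 0 T)" "(\<lambda>t. dx 0 1 (u t)) \<in> borel_measurable (itv 0 T)"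
  by (rule strongly_measurable_image[OF assms], simp add: H1_norm_diff)+

lemma Bochner_L1_integrable:
  assumes "f \<in> Bochner_L1 T (L2 0 1) (L2_norm 0 1)"
  shows "integrable (itv 0 T) (\<lambda>t. em 0 1 (f t))"
proof (rule Bochner_Integration.integrable_bound)
  show "integrable (itv 0 T) (\<lambda>t. L2_norm 0 1 (f t))" "(\<lambda>t. em 0 1 (f t)) \<in> borel_measurable (itv 0 T)"
    using assms L2_curve_measurable by (auto simp: Bochner_L1_def)
  have "AE t in itv 0 T. f t \<in> L2 0 1" using assms by (auto simp: Bochner_L1_def intro: strongly_measurable_AE)
  then show "AE t in itv 0 T. norm (em 0 1 (f t)) \<le> norm (L2_norm 0 1 (f t))"
    by eventually_elim (simp add: norm_em)
qed

lemma strongly_measurable_if_continuous: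
  assumes X: "\<And>t. t \<in> {0..T} \<Longrightarrow> u t \<in> X"
    and cont: "\<And>t. t \<in> {0..T} \<Longrightarrow> ((\<lambda>s. N (\<lambda>x. u s x - u t x)) \<longlongrightarrow> 0) (at t within {0..T})"
    and N0: "\<And>t. t \<in> {0..T} \<Longrightarrow> N (\<lambda>x. u t x - u t x) = 0"
  shows "strongly_measurable T X N u"
  unfolding strongly_measurable_def
proof (intro exI conjI allI ballI)
  \<comment> \<open>Rounding down to the grid of mesh \<open>1 / (n + 1)\<close>: the sampled times
    take finitely many values and stay in [0, T], so sampling a continuous curve there yields the
    approximating simple functions.\<close>
  define r where "r n t = real_of_int \<lfloor>real (Suc n) * t\<rfloor> / real (Suc n)" for n t
  have r: "r n t \<in> {0..T}" "\<bar>r n t - t\<bar> \<le> inverse (real (Suc n))" if "t \<in> {0<..<T}" for n t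
  proof -
    have n: "real (Suc n) > 0" by simp
    have fl: "real_of_int \<lfloor>real (Suc n) * t\<rfloor> \<le> real (Suc n) * t" "real (Suc n) * t - 1 \<le> real_of_int \<lfloor>real (Suc n) * t\<rfloor>"
      by linarith+
    have le: "r n t \<le> t" unfolding r_def using fl(1) n by (subst pos_divide_le_eq) (auto simp: mult.commute)
    have "0 \<le> real_of_int \<lfloor>real (Suc n) * t\<rfloor>" using that by simp
    then have ge: "0 \<le> r n t" unfolding r_def by simp
    have "t - inverse (real (Suc n)) = (real (Suc n) * t - 1) / real (Suc n)" using n by (simp add: field_simps)
    also have "\<dots> \<le> r n t" unfolding r_def using fl(2) n by (intro divide_right_mono) auto
    finally show "\<bar>r n t - t\<bar> \<le> inverse (real (Suc n))" using le by simp
    show "r n t \<in> {0..T}" using le ge that by simp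
  qed
  show "simple_function (itv 0 T) (\<lambda>t. u (r n t))" for n
    unfolding r_def
  proof (rule simple_function_compose1[where f="\<lambda>t. \<lfloor>real (Suc n) * t\<rfloor>" and g="\<lambda>k. u (real_of_int k / real (Suc n))"])
    show "simple_function (itv 0 T) (\<lambda>t. \<lfloor>real (Suc n) * t\<rfloor>)"
      unfolding simple_function_def
    proof (intro conjI ballI)
      have "(\<lambda>t. \<lfloor>real (Suc n) * t\<rfloor>) ` space (itv 0 T) \<subseteq> {0..\<lfloor>real (Suc n) * T\<rfloor>}"
        by (auto intro!: floor_mono mult_left_mono simp del: of_nat_Suc)
      then show "finite ((\<lambda>t. \<lfloor>real (Suc n) * t\<rfloor>) ` space (itv 0 T))" by (rule finite_subset) simp
      fix k
      have "(\<lambda>t. \<lfloor>real (Suc n) * t\<rfloor>) -` {k} \<in> sets borel"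
        using measurable_sets[of "\<lambda>t. \<lfloor>real (Suc n) * t\<rfloor>" borel "count_space UNIV" "{k}"] by simp
      then have "(\<lambda>t. \<lfloor>real (Suc n) * t\<rfloor>) -` {k} \<in> sets lebesgue" by simp
      then show "(\<lambda>t. \<lfloor>real (Suc n) * t\<rfloor>) -` {k} \<inter> space (itv 0 T) \<in> sets (itv 0 T)"
        by (auto simp: sets_restrict_space)
    qed
  qed
  show "u (r n t) \<in> X" if "t \<in> {0<..<T}" for n t
    by (rule X[OF r(1)[OF that]])
  show "AE t in itv 0 T. u t \<in> X \<and> (\<lambda>n. N (\<lambda>x. u (r n t) x - u t x)) \<longlonglongrightarrow> 0"
  proof (rule AE_I2, rule conjI)
    fix t assume "t \<in> space (itv 0 T)"
    then have t: "t \<in> {0<..<T}" by simp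
    then show "u t \<in> X" by (intro X) auto
    have lim: "(\<lambda>n. r n t) \<longlonglongrightarrow> t"
    proof -
      have "(\<lambda>n. r n t - t) \<longlonglongrightarrow> 0"
        by (rule Lim_null_comparison[OF always_eventually LIMSEQ_inverse_real_of_nat]) (use r(2)[OF t] in auto)
      then show ?thesis by (simp add: LIM_zero_iff)
    qed
    have t': "t \<in> {0..T}" using t by auto
    have "((\<lambda>s. N (\<lambda>x. u s x - u t x)) \<longlongrightarrow> N (\<lambda>x. u t x - u t x)) (at t within {0..T})"
      using cont[OF t'] N0[OF t'] by simp
    then have "continuous (at t within {0..T}) (\<lambda>s. N (\<lambda>x. u s x - u t x))" by (simp add: continuous_within)
    then have "(\<lambda>n. N (\<lambda>x. u (r n t) x - u t x)) \<longlonglongrightarrow> N (\<lambda>x. u t x - u t x)"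
      by (rule continuous_within_tendsto_compose'[OF _ r(1)[OF t] lim])
    then show "(\<lambda>n. N (\<lambda>x. u (r n t) x - u t x)) \<longlonglongrightarrow> 0" using N0[OF t'] by simp
  qed
qed

lemma Bochner_Linf_L2_if_continuous:
  assumes L2: "\<And>t. t \<in> {0..T} \<Longrightarrow> u t \<in> L2 0 1" and cont: "continuous_on {0..T} (\<lambda>t. em 0 1 (u t))"
  shows "u \<in> Bochner_Linf T (L2 0 1) (L2_norm 0 1)"
    and "\<And>t. t \<in> {0..T} \<Longrightarrow> ((\<lambda>s. L2_norm 0 1 (\<lambda>x. u s x - u t x)) \<longlongrightarrow> 0) (at t within {0..T})"
proof -
  show lim: "((\<lambda>s. L2_norm 0 1 (\<lambda>x. u s x - u t x)) \<longlongrightarrow> 0) (at t within {0..T})" if t: "t \<in> {0..T}" for t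
  proof -
    have "((\<lambda>s. norm (em 0 1 (u s) - em 0 1 (u t))) \<longlongrightarrow> norm (em 0 1 (u t) - em 0 1 (u t))) (at t within {0..T})"
      using cont t by (intro tendsto_intros) (auto simp: continuous_on_def)
    moreover have "\<forall>\<^sub>F s in at t within {0..T}. norm (em 0 1 (u s) - em 0 1 (u t)) = L2_norm 0 1 (\<lambda>x. u s x - u t x)"
      unfolding eventually_at_filter using L2 t by (intro always_eventually) (auto simp: L2_norm_diff)
    ultimately show ?thesis using tendsto_cong by fastforce
  qed
  have "L2_norm 0 1 (\<lambda>x. u t x - u t x) = 0" if "t \<in> {0..T}" for t
    using L2_norm_diff[OF L2[OF that] L2[OF that]] by simp
  then have "strongly_measurable T (L2 0 1) (L2_norm 0 1) u"
    by (intro strongly_measurable_if_continuous[OF L2 lim])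
  moreover obtain C where "\<And>t. t \<in> {0..T} \<Longrightarrow> norm (em 0 1 (u t)) \<le> C"
    using continuous_bounded_Icc[OF cont] by metis
  then have "AE t in itv 0 T. L2_norm 0 1 (u t) \<le> C"
    by (intro AE_I2) (simp add: norm_em[symmetric] L2)
  ultimately show "u \<in> Bochner_Linf T (L2 0 1) (L2_norm 0 1)"
    by (auto simp: Bochner_Linf_def)
qed

lemma Bochner_Linf_H1_if_continuous:
  assumes H1: "\<And>t. t \<in> {0..T} \<Longrightarrow> u t \<in> H1 0 1"
    and cont: "continuous_on {0..T} (\<lambda>t. em 0 1 (u t))" "continuous_on {0..T} (\<lambda>t. dx 0 1 (u t))"
  shows "u \<in> Bochner_Linf T (H1 0 1) (H1_norm 0 1)"
proof -
  have lim: "((\<lambda>s. H1_norm 0 1 (\<lambda>x. u s x - u t x)) \<longlongrightarrow> 0) (at t within {0..T})" if t: "t \<in> {0..T}" for t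
  proof -
    let ?N = "\<lambda>s. sqrt ((norm (em 0 1 (u s) - em 0 1 (u t)))\<^sup>2 + (norm (dx 0 1 (u s) - dx 0 1 (u t)))\<^sup>2)"
    have "(?N \<longlongrightarrow> ?N t) (at t within {0..T})"
      using cont t by (intro tendsto_intros) (auto simp: continuous_on_def)
    moreover have "\<forall>\<^sub>F s in at t within {0..T}. ?N s = H1_norm 0 1 (\<lambda>x. u s x - u t x)"
      unfolding eventually_at_filter using H1 t by (intro always_eventually) (auto simp: H1_norm_diff)
    ultimately have "((\<lambda>s. H1_norm 0 1 (\<lambda>x. u s x - u t x)) \<longlongrightarrow> ?N t) (at t within {0..T})"
      by (rule Lim_transform_eventually)
    then show ?thesis by simp
  qed
  have "H1_norm 0 1 (\<lambda>x. u t x - u t x) = 0" if "t \<in> {0..T}" for t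
    using H1_norm_diff[OF _ H1[OF that] H1[OF that]] by simp
  then have "strongly_measurable T (H1 0 1) (H1_norm 0 1) u"
    by (intro strongly_measurable_if_continuous[OF H1 lim])
  moreover obtain C C' where C: "\<And>t. t \<in> {0..T} \<Longrightarrow> norm (em 0 1 (u t)) \<le> C"
      "\<And>t. t \<in> {0..T} \<Longrightarrow> norm (dx 0 1 (u t)) \<le> C'"
    using continuous_bounded_Icc[OF cont(1)] continuous_bounded_Icc[OF cont(2)] by metis
  have "AE t in itv 0 T. H1_norm 0 1 (u t) \<le> sqrt (C\<^sup>2 + C'\<^sup>2)"
  proof (rule AE_I2)
    fix t assume "t \<in> space (itv 0 T)"
    then have t: "t \<in> {0..T}" by simp
    show "H1_norm 0 1 (u t) \<le> sqrt (C\<^sup>2 + C'\<^sup>2)"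
      unfolding H1_norm_eq[OF H1[OF t]]
      by (intro real_sqrt_le_mono add_mono power_mono C t norm_ge_zero)
  qed
  ultimately show ?thesis
    by (auto simp: Bochner_Linf_def)
qed

section \<open>Existence\<close>

lemma H1_const: "(\<lambda>x. c) \<in> H1 0 1" "dx 0 1 (\<lambda>x. c) = 0" "z \<in> {0..1} \<Longrightarrow> trace_at 0 1 (\<lambda>x. c) z = c"
proof -
  have AE: "AE x in itv 0 1. c = c + 0 \<bullet> ivl 0 x" by simp
  note H = H1I[OF zero_less_one _ AE]
  show "(\<lambda>x. c) \<in> H1 0 1" by (rule H(1)) simp
  have "dx 0 1 (\<lambda>x. c) = res 0 1 0" by (rule H(2)) simp
  then show "dx 0 1 (\<lambda>x. c) = 0" by (simp add: linear_0[OF bounded_linear.linear[OF bounded_linear_res]])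
  show "z \<in> {0..1} \<Longrightarrow> trace_at 0 1 (\<lambda>x. c) z = c" using H(3)[of z] by simp
qed

text \<open>The hypothesis is integration by parts for a function known only as the vector
  \<open>y\<close>, with derivative \<open>d\<close> and end values \<open>a\<close>,
  \<open>b\<close>. Testing with the constant 1 gives \<open>b - a\<close> as the integral of
  \<open>d\<close>. Subtracting true integration by parts and testing with a primitive of the
  discrepancy forces the discrepancy to vanish.\<close>

lemma H1_if_by_parts:
  assumes y: "y = res 0 1 y" and d: "d = res 0 1 d"
    and parts: "\<And>v. v \<in> H1 0 1 \<Longrightarrow> d \<bullet> em 0 1 v + y \<bullet> dx 0 1 v = b * trace_at 0 1 v 1 - a * trace_at 0 1 v 0"
  shows "(\<lambda>x. a + d \<bullet> ivl 0 x) \<in> H1 0 1" "em 0 1 (\<lambda>x. a + d \<bullet> ivl 0 x) = y" "dx 0 1 (\<lambda>x. a + d \<bullet> ivl 0 x) = d"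
    "trace_at 0 1 (\<lambda>x. a + d \<bullet> ivl 0 x) 0 = a" "trace_at 0 1 (\<lambda>x. a + d \<bullet> ivl 0 x) 1 = b"
proof -
  let ?u = "\<lambda>x. a + d \<bullet> ivl 0 x"
  have "continuous_on {0..1} ?u" by (intro continuous_intros continuous_inner_ivl)
  then have m: "?u \<in> borel_measurable (itv 0 1)"
    by (intro borel_measurable_integrable integrable_itv_continuous)
  have AE: "AE x in itv 0 1. ?u x = a + d \<bullet> ivl 0 x" by simp
  note H = H1I[OF zero_less_one m AE]
  show u: "?u \<in> H1 0 1" by (rule H(1))
  show dx: "dx 0 1 ?u = d" using H(2) d by simp
  have tr: "trace_at 0 1 ?u z = a + d \<bullet> ivl 0 z" if "z \<in> {0..1}" for z by (rule H(3)[OF that])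
  show tr0: "trace_at 0 1 ?u 0 = a" using tr[of 0] by (simp add: ivl_empty)
  have "d \<bullet> ivl 0 1 = b - a"
    using parts[OF H1_const(1)[of 1]] by (simp add: H1_const em_1)
  then show tr1: "trace_at 0 1 ?u 1 = b" using tr[of 1] by simp
  have sub: "em 0 1 ?u - y = res 0 1 (em 0 1 ?u - y)"
    using res_em[OF H1_L2[OF u]] y by (simp add: res_diff)
  \<comment> \<open>A test function whose derivative is the discrepancy itself.\<close>
  let ?z = "em 0 1 ?u - y" and ?v = "\<lambda>x. 0 + (em 0 1 ?u - y) \<bullet> ivl 0 x"
  have "continuous_on {0..1} ?v" by (intro continuous_intros continuous_inner_ivl)
  then have mv: "?v \<in> borel_measurable (itv 0 1)"
    by (intro borel_measurable_integrable integrable_itv_continuous)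
  have AEv: "AE x in itv 0 1. ?v x = 0 + ?z \<bullet> ivl 0 x" by simp
  note V = H1I[OF zero_less_one mv AEv]
  have "?z \<bullet> dx 0 1 ?v = 0"
    using H1_by_parts[OF zero_less_one u V(1)] parts[OF V(1)] by (simp add: dx tr0 tr1 inner_diff_left)
  then have "?z \<bullet> ?z = 0" using V(2) sub by simp
  then show "em 0 1 ?u = y" by simp
qed

lemma L2_inner_em_AE:
  assumes "AE t in itv 0 T. u t \<in> L2 0 1" "v \<in> L2 0 1"
  shows "AE t in itv 0 T. L2_inner 0 1 (u t) v = em 0 1 (u t) \<bullet> em 0 1 v"
  using assms(1) by eventually_elim (simp add: inner_em assms(2))

text \<open>The solution is defined by integrating \<open>D t\<close> in space from the trace
  \<open>c0 t\<close>, so it lies in \<open>H\<^sup>1\<close> at every time. The second of the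
  \<open>weak_identities\<close> then shows through \<open>H1_if_by_parts\<close> that it equals the
  time integral of \<open>V\<close> started at \<open>u0\<close> and has trace \<open>c1 t\<close>
  at 1.\<close>

theorem weak_solution_exists:
  fixes h0 h1 lam0 lam1 K lam ht0 ht1 lt0 lt1 T :: real
    and g0 g1 u0 u1 :: "real \<Rightarrow> real" and f :: "real \<Rightarrow> real \<Rightarrow> real"
  assumes det: "(1 + lam0) * (1 + lam1) - lt0 * lt1 \<noteq> 0" and T: "T > 0"
    and g0: "g0 \<in> L2 0 T" and g1: "g1 \<in> L2 0 T"
    and fB: "f \<in> Bochner_L1 T (L2 0 1) (L2_norm 0 1)"
    and u0: "u0 \<in> H1 0 1" and u1: "u1 \<in> L2 0 1"
  shows "\<exists>u. weak_solution T h0 h1 lam0 lam1 K lam ht0 ht1 lt0 lt1 g0 g1 f u0 u1 u"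
proof -
  define d where "d = (1 + lam0) * (1 + lam1) - lt0 * lt1"
  define m11 where "m11 = (1 + lam1) / d"
  define m12 where "m12 = - lt1 / d"
  define m21 where "m21 = - lt0 / d"
  define m22 where "m22 = (1 + lam0) / d"
  have "d \<noteq> 0" using det by (simp add: d_def)
  then have mat: "(1 + lam0) * m11 + lt1 * m21 = 1" "(1 + lam0) * m12 + lt1 * m22 = 0"
    "lt0 * m11 + (1 + lam1) * m21 = 0" "lt0 * m12 + (1 + lam1) * m22 = 1"
    by (simp_all add: m11_def m12_def m21_def m22_def field_simps) (simp_all add: d_def algebra_simps)
  define p0 where "p0 = em 0 1 u1 + dx 0 1 u0"
  define q0 where "q0 = em 0 1 u1 - dx 0 1 u0"
  define F where "F t = res 0 1 (em 0 1 (f t))" for t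
  define c00 where "c00 = trace_at 0 1 u0 0"
  define c10 where "c10 = trace_at 0 1 u0 1"
  define U0 where "U0 = em 0 1 u0"
  have fL2: "AE t in itv 0 T. f t \<in> L2 0 1"
    using fB by (auto simp: Bochner_L1_def intro: strongly_measurable_AE)
  interpret wave_data h0 h1 K lam ht0 ht1 T m11 m12 m21 m22 c00 c10 "em 0 T g0" "em 0 T g1" p0 q0 U0 F
  proof
    show "0 < T" by (rule T)
    show "integrable (itv 0 T) F"
      unfolding F_def by (rule integrable_bounded_linear[OF bounded_linear_res Bochner_L1_integrable[OF fB]])
    show "F s = res 0 1 (F s)" for s by (simp add: F_def res_res)
  qed
  have supp: "p0 = res 0 1 p0" "q0 = res 0 1 q0"
    by (simp_all add: p0_def q0_def res_add res_diff res_em u1 res_dx u0)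
  obtain \<rho> \<sigma> A B c0 c1 V D where
    cont: "continuous_on {0..T} c0" "continuous_on {0..T} c1" "continuous_on {0..T} V" "continuous_on {0..T} D"
    and A: "A = vel m11 m12 \<rho> \<sigma> c0 c1" and B: "B = vel m21 m22 \<rho> \<sigma> c0 c1" and rs: "\<rho> = res 0 T \<rho>" "\<sigma> = res 0 T \<sigma>"
    and c0: "\<And>t. t \<in> {0..T} \<Longrightarrow> c0 t = c00 + A \<bullet> ivl 0 t"
    and c1: "\<And>t. t \<in> {0..T} \<Longrightarrow> c1 t = c10 + B \<bullet> ivl 0 t"
    and V_supp: "\<And>t. t \<in> {0..T} \<Longrightarrow> V t = res 0 1 (V t)"
    and D_supp: "\<And>t. t \<in> {0..T} \<Longrightarrow> D t = res 0 1 (D t)"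
    and V0: "V 0 = (1/2) *\<^sub>R (p0 + q0)"
    and Vv: "\<And>v t. v \<in> H1 0 1 \<Longrightarrow> t \<in> {0..T} \<Longrightarrow>
      V t \<bullet> em 0 1 v = (1/2) *\<^sub>R (p0 + q0) \<bullet> em 0 1 v
        + prim (itv 0 T) (\<lambda>s. src V s \<bullet> em 0 1 v - D s \<bullet> dx 0 1 v) t
        + trace_at 0 1 v 1 * ((B - \<sigma>) \<bullet> ivl 0 t) + trace_at 0 1 v 0 * ((A - \<rho>) \<bullet> ivl 0 t)"
    and Dv: "\<And>v t. v \<in> H1 0 1 \<Longrightarrow> t \<in> {0..T} \<Longrightarrow>
      D t \<bullet> em 0 1 v = (1/2) *\<^sub>R (p0 - q0) \<bullet> em 0 1 v - prim (itv 0 T) V t \<bullet> dx 0 1 v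
        + trace_at 0 1 v 1 * (B \<bullet> ivl 0 t) - trace_at 0 1 v 0 * (A \<bullet> ivl 0 t)"
    by (rule weak_identities[OF supp]) (rule that, assumption+)
  note Vint = integrable_itv_continuous[OF cont(3)]
  note src = integrable_src[OF cont(3)]
  define Y where "Y t = U0 + prim (itv 0 T) V t" for t
  have Y_cont: "continuous_on {0..T} Y"
    unfolding Y_def by (intro continuous_intros itv.continuous_prim Vint)
  have Y_supp: "Y t = res 0 1 (Y t)" for t
  proof -
    have "prim (itv 0 T) V t = prim (itv 0 T) (\<lambda>s. res 0 1 (V s)) t"
      using V_supp by (intro itv.prim_cong_AE Vint integrable_bounded_linear[OF bounded_linear_res] AE_I2) auto
    also have "\<dots> = res 0 1 (prim (itv 0 T) V t)"
      by (rule itv.prim_linear[OF bounded_linear_res Vint, symmetric])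
    finally have "res 0 1 (prim (itv 0 T) V t) = prim (itv 0 T) V t" ..
    then show ?thesis
      by (simp add: Y_def res_add U0_def res_em[OF H1_L2[OF u0]])
  qed
  define u where "u t = (\<lambda>x. c0 t + D t \<bullet> ivl 0 x)" for t
  have u: "u t \<in> H1 0 1" "em 0 1 (u t) = Y t" "dx 0 1 (u t) = D t" "trace_at 0 1 (u t) 0 = c0 t" "trace_at 0 1 (u t) 1 = c1 t"
    if t: "t \<in> {0..T}" for t
  proof -
    have "D t \<bullet> em 0 1 v + Y t \<bullet> dx 0 1 v = c1 t * trace_at 0 1 v 1 - c0 t * trace_at 0 1 v 0" if v: "v \<in> H1 0 1" for v
    proof -
      have "(1/2) *\<^sub>R (p0 - q0) = dx 0 1 u0" by (simp add: p0_def q0_def flip: scaleR_2)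
      then show ?thesis
        using Dv[OF v t] H1_by_parts[OF zero_less_one u0 v]
        by (simp add: Y_def U0_def inner_add_left c0[OF t] c1[OF t] c00_def c10_def algebra_simps)
    qed
    note H1_if_by_parts[OF Y_supp D_supp[OF t] this]
    then show "u t \<in> H1 0 1" "em 0 1 (u t) = Y t" "dx 0 1 (u t) = D t" "trace_at 0 1 (u t) 0 = c0 t" "trace_at 0 1 (u t) 1 = c1 t"
      unfolding u_def by blast+
  qed
  define ut where "ut t = fn (V t)" for t
  have ut: "ut t \<in> L2 0 1" for t by (simp add: ut_def L2_fn)
  have em_ut: "em 0 1 (ut t) = V t" if "t \<in> {0..T}" for t
    using V_supp[OF that] by (simp add: ut_def em_fn)
  have cont_em: "continuous_on {0..T} (\<lambda>t. em 0 1 (u t))" "continuous_on {0..T} (\<lambda>t. dx 0 1 (u t))"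
    "continuous_on {0..T} (\<lambda>t. em 0 1 (ut t))"
    using u em_ut by (auto intro: continuous_on_eq[OF Y_cont] continuous_on_eq[OF cont(4)] continuous_on_eq[OF cont(3)])
  have uL2: "\<And>t. t \<in> {0..T} \<Longrightarrow> u t \<in> L2 0 1" using u(1) H1_L2 by blast
  note u_curve = Bochner_Linf_L2_if_continuous[OF uL2 cont_em(1)]
  note ut_curve = Bochner_Linf_L2_if_continuous[of T ut, OF ut cont_em(3)]
  have in_itv: "t \<in> space (itv 0 T) \<Longrightarrow> t \<in> {0..T}" for t by simp
  define b0 where "b0 t = trace_at 0 1 (u t) 0" for t
  define b1 where "b1 t = trace_at 0 1 (u t) 1" for t
  have trace_H1: "b \<in> H1 0 T" "dx 0 T b = res 0 T C"
    if b: "\<And>t. t \<in> {0..T} \<Longrightarrow> b t = c t" and c: "continuous_on {0..T} c" "\<And>t. t \<in> {0..T} \<Longrightarrow> c t = k + C \<bullet> ivl 0 t" for b c k C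
  proof -
    have "continuous_on {0..T} b" by (rule continuous_on_eq[OF c(1)]) (simp add: b)
    then have m: "b \<in> borel_measurable (itv 0 T)"
      by (intro borel_measurable_integrable integrable_itv_continuous)
    have "AE t in itv 0 T. b t = k + C \<bullet> ivl 0 t" using b c(2) by (intro AE_I2) simp
    then show "b \<in> H1 0 T" "dx 0 T b = res 0 T C" by (rule H1I[OF T m])+
  qed
  have AB_supp: "res 0 T A = A" "res 0 T B = B" by (simp_all add: A B vel_def res_res)
  have b0: "b0 \<in> H1 0 T" "dx 0 T b0 = A"
    using trace_H1[of b0 c0 c00 A] u(4) cont(1) c0 AB_supp by (auto simp: b0_def)
  have b1: "b1 \<in> H1 0 T" "dx 0 T b1 = B"
    using trace_H1[of b1 c1 c10 B] u(5) cont(2) c1 AB_supp by (auto simp: b1_def)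
  have b0': "AE t in itv 0 T. weak_deriv 0 T b0 t = fn A t" and b1': "AE t in itv 0 T. weak_deriv 0 T b1 t = fn B t"
    using fn_em[OF weak_deriv_some(1)[OF b0(1)]] fn_em[OF weak_deriv_some(1)[OF b1(1)]]
    by (auto simp: b0 b1 elim: eventually_mono)
  have bc: "AE t in itv 0 T. b0 t = c0 t" "AE t in itv 0 T. b1 t = c1 t"
    using u by (auto simp: b0_def b1_def intro!: AE_I2)
  have cL2: "c0 \<in> L2 0 T" "c1 \<in> L2 0 T" using cont by (auto intro: L2_continuous)
  define LA where "LA = h0 *\<^sub>R em 0 T c0 + ht1 *\<^sub>R em 0 T c1 + em 0 T g0"
  define LB where "LB = h1 *\<^sub>R em 0 T c1 + ht0 *\<^sub>R em 0 T c0 + em 0 T g1"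
  have L_supp: "res 0 T LA = LA" "res 0 T LB = LB"
    by (simp_all add: LA_def LB_def res_add res_scale res_em cL2 g0 g1)
  have A': "A = m11 *\<^sub>R (\<rho> - LA) + m12 *\<^sub>R (\<sigma> - LB)" and B': "B = m21 *\<^sub>R (\<rho> - LA) + m22 *\<^sub>R (\<sigma> - LB)"
    unfolding A B vel_def LA_def[symmetric] LB_def[symmetric] res_add res_scale res_diff
    by (simp_all only: rs[symmetric] L_supp)
  \<comment> \<open>Applying the boundary matrix to \<open>A\<close> and \<open>B\<close> cancels
    the inverse built into \<open>vel\<close> and recovers the boundary condition at 0; the same is
    done below for the end 1.\<close>
  have "(1 + lam0) *\<^sub>R A + lt1 *\<^sub>R B = ((1 + lam0) * m11 + lt1 * m21) *\<^sub>R (\<rho> - LA) + ((1 + lam0) * m12 + lt1 * m22) *\<^sub>R (\<sigma> - LB)"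
    unfolding A' B' by (simp only: scaleR_add_right scaleR_add_left scaleR_scaleR add_ac)
  then have "(1 + lam0) *\<^sub>R A + lt1 *\<^sub>R B = \<rho> - LA"
    by (simp only: mat scaleR_one scaleR_zero_left add_0_right)
  then have relA: "A - \<rho> = - (lam0 *\<^sub>R A + lt1 *\<^sub>R B + LA)"
    by (simp add: scaleR_add_left algebra_simps)
  have "lt0 *\<^sub>R A + (1 + lam1) *\<^sub>R B = (lt0 * m11 + (1 + lam1) * m21) *\<^sub>R (\<rho> - LA) + (lt0 * m12 + (1 + lam1) * m22) *\<^sub>R (\<sigma> - LB)"
    unfolding A' B' by (simp only: scaleR_add_right scaleR_add_left scaleR_scaleR add_ac)
  then have "lt0 *\<^sub>R A + (1 + lam1) *\<^sub>R B = \<sigma> - LB"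
    by (simp only: mat scaleR_one scaleR_zero_left add_0_left)
  then have relB: "B - \<sigma> = - (lam1 *\<^sub>R B + lt0 *\<^sub>R A + LB)"
    by (simp add: scaleR_add_left algebra_simps)
  have fn_lin: "AE t in itv 0 T. fn (- (k *\<^sub>R X + l *\<^sub>R Z + (m *\<^sub>R em 0 T v + n *\<^sub>R em 0 T w + em 0 T g))) t
      = - (k * fn X t + l * fn Z t + (m * v t + n * w t + g t))"
    if "v \<in> L2 0 T" "w \<in> L2 0 T" "g \<in> L2 0 T" for k l m n X Z v w g
  proof -
    let ?E = "m *\<^sub>R em 0 T v + n *\<^sub>R em 0 T w + em 0 T g"
    have "AE t in lborel. fn (- (k *\<^sub>R X + l *\<^sub>R Z + ?E)) t
        = - (k * fn X t + l * fn Z t + (m * fn (em 0 T v) t + n * fn (em 0 T w) t + fn (em 0 T g) t))"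
      using fn_uminus[of "k *\<^sub>R X + l *\<^sub>R Z + ?E"] fn_add[of "k *\<^sub>R X + l *\<^sub>R Z" ?E] fn_add[of "k *\<^sub>R X" "l *\<^sub>R Z"]
        fn_scaleR[of k X] fn_scaleR[of l Z] fn_add[of "m *\<^sub>R em 0 T v + n *\<^sub>R em 0 T w" "em 0 T g"]
        fn_add[of "m *\<^sub>R em 0 T v" "n *\<^sub>R em 0 T w"] fn_scaleR[of m "em 0 T v"] fn_scaleR[of n "em 0 T w"]
      by eventually_elim simp
    then have "AE t in itv 0 T. fn (- (k *\<^sub>R X + l *\<^sub>R Z + ?E)) t
        = - (k * fn X t + l * fn Z t + (m * fn (em 0 T v) t + n * fn (em 0 T w) t + fn (em 0 T g) t))"
      unfolding AE_itv_iff by eventually_elim simp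
    with fn_em[OF that(1)] fn_em[OF that(2)] fn_em[OF that(3)] show ?thesis
      by eventually_elim simp
  qed
  have fnA: "AE t in itv 0 T. fn (A - \<rho>) t = - (lam0 * fn A t + lt1 * fn B t + (h0 * c0 t + ht1 * c1 t + g0 t))"
    unfolding relA LA_def by (rule fn_lin[OF cL2 g0])
  have fnB: "AE t in itv 0 T. fn (B - \<sigma>) t = - (lam1 * fn B t + lt0 * fn A t + (h1 * c1 t + ht0 * c0 t + g1 t))"
    unfolding relB LB_def by (rule fn_lin[OF cL2(2,1) g1])
  have initial: "has_initial_value T u u0"
    unfolding has_initial_value_def
  proof (intro exI[of _ u] conjI ballI)
    show "u t \<in> L2 0 1" "((\<lambda>s. L2_norm 0 1 (\<lambda>x. u s x - u t x)) \<longlongrightarrow> 0) (at t within {0..T})" if "t \<in> {0..T}" for t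
      using that uL2 u_curve(2) by auto
    show "AE t in itv 0 T. ae_eq 0 1 (u t) (u t)" by (simp add: ae_eq_def)
    have "em 0 1 (u 0) = em 0 1 u0" using u(2)[of 0] T by (simp add: Y_def prim_itv_start U0_def)
    then show "ae_eq 0 1 (u 0) u0" using em_eq_iff[OF uL2 H1_L2[OF u0], of 0] T by simp
  qed
  have initial': "has_weak_initial_value T ut u1"
    unfolding has_weak_initial_value_def
  proof (intro exI[of _ ut] conjI ballI)
    show "continuous_on {0..T} (\<lambda>t. L2_inner 0 1 (ut t) v)" if "v \<in> L2 0 1" for v
      unfolding inner_em[OF ut that, symmetric] by (intro continuous_intros cont_em)
    have "em 0 1 (ut 0) = em 0 1 u1"
      using em_ut[of 0] T by (simp add: V0 p0_def q0_def flip: scaleR_2)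
    then show "ae_eq 0 1 (ut 0) u1" using em_eq_iff[OF ut u1] by simp
  qed (use ut in \<open>auto simp: ae_eq_def\<close>)
  have time_deriv: "has_weak_time_deriv T u ut"
    unfolding has_weak_time_deriv_def
  proof
    fix v assume v: "v \<in> L2 0 1"
    have VI: "integrable (itv 0 T) (\<lambda>t. V t \<bullet> em 0 1 v)" using Vint by simp
    have eq: "AE t in itv 0 T. L2_inner 0 1 (ut t) v = V t \<bullet> em 0 1 v"
      using em_ut by (intro AE_I2) (simp add: inner_em[OF ut v, symmetric])
    note I = integrable_itv_cong_AE[OF VI eq]
    show "has_weak_deriv 0 T (\<lambda>t. L2_inner 0 1 (u t) v) (\<lambda>t. L2_inner 0 1 (ut t) v)"
    proof (rule has_weak_deriv_prim[OF I])
      have eq': "AE t in itv 0 T. L2_inner 0 1 (u t) v = Y t \<bullet> em 0 1 v"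
        using u(2) uL2 by (intro AE_I2) (simp add: inner_em[OF _ v, symmetric])
      have "continuous_on {0..T} (\<lambda>t. Y t \<bullet> em 0 1 v)" by (intro continuous_intros Y_cont)
      from borel_measurable_integrable[OF integrable_itv_continuous[OF this]]
      show "(\<lambda>t. L2_inner 0 1 (u t) v) \<in> borel_measurable (itv 0 T)"
        by (rule itv_measurable_AE_cong[OF _ eq'])
      have "prim (itv 0 T) (\<lambda>t. L2_inner 0 1 (ut t) v) t = prim (itv 0 T) (\<lambda>t. V t \<bullet> em 0 1 v) t" for t
        by (rule itv.prim_cong_AE[OF I VI]) (use eq in \<open>auto elim: eventually_mono\<close>)
      with eq' show "AE t in itv 0 T. L2_inner 0 1 (u t) v = U0 \<bullet> em 0 1 v + prim (itv 0 T) (\<lambda>t. L2_inner 0 1 (ut t) v) t"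
        by (auto simp: Y_def inner_add_left itv.prim_inner[OF Vint] elim: eventually_mono)
    qed
  qed
  have equation: "- (LINT t|itv 0 T. L2_inner 0 1 (ut t) v * deriv \<phi> t)
     + (LINT t|itv 0 T.
          (bilin h0 h1 (u t) v
           + (lam0 * weak_deriv 0 T b0 t + ht1 * b1 t + lt1 * weak_deriv 0 T b1 t) * trace_at 0 1 v 0
           + (lam1 * weak_deriv 0 T b1 t + ht0 * b0 t + lt0 * weak_deriv 0 T b0 t) * trace_at 0 1 v 1
           + L2_inner 0 1 (\<lambda>x. K * u t x + lam * ut t x) v) * \<phi> t)
     = (LINT t|itv 0 T. (- g0 t * trace_at 0 1 v 0 - g1 t * trace_at 0 1 v 1 + L2_inner 0 1 (f t) v) * \<phi> t)"
    if v: "v \<in> H1 0 1" and \<phi>: "\<phi> \<in> test_fun 0 T" for v \<phi>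
  proof -
    let ?e = "em 0 1 v" and ?g = "dx 0 1 v" and ?va = "trace_at 0 1 v 0" and ?vb = "trace_at 0 1 v 1"
    have re: "res 0 1 ?e = ?e" by (rule res_em[OF H1_L2[OF v]])
    \<comment> \<open>The weak time derivative of the pairing of \<open>u\<^sub>t\<close> with
      \<open>v\<close>, read off from the first of the \<open>weak_identities\<close>: pairings with
      \<open>ivl 0 t\<close> are primitives of the representatives.\<close>
    define w where "w t = src V t \<bullet> ?e - D t \<bullet> ?g + ?vb * fn (B - \<sigma>) t + ?va * fn (A - \<rho>) t" for t
    define X where "X t = bilin h0 h1 (u t) v
           + (lam0 * weak_deriv 0 T b0 t + ht1 * b1 t + lt1 * weak_deriv 0 T b1 t) * ?va
           + (lam1 * weak_deriv 0 T b1 t + ht0 * b0 t + lt0 * weak_deriv 0 T b0 t) * ?vb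
           + L2_inner 0 1 (\<lambda>x. K * u t x + lam * ut t x) v" for t
    define Z where "Z t = - g0 t * ?va - g1 t * ?vb + L2_inner 0 1 (f t) v" for t
    have ints: "integrable (itv 0 T) (\<lambda>t. src V t \<bullet> ?e)" "integrable (itv 0 T) (\<lambda>t. D t \<bullet> ?g)"
      "integrable (itv 0 T) (fn (B - \<sigma>))" "integrable (itv 0 T) (fn (A - \<rho>))"
      using src integrable_itv_continuous[OF cont(4)] by (auto intro: L2_integrable L2_fn)
    have w: "integrable (itv 0 T) w" unfolding w_def using ints by simp
    have weak: "has_weak_deriv 0 T (\<lambda>t. L2_inner 0 1 (ut t) v) w"
    proof (rule has_weak_deriv_prim[OF w])
      have eq: "AE t in itv 0 T. L2_inner 0 1 (ut t) v = V t \<bullet> ?e"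
        using em_ut by (intro AE_I2) (simp add: inner_em[OF ut H1_L2[OF v], symmetric])
      have "(\<lambda>t. V t \<bullet> ?e) \<in> borel_measurable (itv 0 T)" using Vint by auto
      then show "(\<lambda>t. L2_inner 0 1 (ut t) v) \<in> borel_measurable (itv 0 T)"
        by (rule itv_measurable_AE_cong[OF _ eq])
      show "AE t in itv 0 T. L2_inner 0 1 (ut t) v = (1/2) *\<^sub>R (p0 + q0) \<bullet> ?e + prim (itv 0 T) w t"
        using eq AE_space[of "itv 0 T"]
      proof eventually_elim
        case (elim t)
        then have t: "t \<in> {0..T}" by simp
        have "prim (itv 0 T) w t = prim (itv 0 T) (\<lambda>s. src V s \<bullet> ?e - D s \<bullet> ?g) t
            + ?vb * prim (itv 0 T) (fn (B - \<sigma>)) t + ?va * prim (itv 0 T) (fn (A - \<rho>)) t"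
          unfolding w_def using ints by (simp add: itv.prim_add itv.prim_cmult)
        then show ?case using Vv[OF v t] elim(1) t by (simp add: prim_fn_eq_inner)
      qed
    qed
    have Z_AE: "AE t in itv 0 T. Z t = - g0 t * ?va - g1 t * ?vb + em 0 1 (f t) \<bullet> ?e"
      using L2_inner_em_AE[OF fL2 H1_L2[OF v]] by (auto simp: Z_def elim: eventually_mono)
    have "integrable (itv 0 T) (\<lambda>t. - g0 t * ?va - g1 t * ?vb + em 0 1 (f t) \<bullet> ?e)"
      using L2_integrable[OF g0] L2_integrable[OF g1] Bochner_L1_integrable[OF fB] by auto
    then have Z: "integrable (itv 0 T) Z" by (rule integrable_itv_cong_AE[OF _ Z_AE])
    \<comment> \<open>The boundary relations for \<open>A - \<rho>\<close> and
      \<open>B - \<sigma>\<close> enter here and turn the fluxes in \<open>w\<close> into the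
      boundary terms of the equation.\<close>
    have X_eq: "AE t in itv 0 T. X t = Z t - w t"
      using Z_AE bc b0' b1' fnA fnB AE_space[of "itv 0 T"]
    proof eventually_elim
      case (elim t)
      then have t: "t \<in> {0..T}" by simp
      have 1: "bilin h0 h1 (u t) v = D t \<bullet> ?g + h0 * c0 t * ?va + h1 * c1 t * ?vb"
        using u[OF t] weak_deriv_some(1)[OF u(1)[OF t]] weak_deriv_some(1)[OF v]
        by (simp add: bilin_def flip: inner_em)
      have 2: "L2_inner 0 1 (\<lambda>x. K * u t x + lam * ut t x) v = K * (Y t \<bullet> ?e) + lam * (V t \<bullet> ?e)"
        using L2_lincomb[OF uL2[OF t] ut, of K lam t] u(2)[OF t] em_ut[OF t]
        by (simp add: inner_add_left H1_L2 v flip: inner_em)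
      have 3: "src V t \<bullet> ?e = em 0 1 (f t) \<bullet> ?e - (K * (Y t \<bullet> ?e) + lam * (V t \<bullet> ?e))"
        by (simp add: src_def F_def Y_def inner_diff_left inner_res re inner_add_left)
      show ?case unfolding X_def w_def 1 2 3 elim(1-7) by (simp add: algebra_simps)
    qed
    have c\<phi>: "continuous_on {0..T} \<phi>" by (intro smooth_continuous_on test_fun_smooth[OF \<phi>])
    note w\<phi> = integrable_mult_continuous[OF w c\<phi>] and Z\<phi> = integrable_mult_continuous[OF Z c\<phi>]
    have "(LINT t|itv 0 T. X t * \<phi> t) = (LINT t|itv 0 T. Z t * \<phi> t - w t * \<phi> t)"
    proof (rule integral_itv_cong_AE)
      show "(\<lambda>t. Z t * \<phi> t - w t * \<phi> t) \<in> borel_measurable (itv 0 T)" using w\<phi> Z\<phi> by simp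
      show "AE t in itv 0 T. X t * \<phi> t = Z t * \<phi> t - w t * \<phi> t"
        using X_eq by eventually_elim (simp add: left_diff_distrib)
    qed
    also have "\<dots> = (LINT t|itv 0 T. Z t * \<phi> t) - (LINT t|itv 0 T. w t * \<phi> t)"
      by (rule Bochner_Integration.integral_diff[OF Z\<phi> w\<phi>])
    also have "(LINT t|itv 0 T. w t * \<phi> t) = - (LINT t|itv 0 T. L2_inner 0 1 (ut t) v * deriv \<phi> t)"
      using weak \<phi> by (simp add: has_weak_deriv_def)
    finally show ?thesis unfolding X_def Z_def by simp
  qed
  have "weak_solution T h0 h1 lam0 lam1 K lam ht0 ht1 lt0 lt1 g0 g1 f u0 u1 u"
    unfolding weak_solution_def Let_def
  proof (intro conjI bexI[of _ ut] ballI)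
    show "u \<in> Bochner_Linf T (H1 0 1) (H1_norm 0 1)"
      by (rule Bochner_Linf_H1_if_continuous[OF u(1) cont_em(1,2)])
    show "(\<lambda>t. trace_at 0 1 (u t) 0) \<in> H1 0 T" "(\<lambda>t. trace_at 0 1 (u t) 1) \<in> H1 0 T"
      using b0(1) b1(1) by (simp_all only: b0_def[abs_def] b1_def[abs_def])
    show "ut \<in> Bochner_Linf T (L2 0 1) (L2_norm 0 1)" by (rule ut_curve(1))
  qed (rule initial initial' time_deriv equation[unfolded b0_def[abs_def] b1_def[abs_def]], assumption?, assumption?)+
  then show ?thesis by blast
qed

section \<open>Uniqueness\<close>

lemma norm_lsq_mono:
  assumes "AE x in lborel. \<bar>fn y x\<bar> \<le> \<bar>fn z x\<bar>"
  shows "norm y \<le> norm z"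
proof (rule power2_le_imp_le)
  have sq: "integrable lborel (\<lambda>x. (fn w x)\<^sup>2)" for w using fn_sq_int[of w] by (simp add: sq_int_def)
  show "(norm y)\<^sup>2 \<le> (norm z)\<^sup>2"
    unfolding norm_sq_lsq
    by (rule integral_mono_AE[OF sq sq]) (use assms in \<open>auto simp: abs_le_square_iff elim: eventually_mono\<close>)
qed simp

text \<open>A ramp with value 1 at the end \<open>c\<close> that reaches 0 at distance
  \<open>e\<close>. Integration by parts against it isolates the trace at \<open>c\<close>, and
  \<open>e\<close> balances the size of the ramp against its slope.\<close>

lemma hat_function:
  assumes e: "0 < e" "e < 1" and c: "c = 0 \<or> c = 1"
  obtains \<psi> where "\<psi> \<in> H1 0 1" "norm (em 0 1 \<psi>) \<le> sqrt e" "norm (dx 0 1 \<psi>) \<le> 1 / sqrt e"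
    "\<And>v. v \<in> H1 0 1 \<Longrightarrow> \<bar>trace_at 0 1 v c\<bar> = \<bar>dx 0 1 v \<bullet> em 0 1 \<psi> + em 0 1 v \<bullet> dx 0 1 \<psi>\<bar>"
proof -
  \<comment> \<open>\<open>k\<close> is the value of the ramp at 0 and (l, r) the stretch of length
    \<open>e\<close> next to \<open>c\<close> where it is not constant; \<open>a\<close> is its
    slope there.\<close>
  obtain k l r :: real where klr: "(c = 0 \<and> k = 1 \<and> l = 0 \<and> r = e) \<or> (c = 1 \<and> k = 0 \<and> l = 1 - e \<and> r = (1::real))"
    using c by blast
  define a where "a = (if c = 0 then - (1 / e) else 1 / e)"
  define \<psi> where "\<psi> x = k + (a *\<^sub>R ivl l r) \<bullet> ivl 0 x" for x
  have "continuous_on {0..1} \<psi>" unfolding \<psi>_def by (intro continuous_intros continuous_inner_ivl)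
  then have m: "\<psi> \<in> borel_measurable (itv 0 1)"
    by (intro borel_measurable_integrable integrable_itv_continuous)
  have AE: "AE x in itv 0 1. \<psi> x = k + (a *\<^sub>R ivl l r) \<bullet> ivl 0 x" by (simp add: \<psi>_def)
  note H = H1I[OF zero_less_one m AE]
  have lr: "0 \<le> l" "r \<le> 1" "r - l = e" using klr e by auto
  have dx: "dx 0 1 \<psi> = a *\<^sub>R ivl l r" using H(2) lr by (simp add: res_scale res_ivl)
  have val: "\<psi> x = k + a * max 0 (min r x - l)" if "0 \<le> x" for x
    using lr that by (simp add: \<psi>_def inner_ivl_ivl)
  have tr: "trace_at 0 1 \<psi> z = \<psi> z" if "z \<in> {0..1}" for z by (rule trans[OF H(3)[OF that] \<psi>_def[symmetric]])
  have t01: "trace_at 0 1 \<psi> 0 = k" "trace_at 0 1 \<psi> 1 = 1 - k"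
    using klr e tr[of 0] tr[of 1] val[of 0] val[of 1] by (auto simp: a_def)
  show ?thesis
  proof (rule that[OF H(1)])
    show "norm (dx 0 1 \<psi>) \<le> 1 / sqrt e"
      unfolding dx using lr e by (simp add: norm_ivl a_def real_div_sqrt field_simps)
    have ptw: "\<bar>\<psi> x\<bar> \<le> indicat_real {l<..<r} x" if "0 < x" "x < 1" "x \<noteq> l" "x \<noteq> r" for x
    proof (cases "c = 0")
      case True
      then have "\<psi> x = 1 - min e x / e" "l = 0" "r = e" using klr val[of x] that e by (auto simp: a_def)
      then show ?thesis using that e by (cases "x < e") (auto simp: indicator_def min_def)
    next
      case False
      then have "\<psi> x = max 0 (x - l) / e" "l = 1 - e" "r = 1" using klr val[of x] that c by (auto simp: a_def)
      then show ?thesis using that e by (cases "x < l") (auto simp: indicator_def max_def)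
    qed
    have "AE x in lborel. \<bar>fn (em 0 1 \<psi>) x\<bar> \<le> \<bar>fn (ivl l r) x\<bar>"
      using fn_em_H1[OF H(1)] fn_ivl[of l r] AE_lborel_singleton[of l] AE_lborel_singleton[of r]
    proof eventually_elim
      case (elim x)
      have "fn (em 0 1 \<psi>) x = indicat_real {0<..<1} x * \<psi> x"
        unfolding elim(1) t01 dx by (simp add: \<psi>_def)
      then show ?case using ptw[of x] elim(2-4) by (cases "0 < x \<and> x < 1") auto
    qed
    from norm_lsq_mono[OF this] show "norm (em 0 1 \<psi>) \<le> sqrt e"
      using lr e by (simp add: norm_ivl)
    fix v assume v: "v \<in> H1 0 1"
    show "\<bar>trace_at 0 1 v c\<bar> = \<bar>dx 0 1 v \<bullet> em 0 1 \<psi> + em 0 1 v \<bullet> dx 0 1 \<psi>\<bar>"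
      unfolding H1_by_parts[OF zero_less_one v H(1)] t01 using klr by auto
  qed
qed

lemma trace_bound:
  assumes v: "v \<in> H1 0 1" and e: "0 < e" "e < 1" and c: "c = 0 \<or> c = 1"
  shows "\<bar>trace_at 0 1 v c\<bar> \<le> norm (dx 0 1 v) * sqrt e + norm (em 0 1 v) / sqrt e"
proof -
  obtain \<psi> where \<psi>: "\<psi> \<in> H1 0 1" "norm (em 0 1 \<psi>) \<le> sqrt e" "norm (dx 0 1 \<psi>) \<le> 1 / sqrt e"
    "\<bar>trace_at 0 1 v c\<bar> = \<bar>dx 0 1 v \<bullet> em 0 1 \<psi> + em 0 1 v \<bullet> dx 0 1 \<psi>\<bar>"
    using hat_function[OF e c] v by metis
  have "\<bar>trace_at 0 1 v c\<bar> \<le> \<bar>dx 0 1 v \<bullet> em 0 1 \<psi>\<bar> + \<bar>em 0 1 v \<bullet> dx 0 1 \<psi>\<bar>"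
    unfolding \<psi>(4) by (rule abs_triangle_ineq)
  also have "\<dots> \<le> norm (dx 0 1 v) * norm (em 0 1 \<psi>) + norm (em 0 1 v) * norm (dx 0 1 \<psi>)"
    by (intro add_mono Cauchy_Schwarz_ineq2)
  also have "\<dots> \<le> norm (dx 0 1 v) * sqrt e + norm (em 0 1 v) * (1 / sqrt e)"
    using \<psi> by (intro add_mono mult_left_mono) auto
  finally show ?thesis by simp
qed

text \<open>The positive part of \<open>g - c\<close> is continuous and zero almost everywhere,
  hence zero also at time 0.\<close>

lemma AE_le_imp_le_start:
  assumes T: "0 < T" and g: "continuous_on {0..T} (g :: real \<Rightarrow> real)" and le: "AE t in itv 0 T. g t \<le> c"
  shows "g 0 \<le> c"
proof -
  have "max (g 0 - c) 0 = 0"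
    by (rule ae_eq_continuous_imp_eq[OF T, where v="\<lambda>t. max (g t - c) 0" and w="\<lambda>t. 0"])
      (use T g le in \<open>auto intro!: continuous_intros elim: eventually_mono\<close>)
  then show ?thesis by simp
qed

text \<open>
  Interpolates between convergence in \<open>L\<^sup>2\<close> and boundedness in \<open>H\<^sup>1\<close>: by \<open>trace_bound\<close> the distance of the
  traces is at most a constant times \<open>sqrt e\<close> plus a term that vanishes at time 0; then \<open>e\<close> tends to 0.
\<close>

lemma trace_initial:
  assumes T: "0 < T" and u0: "u0 \<in> H1 0 1" and c: "c = 0 \<or> c = 1"
    and u: "AE t in itv 0 T. u t \<in> H1 0 1" "AE t in itv 0 T. em 0 1 (u t) = Y t" "AE t in itv 0 T. norm (dx 0 1 (u t)) \<le> C"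
    and Y: "continuous_on {0..T} Y" "Y 0 = em 0 1 u0"
    and b: "continuous_on {0..T} b" "AE t in itv 0 T. trace_at 0 1 (u t) c = b t"
  shows "b 0 = trace_at 0 1 u0 c"
proof -
  define k where "k = trace_at 0 1 u0 c"
  define C' where "C' = C + norm (dx 0 1 u0)"
  have c01: "c \<in> {0..1}" using c by auto
  have bound: "\<bar>b 0 - k\<bar> \<le> C' * sqrt e" if e: "0 < e" "e < 1" for e
  proof -
    have "AE t in itv 0 T. \<bar>b t - k\<bar> - norm (Y t - em 0 1 u0) / sqrt e \<le> C' * sqrt e"
      using u b(2)
    proof eventually_elim
      case (elim t)
      have "\<bar>b t - k\<bar> \<le> norm (dx 0 1 (u t) - dx 0 1 u0) * sqrt e + norm (Y t - em 0 1 u0) / sqrt e"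
        using trace_bound[OF H1_diff(1)[OF zero_less_one elim(1) u0] e c] elim
          H1_diff(2,3)[OF zero_less_one elim(1) u0] L2_diff(2)[OF H1_L2[OF elim(1)] H1_L2[OF u0]] c01
        by (simp add: k_def)
      moreover have "norm (dx 0 1 (u t) - dx 0 1 u0) * sqrt e \<le> C' * sqrt e"
        using elim(3) norm_triangle_ineq4[of "dx 0 1 (u t)" "dx 0 1 u0"] e
        by (intro mult_right_mono) (auto simp: C'_def)
      ultimately show ?case by simp
    qed
    then have "\<bar>b 0 - k\<bar> - norm (Y 0 - em 0 1 u0) / sqrt e \<le> C' * sqrt e"
      by (intro AE_le_imp_le_start[OF T, where g="\<lambda>t. \<bar>b t - k\<bar> - norm (Y t - em 0 1 u0) / sqrt e"])
        (use b(1) Y(1) e in \<open>auto intro!: continuous_intros\<close>)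
    then show ?thesis by (simp add: Y(2))
  qed
  have "((\<lambda>e. C' * sqrt e) \<longlongrightarrow> C' * sqrt 0) (at_right 0)"
    by (intro tendsto_intros)
  moreover have "\<forall>\<^sub>F e in at_right (0::real). \<bar>b 0 - k\<bar> \<le> C' * sqrt e"
    using eventually_at_right_real[of 0 1] by (auto intro: bound elim!: eventually_mono)
  ultimately have "\<bar>b 0 - k\<bar> \<le> C' * sqrt 0"
    by (intro tendsto_lowerbound[where F="at_right 0"]) auto
  then show ?thesis by (simp add: k_def)
qed

section \<open>The equation integrated once in time\<close>

lemma AE_L2I:
  assumes L2: "\<And>t. t \<in> space (itv 0 T) \<Longrightarrow> U t \<in> L2 0 1" and "AE t in itv 0 T. ae_eq 0 1 (U t) (u t)" "AE t in itv 0 T. u t \<in> L2 0 1"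
  shows "AE t in itv 0 T. em 0 1 (U t) = em 0 1 (u t)"
  using assms(2,3) AE_space[of "itv 0 T"] by eventually_elim (simp add: em_eq_iff L2)

lemma Linf_integrable:
  fixes h :: "real \<Rightarrow> 'a::{banach, second_countable_topology}"
  assumes "h \<in> borel_measurable (itv 0 T)" "AE t in itv 0 T. norm (h t) \<le> N (u t)" "AE t in itv 0 T. N (u t) \<le> C"
  shows "integrable (itv 0 T) h" "AE t in itv 0 T. norm (h t) \<le> C"
proof -
  show 1: "AE t in itv 0 T. norm (h t) \<le> C" using assms(2,3) by eventually_elim simp
  show "integrable (itv 0 T) h" by (rule integrable_itv_bounded[OF assms(1) 1])
qed

text \<open>The weak derivative determines the function up to a constant; the continuous
  representative fixes that constant by its value at time 0.\<close>

lemma weak_deriv_initial: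
  assumes T: "0 < T" and p: "integrable (itv 0 T) p" and y: "integrable (itv 0 T) y" and weak: "has_weak_deriv 0 T y p"
    and W: "continuous_on {0..T} W" "AE t in itv 0 T. W t = y t" and t: "t \<in> {0..T}"
  shows "W t = W 0 + prim (itv 0 T) p t"
proof -
  obtain c where c: "AE t in itv 0 T. y t = c + prim (itv 0 T) p t"
    using has_weak_deriv_iff[OF T y p] weak by blast
  have eq: "AE t in itv 0 T. W t = c + prim (itv 0 T) p t" using W(2) c by eventually_elim simp
  have cont: "continuous_on {0..T} (\<lambda>t. c + prim (itv 0 T) p t)"
    by (intro continuous_intros itv.continuous_prim p)
  note all = ae_eq_continuous_imp_eq[OF T W(1) cont eq]
  from all[OF t] all[of 0] T show ?thesis by (simp add: prim_itv_start)
qed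

text \<open>The result no longer involves test functions of time and holds at every \<open>t\<close>
  for the weakly continuous representative \<open>W\<close> of the velocity. Boundary velocities
  appear only through their primitives \<open>\<beta>0 \<bullet> ivl 0 t\<close> and
  \<open>\<beta>1 \<bullet> ivl 0 t\<close>; \<open>trace_initial\<close> makes the traces start at
  those of \<open>u0\<close>, so that the initial data cancel for a difference of solutions.\<close>

theorem weak_solution_integrated:
  assumes T: "0 < T" and g0: "g0 \<in> L2 0 T" and g1: "g1 \<in> L2 0 T"
    and fB: "f \<in> Bochner_L1 T (L2 0 1) (L2_norm 0 1)"
    and u0: "u0 \<in> H1 0 1" and u1: "u1 \<in> L2 0 1"
    and sol: "weak_solution T h0 h1 lam0 lam1 K lam ht0 ht1 lt0 lt1 g0 g1 f u0 u1 u"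
  obtains z W :: "real \<Rightarrow> lsq" and \<beta>0 \<beta>1 :: lsq
  where "integrable (itv 0 T) (\<lambda>t. em 0 1 (u t))" "integrable (itv 0 T) (\<lambda>t. dx 0 1 (u t))" "integrable (itv 0 T) z"
    and "AE t in itv 0 T. u t \<in> H1 0 1" "AE t in itv 0 T. em 0 1 (u t) = em 0 1 u0 + prim (itv 0 T) z t"
    and "AE t in itv 0 T. trace_at 0 1 (u t) 0 = trace_at 0 1 u0 0 + \<beta>0 \<bullet> ivl 0 t"
    and "AE t in itv 0 T. trace_at 0 1 (u t) 1 = trace_at 0 1 u0 1 + \<beta>1 \<bullet> ivl 0 t"
    and "AE t in itv 0 T. W t = z t"
    and "\<And>v t. v \<in> H1 0 1 \<Longrightarrow> t \<in> {0..T} \<Longrightarrow> W t \<bullet> em 0 1 v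
      = em 0 1 u1 \<bullet> em 0 1 v
        + prim (itv 0 T) (\<lambda>t. - g0 t * trace_at 0 1 v 0 - g1 t * trace_at 0 1 v 1 + L2_inner 0 1 (f t) v) t
        - (prim (itv 0 T) (\<lambda>t. dx 0 1 (u t)) t \<bullet> dx 0 1 v
           + (h0 * prim (itv 0 T) (\<lambda>t. trace_at 0 1 u0 0 + \<beta>0 \<bullet> ivl 0 t) t + lam0 * (\<beta>0 \<bullet> ivl 0 t)
              + ht1 * prim (itv 0 T) (\<lambda>t. trace_at 0 1 u0 1 + \<beta>1 \<bullet> ivl 0 t) t + lt1 * (\<beta>1 \<bullet> ivl 0 t)) * trace_at 0 1 v 0
           + (h1 * prim (itv 0 T) (\<lambda>t. trace_at 0 1 u0 1 + \<beta>1 \<bullet> ivl 0 t) t + lam1 * (\<beta>1 \<bullet> ivl 0 t)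
              + ht0 * prim (itv 0 T) (\<lambda>t. trace_at 0 1 u0 0 + \<beta>0 \<bullet> ivl 0 t) t + lt0 * (\<beta>0 \<bullet> ivl 0 t)) * trace_at 0 1 v 1
           + K * (prim (itv 0 T) (\<lambda>t. em 0 1 (u t)) t \<bullet> em 0 1 v) + lam * (prim (itv 0 T) z t \<bullet> em 0 1 v))"
proof -
  define b0 where "b0 t = trace_at 0 1 (u t) 0" for t
  define b1 where "b1 t = trace_at 0 1 (u t) 1" for t
  define b0' where "b0' = weak_deriv 0 T b0"
  define b1' where "b1' = weak_deriv 0 T b1"
  obtain ut where uB: "u \<in> Bochner_Linf T (H1 0 1) (H1_norm 0 1)" and b0: "b0 \<in> H1 0 T" and b1: "b1 \<in> H1 0 T"
    and init: "has_initial_value T u u0" and utB: "ut \<in> Bochner_Linf T (L2 0 1) (L2_norm 0 1)"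
    and deriv: "has_weak_time_deriv T u ut" and init': "has_weak_initial_value T ut u1"
    and eqn: "\<And>v \<phi>. v \<in> H1 0 1 \<Longrightarrow> \<phi> \<in> test_fun 0 T \<Longrightarrow>
               - (LINT t|itv 0 T. L2_inner 0 1 (ut t) v * deriv \<phi> t)
               + (LINT t|itv 0 T.
                    (bilin h0 h1 (u t) v
                     + (lam0 * b0' t + ht1 * b1 t + lt1 * b1' t) * trace_at 0 1 v 0
                     + (lam1 * b1' t + ht0 * b0 t + lt0 * b0' t) * trace_at 0 1 v 1
                     + L2_inner 0 1 (\<lambda>x. K * u t x + lam * ut t x) v) * \<phi> t)
               = (LINT t|itv 0 T.
                    (- g0 t * trace_at 0 1 v 0 - g1 t * trace_at 0 1 v 1 + L2_inner 0 1 (f t) v) * \<phi> t)"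
    using sol unfolding weak_solution_def Let_def b0'_def b1'_def b0_def[abs_def] b1_def[abs_def] by blast
  let ?M = "itv 0 T"
  define y where "y t = em 0 1 (u t)" for t
  define d where "d t = dx 0 1 (u t)" for t
  define z where "z t = em 0 1 (ut t)" for t
  have uS: "strongly_measurable T (H1 0 1) (H1_norm 0 1) u" and utS: "strongly_measurable T (L2 0 1) (L2_norm 0 1) ut"
    using uB utB by (auto simp: Bochner_Linf_def)
  have uH1: "AE t in ?M. u t \<in> H1 0 1" and utL2: "AE t in ?M. ut t \<in> L2 0 1"
    using strongly_measurable_AE[OF uS] strongly_measurable_AE[OF utS] .
  have uL2: "AE t in ?M. u t \<in> L2 0 1" using uH1 by eventually_elim (rule H1_L2)
  obtain C C' where C: "AE t in ?M. H1_norm 0 1 (u t) \<le> C" "AE t in ?M. L2_norm 0 1 (ut t) \<le> C'"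
    using uB utB by (auto simp: Bochner_Linf_def)
  have "AE t in ?M. norm (y t) \<le> H1_norm 0 1 (u t)" "AE t in ?M. norm (d t) \<le> H1_norm 0 1 (u t)"
    using uH1 by (auto elim!: eventually_mono simp: H1_norm_eq y_def d_def intro!: real_le_rsqrt)
  then have y: "integrable ?M y" and d: "integrable ?M d" and d_bound: "AE t in ?M. norm (d t) \<le> C"
    using H1_curve_measurable[OF uS] C(1) by (auto simp: y_def[abs_def] d_def[abs_def] intro!: Linf_integrable[where N="H1_norm 0 1" and u=u and C=C])
  have "AE t in ?M. norm (z t) \<le> L2_norm 0 1 (ut t)"
    using utL2 by eventually_elim (simp add: z_def norm_em)
  then have z: "integrable ?M z"
    using L2_curve_measurable[OF utS] C(2) by (auto simp: z_def[abs_def] intro!: Linf_integrable(1)[where N="L2_norm 0 1" and u=ut and C=C'])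
  have z_supp: "AE t in ?M. z t = res 0 1 (z t)" using utL2 by eventually_elim (simp add: z_def res_em)
  have y_inner: "AE t in ?M. L2_inner 0 1 (u t) v = y t \<bullet> em 0 1 v" if "v \<in> L2 0 1" for v
    using L2_inner_em_AE[OF uL2 that] by (simp add: y_def)
  have z_inner: "AE t in ?M. L2_inner 0 1 (ut t) v = z t \<bullet> em 0 1 v" if "v \<in> L2 0 1" for v
    using L2_inner_em_AE[OF utL2 that] by (simp add: z_def)
  obtain U where U: "\<And>t. t \<in> {0..T} \<Longrightarrow> U t \<in> L2 0 1"
      "\<And>t. t \<in> {0..T} \<Longrightarrow> ((\<lambda>s. L2_norm 0 1 (\<lambda>x. U s x - U t x)) \<longlongrightarrow> 0) (at t within {0..T})"
      "AE t in ?M. ae_eq 0 1 (U t) (u t)" "ae_eq 0 1 (U 0) u0"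
    using init unfolding has_initial_value_def by blast
  have U0: "em 0 1 (U 0) = em 0 1 u0" using em_eq_iff[OF U(1) H1_L2[OF u0], of 0] U(4) T by simp
  have UAE: "AE t in ?M. em 0 1 (U t) = y t"
    unfolding y_def by (rule AE_L2I[OF U(1) U(3) uL2]) simp
  have U_cont: "continuous_on {0..T} (\<lambda>t. em 0 1 (U t))"
    unfolding continuous_on_def
  proof
    fix t assume t: "t \<in> {0..T}"
    have "\<forall>\<^sub>F s in at t within {0..T}. L2_norm 0 1 (\<lambda>x. U s x - U t x) = norm (em 0 1 (U s) - em 0 1 (U t))"
      unfolding eventually_at_filter using U(1) t by (intro always_eventually) (auto simp: L2_norm_diff)
    from Lim_transform_eventually[OF U(2)[OF t] this]
    show "((\<lambda>s. em 0 1 (U s)) \<longlongrightarrow> em 0 1 (U t)) (at t within {0..T})"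
      by (simp add: tendsto_norm_zero_iff LIM_zero_iff)
  qed
  have U_eq: "em 0 1 (U t) = em 0 1 u0 + prim ?M z t" if t: "t \<in> {0..T}" for t
  proof -
    let ?r = "em 0 1 (U t) - (em 0 1 u0 + prim ?M z t)"
    have "?r \<bullet> em 0 1 v = 0" if v: "v \<in> L2 0 1" for v
    proof -
      have yv: "integrable ?M (\<lambda>t. L2_inner 0 1 (u t) v)" and zv: "integrable ?M (\<lambda>t. L2_inner 0 1 (ut t) v)"
        using integrable_itv_cong_AE[OF _ y_inner[OF v]] integrable_itv_cong_AE[OF _ z_inner[OF v]] y z by auto
      have "em 0 1 (U t) \<bullet> em 0 1 v = em 0 1 (U 0) \<bullet> em 0 1 v + prim ?M (\<lambda>t. L2_inner 0 1 (ut t) v) t"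
      proof (rule weak_deriv_initial[OF T zv yv _ _ _ t])
        show "has_weak_deriv 0 T (\<lambda>t. L2_inner 0 1 (u t) v) (\<lambda>t. L2_inner 0 1 (ut t) v)"
          using deriv v by (simp add: has_weak_time_deriv_def)
        show "continuous_on {0..T} (\<lambda>t. em 0 1 (U t) \<bullet> em 0 1 v)" by (intro continuous_intros U_cont)
        show "AE t in ?M. em 0 1 (U t) \<bullet> em 0 1 v = L2_inner 0 1 (u t) v"
          using UAE y_inner[OF v] by eventually_elim simp
      qed
      also have "prim ?M (\<lambda>t. L2_inner 0 1 (ut t) v) t = prim ?M (\<lambda>t. z t \<bullet> em 0 1 v) t"
        by (rule itv.prim_cong_AE[OF zv]) (use z z_inner[OF v] in \<open>auto elim: eventually_mono\<close>)
      finally show ?thesis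
        by (simp add: U0 inner_diff_left inner_add_left itv.prim_inner[OF z])
    qed
    \<comment> \<open>The remainder is tested with itself; since it lives on (0, 1), this gives its
      norm.\<close>
    from this[OF L2_fn[of ?r]] have "?r \<bullet> res 0 1 ?r = 0" by (simp add: em_fn)
    moreover have "res 0 1 ?r = ?r"
    proof -
      have "prim ?M (\<lambda>s. res 0 1 (z s)) t = prim ?M z t"
        by (rule itv.prim_cong_AE[OF integrable_bounded_linear[OF bounded_linear_res z] z])
          (use z_supp in \<open>auto elim: eventually_mono\<close>)
      then show ?thesis
        by (simp add: res_diff res_add res_em U(1)[OF t] H1_L2[OF u0] itv.prim_linear[OF bounded_linear_res z])
    qed
    ultimately show ?thesis by simp
  qed
  have y_eq: "AE t in ?M. y t = em 0 1 u0 + prim ?M z t"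
    using UAE AE_space[of ?M] by eventually_elim (simp add: U_eq[symmetric])
  have trace: "AE t in ?M. b t = trace_at 0 1 u0 c + dx 0 T b \<bullet> ivl 0 t"
    if b: "b \<in> H1 0 T" and bt: "\<And>t. b t = trace_at 0 1 (u t) c" and c: "c = 0 \<or> c = 1" for b c
  proof -
    let ?b = "\<lambda>t. trace_at 0 T b 0 + dx 0 T b \<bullet> ivl 0 t"
    note r = H1_repr(1)[OF T b]
    have "?b 0 = trace_at 0 1 u0 c"
    proof (rule trace_initial[where b="?b", OF T u0 c uH1 _ d_bound[unfolded d_def] U_cont U0])
      show "AE t in ?M. em 0 1 (u t) = em 0 1 (U t)" using UAE by eventually_elim (simp add: y_def)
      show "continuous_on {0..T} ?b" by (intro continuous_intros continuous_inner_ivl)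
      show "AE t in ?M. trace_at 0 1 (u t) c = ?b t" using r by (simp add: bt)
    qed
    with r show ?thesis by (simp add: ivl_empty)
  qed
  define \<beta>0 where "\<beta>0 = dx 0 T b0"
  define \<beta>1 where "\<beta>1 = dx 0 T b1"
  define c0 where "c0 t = trace_at 0 1 u0 0 + \<beta>0 \<bullet> ivl 0 t" for t
  define c1 where "c1 t = trace_at 0 1 u0 1 + \<beta>1 \<bullet> ivl 0 t" for t
  have b0_eq: "AE t in ?M. b0 t = c0 t" and b1_eq: "AE t in ?M. b1 t = c1 t"
    using trace[OF b0, of 0] trace[OF b1, of 1] by (auto simp: b0_def b1_def \<beta>0_def \<beta>1_def c0_def c1_def)
  have b': "b0' \<in> L2 0 T" "b1' \<in> L2 0 T" unfolding b0'_def b1'_def using b0 b1 by (auto intro: weak_deriv_some)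
  have b'_prim: "prim ?M b0' t = \<beta>0 \<bullet> ivl 0 t" "prim ?M b1' t = \<beta>1 \<bullet> ivl 0 t" if "t \<in> {0..T}" for t
    using that prim_L2_eq_inner[OF b'(1)] prim_L2_eq_inner[OF b'(2)] by (auto simp: \<beta>0_def \<beta>1_def b0'_def b1'_def)
  have ci: "integrable ?M c0" "integrable ?M c1"
    unfolding c0_def c1_def by (intro integrable_itv_continuous continuous_intros continuous_inner_ivl)+
  obtain W where W: "\<And>t. t \<in> {0..T} \<Longrightarrow> W t \<in> L2 0 1"
      "\<And>v. v \<in> L2 0 1 \<Longrightarrow> continuous_on {0..T} (\<lambda>t. L2_inner 0 1 (W t) v)"
      "AE t in ?M. ae_eq 0 1 (W t) (ut t)" "ae_eq 0 1 (W 0) u1"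
    using init' unfolding has_weak_initial_value_def by blast
  have W0: "em 0 1 (W 0) = em 0 1 u1" using em_eq_iff[OF W(1) u1, of 0] W(4) T by simp
  have WAE: "AE t in ?M. em 0 1 (W t) = z t"
    unfolding z_def by (rule AE_L2I[OF W(1) W(3) utL2]) simp
  have fL2: "AE t in ?M. f t \<in> L2 0 1"
    using fB by (auto simp: Bochner_L1_def intro: strongly_measurable_AE)
  show ?thesis
  proof (rule that[of z \<beta>0 \<beta>1 "\<lambda>t. em 0 1 (W t)"])
    show "integrable ?M (\<lambda>t. em 0 1 (u t))" "integrable ?M (\<lambda>t. dx 0 1 (u t))"
      using y d unfolding y_def[abs_def] d_def[abs_def] by auto
    show "AE t in ?M. em 0 1 (u t) = em 0 1 u0 + prim ?M z t" using y_eq unfolding y_def .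
    show "AE t in ?M. trace_at 0 1 (u t) 0 = trace_at 0 1 u0 0 + \<beta>0 \<bullet> ivl 0 t"
      "AE t in ?M. trace_at 0 1 (u t) 1 = trace_at 0 1 u0 1 + \<beta>1 \<bullet> ivl 0 t"
      using b0_eq b1_eq unfolding b0_def b1_def c0_def c1_def by auto
    fix v t assume v: "v \<in> H1 0 1" and t: "t \<in> {0..T}"
    let ?e = "em 0 1 v" and ?g = "dx 0 1 v" and ?va = "trace_at 0 1 v 0" and ?vb = "trace_at 0 1 v 1"
    define X where "X t = bilin h0 h1 (u t) v + (lam0 * b0' t + ht1 * b1 t + lt1 * b1' t) * ?va
           + (lam1 * b1' t + ht0 * b0 t + lt0 * b0' t) * ?vb + L2_inner 0 1 (\<lambda>x. K * u t x + lam * ut t x) v" for t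
    define X' where "X' t = d t \<bullet> ?g + (h0 * c0 t + lam0 * b0' t + ht1 * c1 t + lt1 * b1' t) * ?va
           + (h1 * c1 t + lam1 * b1' t + ht0 * c0 t + lt0 * b0' t) * ?vb + K * (y t \<bullet> ?e) + lam * (z t \<bullet> ?e)" for t
    define Z where "Z t = - g0 t * ?va - g1 t * ?vb + L2_inner 0 1 (f t) v" for t
    have X_eq: "AE t in ?M. X t = X' t"
      using uH1 utL2 b0_eq b1_eq
    proof eventually_elim
      case (elim t)
      have 1: "bilin h0 h1 (u t) v = d t \<bullet> ?g + h0 * b0 t * ?va + h1 * b1 t * ?vb"
        using weak_deriv_some(1)[OF elim(1)] weak_deriv_some(1)[OF v]
        by (simp add: bilin_def d_def b0_def b1_def flip: inner_em)
      have 2: "L2_inner 0 1 (\<lambda>x. K * u t x + lam * ut t x) v = K * (y t \<bullet> ?e) + lam * (z t \<bullet> ?e)"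
        using L2_lincomb[OF H1_L2[OF elim(1)] elim(2), of K lam]
        by (simp add: inner_add_left H1_L2 v y_def z_def flip: inner_em)
      show ?case unfolding X_def X'_def 1 2 elim(3,4) by (simp add: algebra_simps)
    qed
    note bi = L2_integrable[OF b'(1)] L2_integrable[OF b'(2)]
    have X': "integrable ?M X'"
      unfolding X'_def using y d z ci bi by (intro Bochner_Integration.integrable_add integrable_mult_right integrable_mult_left integrable_inner_left) auto
    have X: "integrable ?M X" by (rule integrable_itv_cong_AE[OF X' X_eq])
    have Z_eq: "AE t in ?M. Z t = - g0 t * ?va - g1 t * ?vb + em 0 1 (f t) \<bullet> ?e"
      using L2_inner_em_AE[OF fL2 H1_L2[OF v]] by (auto simp: Z_def elim: eventually_mono)
    have "integrable ?M (\<lambda>t. - g0 t * ?va - g1 t * ?vb + em 0 1 (f t) \<bullet> ?e)"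
      using L2_integrable[OF g0] L2_integrable[OF g1] Bochner_L1_integrable[OF fB] by auto
    then have Z: "integrable ?M Z" by (rule integrable_itv_cong_AE[OF _ Z_eq])
    have zv: "integrable ?M (\<lambda>t. L2_inner 0 1 (ut t) v)"
      using integrable_itv_cong_AE[OF _ z_inner[OF H1_L2[OF v]]] z by auto
    have ZX: "integrable ?M (\<lambda>t. Z t - X t)" using Z X by simp
    have "em 0 1 (W t) \<bullet> ?e = em 0 1 (W 0) \<bullet> ?e + prim ?M (\<lambda>t. Z t - X t) t"
    proof (rule weak_deriv_initial[OF T ZX zv _ _ _ t])
      show "has_weak_deriv 0 T (\<lambda>t. L2_inner 0 1 (ut t) v) (\<lambda>t. Z t - X t)"
        unfolding has_weak_deriv_def
      proof
        fix \<phi> assume \<phi>: "\<phi> \<in> test_fun 0 T"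
        have c: "continuous_on {0..T} \<phi>" by (intro smooth_continuous_on test_fun_smooth[OF \<phi>])
        have "(LINT t|?M. (Z t - X t) * \<phi> t) = (LINT t|?M. Z t * \<phi> t) - (LINT t|?M. X t * \<phi> t)"
          using integrable_mult_continuous[OF Z c] integrable_mult_continuous[OF X c] by (simp add: left_diff_distrib)
        then show "(LINT t|?M. L2_inner 0 1 (ut t) v * deriv \<phi> t) = - (LINT t|?M. (Z t - X t) * \<phi> t)"
          using eqn[OF v \<phi>] unfolding X_def Z_def by simp
      qed
      have "\<And>t. t \<in> {0..T} \<Longrightarrow> L2_inner 0 1 (W t) v = em 0 1 (W t) \<bullet> ?e"
        by (simp add: inner_em W(1) H1_L2[OF v])
      then show "continuous_on {0..T} (\<lambda>t. em 0 1 (W t) \<bullet> ?e)"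
        by (rule continuous_on_eq[OF W(2)[OF H1_L2[OF v]]])
      show "AE t in ?M. em 0 1 (W t) \<bullet> ?e = L2_inner 0 1 (ut t) v"
        using WAE z_inner[OF H1_L2[OF v]] by eventually_elim simp
    qed
    also have "prim ?M (\<lambda>t. Z t - X t) t = prim ?M Z t - prim ?M X' t"
    proof -
      have "prim ?M X t = prim ?M X' t" by (rule itv.prim_cong_AE[OF X X']) (use X_eq in \<open>auto elim: eventually_mono\<close>)
      then show ?thesis by (simp add: itv.prim_diff[OF Z X])
    qed
    also have "prim ?M X' t = prim ?M d t \<bullet> ?g + (h0 * prim ?M c0 t + lam0 * (\<beta>0 \<bullet> ivl 0 t) + ht1 * prim ?M c1 t + lt1 * (\<beta>1 \<bullet> ivl 0 t)) * ?va
        + (h1 * prim ?M c1 t + lam1 * (\<beta>1 \<bullet> ivl 0 t) + ht0 * prim ?M c0 t + lt0 * (\<beta>0 \<bullet> ivl 0 t)) * ?vb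
        + K * (prim ?M y t \<bullet> ?e) + lam * (prim ?M z t \<bullet> ?e)"
    proof -
      have "prim ?M X' t = prim ?M (\<lambda>t. d t \<bullet> ?g + ?va * (h0 * c0 t + lam0 * b0' t + ht1 * c1 t + lt1 * b1' t)
          + ?vb * (h1 * c1 t + lam1 * b1' t + ht0 * c0 t + lt0 * b0' t) + K * (y t \<bullet> ?e) + lam * (z t \<bullet> ?e)) t"
        unfolding X'_def by (simp add: mult.commute)
      also have "\<dots> = prim ?M (\<lambda>t. d t \<bullet> ?g) t + ?va * (h0 * prim ?M c0 t + lam0 * prim ?M b0' t + ht1 * prim ?M c1 t + lt1 * prim ?M b1' t)
          + ?vb * (h1 * prim ?M c1 t + lam1 * prim ?M b1' t + ht0 * prim ?M c0 t + lt0 * prim ?M b0' t)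
          + K * prim ?M (\<lambda>t. y t \<bullet> ?e) t + lam * prim ?M (\<lambda>t. z t \<bullet> ?e) t"
        using y d z ci bi by (simp add: itv.prim_add itv.prim_cmult)
      finally show ?thesis
        by (simp add: itv.prim_inner[OF d] itv.prim_inner[OF y] itv.prim_inner[OF z] b'_prim[OF t] mult.commute)
    qed
    finally show "em 0 1 (W t) \<bullet> ?e = em 0 1 u1 \<bullet> ?e
        + prim ?M (\<lambda>t. - g0 t * ?va - g1 t * ?vb + L2_inner 0 1 (f t) v) t
        - (prim ?M (\<lambda>t. dx 0 1 (u t)) t \<bullet> ?g
           + (h0 * prim ?M (\<lambda>t. trace_at 0 1 u0 0 + \<beta>0 \<bullet> ivl 0 t) t + lam0 * (\<beta>0 \<bullet> ivl 0 t)
              + ht1 * prim ?M (\<lambda>t. trace_at 0 1 u0 1 + \<beta>1 \<bullet> ivl 0 t) t + lt1 * (\<beta>1 \<bullet> ivl 0 t)) * ?va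
           + (h1 * prim ?M (\<lambda>t. trace_at 0 1 u0 1 + \<beta>1 \<bullet> ivl 0 t) t + lam1 * (\<beta>1 \<bullet> ivl 0 t)
              + ht0 * prim ?M (\<lambda>t. trace_at 0 1 u0 0 + \<beta>0 \<bullet> ivl 0 t) t + lt0 * (\<beta>0 \<bullet> ivl 0 t)) * ?vb
           + K * (prim ?M (\<lambda>t. em 0 1 (u t)) t \<bullet> ?e) + lam * (prim ?M z t \<bullet> ?e))"
      unfolding W0 Z_def[abs_def] c0_def[abs_def] c1_def[abs_def] y_def[abs_def] d_def[abs_def] by simp
  qed (use z uH1 WAE in auto)
qed

section \<open>Gronwall's inequality and the energy estimate\<close>

lemma gronwall_zero:
  assumes E: "continuous_on {0..T} E" and C: "0 \<le> C"
    and le: "\<And>t. t \<in> {0..T} \<Longrightarrow> E t \<le> prim (itv 0 T) (\<lambda>s. C * E s) t" and t: "t \<in> {0..T}"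
  shows "E t \<le> (0 :: real)"
proof -
  obtain m where m: "\<And>t. t \<in> {0..T} \<Longrightarrow> norm (E t) \<le> m"
    using continuous_bounded_Icc[OF E] by metis
  have "0 \<le> m" using m[OF t] norm_ge_zero order_trans by blast
  \<comment> \<open>With this exponent each passage through the integral inequality halves the
    weighted bound, and iteration drives it to 0.\<close>
  define \<gamma> where "\<gamma> = 2 * C + 1"
  have \<gamma>: "0 < \<gamma>" "C / \<gamma> \<le> 1 / 2" using C by (auto simp: \<gamma>_def field_simps)
  have E_int: "integrable (itv 0 T) (\<lambda>s. C * E s)"
    by (intro integrable_itv_continuous continuous_intros E)
  have bound: "E t \<le> (m * (1/2) ^ n) * exp (\<gamma> * t)" if "t \<in> {0..T}" for n t
    using that
  proof (induction n arbitrary: t)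
    case 0
    have "E t \<le> m * 1" using m[OF 0] by simp
    also have "\<dots> \<le> m * exp (\<gamma> * t)" using \<open>0 \<le> m\<close> \<gamma> 0 by (intro mult_left_mono) auto
    finally show ?case by simp
  next
    case (Suc n)
    let ?c = "C * (m * (1/2) ^ n)"
    have "E t \<le> prim (itv 0 T) (\<lambda>s. C * E s) t" by (rule le[OF Suc.prems])
    also have "\<dots> \<le> prim (itv 0 T) (\<lambda>s. ?c * exp (\<gamma> * s)) t"
    proof (rule itv.prim_mono[OF E_int integrable_exp])
      have "C * E s \<le> ?c * exp (\<gamma> * s)" if "s \<in> {0..T}" for s
        using mult_left_mono[OF Suc.IH[OF that] C] by (simp add: mult_ac)
      then show "AE s in itv 0 T. s < t \<longrightarrow> C * E s \<le> ?c * exp (\<gamma> * s)" by (intro AE_I2) auto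
    qed
    also have "\<dots> \<le> ?c * exp (\<gamma> * t) / \<gamma>"
      using C \<open>0 \<le> m\<close> \<gamma> Suc.prems by (intro prim_exp_le) auto
    also have "\<dots> = (C / \<gamma>) * ((m * (1/2) ^ n) * exp (\<gamma> * t))" by simp
    also have "\<dots> \<le> (1/2) * ((m * (1/2) ^ n) * exp (\<gamma> * t))"
      using \<gamma>(2) \<open>0 \<le> m\<close> by (intro mult_right_mono) auto
    finally show ?case by simp
  qed
  have "(\<lambda>n. (m * (1/2) ^ n) * exp (\<gamma> * t)) \<longlonglongrightarrow> (m * 0) * exp (\<gamma> * t)"
    by (intro tendsto_intros LIMSEQ_realpow_zero) auto
  then show ?thesis
    using bound[OF t] by (intro LIMSEQ_le_const[of "\<lambda>n. (m * (1/2) ^ n) * exp (\<gamma> * t)"]) auto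
qed

text \<open>\<open>\<theta>\<close> is the ratio of the mixed coefficient to its critical value. The
  mixed term is at most the fraction \<open>\<theta>\<close> of the diagonal part, by the inequality
  of the means, so the fraction \<open>1 - \<theta>\<close> survives.\<close>

lemma boundary_form_coercive:
  fixes p q s :: real
  assumes "0 < p" "0 < q" and s: "\<bar>s\<bar> < 2 * sqrt (p * q)"
  obtains \<delta> where "0 < \<delta>" "\<And>a b. \<delta> * (a\<^sup>2 + b\<^sup>2) \<le> p * a\<^sup>2 + s * a * b + q * b\<^sup>2"
proof -
  define \<theta> where "\<theta> = \<bar>s\<bar> / (2 * sqrt (p * q))"
  have pq: "0 < sqrt (p * q)" using assms by simp
  have \<theta>: "0 \<le> \<theta>" "\<theta> < 1" "\<bar>s\<bar> = \<theta> * (2 * sqrt (p * q))" using pq s by (auto simp: \<theta>_def)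
  define \<delta> where "\<delta> = (1 - \<theta>) * min p q"
  show ?thesis
  proof
    show "0 < \<delta>" using \<theta> assms by (simp add: \<delta>_def)
    fix a b :: real
    have "2 * (sqrt p * \<bar>a\<bar>) * (sqrt q * \<bar>b\<bar>) \<le> (sqrt p * \<bar>a\<bar>)\<^sup>2 + (sqrt q * \<bar>b\<bar>)\<^sup>2" by (rule sum_squares_bound)
    then have 1: "2 * sqrt (p * q) * \<bar>a * b\<bar> \<le> p * a\<^sup>2 + q * b\<^sup>2"
      using assms by (simp add: power_mult_distrib real_sqrt_mult abs_mult mult_ac)
    have "- (s * a * b) \<le> \<bar>s\<bar> * \<bar>a * b\<bar>" by (metis abs_ge_minus_self abs_mult mult.assoc)
    also have "\<dots> = \<theta> * (2 * sqrt (p * q) * \<bar>a * b\<bar>)" by (simp add: \<theta>(3))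
    also have "\<dots> \<le> \<theta> * (p * a\<^sup>2 + q * b\<^sup>2)" by (rule mult_left_mono[OF 1 \<theta>(1)])
    finally have 2: "(1 - \<theta>) * (p * a\<^sup>2 + q * b\<^sup>2) \<le> p * a\<^sup>2 + s * a * b + q * b\<^sup>2"
      by (simp add: algebra_simps)
    have "min p q * (a\<^sup>2 + b\<^sup>2) \<le> p * a\<^sup>2 + q * b\<^sup>2"
      unfolding distrib_left by (intro add_mono mult_right_mono) auto
    then have "(1 - \<theta>) * (min p q * (a\<^sup>2 + b\<^sup>2)) \<le> (1 - \<theta>) * (p * a\<^sup>2 + q * b\<^sup>2)"
      using \<theta> by (intro mult_left_mono) auto
    with 2 show "\<delta> * (a\<^sup>2 + b\<^sup>2) \<le> p * a\<^sup>2 + s * a * b + q * b\<^sup>2"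
      by (simp add: \<delta>_def mult.assoc)
  qed
qed

lemma young:
  fixes a x d :: real
  assumes "0 < d"
  shows "a * x \<le> d * a\<^sup>2 + x\<^sup>2 / d"
proof -
  have "0 \<le> (d * a - x / 2)\<^sup>2" by simp
  also have "\<dots> = d * (d * a\<^sup>2 - a * x) + x\<^sup>2 / 4" by (simp add: power2_eq_square algebra_simps)
  also have "\<dots> \<le> d * (d * a\<^sup>2 - a * x) + x\<^sup>2" by simp
  also have "\<dots> = d * (d * a\<^sup>2 + x\<^sup>2 / d - a * x)" using assms by (simp add: field_simps power2_eq_square)
  finally show ?thesis using assms by (simp add: zero_le_mult_iff)
qed

lemma sum_sq_le: "(a + b)\<^sup>2 \<le> 2 * a\<^sup>2 + 2 * (b :: real)\<^sup>2"
  using sum_squares_bound[of a b] by (simp add: power2_sum)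

lemma prim_square:
  fixes F :: "real \<Rightarrow> 'a::{real_inner, banach, second_countable_topology}"
  assumes "integrable (itv 0 T) F"
  shows "(norm (prim (itv 0 T) F t))\<^sup>2 = 2 * prim (itv 0 T) (\<lambda>s. F s \<bullet> prim (itv 0 T) F s) t"
  using itv.prim_by_parts[OF assms assms, of t] 
  by (simp add: power2_norm_eq_inner flip: itv.prim_cmult)

text \<open>
  Here \<open>y\<close>, \<open>d\<close>, \<open>z\<close> are the difference of two solutions, its space and its time derivative, and \<open>b0\<close>, \<open>b1\<close> its
  traces. The terms \<open>B0\<^sup>2 + B1\<^sup>2 + \<parallel>Y\<parallel>\<^sup>2\<close> in the energy make coercivity of the form \<open>bilin\<close> unnecessary.
\<close>

theorem energy_zero:
  fixes y d z :: "real \<Rightarrow> lsq" and b0 b1 :: "real \<Rightarrow> real"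
  assumes lam: "0 < lam0" "0 < lam1" "\<bar>lt0 + lt1\<bar> < 2 * sqrt (lam0 * lam1)"
    and ints: "integrable (itv 0 T) y" "integrable (itv 0 T) d" "integrable (itv 0 T) z"
    and b: "continuous_on {0..T} b0" "continuous_on {0..T} b1"
    and y: "AE t in itv 0 T. y t = prim (itv 0 T) z t"
    and id: "AE t in itv 0 T. z t \<bullet> prim (itv 0 T) z t + d t \<bullet> prim (itv 0 T) d t
      + (h0 * prim (itv 0 T) b0 t + lam0 * b0 t + ht1 * prim (itv 0 T) b1 t + lt1 * b1 t) * b0 t
      + (h1 * prim (itv 0 T) b1 t + lam1 * b1 t + ht0 * prim (itv 0 T) b0 t + lt0 * b0 t) * b1 t
      + K * (prim (itv 0 T) y t \<bullet> prim (itv 0 T) z t) + lam * (prim (itv 0 T) z t \<bullet> prim (itv 0 T) z t) = 0"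
    and t: "t \<in> {0..T}"
  shows "prim (itv 0 T) z t = 0"
proof -
  let ?M = "itv 0 T"
  let ?U = "prim ?M z" and ?D = "prim ?M d" and ?Y = "prim ?M y" and ?B0 = "prim ?M b0" and ?B1 = "prim ?M b1"
  obtain \<delta> where \<delta>: "0 < \<delta>" "\<And>a b. \<delta> * (a\<^sup>2 + b\<^sup>2) \<le> lam0 * a\<^sup>2 + (lt0 + lt1) * a * b + lam1 * b\<^sup>2"
    using boundary_form_coercive[OF lam] by metis
  note bi = integrable_itv_continuous[OF b(1)] integrable_itv_continuous[OF b(2)]
  define E where "E t = (norm (?U t))\<^sup>2 + (norm (?D t))\<^sup>2 + (norm (?B0 t))\<^sup>2 + (norm (?B1 t))\<^sup>2 + (norm (?Y t))\<^sup>2" for t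
  \<comment> \<open>Half the time derivative of \<open>E\<close>, in the integrated sense of
    \<open>prim_square\<close>.\<close>
  define J where "J t = z t \<bullet> ?U t + d t \<bullet> ?D t + b0 t \<bullet> ?B0 t + b1 t \<bullet> ?B1 t + y t \<bullet> ?Y t" for t
  \<comment> \<open>The quotient by \<open>\<delta>\<close> collects the terms from Young's
    inequality, with the factors 2 from \<open>sum_sq_le\<close>; the other two summands bound the
    terms with \<open>Y \<bullet> U\<close> and \<open>U \<bullet> U\<close>.\<close>
  define C where "C = (2 * (1 - h0)\<^sup>2 + 2 * ht1\<^sup>2 + 2 * (1 - h1)\<^sup>2 + 2 * ht0\<^sup>2) / \<delta> + \<bar>1 - K\<bar> + \<bar>lam\<bar>"
  have C: "0 \<le> C" using \<delta> by (simp add: C_def)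
  note ii = itv.integrable_inner_prim[OF ints(1,1)] itv.integrable_inner_prim[OF ints(2,2)]
    itv.integrable_inner_prim[OF ints(3,3)] itv.integrable_inner_prim[OF bi(1,1)] itv.integrable_inner_prim[OF bi(2,2)]
  have J: "integrable ?M J" unfolding J_def using ii by (intro Bochner_Integration.integrable_add)
  have E_cont: "continuous_on {0..T} E"
    unfolding E_def by (intro continuous_intros itv.continuous_prim ints bi)
  have E_J: "E t = prim ?M (\<lambda>s. 2 * J s) t" for t
    unfolding E_def prim_square[OF ints(1)] prim_square[OF ints(2)] prim_square[OF ints(3)] prim_square[OF bi(1)] prim_square[OF bi(2)]
      itv.prim_cmult J_def
    using ii by (simp add: itv.prim_add algebra_simps)
  have "AE t in ?M. J t \<le> C * E t"
    using y id
  proof eventually_elim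
    case (elim t)
    define B0 where "B0 = ?B0 t"
    define B1 where "B1 = ?B1 t"
    define U where "U = ?U t"
    define Y where "Y = ?Y t"
    define p where "p = b0 t"
    define q where "q = b1 t"
    define A where "A = (2 * (1 - h0)\<^sup>2 + 2 * ht1\<^sup>2 + 2 * (1 - h1)\<^sup>2 + 2 * ht0\<^sup>2) / \<delta>"
    \<comment> \<open>The tested equation eliminates \<open>z \<bullet> U + d \<bullet> D\<close>.
      The squares added to the energy contribute \<open>p * B0\<close>, \<open>q * B1\<close> and
      \<open>U \<bullet> Y\<close>, whence the coefficients \<open>1 - h0\<close>,
      \<open>1 - h1\<close> and \<open>1 - K\<close>.\<close>
    have J_eq: "J t = - (lam0 * p\<^sup>2 + (lt0 + lt1) * p * q + lam1 * q\<^sup>2) + p * ((1 - h0) * B0 + (- ht1) * B1)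
        + q * ((1 - h1) * B1 + (- ht0) * B0) + (1 - K) * (Y \<bullet> U) - lam * (U \<bullet> U)"
      using elim(2) unfolding J_def elim(1)
      by (simp add: B0_def B1_def U_def Y_def p_def q_def inner_commute power2_eq_square algebra_simps)
    \<comment> \<open>Used once for each boundary value \<open>p\<close>, \<open>q\<close>, this
      costs exactly the \<open>\<delta> * (p\<^sup>2 + q\<^sup>2)\<close> that the boundary form
      provides.\<close>
    have two: "r * (k * u + l * w) \<le> \<delta> * r\<^sup>2 + ((2 * k\<^sup>2) / \<delta> * u\<^sup>2 + (2 * l\<^sup>2) / \<delta> * w\<^sup>2)" for r k u l w :: real
    proof -
      have "r * (k * u + l * w) \<le> \<delta> * r\<^sup>2 + (k * u + l * w)\<^sup>2 / \<delta>" by (rule young[OF \<delta>(1)])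
      also have "(k * u + l * w)\<^sup>2 / \<delta> \<le> (2 * (k * u)\<^sup>2 + 2 * (l * w)\<^sup>2) / \<delta>"
        using \<delta>(1) by (intro divide_right_mono sum_sq_le) auto
      finally show ?thesis by (simp add: power_mult_distrib add_divide_distrib)
    qed
    have YU: "(1 - K) * (Y \<bullet> U) \<le> \<bar>1 - K\<bar> * ((norm Y)\<^sup>2 + (norm U)\<^sup>2)"
    proof -
      have "\<bar>Y \<bullet> U\<bar> \<le> norm Y * norm U" by (rule Cauchy_Schwarz_ineq2)
      also have "\<dots> \<le> (norm Y)\<^sup>2 + (norm U)\<^sup>2"
        using sum_squares_bound[of "norm Y" "norm U"] mult_nonneg_nonneg[OF norm_ge_zero[of Y] norm_ge_zero[of U]] by linarith
      finally have "\<bar>1 - K\<bar> * \<bar>Y \<bullet> U\<bar> \<le> \<bar>1 - K\<bar> * ((norm Y)\<^sup>2 + (norm U)\<^sup>2)" by (intro mult_left_mono) auto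
      then show ?thesis using abs_ge_self[of "(1 - K) * (Y \<bullet> U)"] by (simp add: abs_mult)
    qed
    have UU: "- (lam * (U \<bullet> U)) \<le> \<bar>lam\<bar> * (norm U)\<^sup>2"
      using mult_right_mono[of "- lam" "\<bar>lam\<bar>" "(norm U)\<^sup>2"] by (simp add: power2_norm_eq_inner)
    have "J t \<le> (2 * (1 - h0)\<^sup>2 / \<delta> * B0\<^sup>2 + 2 * ht1\<^sup>2 / \<delta> * B1\<^sup>2) + (2 * (1 - h1)\<^sup>2 / \<delta> * B1\<^sup>2 + 2 * ht0\<^sup>2 / \<delta> * B0\<^sup>2)
        + \<bar>1 - K\<bar> * ((norm Y)\<^sup>2 + (norm U)\<^sup>2) + \<bar>lam\<bar> * (norm U)\<^sup>2"
      using \<delta>(2)[of p q] two[of p "1 - h0" B0 "- ht1" B1] two[of q "1 - h1" B1 "- ht0" B0] YU UU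
      unfolding J_eq distrib_left power2_minus by linarith
    also have "\<dots> \<le> A * (B0\<^sup>2 + B1\<^sup>2) + \<bar>1 - K\<bar> * ((norm Y)\<^sup>2 + (norm U)\<^sup>2) + \<bar>lam\<bar> * (norm U)\<^sup>2"
    proof -
      have nn: "0 \<le> 2 * x\<^sup>2 / \<delta> * w\<^sup>2" for x w :: real using \<delta> by simp
      have "A * (B0\<^sup>2 + B1\<^sup>2) = 2 * (1 - h0)\<^sup>2 / \<delta> * B0\<^sup>2 + 2 * ht1\<^sup>2 / \<delta> * B0\<^sup>2 + 2 * (1 - h1)\<^sup>2 / \<delta> * B0\<^sup>2 + 2 * ht0\<^sup>2 / \<delta> * B0\<^sup>2
          + (2 * (1 - h0)\<^sup>2 / \<delta> * B1\<^sup>2 + 2 * ht1\<^sup>2 / \<delta> * B1\<^sup>2 + 2 * (1 - h1)\<^sup>2 / \<delta> * B1\<^sup>2 + 2 * ht0\<^sup>2 / \<delta> * B1\<^sup>2)"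
        unfolding A_def distrib_left add_divide_distrib by (simp only: distrib_right)
      then show ?thesis
        using nn[of ht1 B0] nn[of "1 - h1" B0] nn[of "1 - h0" B1] nn[of ht0 B1] by linarith
    qed
    also have "\<dots> \<le> C * E t"
    proof -
      have A: "0 \<le> A" unfolding A_def using \<delta> by simp
      have "E t = (norm U)\<^sup>2 + (norm (?D t))\<^sup>2 + B0\<^sup>2 + B1\<^sup>2 + (norm Y)\<^sup>2"
        by (simp add: E_def B0_def B1_def U_def Y_def)
      then have "B0\<^sup>2 + B1\<^sup>2 \<le> E t" "(norm Y)\<^sup>2 + (norm U)\<^sup>2 \<le> E t" "(norm U)\<^sup>2 \<le> E t" by auto
      then have "A * (B0\<^sup>2 + B1\<^sup>2) \<le> A * E t" "\<bar>1 - K\<bar> * ((norm Y)\<^sup>2 + (norm U)\<^sup>2) \<le> \<bar>1 - K\<bar> * E t" "\<bar>lam\<bar> * (norm U)\<^sup>2 \<le> \<bar>lam\<bar> * E t"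
        using A by (auto intro: mult_left_mono)
      moreover have "C * E t = A * E t + \<bar>1 - K\<bar> * E t + \<bar>lam\<bar> * E t"
        unfolding C_def A_def by (simp only: distrib_right)
      ultimately show ?thesis by linarith
    qed
    finally show ?case .
  qed
  then have AE: "AE t in ?M. 2 * J t \<le> (2 * C) * E t"
    by eventually_elim simp
  have "E t \<le> 0"
  proof (rule gronwall_zero[OF E_cont _ _ t])
    show "0 \<le> 2 * C" using C by simp
    show "E t \<le> prim ?M (\<lambda>s. (2 * C) * E s) t" for t
      unfolding E_J
    proof (rule itv.prim_mono)
      show "integrable ?M (\<lambda>s. 2 * C * prim ?M (\<lambda>s. 2 * J s) s)"
        unfolding E_J[symmetric] by (intro integrable_itv_continuous continuous_intros E_cont)
      show "AE s in ?M. s < t \<longrightarrow> 2 * J s \<le> 2 * C * prim ?M (\<lambda>s. 2 * J s) s"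
        unfolding E_J[symmetric] using AE by eventually_elim simp
    qed (use J in simp)
  qed
  then have "(norm (?U t))\<^sup>2 \<le> 0"
    unfolding E_def by (smt (verit) zero_le_power2)
  then show ?thesis by simp
qed

text \<open>The integrated identity holds for all \<open>v\<close> at every time, so a test function
  that depends on the time is admissible. Both solutions have the same data, which cancel on
  subtraction and leave the identity required by \<open>energy_zero\<close>.\<close>

theorem weak_solution_unique:
  fixes h0 h1 lam0 lam1 K lam ht0 ht1 lt0 lt1 T :: real
    and g0 g1 u0 u1 :: "real \<Rightarrow> real" and f :: "real \<Rightarrow> real \<Rightarrow> real"
  assumes lam: "0 < lam0" "0 < lam1" "\<bar>lt0 + lt1\<bar> < 2 * sqrt (lam0 * lam1)" and T: "0 < T"
    and data: "g0 \<in> L2 0 T" "g1 \<in> L2 0 T" "f \<in> Bochner_L1 T (L2 0 1) (L2_norm 0 1)" "u0 \<in> H1 0 1" "u1 \<in> L2 0 1"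
    and u: "weak_solution T h0 h1 lam0 lam1 K lam ht0 ht1 lt0 lt1 g0 g1 f u0 u1 u"
    and w: "weak_solution T h0 h1 lam0 lam1 K lam ht0 ht1 lt0 lt1 g0 g1 f u0 u1 w"
  shows "AE t in itv 0 T. ae_eq 0 1 (w t) (u t)"
proof -
  let ?M = "itv 0 T"
  let ?id = "\<lambda>u z W \<beta>0 \<beta>1. (\<forall>v\<in>H1 0 1. \<forall>t\<in>{0..T}. W t \<bullet> em 0 1 v
      = em 0 1 u1 \<bullet> em 0 1 v
        + prim ?M (\<lambda>t. - g0 t * trace_at 0 1 v 0 - g1 t * trace_at 0 1 v 1 + L2_inner 0 1 (f t) v) t
        - (prim ?M (\<lambda>t. dx 0 1 (u t)) t \<bullet> dx 0 1 v
           + (h0 * prim ?M (\<lambda>t. trace_at 0 1 u0 0 + \<beta>0 \<bullet> ivl 0 t) t + lam0 * (\<beta>0 \<bullet> ivl 0 t)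
              + ht1 * prim ?M (\<lambda>t. trace_at 0 1 u0 1 + \<beta>1 \<bullet> ivl 0 t) t + lt1 * (\<beta>1 \<bullet> ivl 0 t)) * trace_at 0 1 v 0
           + (h1 * prim ?M (\<lambda>t. trace_at 0 1 u0 1 + \<beta>1 \<bullet> ivl 0 t) t + lam1 * (\<beta>1 \<bullet> ivl 0 t)
              + ht0 * prim ?M (\<lambda>t. trace_at 0 1 u0 0 + \<beta>0 \<bullet> ivl 0 t) t + lt0 * (\<beta>0 \<bullet> ivl 0 t)) * trace_at 0 1 v 1
           + K * (prim ?M (\<lambda>t. em 0 1 (u t)) t \<bullet> em 0 1 v) + lam * (prim ?M z t \<bullet> em 0 1 v)))"
  let ?props = "\<lambda>u z W \<beta>0 \<beta>1. integrable ?M (\<lambda>t. em 0 1 (u t)) \<and> integrable ?M (\<lambda>t. dx 0 1 (u t)) \<and> integrable ?M z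
    \<and> (AE t in ?M. u t \<in> H1 0 1) \<and> (AE t in ?M. em 0 1 (u t) = em 0 1 u0 + prim ?M z t)
    \<and> (AE t in ?M. trace_at 0 1 (u t) 0 = trace_at 0 1 u0 0 + \<beta>0 \<bullet> ivl 0 t)
    \<and> (AE t in ?M. trace_at 0 1 (u t) 1 = trace_at 0 1 u0 1 + \<beta>1 \<bullet> ivl 0 t)
    \<and> (AE t in ?M. W t = z t) \<and> ?id u z W \<beta>0 \<beta>1"
  have ex: "\<exists>z W \<beta>0 \<beta>1. ?props u z W \<beta>0 \<beta>1"
    if "weak_solution T h0 h1 lam0 lam1 K lam ht0 ht1 lt0 lt1 g0 g1 f u0 u1 u" for u
    by (rule weak_solution_integrated[OF T data that]) (intro exI conjI ballI; assumption | (fact))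
  from ex[OF u] ex[OF w] obtain z W \<beta>0 \<beta>1 z' W' \<beta>0' \<beta>1' where
    P: "?props u z W \<beta>0 \<beta>1" and P': "?props w z' W' \<beta>0' \<beta>1'"
    by blast
  define y where "y t = em 0 1 (u t) - em 0 1 (w t)" for t
  define d where "d t = dx 0 1 (u t) - dx 0 1 (w t)" for t
  define s where "s t = z t - z' t" for t
  define b0 where "b0 t = (\<beta>0 - \<beta>0') \<bullet> ivl 0 t" for t
  define b1 where "b1 t = (\<beta>1 - \<beta>1') \<bullet> ivl 0 t" for t
  have ints: "integrable ?M y" "integrable ?M d" "integrable ?M s"
    unfolding y_def d_def s_def using P P' by auto
  have ci: "integrable ?M (\<lambda>t. c + \<beta> \<bullet> ivl 0 t)" for c \<beta>
    by (intro integrable_itv_continuous continuous_intros continuous_inner_ivl)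
  have prims: "prim ?M s t = prim ?M z t - prim ?M z' t"
    "prim ?M d t = prim ?M (\<lambda>t. dx 0 1 (u t)) t - prim ?M (\<lambda>t. dx 0 1 (w t)) t"
    "prim ?M y t = prim ?M (\<lambda>t. em 0 1 (u t)) t - prim ?M (\<lambda>t. em 0 1 (w t)) t"
    "prim ?M b0 t = prim ?M (\<lambda>t. trace_at 0 1 u0 0 + \<beta>0 \<bullet> ivl 0 t) t - prim ?M (\<lambda>t. trace_at 0 1 u0 0 + \<beta>0' \<bullet> ivl 0 t) t"
    "prim ?M b1 t = prim ?M (\<lambda>t. trace_at 0 1 u0 1 + \<beta>1 \<bullet> ivl 0 t) t - prim ?M (\<lambda>t. trace_at 0 1 u0 1 + \<beta>1' \<bullet> ivl 0 t) t" for t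
    unfolding s_def d_def y_def b0_def b1_def using P P' ci
    by (simp_all add: inner_diff_left flip: itv.prim_diff)
  have y_eq: "AE t in ?M. y t = prim ?M s t"
  proof -
    have "AE t in ?M. em 0 1 (u t) = em 0 1 u0 + prim ?M z t" "AE t in ?M. em 0 1 (w t) = em 0 1 u0 + prim ?M z' t"
      using P P' by blast+
    then show ?thesis by eventually_elim (simp add: y_def prims)
  qed
  have zero: "prim ?M s t = 0" if t: "t \<in> {0..T}" for t
  proof (rule energy_zero[OF lam ints _ _ y_eq _ t, where ?b0.0=b0 and ?b1.0=b1])
    show "continuous_on {0..T} b0" "continuous_on {0..T} b1"
      unfolding b0_def b1_def by (rule continuous_inner_ivl)+
    have AEs: "AE t in ?M. u t \<in> H1 0 1" "AE t in ?M. w t \<in> H1 0 1" "AE t in ?M. W t = z t" "AE t in ?M. W' t = z' t"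
      "AE t in ?M. trace_at 0 1 (u t) 0 = trace_at 0 1 u0 0 + \<beta>0 \<bullet> ivl 0 t"
      "AE t in ?M. trace_at 0 1 (u t) 1 = trace_at 0 1 u0 1 + \<beta>1 \<bullet> ivl 0 t"
      "AE t in ?M. trace_at 0 1 (w t) 0 = trace_at 0 1 u0 0 + \<beta>0' \<bullet> ivl 0 t"
      "AE t in ?M. trace_at 0 1 (w t) 1 = trace_at 0 1 u0 1 + \<beta>1' \<bullet> ivl 0 t"
      using P P' by blast+
    have ids: "?id u z W \<beta>0 \<beta>1" "?id w z' W' \<beta>0' \<beta>1'" using P P' by blast+
    show "AE t in ?M. s t \<bullet> prim ?M s t + d t \<bullet> prim ?M d t
      + (h0 * prim ?M b0 t + lam0 * b0 t + ht1 * prim ?M b1 t + lt1 * b1 t) * b0 t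
      + (h1 * prim ?M b1 t + lam1 * b1 t + ht0 * prim ?M b0 t + lt0 * b0 t) * b1 t
      + K * (prim ?M y t \<bullet> prim ?M s t) + lam * (prim ?M s t \<bullet> prim ?M s t) = 0"
      using AEs y_eq AE_space[of ?M]
    proof eventually_elim
      case (elim t)
      then have t: "t \<in> {0..T}" by simp
      \<comment> \<open>At this fixed time the difference is a Sobolev function whose embedding is
        the primitive of the difference of velocities and whose traces are \<open>b0 t\<close> and
        \<open>b1 t\<close>.\<close>
      define v where "v = (\<lambda>x. u t x - w t x)"
      have v: "v \<in> H1 0 1" "dx 0 1 v = d t" "em 0 1 v = prim ?M s t" "trace_at 0 1 v 0 = b0 t" "trace_at 0 1 v 1 = b1 t"
        using H1_diff[OF zero_less_one elim(1,2)] L2_diff(2)[OF H1_L2[OF elim(1)] H1_L2[OF elim(2)]] elim(5-9)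
        by (simp_all add: v_def d_def y_def b0_def b1_def inner_diff_left)
      note e = ids(1)[rule_format, OF v(1) t, unfolded v(2-5)] ids(2)[rule_format, OF v(1) t, unfolded v(2-5)]
      have "s t \<bullet> prim ?M s t = W t \<bullet> prim ?M s t - W' t \<bullet> prim ?M s t"
        by (simp add: s_def elim(3,4) inner_diff_left)
      also have "\<dots> = - (prim ?M d t \<bullet> d t
          + (h0 * prim ?M b0 t + lam0 * b0 t + ht1 * prim ?M b1 t + lt1 * b1 t) * b0 t
          + (h1 * prim ?M b1 t + lam1 * b1 t + ht0 * prim ?M b0 t + lt0 * b0 t) * b1 t
          + K * (prim ?M y t \<bullet> prim ?M s t) + lam * (prim ?M s t \<bullet> prim ?M s t))"
        unfolding e unfolding prims(2-5) unfolding b0_def b1_def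
        by (simp add: prims(1) inner_diff_left inner_diff_right algebra_simps)
      finally show ?case by (simp add: inner_commute)
    qed
  qed
  have "AE t in ?M. u t \<in> H1 0 1" "AE t in ?M. w t \<in> H1 0 1" using P P' by blast+
  with y_eq AE_space[of ?M] show ?thesis
  proof eventually_elim
    case (elim t)
    then have "em 0 1 (w t) = em 0 1 (u t)" using zero[of t] by (simp add: y_def)
    then show ?case using em_eq_iff H1_L2 elim by blast
  qed
qed

theorem theorem3p1:
  fixes h0 h1 lam0 lam1 K lam ht0 ht1 lt0 lt1 T :: real
    and g0 g1 u0 u1 :: "real \<Rightarrow> real"
    and f :: "real \<Rightarrow> real \<Rightarrow> real"
  assumes "h0 > 0" and "lam0 > 0" and "lam1 > 0" and "h1 \<ge> 0"
    and "\<bar>lt0 + lt1\<bar> < 2 * sqrt (lam0 * lam1)"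
    and "T > 0"
    and "g0 \<in> L2 0 T" and "g1 \<in> L2 0 T"
    and "f \<in> Bochner_L1 T (L2 0 1) (L2_norm 0 1)"
    and "u0 \<in> H1 0 1" and "u1 \<in> L2 0 1"
  shows "\<exists>u. weak_solution T h0 h1 lam0 lam1 K lam ht0 ht1 lt0 lt1 g0 g1 f u0 u1 u \<and>
             (\<forall>w. weak_solution T h0 h1 lam0 lam1 K lam ht0 ht1 lt0 lt1 g0 g1 f u0 u1 w
                  \<longrightarrow> (AE t in itv 0 T. ae_eq 0 1 (w t) (u t)))"
proof -
  \<comment> \<open>Since \<open>4 * (lt0 * lt1) \<le> (lt0 + lt1)\<^sup>2\<close>, the hypothesis
    gives \<open>lt0 * lt1 < lam0 * lam1\<close>, and the determinant of the boundary system exceeds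
    \<open>1 + lam0 + lam1\<close>.\<close>
  have "(lt0 + lt1)\<^sup>2 < (2 * sqrt (lam0 * lam1))\<^sup>2"
    using assms(5) by (metis abs_ge_zero power2_abs power_strict_mono zero_less_numeral)
  then have "(lt0 + lt1)\<^sup>2 < 4 * (lam0 * lam1)"
    using assms(2,3) by (simp add: power_mult_distrib)
  moreover have "4 * (lt0 * lt1) \<le> (lt0 + lt1)\<^sup>2"
    using zero_le_power2[of "lt0 - lt1"] by (simp add: power2_eq_square algebra_simps)
  ultimately have "lt0 * lt1 < lam0 * lam1" by linarith
  then have "(1 + lam0) * (1 + lam1) - lt0 * lt1 \<noteq> 0"
    using assms(2,3) by (simp add: algebra_simps)
  then obtain u where u: "weak_solution T h0 h1 lam0 lam1 K lam ht0 ht1 lt0 lt1 g0 g1 f u0 u1 u"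
    using weak_solution_exists[OF _ assms(6-11)] by blast
  then show ?thesis
    using weak_solution_unique[OF assms(2,3,5,6-11) u] by blast
qed

end
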